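(* Let $R$ be a $\mathbb Z[q]_{(p,q-1)}$-algebra and let $A$ be a complete $R$-algebra with a fixed topologically étale coordinate $x$. The (continuous) $R$-linear flip map $\tau:\widehat{A\langle\xi\rangle}_q\to\widehat{A\langle\xi\rangle}_q$ defined, for $f\in A$, by $\tau(f)=\theta(f)$ and, for $n\ge1$, by $$\tau\left(f\xi^{[n]}\right)=\theta(f)\sum_{k=1}^n(-1)^kq^{\frac{k(k-1)}2}(1-q)^{n-k}\binom{n-1}{k-1}_qx^{n-k}\xi^{[k]}$$ is an $R$-algebra automorphism of $\widehat{A\langle\xi\rangle}_q$ such that $\tau\circ\tau=\mathrm{Id}_{\widehat{A\langle\xi\rangle}_q}$.
   Context: Fix a prime $p$; $\mathbb Z[q]_{(p,q-1)}$ is the localization of $\mathbb Z[q]$ at $(p,q-1)$. All modules carry the $(p,q-1)$-adic topology; completion and completeness refer to it. $(n)_q=\frac{q^n-1}{q-1}$; $(n)_q!$, $\binom nk_q$ are the usual $q$-analogs. A topologically étale coordinate $x$ on $A$ is an element such that $R[X]\to A$, $X\mapsto x$, is formally étale and topologically finitely presented. Twisted divided polynomials: $A\langle\xi\rangle_q$ is the commutative $A$-algebra, free as an $A$-module on $\xi^{[n]}$, $n\in\mathbb N$ ($\xi^{[0]}=1$, $\xi=\xi^{[1]}$), with $$\xi^{[n]}\xi^{[m]}=\sum_{0\le i\le n,m}q^{\frac{i(i-1)}2}\binom{n+m-i}{n}_q\binom ni_q(q-1)^ix^i\xi^{[n+m-i]},$$ and $\widehat{A\langle\xi\rangle}_q$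 is its completion. With $\xi^{(n)}=\xi(\xi+x-qx)\cdots(\xi+x-q^{n-1}x)\in A[\xi]$, there is a canonical $A$-algebra morphism $A[\xi]\to A\langle\xi\rangle_q$, $\xi^{(n)}\mapsto(n)_q!\,\xi^{[n]}$. $q$-Taylor map $\theta$: let $\sigma$ be the unique $R$-algebra endomorphism of $A$ with $\sigma(x)=qx$, $\sigma\equiv\mathrm{Id}\bmod q-1$. Let $P=A\otimes_RA$, viewed as an $A$-algebra via $f\mapsto f\otimes1$, $I=\ker(P\to A)$ the kernel of multiplication, extend $\sigma$ to $P$ as $\sigma\otimes\mathrm{Id}_A$, let $I^{(n+1)}=I\sigma(I)\cdots\sigma^n(I)$ and $\overline{I^{(n+1)}}^{\mathrm{cl}}$ the closure of its image in $\widehat P$. The $A$-algebra maps $A[\xi]/(\xi^{(n+1)})\to\widehat P/\overline{I^{(n+1)}}^{\mathrm{cl}}$, $\xi\mapsto1\otimes x-x\otimes1$, are isomorphisms. Put $A[[\xi]]_q=\varprojlim A[\xi]/(\xi^{(n+1)})$; the map $A[\xi]\to\widehat{A\langle\xi\rangle}_q$ factors through $A[[\xi]]_q$. Then $\theta$ is the composite $A\to P\to\varprojlim\widehat P/\overline{I^{(n+1)}}^{\mathrm{cl}}\simeq A[[\xi]]_q\to\widehat{A\langle\xi\rangle}_q$, the first map being $f\mapsto1\otimes f$; it is a morphism of $R$-algebras with $\theta(x)=x+\xi$. *)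

theory Defs
  imports
    "HOL-Library.Multiset"
    "HOL-Computational_Algebra.Polynomial"
    "HOL-Computational_Algebra.Fraction_Field"
    "HOL-Algebra.UnivPoly"
    "HOL-Algebra.QuotRing"
    "HOL-Algebra.Ideal_Product"
    "HOL-Algebra.IntRing"
begin

section \<open>The base ring and the \<open>q\<close>-analogs\<close>

text \<open>Elements of \<open>\<int>[q]\<close> are terms of type \<^typ>\<open>int poly\<close>, with \<open>q = [:0, 1:]\<close>.\<close>

definition pq_prime :: "nat \<Rightarrow> int poly set" where
  "pq_prime p = {[:int p:] * f + [:-1, 1:] * g | f g. True}"

definition Zq_loc :: "nat \<Rightarrow> int poly fract ring" where
  "Zq_loc p = \<lparr>carrier = {Fract f g | f g. g \<notin> pq_prime p},
     mult = (*), one = 1, zero = 0, add = (+)\<rparr>"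

text \<open>The map from \<open>\<int>[q]\<close> to a \<open>\<int>[q]\<^sub>(\<^sub>p\<^sub>,\<^sub>q\<^sub>-\<^sub>1\<^sub>)\<close>-algebra with structure map \<open>\<phi>\<close>.
  Below, a ring \<open>B\<close> over \<open>\<int>[q]\<close> is always given together with its structure map
  \<open>c :: int poly \<Rightarrow> 'b\<close>, so that \<open>c [:0, 1:]\<close> is the element \<open>q\<close> of \<open>B\<close>.\<close>

definition Zq_map :: "(int poly fract \<Rightarrow> 'r) \<Rightarrow> int poly \<Rightarrow> 'r" where
  "Zq_map \<phi> f = \<phi> (Fract f 1)"

definition qint :: "nat \<Rightarrow> int poly" where
  "qint n = ([:0, 1:] ^ n - 1) div [:-1, 1:]"

definition qfact :: "nat \<Rightarrow> int poly" where
  "qfact n = (\<Prod>k = 1..n. qint k)"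

definition qbinom :: "nat \<Rightarrow> nat \<Rightarrow> int poly" where
  "qbinom n k = (if k \<le> n then qfact n div (qfact k * qfact (n - k)) else 0)"

definition pq_ideal :: "nat \<Rightarrow> ('b, 'm) ring_scheme \<Rightarrow> (int poly \<Rightarrow> 'b) \<Rightarrow> 'b set" where
  "pq_ideal p B c = Idl\<^bsub>B\<^esub> {c [:int p:], c [:-1, 1:]}"


section \<open>Adic topologies, limits and completions\<close>

primrec ideal_pow :: "('b, 'm) ring_scheme \<Rightarrow> 'b set \<Rightarrow> nat \<Rightarrow> 'b set" where
  "ideal_pow B J 0 = carrier B"
| "ideal_pow B J (Suc n) = ideal_prod B (ideal_pow B J n) J"

text \<open>The limit of the rings \<open>B / K n\<close> for a decreasing sequence of ideals \<open>K\<close>. For cosets,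
  \<open>s (Suc n) \<subseteq> s n\<close> says that the transition map sends \<open>s (Suc n)\<close> to \<open>s n\<close>.\<close>

definition quot_limit :: "('b, 'm) ring_scheme \<Rightarrow> (nat \<Rightarrow> 'b set) \<Rightarrow> (nat \<Rightarrow> 'b set) ring" where
  "quot_limit B K = \<lparr>
     carrier = {s. (\<forall>n. s n \<in> carrier (B Quot K n)) \<and> (\<forall>n. s (Suc n) \<subseteq> s n)},
     mult = (\<lambda>s t n. s n \<otimes>\<^bsub>B Quot K n\<^esub> t n),
     one = (\<lambda>n. \<one>\<^bsub>B Quot K n\<^esub>),
     zero = (\<lambda>n. \<zero>\<^bsub>B Quot K n\<^esub>),
     add = (\<lambda>s t n. s n \<oplus>\<^bsub>B Quot K n\<^esub> t n)\<rparr>"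

definition to_quot_limit :: "('b, 'm) ring_scheme \<Rightarrow> (nat \<Rightarrow> 'b set) \<Rightarrow> 'b \<Rightarrow> nat \<Rightarrow> 'b set" where
  "to_quot_limit B K b = (\<lambda>n. K n +>\<^bsub>B\<^esub> b)"

text \<open>The map \<open>lim B / K n \<rightarrow> lim C / L n\<close> induced by a ring morphism \<open>h: B \<rightarrow> C\<close> with
  \<open>h (K n) \<subseteq> L n\<close>; the union is over representatives, all of which give the same coset.\<close>

definition quot_limit_map ::
  "('c, 'm) ring_scheme \<Rightarrow> (nat \<Rightarrow> 'c set) \<Rightarrow> ('b \<Rightarrow> 'c) \<Rightarrow> (nat \<Rightarrow> 'b set) \<Rightarrow> nat \<Rightarrow> 'c set" where
  "quot_limit_map C L h s = (\<lambda>n. \<Union>b\<in>s n. L n +>\<^bsub>C\<^esub> h b)"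

definition completion :: "('b, 'm) ring_scheme \<Rightarrow> 'b set \<Rightarrow> (nat \<Rightarrow> 'b set) ring" where
  "completion B J = quot_limit B (ideal_pow B J)"

definition to_completion :: "('b, 'm) ring_scheme \<Rightarrow> 'b set \<Rightarrow> 'b \<Rightarrow> nat \<Rightarrow> 'b set" where
  "to_completion B J = to_quot_limit B (ideal_pow B J)"

definition adic_complete :: "('b, 'm) ring_scheme \<Rightarrow> 'b set \<Rightarrow> bool" where
  "adic_complete B J \<longleftrightarrow> bij_betw (to_completion B J) (carrier B) (carrier (completion B J))"

definition adic_closure :: "('b, 'm) ring_scheme \<Rightarrow> 'b set \<Rightarrow> 'b set \<Rightarrow> 'b set" where
  "adic_closure B J S = {y \<in> carrier B. \<forall>m. \<exists>s\<in>S. y \<ominus>\<^bsub>B\<^esub> s \<in> ideal_pow B J m}"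


section \<open>Monoid algebras and tensor products\<close>

definition monoid_algebra ::
  "('b, 'm) ring_scheme \<Rightarrow> ('g, 'n) monoid_scheme \<Rightarrow> ('g \<Rightarrow> 'b) ring" where
  "monoid_algebra B G = \<lparr>
     carrier = {u. (\<forall>g\<in>carrier G. u g \<in> carrier B) \<and> (\<forall>g. g \<notin> carrier G \<longrightarrow> u g = \<zero>\<^bsub>B\<^esub>) \<and>
                   finite {g. u g \<noteq> \<zero>\<^bsub>B\<^esub>}},
     mult = (\<lambda>u v k. finsum B (\<lambda>(g, h). u g \<otimes>\<^bsub>B\<^esub> v h)
                {(g, h). u g \<noteq> \<zero>\<^bsub>B\<^esub> \<and> v h \<noteq> \<zero>\<^bsub>B\<^esub> \<and> g \<otimes>\<^bsub>G\<^esub> h = k}),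
     one = (\<lambda>g. if g = \<one>\<^bsub>G\<^esub> then \<one>\<^bsub>B\<^esub> else \<zero>\<^bsub>B\<^esub>),
     zero = (\<lambda>g. \<zero>\<^bsub>B\<^esub>),
     add = (\<lambda>u v g. u g \<oplus>\<^bsub>B\<^esub> v g)\<rparr>"

definition single :: "('b, 'm) ring_scheme \<Rightarrow> 'g \<Rightarrow> 'b \<Rightarrow> 'g \<Rightarrow> 'b" where
  "single B g b = (\<lambda>h. if h = g then b else \<zero>\<^bsub>B\<^esub>)"

text \<open>\<open>B \<otimes>\<^sub>R C\<close> is the free abelian group on \<open>B \<times> C\<close> with \<open>(b, c) (b', c') = (b b', c c')\<close>,
  modulo the usual relations (the subgroup they span is an ideal).\<close>

definition tensor_rel ::
  "('r, 'k) ring_scheme \<Rightarrow> ('b, 'm) ring_scheme \<Rightarrow> ('r \<Rightarrow> 'b) \<Rightarrow>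
   ('c, 'n) ring_scheme \<Rightarrow> ('r \<Rightarrow> 'c) \<Rightarrow> ('b \<times> 'c \<Rightarrow> int) set" where
  "tensor_rel R B \<beta> C \<gamma> =
     (let F = monoid_algebra \<Z> (B \<times>\<times> C); e = (\<lambda>b c. single \<Z> (b, c) 1) in
      {e (b \<oplus>\<^bsub>B\<^esub> b') c \<ominus>\<^bsub>F\<^esub> (e b c \<oplus>\<^bsub>F\<^esub> e b' c) | b b' c.
         b \<in> carrier B \<and> b' \<in> carrier B \<and> c \<in> carrier C} \<union>
      {e b (c \<oplus>\<^bsub>C\<^esub> c') \<ominus>\<^bsub>F\<^esub> (e b c \<oplus>\<^bsub>F\<^esub> e b c') | b c c'.
         b \<in> carrier B \<and> c \<in> carrier C \<and> c' \<in> carrier C} \<union>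
      {e (\<beta> r \<otimes>\<^bsub>B\<^esub> b) c \<ominus>\<^bsub>F\<^esub> e b (\<gamma> r \<otimes>\<^bsub>C\<^esub> c) | r b c.
         r \<in> carrier R \<and> b \<in> carrier B \<and> c \<in> carrier C})"

definition tensor_ring ::
  "('r, 'k) ring_scheme \<Rightarrow> ('b, 'm) ring_scheme \<Rightarrow> ('r \<Rightarrow> 'b) \<Rightarrow>
   ('c, 'n) ring_scheme \<Rightarrow> ('r \<Rightarrow> 'c) \<Rightarrow> ('b \<times> 'c \<Rightarrow> int) set ring" where
  "tensor_ring R B \<beta> C \<gamma> =
     (let F = monoid_algebra \<Z> (B \<times>\<times> C) in F Quot (Idl\<^bsub>F\<^esub> (tensor_rel R B \<beta> C \<gamma>)))"

definition pure_tensor ::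
  "('r, 'k) ring_scheme \<Rightarrow> ('b, 'm) ring_scheme \<Rightarrow> ('r \<Rightarrow> 'b) \<Rightarrow>
   ('c, 'n) ring_scheme \<Rightarrow> ('r \<Rightarrow> 'c) \<Rightarrow> 'b \<Rightarrow> 'c \<Rightarrow> ('b \<times> 'c \<Rightarrow> int) set" where
  "pure_tensor R B \<beta> C \<gamma> b c =
     (let F = monoid_algebra \<Z> (B \<times>\<times> C)
      in (Idl\<^bsub>F\<^esub> (tensor_rel R B \<beta> C \<gamma>)) +>\<^bsub>F\<^esub> single \<Z> (b, c) 1)"

text \<open>\<open>B[T\<^sub>0, \<dots>, T\<^sub>n\<^sub>-\<^sub>1]\<close>, a multiset being a monomial.\<close>

definition mpoly_ring :: "('b, 'm) ring_scheme \<Rightarrow> nat \<Rightarrow> (nat multiset \<Rightarrow> 'b) ring" where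
  "mpoly_ring B n =
     monoid_algebra B \<lparr>carrier = {M. set_mset M \<subseteq> {..<n}}, mult = (+), one = {#}\<rparr>"


section \<open>Topologically etale coordinates\<close>

text \<open>Let \<open>f: B \<rightarrow> A\<close> be a ring morphism, \<open>B\<close> with the \<open>J\<close>-adic and \<open>A\<close> with the \<open>J A\<close>-adic
  topology. It is formally etale (as a morphism of topological rings) if, for every discrete
  topological \<open>B\<close>-algebra \<open>g: B \<rightarrow> C\<close> (that is, \<open>g\<close> kills a power of \<open>J\<close>) and every nilpotent
  ideal \<open>N\<close> of \<open>C\<close>, every \<open>B\<close>-algebra morphism \<open>v: A \<rightarrow> C / N\<close> lifts uniquely to \<open>C\<close>;
  continuity of \<open>B\<close>-algebra morphisms \<open>A \<rightarrow> C\<close> and \<open>A \<rightarrow> C / N\<close> is automatic.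
  A term cannot quantify over all types, but rings \<open>C\<close> with carrier in the type
  \<open>('b \<times> 'a) list set\<close> are enough for the property to hold for all \<open>C\<close>: a lifting problem, a
  lift and a pair of distinct lifts all restrict to a subring of \<open>C\<close> generated by \<open>g B\<close>
  together with one or two elements for each element of \<open>A\<close>, and this
  subring injects into \<open>('b \<times> 'a) list\<close>.\<close>

definition formally_etale ::
  "('b, 'm) ring_scheme \<Rightarrow> 'b set \<Rightarrow> ('a, 'n) ring_scheme \<Rightarrow> ('b \<Rightarrow> 'a) \<Rightarrow> bool" where
  "formally_etale B J A f \<longleftrightarrow>
     (\<forall>(C :: ('b \<times> 'a) list set ring) N g v.
        cring C \<and> ideal N C \<and> (\<exists>n. ideal_pow C N n = {\<zero>\<^bsub>C\<^esub>}) \<and>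
        g \<in> ring_hom B C \<and> (\<exists>m. \<forall>b\<in>ideal_pow B J m. g b = \<zero>\<^bsub>C\<^esub>) \<and>
        v \<in> ring_hom A (C Quot N) \<and> (\<forall>b\<in>carrier B. v (f b) = N +>\<^bsub>C\<^esub> g b) \<longrightarrow>
        (\<exists>!u. u \<in> ring_hom A C \<and> u \<in> extensional (carrier A) \<and>
              (\<forall>b\<in>carrier B. u (f b) = g b) \<and>
              (\<forall>a\<in>carrier A. N +>\<^bsub>C\<^esub> u a = v a)))"

text \<open>Topologically finitely presented: a quotient of the completion \<open>E\<close> of some
  \<open>B[T\<^sub>0, \<dots>, T\<^sub>n\<^sub>-\<^sub>1]\<close> by the closure of a finitely generated ideal. (For separated \<open>A\<close> this
  includes the quotients by a finitely generated ideal, which is then closed.)\<close>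

definition top_fin_presented ::
  "('b, 'm) ring_scheme \<Rightarrow> 'b set \<Rightarrow> ('a, 'n) ring_scheme \<Rightarrow> ('b \<Rightarrow> 'a) \<Rightarrow> bool" where
  "top_fin_presented B J A f \<longleftrightarrow>
     (\<exists>n \<pi> S.
        let T = mpoly_ring B n;
            J\<^sub>T = Idl\<^bsub>T\<^esub> (single B {#} ` J);
            E = completion T J\<^sub>T;
            i = to_completion T J\<^sub>T \<circ> single B {#};
            J\<^sub>E = Idl\<^bsub>E\<^esub> (i ` J)
        in \<pi> \<in> ring_hom E A \<and> \<pi> ` carrier E = carrier A \<and>
           (\<forall>b\<in>carrier B. \<pi> (i b) = f b) \<and>
           finite S \<and> S \<subseteq> carrier E \<and>
           a_kernel E A \<pi> = adic_closure E J\<^sub>E (Idl\<^bsub>E\<^esub> S))"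

definition top_etale_coordinate ::
  "nat \<Rightarrow> ('r, 'k) ring_scheme \<Rightarrow> (int poly \<Rightarrow> 'r) \<Rightarrow> ('a, 'm) ring_scheme \<Rightarrow> ('r \<Rightarrow> 'a) \<Rightarrow>
   'a \<Rightarrow> bool" where
  "top_etale_coordinate p R c A \<eta> x \<longleftrightarrow>
     x \<in> carrier A \<and>
     (let J = pq_ideal p (UP R) (\<lambda>f. up_ring.monom (UP R) (c f) 0);
          ev = UnivPoly.eval R A \<eta> x
      in formally_etale (UP R) J A ev \<and> top_fin_presented (UP R) J A ev)"


section \<open>Twisted divided polynomials\<close>

text \<open>As an \<open>A\<close>-module, \<open>A\<langle>\<xi>\<rangle>\<^sub>q\<close> has the same underlying set as \<open>A[\<xi>]\<close>, but now
  \<^term>\<open>up_ring.monom (dp_ring c A x) a n\<close> stands for \<open>a \<xi>\<^sup>[\<^sup>n\<^sup>]\<close>.\<close>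

definition dp_ring ::
  "(int poly \<Rightarrow> 'a) \<Rightarrow> ('a, 'm) ring_scheme \<Rightarrow> 'a \<Rightarrow> ('a, nat \<Rightarrow> 'a) up_ring" where
  "dp_ring c A x = (UP A)\<lparr>mult := (\<lambda>u v k.
     finsum A (\<lambda>(n, m, i).
       c ([:0, 1:] ^ (i * (i - 1) div 2) * qbinom (n + m - i) n * qbinom n i * [:-1, 1:] ^ i)
         \<otimes>\<^bsub>A\<^esub> x [^]\<^bsub>A\<^esub> i \<otimes>\<^bsub>A\<^esub> (u n \<otimes>\<^bsub>A\<^esub> v m))
       {(n, m, i). i \<le> n \<and> i \<le> m \<and> n + m - i = k})\<rparr>"

definition dp_ideal ::
  "nat \<Rightarrow> (int poly \<Rightarrow> 'a) \<Rightarrow> ('a, 'm) ring_scheme \<Rightarrow> 'a \<Rightarrow> (nat \<Rightarrow> 'a) set" where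
  "dp_ideal p c A x = pq_ideal p (dp_ring c A x) (\<lambda>f. up_ring.monom (dp_ring c A x) (c f) 0)"

definition dp_hat ::
  "nat \<Rightarrow> (int poly \<Rightarrow> 'a) \<Rightarrow> ('a, 'm) ring_scheme \<Rightarrow> 'a \<Rightarrow> (nat \<Rightarrow> (nat \<Rightarrow> 'a) set) ring" where
  "dp_hat p c A x = completion (dp_ring c A x) (dp_ideal p c A x)"

definition to_dp_hat ::
  "nat \<Rightarrow> (int poly \<Rightarrow> 'a) \<Rightarrow> ('a, 'm) ring_scheme \<Rightarrow> 'a \<Rightarrow>
   (nat \<Rightarrow> 'a) \<Rightarrow> nat \<Rightarrow> (nat \<Rightarrow> 'a) set" where
  "to_dp_hat p c A x = to_completion (dp_ring c A x) (dp_ideal p c A x)"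

definition dp_hat_monom ::
  "nat \<Rightarrow> (int poly \<Rightarrow> 'a) \<Rightarrow> ('a, 'm) ring_scheme \<Rightarrow> 'a \<Rightarrow>
   'a \<Rightarrow> nat \<Rightarrow> nat \<Rightarrow> (nat \<Rightarrow> 'a) set" where
  "dp_hat_monom p c A x a n = to_dp_hat p c A x (up_ring.monom (dp_ring c A x) a n)"

definition dp_hat_ideal ::
  "nat \<Rightarrow> (int poly \<Rightarrow> 'a) \<Rightarrow> ('a, 'm) ring_scheme \<Rightarrow> 'a \<Rightarrow> (nat \<Rightarrow> (nat \<Rightarrow> 'a) set) set" where
  "dp_hat_ideal p c A x = pq_ideal p (dp_hat p c A x) (\<lambda>f. dp_hat_monom p c A x (c f) 0)"

text \<open>\<open>\<xi>\<^sup>(\<^sup>n\<^sup>) = \<xi> (\<xi> + x - q x) \<cdots> (\<xi> + x - q\<^sup>n\<^sup>-\<^sup>1 x)\<close> in \<open>A[\<xi>]\<close>\<close>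

definition twisted_pow ::
  "(int poly \<Rightarrow> 'a) \<Rightarrow> ('a, 'm) ring_scheme \<Rightarrow> 'a \<Rightarrow> nat \<Rightarrow> nat \<Rightarrow> 'a" where
  "twisted_pow c A x n = (\<Otimes>\<^bsub>UP A\<^esub>i \<in> {..<n}.
     up_ring.monom (UP A) \<one>\<^bsub>A\<^esub> 1 \<oplus>\<^bsub>UP A\<^esub>
     up_ring.monom (UP A) (x \<ominus>\<^bsub>A\<^esub> c ([:0, 1:] ^ i) \<otimes>\<^bsub>A\<^esub> x) 0)"

definition up_to_dp ::
  "(int poly \<Rightarrow> 'a) \<Rightarrow> ('a, 'm) ring_scheme \<Rightarrow> 'a \<Rightarrow> (nat \<Rightarrow> 'a) \<Rightarrow> nat \<Rightarrow> 'a" where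
  "up_to_dp c A x = (THE h.
     h \<in> ring_hom (UP A) (dp_ring c A x) \<and> h \<in> extensional (carrier (UP A)) \<and>
     (\<forall>a\<in>carrier A. h (up_ring.monom (UP A) a 0) = up_ring.monom (dp_ring c A x) a 0) \<and>
     (\<forall>n. h (twisted_pow c A x n) = up_ring.monom (dp_ring c A x) (c (qfact n)) n))"

definition q_series_ideal ::
  "(int poly \<Rightarrow> 'a) \<Rightarrow> ('a, 'm) ring_scheme \<Rightarrow> 'a \<Rightarrow> nat \<Rightarrow> (nat \<Rightarrow> 'a) set" where
  "q_series_ideal c A x n = PIdl\<^bsub>UP A\<^esub> (twisted_pow c A x (Suc n))"

text \<open>\<open>A[[\<xi>]]\<^sub>q\<close>\<close>

definition q_series ::
  "(int poly \<Rightarrow> 'a) \<Rightarrow> ('a, 'm) ring_scheme \<Rightarrow> 'a \<Rightarrow> (nat \<Rightarrow> (nat \<Rightarrow> 'a) set) ring" where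
  "q_series c A x = quot_limit (UP A) (q_series_ideal c A x)"

text \<open>The factorization of \<open>A[\<xi>] \<rightarrow> A\<langle>\<xi>\<rangle>\<^sub>q^\<close> through \<open>A[[\<xi>]]\<^sub>q\<close>, i.e. its continuous extension:
  \<open>s = (s n)\<close> is sent to the limit of the images of any representatives of the \<open>s n\<close>.\<close>

definition q_series_to_dp ::
  "nat \<Rightarrow> (int poly \<Rightarrow> 'a) \<Rightarrow> ('a, 'm) ring_scheme \<Rightarrow> 'a \<Rightarrow>
   (nat \<Rightarrow> (nat \<Rightarrow> 'a) set) \<Rightarrow> nat \<Rightarrow> (nat \<Rightarrow> 'a) set" where
  "q_series_to_dp p c A x s = (THE y.
     y \<in> carrier (dp_hat p c A x) \<and>
     (\<forall>m. \<exists>N. \<forall>n\<ge>N. \<forall>b\<in>s n.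
        y \<ominus>\<^bsub>dp_hat p c A x\<^esub> to_dp_hat p c A x (up_to_dp c A x b)
          \<in> ideal_pow (dp_hat p c A x) (dp_hat_ideal p c A x) m))"


section \<open>The \<open>q\<close>-Taylor map\<close>

definition q_endo ::
  "('r, 'k) ring_scheme \<Rightarrow> (int poly \<Rightarrow> 'a) \<Rightarrow> ('a, 'm) ring_scheme \<Rightarrow> ('r \<Rightarrow> 'a) \<Rightarrow>
   'a \<Rightarrow> 'a \<Rightarrow> 'a" where
  "q_endo R c A \<eta> x = (THE s.
     s \<in> ring_hom A A \<and> s \<in> extensional (carrier A) \<and>
     (\<forall>r\<in>carrier R. s (\<eta> r) = \<eta> r) \<and>
     s x = c [:0, 1:] \<otimes>\<^bsub>A\<^esub> x \<and>
     (\<forall>a\<in>carrier A. s a \<ominus>\<^bsub>A\<^esub> a \<in> PIdl\<^bsub>A\<^esub> (c [:-1, 1:])))"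

abbreviation self_tensor ::
  "('r, 'k) ring_scheme \<Rightarrow> ('a, 'm) ring_scheme \<Rightarrow> ('r \<Rightarrow> 'a) \<Rightarrow> ('a \<times> 'a \<Rightarrow> int) set ring" where
  "self_tensor R A \<eta> \<equiv> tensor_ring R A \<eta> A \<eta>"

abbreviation self_pure ::
  "('r, 'k) ring_scheme \<Rightarrow> ('a, 'm) ring_scheme \<Rightarrow> ('r \<Rightarrow> 'a) \<Rightarrow> 'a \<Rightarrow> 'a \<Rightarrow>
   ('a \<times> 'a \<Rightarrow> int) set" where
  "self_pure R A \<eta> \<equiv> pure_tensor R A \<eta> A \<eta>"

definition tensor_mult ::
  "('r, 'k) ring_scheme \<Rightarrow> ('a, 'm) ring_scheme \<Rightarrow> ('r \<Rightarrow> 'a) \<Rightarrow>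
   ('a \<times> 'a \<Rightarrow> int) set \<Rightarrow> 'a" where
  "tensor_mult R A \<eta> = (THE h.
     h \<in> ring_hom (self_tensor R A \<eta>) A \<and> h \<in> extensional (carrier (self_tensor R A \<eta>)) \<and>
     (\<forall>a\<in>carrier A. \<forall>b\<in>carrier A. h (self_pure R A \<eta> a b) = a \<otimes>\<^bsub>A\<^esub> b))"

definition diag_ideal ::
  "('r, 'k) ring_scheme \<Rightarrow> ('a, 'm) ring_scheme \<Rightarrow> ('r \<Rightarrow> 'a) \<Rightarrow>
   ('a \<times> 'a \<Rightarrow> int) set set" where
  "diag_ideal R A \<eta> = a_kernel (self_tensor R A \<eta>) A (tensor_mult R A \<eta>)"

definition q_endo_tensor ::
  "('r, 'k) ring_scheme \<Rightarrow> (int poly \<Rightarrow> 'a) \<Rightarrow> ('a, 'm) ring_scheme \<Rightarrow> ('r \<Rightarrow> 'a) \<Rightarrow> 'a \<Rightarrow>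
   ('a \<times> 'a \<Rightarrow> int) set \<Rightarrow> ('a \<times> 'a \<Rightarrow> int) set" where
  "q_endo_tensor R c A \<eta> x = (THE h.
     h \<in> ring_hom (self_tensor R A \<eta>) (self_tensor R A \<eta>) \<and>
     h \<in> extensional (carrier (self_tensor R A \<eta>)) \<and>
     (\<forall>a\<in>carrier A. \<forall>b\<in>carrier A.
        h (self_pure R A \<eta> a b) = self_pure R A \<eta> (q_endo R c A \<eta> x a) b))"

text \<open>\<^term>\<open>twisted_ideal R c A \<eta> x n\<close> is \<open>I\<^sup>(\<^sup>n\<^sup>+\<^sup>1\<^sup>) = I \<sigma>(I) \<cdots> \<sigma>\<^sup>n(I)\<close> (note the shift).\<close>

primrec twisted_ideal ::
  "('r, 'k) ring_scheme \<Rightarrow> (int poly \<Rightarrow> 'a) \<Rightarrow> ('a, 'm) ring_scheme \<Rightarrow> ('r \<Rightarrow> 'a) \<Rightarrow> 'a \<Rightarrow>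
   nat \<Rightarrow> ('a \<times> 'a \<Rightarrow> int) set set" where
  "twisted_ideal R c A \<eta> x 0 = diag_ideal R A \<eta>"
| "twisted_ideal R c A \<eta> x (Suc n) =
     ideal_prod (self_tensor R A \<eta>) (twisted_ideal R c A \<eta> x n)
       (Idl\<^bsub>self_tensor R A \<eta>\<^esub> ((q_endo_tensor R c A \<eta> x ^^ Suc n) ` diag_ideal R A \<eta>))"

definition tensor_ideal ::
  "nat \<Rightarrow> ('r, 'k) ring_scheme \<Rightarrow> (int poly \<Rightarrow> 'a) \<Rightarrow> ('a, 'm) ring_scheme \<Rightarrow> ('r \<Rightarrow> 'a) \<Rightarrow>
   ('a \<times> 'a \<Rightarrow> int) set set" where
  "tensor_ideal p R c A \<eta> =
     pq_ideal p (self_tensor R A \<eta>) (\<lambda>f. self_pure R A \<eta> (c f) \<one>\<^bsub>A\<^esub>)"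

definition tensor_hat ::
  "nat \<Rightarrow> ('r, 'k) ring_scheme \<Rightarrow> (int poly \<Rightarrow> 'a) \<Rightarrow> ('a, 'm) ring_scheme \<Rightarrow> ('r \<Rightarrow> 'a) \<Rightarrow>
   (nat \<Rightarrow> ('a \<times> 'a \<Rightarrow> int) set set) ring" where
  "tensor_hat p R c A \<eta> = completion (self_tensor R A \<eta>) (tensor_ideal p R c A \<eta>)"

definition tensor_hat_pure ::
  "nat \<Rightarrow> ('r, 'k) ring_scheme \<Rightarrow> (int poly \<Rightarrow> 'a) \<Rightarrow> ('a, 'm) ring_scheme \<Rightarrow> ('r \<Rightarrow> 'a) \<Rightarrow>
   'a \<Rightarrow> 'a \<Rightarrow> nat \<Rightarrow> ('a \<times> 'a \<Rightarrow> int) set set" where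
  "tensor_hat_pure p R c A \<eta> a b =
     to_completion (self_tensor R A \<eta>) (tensor_ideal p R c A \<eta>) (self_pure R A \<eta> a b)"

definition twisted_closure ::
  "nat \<Rightarrow> ('r, 'k) ring_scheme \<Rightarrow> (int poly \<Rightarrow> 'a) \<Rightarrow> ('a, 'm) ring_scheme \<Rightarrow> ('r \<Rightarrow> 'a) \<Rightarrow>
   'a \<Rightarrow> nat \<Rightarrow> (nat \<Rightarrow> ('a \<times> 'a \<Rightarrow> int) set set) set" where
  "twisted_closure p R c A \<eta> x n =
     adic_closure (tensor_hat p R c A \<eta>)
       (pq_ideal p (tensor_hat p R c A \<eta>) (\<lambda>f. tensor_hat_pure p R c A \<eta> (c f) \<one>\<^bsub>A\<^esub>))
       (to_completion (self_tensor R A \<eta>) (tensor_ideal p R c A \<eta>) ` twisted_ideal R c A \<eta> x n)"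

text \<open>The isomorphism from \<open>A[[\<xi>]]\<^sub>q\<close> to \<open>lim P^ / cl I\<^sup>(\<^sup>n\<^sup>+\<^sup>1\<^sup>)\<close> induced by the \<open>A\<close>-algebra morphism
  \<open>A[\<xi>] \<rightarrow> P^\<close>, \<open>\<xi> \<mapsto> 1 \<otimes> x - x \<otimes> 1\<close>\<close>

definition q_series_to_tensor ::
  "nat \<Rightarrow> ('r, 'k) ring_scheme \<Rightarrow> (int poly \<Rightarrow> 'a) \<Rightarrow> ('a, 'm) ring_scheme \<Rightarrow> ('r \<Rightarrow> 'a) \<Rightarrow> 'a \<Rightarrow>
   (nat \<Rightarrow> (nat \<Rightarrow> 'a) set) \<Rightarrow> nat \<Rightarrow> (nat \<Rightarrow> ('a \<times> 'a \<Rightarrow> int) set set) set" where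
  "q_series_to_tensor p R c A \<eta> x =
     (let H = tensor_hat p R c A \<eta>; t = tensor_hat_pure p R c A \<eta>
      in quot_limit_map H (twisted_closure p R c A \<eta> x)
           (UnivPoly.eval A H (\<lambda>a. t a \<one>\<^bsub>A\<^esub>) (t \<one>\<^bsub>A\<^esub> x \<ominus>\<^bsub>H\<^esub> t x \<one>\<^bsub>A\<^esub>)))"

definition q_taylor ::
  "nat \<Rightarrow> ('r, 'k) ring_scheme \<Rightarrow> (int poly \<Rightarrow> 'a) \<Rightarrow> ('a, 'm) ring_scheme \<Rightarrow> ('r \<Rightarrow> 'a) \<Rightarrow> 'a \<Rightarrow>
   'a \<Rightarrow> nat \<Rightarrow> (nat \<Rightarrow> 'a) set" where
  "q_taylor p R c A \<eta> x f =
     q_series_to_dp p c A x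
       (inv_into (carrier (q_series c A x)) (q_series_to_tensor p R c A \<eta> x)
         (to_quot_limit (tensor_hat p R c A \<eta>) (twisted_closure p R c A \<eta> x)
           (tensor_hat_pure p R c A \<eta> \<one>\<^bsub>A\<^esub> f)))"


section \<open>The flip map\<close>

definition flip_poly ::
  "(int poly \<Rightarrow> 'a) \<Rightarrow> ('a, 'm) ring_scheme \<Rightarrow> 'a \<Rightarrow> nat \<Rightarrow> nat \<Rightarrow> 'a" where
  "flip_poly c A x n = (\<Oplus>\<^bsub>dp_ring c A x\<^esub>k \<in> {1..n}.
     up_ring.monom (dp_ring c A x)
       (c ((-1) ^ k * [:0, 1:] ^ (k * (k - 1) div 2) * [:1, -1:] ^ (n - k) *
           qbinom (n - 1) (k - 1))
        \<otimes>\<^bsub>A\<^esub> x [^]\<^bsub>A\<^esub> (n - k)) k)"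

definition is_flip_map ::
  "nat \<Rightarrow> ('r, 'k) ring_scheme \<Rightarrow> (int poly \<Rightarrow> 'a) \<Rightarrow> ('a, 'm) ring_scheme \<Rightarrow> ('r \<Rightarrow> 'a) \<Rightarrow> 'a \<Rightarrow>
   ((nat \<Rightarrow> (nat \<Rightarrow> 'a) set) \<Rightarrow> nat \<Rightarrow> (nat \<Rightarrow> 'a) set) \<Rightarrow> bool" where
  "is_flip_map p R c A \<eta> x \<tau> \<longleftrightarrow>
     (let H = dp_hat p c A x; J = dp_hat_ideal p c A x; mon = dp_hat_monom p c A x;
          \<theta> = q_taylor p R c A \<eta> x
      in \<tau> \<in> carrier H \<rightarrow> carrier H \<and>
         (\<forall>y\<in>carrier H. \<forall>z\<in>carrier H. \<tau> (y \<oplus>\<^bsub>H\<^esub> z) = \<tau> y \<oplus>\<^bsub>H\<^esub> \<tau> z) \<and>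
         (\<forall>r\<in>carrier R. \<forall>y\<in>carrier H. \<tau> (mon (\<eta> r) 0 \<otimes>\<^bsub>H\<^esub> y) = mon (\<eta> r) 0 \<otimes>\<^bsub>H\<^esub> \<tau> y) \<and>
         (\<forall>m. \<exists>k. \<forall>y\<in>ideal_pow H J k. \<tau> y \<in> ideal_pow H J m) \<and>
         (\<forall>f\<in>carrier A. \<tau> (mon f 0) = \<theta> f) \<and>
         (\<forall>f\<in>carrier A. \<forall>n\<ge>1.
            \<tau> (mon f n) = \<theta> f \<otimes>\<^bsub>H\<^esub> to_dp_hat p c A x (flip_poly c A x n)))"

end

theory Submission
  imports Defs "HOL-Computational_Algebra.Polynomial_Factorial" "HOL-Algebra.Weak_Morphisms"
begin

text \<open>Over \<open>\<int>[q]\<close> the twisted divided powers embed into polynomials in \<open>x, y\<close> over the fraction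
  field by \<open>\<xi>\<^sup>[\<^sup>n\<^sup>] \<mapsto> \<Prod>\<^sub>i\<^sub><\<^sub>n (y - q\<^sup>i x) / (n)\<^sub>q!\<close>, and there the flip exchanges \<open>x\<close> and \<open>y = x + \<xi>\<close>;
  this yields the product formula for the polynomials \<open>\<tau>(\<xi>\<^sup>[\<^sup>n\<^sup>])\<close> and the formula for
  \<open>\<tau>(\<tau>(\<xi>\<^sup>[\<^sup>n\<^sup>]))\<close>. Etaleness of \<open>x\<close> lifts \<open>x \<mapsto> x + \<xi>\<close> to compatible maps
  \<open>A \<rightarrow> A[\<xi>] / (\<xi>\<^sup>(\<^sup>n\<^sup>))\<close>, whose limit is identified with \<open>\<theta>\<close>: uniqueness of lifts shows that
  \<open>\<xi> \<mapsto> 1 \<otimes> x - x \<otimes> 1\<close> sends them to \<open>f \<mapsto> 1 \<otimes> f\<close>, and evaluation at \<open>\<xi> = (q\<^sup>k - 1) x\<close>, which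
  computes \<open>\<sigma>\<^sup>k\<close>, shows that \<open>A[\<xi>] / (\<xi>\<^sup>(\<^sup>n\<^sup>+\<^sup>1\<^sup>))\<close> injects into the quotient by \<open>I\<^sup>(\<^sup>n\<^sup>+\<^sup>1\<^sup>)\<close>. Finally
  \<open>\<tau> \<circ> \<theta>\<close> and the inclusion of \<open>A\<close> agree on \<open>x\<close> and modulo \<open>\<xi>\<close>, which is topologically
  nilpotent, hence are equal by etaleness.\<close>

text \<open>The product rule and the flip formulas cannot be derived by division over A, where
  (n)_q! may be a zero divisor. They are proved where q-factorials are invertible, descend to
  \<int>[q][x] by injectivity, and reach every A by base change. Formal etaleness speaks of discrete
  targets only. A lift of x to x + \<xi> therefore exists only modulo (\<xi>^(m)) + (p, q-1)^m, and
  is handled through representatives. Its coefficients in the monic basis \<xi>^(k) are unique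
  modulo (p, q-1)^m, so they converge in A. The series so obtained has an image in the completed
  divided power ring because (n)_q! lies in (p, q-1)^m as soon as n \<ge> p m. The inverse
  isomorphism in the definition of \<theta> is evaluated by injectivity at an explicit preimage of 1
  \<otimes> f. Every uniqueness argument needs a nilpotent ideal. The twisted powers of I are not
  powers of one ideal, so nilpotence is gained in two stages: modulo q - 1 the twist disappears, and
  q - 1 is nilpotent modulo (p, q-1)^m.\<close>

section \<open>q-integers, q-factorials and q-binomial coefficients in \<int>[q]\<close>

lemma pCons_neg1_1: "[:-1, 1:] = [:0, 1:] - (1 :: int poly)"
  by (simp add: one_pCons)

text \<open>The geometric series shows that the division by q - 1 in the definition is
  exact.\<close>

lemma qint_eq_sum: "qint n = (\<Sum>i<n. [:0, 1:] ^ i)"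
proof -
  have "[:0, 1:] ^ n - (1 :: int poly) = [:-1, 1:] * (\<Sum>i<n. [:0, 1:] ^ i)"
    unfolding pCons_neg1_1 by (rule power_diff_1_eq)
  then show ?thesis
    unfolding qint_def by (metis nonzero_mult_div_cancel_left pCons_eq_0_iff one_neq_zero)
qed

lemma qint_0 [simp]: "qint 0 = 0"
  and qint_Suc: "qint (Suc n) = qint n + [:0, 1:] ^ n"
  by (simp_all add: qint_eq_sum)

lemma qint_Suc_0 [simp]: "qint (Suc 0) = 1"
  by (simp add: qint_Suc)

lemma qint_add: "qint (m + n) = qint m + [:0, 1:] ^ m * qint n"
  by (induction n) (simp_all add: qint_Suc algebra_simps power_add)

lemma qint_mult_q_minus_1: "[:-1, 1:] * qint n = [:0, 1:] ^ n - 1"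
  unfolding pCons_neg1_1 qint_eq_sum by (rule power_diff_1_eq[symmetric])

text \<open>Specialising q to 1 is the source of the nonvanishing of q-integers and
  q-factorials.\<close>

lemma poly_qint_1: "poly (qint n) 1 = int n"
  by (induction n) (simp_all add: qint_Suc)

lemma qint_nonzero: "n > 0 \<Longrightarrow> qint n \<noteq> 0"
  using poly_qint_1[of n] by auto

lemma qfact_0 [simp]: "qfact 0 = 1"
  and qfact_Suc: "qfact (Suc n) = qint (Suc n) * qfact n"
  by (simp_all add: qfact_def prod.nat_ivl_Suc' mult.commute)

lemma qfact_nonzero [simp]: "qfact n \<noteq> 0"
  by (induction n) (simp_all add: qfact_Suc qint_nonzero)

text \<open>Splitting (n+1)_q as (k)_q + q^k (n+1-k)_q reduces the claim to two instances for n, as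
  in Pascal's rule. It makes the \<open>div\<close> in \<open>qbinom\<close> exact.\<close>

lemma qfact_dvd: "k \<le> n \<Longrightarrow> qfact k * qfact (n - k) dvd qfact n"
proof (induction n arbitrary: k)
  case (Suc n)
  show ?case
  proof (cases "k = 0 \<or> k = Suc n")
    case False
    then obtain j where k: "k = Suc j" "j < n"
      using Suc.prems by (metis Suc_less_SucD le_neq_implies_less not0_implies_Suc)
    then have nk: "Suc n - k = Suc (n - k)" "n - k = n - Suc j" "n - j = Suc (n - Suc j)"
      by auto
    have "qfact (Suc n) = qint (k + (Suc n - k)) * qfact n"
      using Suc.prems by (simp add: qfact_Suc)
    also have "\<dots> = qint k * qfact n + [:0, 1:] ^ k * (qint (Suc n - k) * qfact n)"
      by (simp only: qint_add distrib_right mult.assoc)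
    finally have *: "qfact (Suc n) = qint k * qfact n + [:0, 1:] ^ k * (qint (Suc n - k) * qfact n)" .
    have "qint k * (qfact j * qfact (n - j)) dvd qint k * qfact n"
      using Suc.IH[of j] k by (intro mult_dvd_mono) auto
    moreover have "qint (Suc n - k) * (qfact k * qfact (n - k)) dvd qint (Suc n - k) * qfact n"
      using Suc.IH[of k] k by (intro mult_dvd_mono) auto
    moreover have "qfact k * qfact (Suc n - k) = qint k * (qfact j * qfact (n - j))"
      and "qfact k * qfact (Suc n - k) = qint (Suc n - k) * (qfact k * qfact (n - k))"
      by (simp_all add: nk k(1) qfact_Suc ac_simps)
    ultimately show ?thesis
      unfolding * by (metis dvd_add dvd_mult)
  qed auto
qed simp

lemma qbinom_qfact: "k \<le> n \<Longrightarrow> qbinom n k * (qfact k * qfact (n - k)) = qfact n"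
  using qfact_dvd[of k n] by (simp add: qbinom_def)

lemma qbinom_eq_0 [simp]: "n < k \<Longrightarrow> qbinom n k = 0"
  by (simp add: qbinom_def)

lemma qbinom_unique: "k \<le> n \<Longrightarrow> b * (qfact k * qfact (n - k)) = qfact n \<Longrightarrow> qbinom n k = b"
  using qbinom_qfact[of k n] by (metis mult_right_cancel mult_eq_0_iff qfact_nonzero)

lemma qbinom_0 [simp]: "qbinom n 0 = 1"
  and qbinom_same [simp]: "qbinom n n = 1"
  by (rule qbinom_unique; simp)+

text \<open>For k < n both sides become (n)_q! after multiplication by the factorials of k and n - k
  - 1; for k = n both are 0. Being free of division, it is the tool for all later comparisons of
  binomials.\<close>

lemma qbinom_absorb: "qbinom n (Suc k) * qint (Suc k) = qbinom n k * qint (n - k)"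
proof (cases "Suc k \<le> n")
  case True
  then have nk: "n - k = Suc (n - Suc k)" by simp
  have "qbinom n (Suc k) * qint (Suc k) * (qfact k * qfact (n - Suc k)) = qfact n"
    using qbinom_qfact[OF True] by (simp add: qfact_Suc ac_simps)
  also have "\<dots> = qbinom n k * qint (n - k) * (qfact k * qfact (n - Suc k))"
    using qbinom_qfact[of k n] True unfolding nk qfact_Suc by (simp add: ac_simps)
  finally show ?thesis by simp
next
  case False
  then show ?thesis by (cases "k = n") auto
qed

text \<open>Pascal's rule multiplied by (k+1)_q reduces, by absorption, to the additivity rule for
  q-integers.\<close>

lemma qbinom_Pascal_aux:
  assumes "k \<le> n"
  shows "(qbinom n (Suc k) + [:0, 1:] ^ (n - k) * qbinom n k) * qint (Suc k) = qbinom n k * qint (Suc n)"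
proof -
  have "(qbinom n (Suc k) + [:0, 1:] ^ (n - k) * qbinom n k) * qint (Suc k)
    = qbinom n (Suc k) * qint (Suc k) + qbinom n k * ([:0, 1:] ^ (n - k) * qint (Suc k))"
    by (simp only: distrib_left distrib_right mult_ac)
  also have "\<dots> = qbinom n k * (qint (n - k) + [:0, 1:] ^ (n - k) * qint (Suc k))"
    by (simp only: qbinom_absorb distrib_left)
  also have "qint (n - k) + [:0, 1:] ^ (n - k) * qint (Suc k) = qint (Suc n)"
    using qint_add[of "n - k" "Suc k"] assms by simp
  finally show ?thesis .
qed

lemma qbinom_Suc_Suc:
  assumes "k \<le> n"
  shows "qbinom (Suc n) (Suc k) = qbinom n (Suc k) + [:0, 1:] ^ (n - k) * qbinom n k"
proof -
  have "(qbinom n (Suc k) + [:0, 1:] ^ (n - k) * qbinom n k) * (qfact (Suc k) * qfact (Suc n - Suc k))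
    = qbinom n k * qint (Suc n) * (qfact k * qfact (n - k))"
    using qbinom_Pascal_aux[OF assms] by (simp add: qfact_Suc flip: mult.assoc)
  also have "\<dots> = qfact (Suc n)"
    using qbinom_qfact[OF assms] by (simp add: qfact_Suc ac_simps)
  finally show ?thesis using assms by (intro qbinom_unique) auto
qed

text \<open>Modulo q - 1 each power of q is 1, so (n)_q becomes n. For n divisible by p this places
  (n)_q in (p, q-1).\<close>

lemma qint_in_pq:
  obtains g where "qint n = [:int n:] + [:-1, 1:] * g"
proof -
  have "\<exists>g. qint n = [:int n:] + [:-1, 1:] * g"
  proof (induction n)
    case (Suc n)
    then obtain g where g: "qint n = [:int n:] + [:-1, 1:] * g" by auto
    have "qint (Suc n) = [:int (Suc n):] + [:-1, 1:] * (g + qint n)"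
    proof -
      have "[:0, 1:] ^ n = 1 + [:-1, 1:] * qint n"
        using qint_mult_q_minus_1[of n] by simp
      moreover have "[:int (Suc n):] = [:int n:] + 1"
        by (simp add: one_pCons)
      ultimately show ?thesis
        by (simp only: qint_Suc g distrib_left ac_simps)
    qed
    then show ?case by blast
  qed (rule exI[of _ 0], simp)
  then show thesis using that by blast
qed

section \<open>Structure constants of twisted powers and of the flip, with their recursions\<close>

text \<open>\<open>dp_coef\<close> and \<open>tw_coef\<close> are the coefficients of x^i in front
  of the element of index n + m - i in the products of two divided powers \<xi>^[n] \<xi>^[m] and of
  two undivided powers \<xi>^(n) \<xi>^(m). \<open>flip_coef\<close> is the coefficient of x^(n-k)
  \<xi>^[k] in the flip of \<xi>^[n].\<close>

definition dp_coef :: "nat \<Rightarrow> nat \<Rightarrow> nat \<Rightarrow> int poly" where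
  "dp_coef n m i = [:0, 1:] ^ (i * (i - 1) div 2) * qbinom (n + m - i) n * qbinom n i * [:-1, 1:] ^ i"

definition tw_coef :: "nat \<Rightarrow> nat \<Rightarrow> nat \<Rightarrow> int poly" where
  "tw_coef n m i = [:0, 1:] ^ (i * (i - 1) div 2) * [:-1, 1:] ^ i * qbinom n i * qbinom m i * qfact i"

definition flip_coef :: "nat \<Rightarrow> nat \<Rightarrow> int poly" where
  "flip_coef n k = (-1) ^ k * [:0, 1:] ^ (k * (k - 1) div 2) * [:1, -1:] ^ (n - k) * qbinom (n - 1) (k - 1)"

text \<open>Passing from divided to undivided powers costs (n)_q! (m)_q! on one side and the
  factorial of the resulting index on the other.\<close>

lemma dp_coef_tw_coef:
  assumes "i \<le> n" "i \<le> m"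
  shows "dp_coef n m i * (qfact n * qfact m) = tw_coef n m i * qfact (n + m - i)"
proof -
  have 1: "qbinom (n + m - i) n * (qfact n * qfact (m - i)) = qfact (n + m - i)"
    using qbinom_qfact[of n "n + m - i"] assms by simp
  have 2: "qbinom m i * (qfact i * qfact (m - i)) = qfact m"
    using qbinom_qfact assms by simp
  have 3: "qbinom (n + m - i) n * (qfact n * qfact m) = qbinom m i * qfact i * qfact (n + m - i)"
    unfolding 2[symmetric] 1[symmetric] by (simp only: mult_ac)
  have "dp_coef n m i * (qfact n * qfact m) = [:0, 1:] ^ (i * (i - 1) div 2) * qbinom n i * [:-1, 1:] ^ i
      * (qbinom (n + m - i) n * (qfact n * qfact m))"
    by (simp only: dp_coef_def mult_ac)
  also have "\<dots> = tw_coef n m i * qfact (n + m - i)"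
    unfolding 3 by (simp only: tw_coef_def mult_ac)
  finally show ?thesis .
qed

lemma dp_coef_eq_0: "i > n \<or> i > m \<Longrightarrow> dp_coef n m i = 0"
  unfolding dp_coef_def by (cases "i > n") auto

lemma triangle_Suc: "Suc j * (Suc j - 1) div 2 = j * (j - 1) div 2 + j"
proof (cases j)
  case (Suc k)
  have "Suc j * (Suc j - 1) = j * (j - 1) + 2 * j" by (simp add: Suc algebra_simps)
  then show ?thesis by simp
qed simp

text \<open>This is what one more factor y - q^m x does to a product: written as (y - q^(n+m-j) x) +
  (q^(n+m-j) - q^m) x, its first part lengthens the twisted power and its second part raises the
  power of x.\<close>

lemma tw_coef_Suc:
  assumes "j \<le> m"
  shows "tw_coef n (Suc m) (Suc j)
    = tw_coef n m (Suc j) + tw_coef n m j * ([:0, 1:] ^ (n + m - j) - [:0, 1:] ^ m)"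
proof (cases "j \<le> n")
  case True
  have "[:0, 1:] ^ (n + m - j) = [:0, 1:] ^ m * ([:0, 1:] :: int poly) ^ (n - j)"
    using True by (simp add: add.commute flip: power_add)
  \<comment> \<open>The difference of two powers of q supplies the next factor q - 1 and a q-integer
    that absorption can move.\<close>
  then have d: "[:0, 1:] ^ (n + m - j) - [:0, 1:] ^ m = [:0, 1:] ^ m * ([:-1, 1:] * qint (n - j))"
    unfolding qint_mult_q_minus_1 by (simp add: algebra_simps)
  have q: "[:0, 1:] ^ m = [:0, 1:] ^ j * ([:0, 1:] :: int poly) ^ (m - j)"
    using assms by (simp flip: power_add)
  let ?a = "[:0, 1:] ^ (j * (j - 1) div 2) * [:0, 1:] ^ j * [:-1, 1:] ^ Suc j * qfact j * qbinom m j * [:0, 1:] ^ (m - j)"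
  have "tw_coef n (Suc m) (Suc j) = tw_coef n m (Suc j) + ?a * (qbinom n (Suc j) * qint (Suc j))"
    unfolding tw_coef_def qbinom_Suc_Suc[OF assms] triangle_Suc qfact_Suc power_add
    by (simp only: distrib_left distrib_right mult.assoc mult.commute mult.left_commute)
  also have "?a * (qbinom n (Suc j) * qint (Suc j)) = ?a * (qbinom n j * qint (n - j))"
    by (simp only: qbinom_absorb)
  also have "\<dots> = tw_coef n m j * ([:0, 1:] ^ (n + m - j) - [:0, 1:] ^ m)"
    unfolding d unfolding q tw_coef_def power_Suc
    by (simp only: mult.assoc mult.commute mult.left_commute)
  finally show ?thesis .
qed (simp add: tw_coef_def)


text \<open>After multiplication by (q-1)^2 every (n)_q turns into q^n - 1, which leaves an identity
  between powers of q; q - 1 can be cancelled in a domain.\<close>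

lemma qint_flip_identity: "qint (i + d + 2) * qint (i + d + 1)
    = [:0, 1:] ^ d * (qint (i + 2) * qint (i + 1)) + qint (2 * i + d + 3) * qint d"
proof -
  let ?t = "[:-1, 1:] :: int poly" and ?q = "[:0, 1:] :: int poly"
  have *: "?t * qint n = ?q ^ n - 1" for n by (rule qint_mult_q_minus_1)
  have "?t * ?t * (qint (i + d + 2) * qint (i + d + 1)) = (?t * qint (i + d + 2)) * (?t * qint (i + d + 1))"
    by (simp only: ac_simps)
  also have "\<dots> = ?q ^ d * ((?t * qint (i + 2)) * (?t * qint (i + 1))) + (?t * qint (2 * i + d + 3)) * (?t * qint d)"
    unfolding * by (simp only: power_add mult_2 power2_eq_square power3_eq_cube power_one_right) (simp add: algebra_simps del: mult_pCons_left mult_pCons_right)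
  also have "\<dots> = ?t * ?t * (?q ^ d * (qint (i + 2) * qint (i + 1)) + qint (2 * i + d + 3) * qint d)"
    by (simp only: distrib_left ac_simps)
  finally show ?thesis
    by (rule mult_left_cancel[THEN iffD1, rotated]) simp
qed

text \<open>Multiplied by (i+1)_q, all three binomials are expressed through
  \<open>qbinom m i\<close>, and \<open>qint_flip_identity\<close> with d = m - i remains.\<close>

lemma qbinom_flip_identity:
  assumes "i \<le> m"
  shows "qint (m + 2) * qbinom (Suc m) (Suc i)
    = [:0, 1:] ^ (m - i) * qint (i + 2) * qbinom m i + qint (m + i + 3) * qbinom m (Suc i)"
proof -
  have m: "m = i + (m - i)" "2 * i + (m - i) + 3 = m + i + 3" using assms by auto
  have 1: "qbinom (Suc m) (Suc i) * qint (Suc i) = qbinom m i * qint (m + 1)"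
    using qbinom_Pascal_aux[OF assms] by (simp add: qbinom_Suc_Suc[OF assms])
  have "(qint (m + 2) * qbinom (Suc m) (Suc i)) * qint (Suc i) = qbinom m i * (qint (m + 2) * qint (m + 1))"
    using 1 by (simp add: ac_simps)
  also have "qint (m + 2) * qint (m + 1) = [:0, 1:] ^ (m - i) * (qint (i + 2) * qint (i + 1)) + qint (m + i + 3) * qint (m - i)"
    using qint_flip_identity[of i "m - i"] unfolding m(2) m(1)[symmetric] .
  also have "qbinom m i * \<dots> = ([:0, 1:] ^ (m - i) * qint (i + 2) * qbinom m i) * qint (Suc i)
      + qint (m + i + 3) * (qbinom m i * qint (m - i))"
    by (simp only: distrib_left add_ac mult_ac Suc_eq_plus1)
  also have "\<dots> = ([:0, 1:] ^ (m - i) * qint (i + 2) * qbinom m i + qint (m + i + 3) * qbinom m (Suc i)) * qint (Suc i)"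
    by (simp only: qbinom_absorb[symmetric] distrib_left distrib_right ac_simps)
  finally show ?thesis using qint_nonzero[of "Suc i"] by simp
qed

text \<open>The recursion that the factor x - q^n y imposes on the coefficients of the flipped
  powers. The term of index j is suppressed at j = 0 because truncated subtraction makes
  \<open>flip_coef n 0\<close> equal to (1-q)^n instead of 0.\<close>

lemma flip_coef_Suc:
  assumes "0 < n"
  shows "qint (Suc n) * flip_coef (Suc n) (Suc j)
    = (if j = 0 then 0 else - ([:0, 1:] ^ n * qint (Suc j) * flip_coef n j)) + [:1, -1:] * qint (n + Suc j) * flip_coef n (Suc j)"
proof -
  obtain m where n: "n = Suc m" using assms gr0_conv_Suc by auto
  \<comment> \<open>The binomials cut off the range: at j = n only the first term on the right
    survives, and beyond that everything vanishes.\<close>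
  consider "j = 0" | i where "j = Suc i" "i < m" | "j = n" | "j > n"
    using n by (metis Suc_less_eq not0_implies_Suc linorder_neqE_nat)
  then show ?thesis
  proof cases
    case 1
    have "[:0, 1:] ^ 0 = (1 :: int poly)" by simp
    with 1 show ?thesis by (simp add: flip_coef_def n mult_ac del: mult_pCons_left mult_pCons_right)
  next
    case 2
    have q: "[:0, 1:] ^ n = [:0, 1:] ^ j * ([:0, 1:] :: int poly) ^ (m - i)"
      using 2 n by (simp flip: power_add)
    have e: "n - j = Suc (m - j)" "Suc n - Suc j = Suc (m - j)" "n - Suc j = m - j" "n - 1 = m" "Suc n - 1 = n"
      "Suc j - 1 = j" "j - 1 = i" "Suc n = m + 2" "Suc j = i + 2" "n + Suc j = m + i + 3" "n = Suc m"
      using 2 n by auto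
    let ?a = "(-1) ^ Suc j * [:0, 1:] ^ (j * (j - 1) div 2) * [:0, 1:] ^ j * [:1, -1:] ^ Suc (m - j)"
    have "qint (Suc n) * flip_coef (Suc n) (Suc j) = ?a * (qint (m + 2) * qbinom (Suc m) (Suc i))"
      unfolding flip_coef_def triangle_Suc power_add using e 2 by (simp only: mult.assoc mult.commute mult.left_commute)
    also have "\<dots> = ?a * ([:0, 1:] ^ (m - i) * qint (i + 2) * qbinom m i + qint (m + i + 3) * qbinom m (Suc i))"
      using 2 by (subst qbinom_flip_identity) (auto simp only: less_imp_le)
    also have "\<dots> = - ([:0, 1:] ^ n * qint (Suc j) * flip_coef n j) + [:1, -1:] * qint (n + Suc j) * flip_coef n (Suc j)"
    proof -
      have "?a * ([:0, 1:] ^ (m - i) * qint (i + 2) * qbinom m i) = - ([:0, 1:] ^ n * qint (Suc j) * flip_coef n j)"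
      proof -
        have "flip_coef n j = (-1) ^ j * [:0, 1:] ^ (j * (j - 1) div 2) * [:1, -1:] ^ Suc (m - j) * qbinom m i"
          by (simp only: flip_coef_def e(1,4,7))
        then show ?thesis
          unfolding q e(9)[symmetric] by (simp add: mult_ac del: mult_pCons_left mult_pCons_right)
      qed
      moreover have "?a * (qint (m + i + 3) * qbinom m (Suc i)) = [:1, -1:] * qint (n + Suc j) * flip_coef n (Suc j)"
      proof -
        have "flip_coef n (Suc j) = (-1) ^ Suc j * ([:0, 1:] ^ (j * (j - 1) div 2) * [:0, 1:] ^ j) * [:1, -1:] ^ (m - j) * qbinom m (Suc i)"
          unfolding flip_coef_def triangle_Suc power_add unfolding e(3,4,6) by (simp only: 2(1))
        then show ?thesis
          unfolding e(10)[symmetric] by (simp add: mult_ac del: mult_pCons_left mult_pCons_right)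
      qed
      ultimately show ?thesis by (simp only: distrib_left)
    qed
    finally show ?thesis using 2 by simp
  next
    case 3
    then have "[:0, 1:] ^ (j * (j - 1) div 2 + j) = [:0, 1:] ^ (j * (j - 1) div 2) * ([:0, 1:] :: int poly) ^ n"
      by (simp add: power_add)
    then show ?thesis using 3 n unfolding flip_coef_def triangle_Suc by (simp add: ac_simps)
  next
    case 4
    then show ?thesis by (simp add: flip_coef_def n)
  qed
qed


section \<open>A faithful model of twisted divided polynomials\<close>

text \<open>The model is Frac(\<int>[q])[x][y]: the inner polynomial variable is x, the outer one is
  y, and nonzero elements of \<int>[q] are invertible scalars.\<close>

definition qS :: "int poly \<Rightarrow> int poly fract poly poly" where
  "qS f = [:[:to_fract f:]:]"

lemma qS_simps [simp]: "qS 0 = 0" "qS 1 = 1" "qS (f + g) = qS f + qS g" "qS (f - g) = qS f - qS g"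
  "qS (- f) = - qS f" "qS (f * g) = qS f * qS g" "qS f = 0 \<longleftrightarrow> f = 0"
  by (simp_all add: qS_def pCons_one)

text \<open>\<open>tw_prod x y n\<close> is \<open>\<xi>\<^sup>(\<^sup>n\<^sup>)\<close> for \<open>\<xi> = y - x\<close>; the flip exchanges \<open>x\<close> and \<open>y\<close>.\<close>

definition tw_prod where
  "tw_prod x y n = (\<Prod>i<n. y - qS ([:0, 1:] ^ i) * x)"

definition dp_prod where
  "dp_prod x y n = [:[:inverse (to_fract (qfact n)):]:] * tw_prod x y n"

lemma tw_prod_Suc: "tw_prod x y (Suc n) = tw_prod x y n * (y - qS ([:0, 1:] ^ n) * x)"
  by (simp add: tw_prod_def)

lemma qfact_dp_prod: "qS (qfact n) * dp_prod x y n = tw_prod x y n"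
proof -
  have "qS (qfact n) * [:[:inverse (to_fract (qfact n)):]:] = 1"
    by (simp add: qS_def pCons_one)
  then show ?thesis unfolding dp_prod_def mult.assoc[symmetric] by (simp only: mult_1)
qed

text \<open>Induction on m, each step being \<open>tw_coef_Suc\<close> read termwise. Here x and y
  are arbitrary elements rather than the two variables, so that the formula remains available with
  their roles exchanged.\<close>

lemma tw_prod_mult:
  "tw_prod x y n * tw_prod x y m = (\<Sum>i\<le>m. qS (tw_coef n m i) * x ^ i * tw_prod x y (n + m - i))"
proof (induction m)
  case 0
  then show ?case by (simp add: tw_coef_def tw_prod_def)
next
  case (Suc m)
  define q where "q n = qS ([:0, 1:] ^ n)" for n
  have W_Suc: "tw_prod x y (Suc k) = tw_prod x y k * (y - q k * x)" for k
    by (simp add: tw_prod_Suc q_def)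
  have b_Suc: "qS (tw_coef n (Suc m) (Suc j)) = qS (tw_coef n m (Suc j)) + qS (tw_coef n m j) * (q (n + m - j) - q m)"
    if "j \<le> m" for j
    by (simp only: tw_coef_Suc[OF that] qS_simps q_def)
  let ?W = "tw_prod x y"
  let ?T = "\<lambda>i. qS (tw_coef n m i) * x ^ i * ?W (Suc (n + m) - i)"
  have step: "qS (tw_coef n m i) * x ^ i * ?W (n + m - i) * (y - q m * x)
      = ?T i + qS (tw_coef n m i) * (q (n + m - i) - q m) * x ^ Suc i * ?W (n + m - i)"
    if "i \<le> m" for i
  proof -
    have W: "?W (Suc (n + m) - i) = ?W (n + m - i) * (y - q (n + m - i) * x)"
      using that by (simp add: Suc_diff_le W_Suc)
    show ?thesis unfolding W by (simp add: algebra_simps)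
  qed
  have "?W n * ?W (Suc m) = (\<Sum>i\<le>m. qS (tw_coef n m i) * x ^ i * ?W (n + m - i)) * (y - q m * x)"
    unfolding W_Suc Suc.IH[symmetric] by (simp only: mult.assoc)
  also have "\<dots> = (\<Sum>i\<le>m. ?T i + qS (tw_coef n m i) * (q (n + m - i) - q m) * x ^ Suc i * ?W (n + m - i))"
    unfolding sum_distrib_right by (rule sum.cong) (simp_all only: step atMost_iff)
  also have "\<dots> = (\<Sum>i\<le>m. ?T i) + (\<Sum>i\<le>m. qS (tw_coef n m i) * (q (n + m - i) - q m) * x ^ Suc i * ?W (n + m - i))"
    by (rule sum.distrib)
  \<comment> \<open>The added term contains the binomial of m over m + 1, which is 0.\<close>
  also have "(\<Sum>i\<le>m. ?T i) = (\<Sum>i\<le>Suc m. ?T i)"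
    by (simp add: tw_coef_def)
  also have "\<dots> = ?T 0 + (\<Sum>i\<le>m. ?T (Suc i))"
    by (rule sum.atMost_Suc_shift)
  also have "?T 0 = qS (tw_coef n (Suc m) 0) * x ^ 0 * ?W (n + Suc m - 0)"
    by (simp add: tw_coef_def)
  also have "\<dots> + (\<Sum>i\<le>m. ?T (Suc i)) + (\<Sum>i\<le>m. qS (tw_coef n m i) * (q (n + m - i) - q m) * x ^ Suc i * ?W (n + m - i))
    = \<dots> + (\<Sum>i\<le>m. ?T (Suc i) + qS (tw_coef n m i) * (q (n + m - i) - q m) * x ^ Suc i * ?W (n + m - i))"
    by (simp only: sum.distrib add.assoc)
  also have "(\<Sum>i\<le>m. ?T (Suc i) + qS (tw_coef n m i) * (q (n + m - i) - q m) * x ^ Suc i * ?W (n + m - i))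
     = (\<Sum>i\<le>m. qS (tw_coef n (Suc m) (Suc i)) * x ^ Suc i * ?W (n + Suc m - Suc i))"
    by (rule sum.cong) (simp_all add: b_Suc distrib_right del: power_Suc)
  also have "qS (tw_coef n (Suc m) 0) * x ^ 0 * ?W (n + Suc m - 0) + \<dots>
     = (\<Sum>i\<le>Suc m. qS (tw_coef n (Suc m) i) * x ^ i * ?W (n + Suc m - i))"
    by (rule sum.atMost_Suc_shift[symmetric])
  finally show ?case .
qed

lemma dp_prod_mult:
  "dp_prod x y n * dp_prod x y m = (\<Sum>i\<le>m. qS (dp_coef n m i) * x ^ i * dp_prod x y (n + m - i))"
proof -
  have "qS (qfact n * qfact m) * (dp_prod x y n * dp_prod x y m) = tw_prod x y n * tw_prod x y m"
    by (simp add: ac_simps flip: qfact_dp_prod)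
  also have "\<dots> = (\<Sum>i\<le>m. qS (tw_coef n m i) * x ^ i * tw_prod x y (n + m - i))"
    by (rule tw_prod_mult)
  also have "\<dots> = (\<Sum>i\<le>m. qS (qfact n * qfact m) * (qS (dp_coef n m i) * x ^ i * dp_prod x y (n + m - i)))"
  proof (rule sum.cong[OF refl])
    fix i assume "i \<in> {..m}"
    have "qS (tw_coef n m i) * tw_prod x y (n + m - i) = qS (tw_coef n m i * qfact (n + m - i)) * dp_prod x y (n + m - i)"
      by (simp flip: qfact_dp_prod)
    \<comment> \<open>If i exceeds n both coefficients vanish; otherwise the factorials are
      redistributed.\<close>
    also have "tw_coef n m i * qfact (n + m - i) = dp_coef n m i * (qfact n * qfact m)"
      using dp_coef_tw_coef[of i n m] \<open>i \<in> {..m}\<close> by (cases "i \<le> n") (simp_all add: dp_coef_eq_0 tw_coef_def)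
    finally show "qS (tw_coef n m i) * x ^ i * tw_prod x y (n + m - i)
      = qS (qfact n * qfact m) * (qS (dp_coef n m i) * x ^ i * dp_prod x y (n + m - i))"
      by (simp add: mult_ac)
  qed
  also have "\<dots> = qS (qfact n * qfact m) * (\<Sum>i\<le>m. qS (dp_coef n m i) * x ^ i * dp_prod x y (n + m - i))"
    by (simp only: sum_distrib_left)
  finally show ?thesis by (rule mult_left_cancel[THEN iffD1, rotated]) simp
qed

text \<open>Induction through the next factor x - q^(n+1) y of the exchanged product. By
  \<open>E_Suc\<close>, multiplication by y sends a divided power to a multiple of x times itself
  plus a multiple of the next one, and the coefficients that result obey
  \<open>flip_coef_Suc\<close>.\<close>

lemma dp_prod_flip:
  "dp_prod y x (Suc n) = (\<Sum>k\<le>n. qS (flip_coef (Suc n) (Suc k)) * x ^ (n - k) * dp_prod x y (Suc k))"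
proof (induction n)
  case 0
  show ?case by (simp add: dp_prod_def tw_prod_def flip_coef_def qfact_Suc)
next
  case (Suc n)
  define q where "q n = qS ([:0, 1:] ^ n)" for n
  define b where "b n = qS (qint n)" for n
  define t where "t = qS [:1, -1:]"
  have W_Suc: "tw_prod x y (Suc k) = tw_prod x y k * (y - q k * x)" for k x y
    by (simp add: tw_prod_Suc q_def)
  \<comment> \<open>Replacing y by its part q^m x inside x - q^n y leaves (1 - q^m q^n) x; this is
    how 1 - q enters the flip coefficients.\<close>
  have bt: "t * b (m + n) = 1 - q m * q n" for m n
  proof -
    have "[:1, -1:] * qint (m + n) = - ([:-1, 1:] * qint (m + n))"
      by simp
    also have "\<dots> = 1 - [:0, 1:] ^ m * [:0, 1:] ^ n"
      unfolding qint_mult_q_minus_1 power_add by (simp only: minus_diff_eq)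
    finally show ?thesis
      unfolding t_def b_def q_def qS_simps(6)[symmetric] by (simp only: qS_simps)
  qed
  let ?E = "dp_prod x y"
  \<comment> \<open>With denominators cleared: y is the next factor y - q^k x plus q^k x.\<close>
  have E_Suc: "dp_prod x y k * y = q k * x * dp_prod x y k + b (Suc k) * dp_prod x y (Suc k)" for k and x y
  proof -
    have 1: "qS (qfact k) * dp_prod x y k = tw_prod x y k"
      by (rule qfact_dp_prod)
    have 2: "qS (qfact k) * (b (Suc k) * dp_prod x y (Suc k)) = tw_prod x y k * (y - q k * x)"
      using qfact_dp_prod[of "Suc k" x y] unfolding W_Suc qfact_Suc b_def qS_simps by (simp only: mult_ac)
    have "qS (qfact k) * (dp_prod x y k * y) = tw_prod x y k * y"
      by (simp only: 1[symmetric] mult.assoc)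
    also have "\<dots> = q k * x * (qS (qfact k) * dp_prod x y k) + qS (qfact k) * (b (Suc k) * dp_prod x y (Suc k))"
      unfolding 1 2 by (simp add: algebra_simps)
    also have "\<dots> = qS (qfact k) * (q k * x * dp_prod x y k + b (Suc k) * dp_prod x y (Suc k))"
      by (simp add: algebra_simps)
    finally show ?thesis by (rule mult_left_cancel[THEN iffD1, rotated]) simp
  qed
  define s where "s n k = qS (flip_coef n k)" for n k
  have s_Suc: "b (Suc (Suc n)) * s (Suc (Suc n)) (Suc k)
      = t * b (Suc n + Suc k) * s (Suc n) (Suc k) - (if k = 0 then 0 else q (Suc n) * b (Suc k) * s (Suc n) k)" for k
    using arg_cong[OF flip_coef_Suc[OF zero_less_Suc, of n k], of qS]
    unfolding s_def b_def t_def q_def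
    by (cases "k = 0") (simp_all only: if_True if_False qS_simps simp_thms minus_zero add_0_left add_0_right diff_zero add.commute diff_conv_add_uminus)
  have IH: "dp_prod y x (Suc n) = (\<Sum>k\<le>n. s (Suc n) (Suc k) * x ^ (n - k) * ?E (Suc k))"
    unfolding s_def by (rule Suc.IH)
  let ?T = "\<lambda>k. s (Suc n) k * x ^ (Suc n - k) * (q (Suc n) * b (Suc k) * ?E (Suc k))"
  let ?U = "\<lambda>k. t * b (Suc n + Suc k) * s (Suc n) (Suc k) * x ^ (Suc n - k) * ?E (Suc k)"
  have "b (Suc (Suc n)) * dp_prod y x (Suc (Suc n)) = dp_prod y x (Suc n) * (x - q (Suc n) * y)"
    by (simp only: right_diff_distrib E_Suc[of y x "Suc n"]) (simp add: mult_ac)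
  also have "\<dots> = (\<Sum>k\<le>n. s (Suc n) (Suc k) * x ^ (n - k) * (?E (Suc k) * (x - q (Suc n) * y)))"
    unfolding IH by (simp only: sum_distrib_right mult.assoc)
  also have "\<dots> = (\<Sum>k\<le>n. ?U k - ?T (Suc k))"
  proof (rule sum.cong[OF refl])
    fix k assume "k \<in> {..n}"
    then have xp: "x ^ (Suc n - k) = x * x ^ (n - k)" "Suc n - Suc k = n - k" by (simp_all add: Suc_diff_le)
    have "?E (Suc k) * (x - q (Suc n) * y) = x * ?E (Suc k) - q (Suc n) * (?E (Suc k) * y)"
      by (simp add: algebra_simps)
    also have "\<dots> = t * b (Suc n + Suc k) * x * ?E (Suc k) - q (Suc n) * b (Suc (Suc k)) * ?E (Suc (Suc k))"
      unfolding bt E_Suc[of x y "Suc k"] by (simp add: algebra_simps)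
    finally have e: "?E (Suc k) * (x - q (Suc n) * y)
      = t * b (Suc n + Suc k) * x * ?E (Suc k) - q (Suc n) * b (Suc (Suc k)) * ?E (Suc (Suc k))" .
    show "s (Suc n) (Suc k) * x ^ (n - k) * (?E (Suc k) * (x - q (Suc n) * y)) = ?U k - ?T (Suc k)"
      unfolding xp e by (simp only: right_diff_distrib mult_ac)
  qed
  also have "\<dots> = (\<Sum>k\<le>n. ?U k) - (\<Sum>k\<le>n. ?T (Suc k))"
    by (rule sum_subtractf)
  also have "(\<Sum>k\<le>n. ?U k) = (\<Sum>k\<le>Suc n. ?U k)"
    by (simp add: s_def flip_coef_def)
  also have "(\<Sum>k\<le>n. ?T (Suc k)) = (\<Sum>k\<le>Suc n. if k = 0 then 0 else ?T k)"
    unfolding sum.atMost_Suc_shift by simp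
  also have "(\<Sum>k\<le>Suc n. ?U k) - (\<Sum>k\<le>Suc n. if k = 0 then 0 else ?T k)
    = (\<Sum>k\<le>Suc n. b (Suc (Suc n)) * s (Suc (Suc n)) (Suc k) * x ^ (Suc n - k) * ?E (Suc k))"
    unfolding sum_subtractf[symmetric]
  proof (rule sum.cong[OF refl])
    fix k assume "k \<in> {..Suc n}"
    show "?U k - (if k = 0 then 0 else ?T k) = b (Suc (Suc n)) * s (Suc (Suc n)) (Suc k) * x ^ (Suc n - k) * ?E (Suc k)"
      unfolding s_Suc by (cases "k = 0") (simp_all only: simp_thms if_True if_False left_diff_distrib right_diff_distrib diff_zero mult_ac)
  qed
  also have "\<dots> = b (Suc (Suc n)) * (\<Sum>k\<le>Suc n. s (Suc (Suc n)) (Suc k) * x ^ (Suc n - k) * ?E (Suc k))"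
    by (simp only: sum_distrib_left mult.assoc)
  finally show ?case
    unfolding s_def by (rule mult_left_cancel[THEN iffD1, rotated]) (simp add: qint_nonzero b_def)
qed


subsection \<open>The universal case\<close>

text \<open>The product of the universal ring over \<int>[q][x]: q lives in the innermost level, x
  is the middle variable, and the outer monomial of degree n stands for \<xi>^[n]. It differs from
  the polynomial product of the same type.\<close>

definition dp_mult :: "int poly poly poly \<Rightarrow> int poly poly poly \<Rightarrow> int poly poly poly" where
  "dp_mult u v = (\<Sum>n\<le>degree u. \<Sum>m\<le>degree v. \<Sum>i\<le>m. Polynomial.monom
     ([:dp_coef n m i:] * [:0, 1:] ^ i * (Polynomial.coeff u n * Polynomial.coeff v m)) (n + m - i))"

abbreviation (input) "xS \<equiv> [:[:0, 1:]:] :: int poly fract poly poly"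
abbreviation (input) "yS \<equiv> [:0, 1:] :: int poly fract poly poly"

text \<open>The outer monomial of degree n goes to the n-th divided power of y - x. Since this map
  is injective and multiplicative, \<open>dp_mult\<close> inherits commutativity and associativity
  from ordinary polynomials.\<close>

definition dp_embed :: "int poly poly poly \<Rightarrow> int poly fract poly poly" where
  "dp_embed u = (\<Sum>n\<le>degree u. [:map_poly to_fract (Polynomial.coeff u n):] * dp_prod xS yS n)"

lemma dp_embed_bound:
  assumes "degree u \<le> N"
  shows "dp_embed u = (\<Sum>n\<le>N. [:map_poly to_fract (Polynomial.coeff u n):] * dp_prod xS yS n)"
  unfolding dp_embed_def
  by (rule sum.mono_neutral_left) (use assms in \<open>auto simp: coeff_eq_0\<close>)

lemma dp_embed_add: "dp_embed (u + v) = dp_embed u + dp_embed v"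
proof -
  let ?N = "max (degree u) (degree v)"
  have "degree (u + v) \<le> ?N" by (rule degree_add_le_max)
  moreover have "[:a + b:] * c = [:a:] * c + [:b:] * c" for a b :: "int poly fract poly" and c
    by (simp add: smult_add_left)
  ultimately show ?thesis
    by (simp add: dp_embed_bound[of _ ?N] sum.distrib del: mult_pCons_left)
qed

lemma dp_embed_0 [simp]: "dp_embed 0 = 0"
  by (simp add: dp_embed_def)

lemma dp_embed_diff: "dp_embed (u - v) = dp_embed u - dp_embed v"
  using dp_embed_add[of "u - v" v] by (simp add: algebra_simps)

lemma dp_embed_sum: "dp_embed (sum f S) = (\<Sum>i\<in>S. dp_embed (f i))"
  by (induction S rule: infinite_finite_induct) (simp_all add: dp_embed_add)

lemma dp_embed_monom: "dp_embed (Polynomial.monom a n) = [:map_poly to_fract a:] * dp_prod xS yS n"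
proof -
  have "dp_embed (Polynomial.monom a n)
    = (\<Sum>k\<le>n. if k = n then [:map_poly to_fract a:] * dp_prod xS yS n else 0)"
    unfolding dp_embed_bound[OF degree_monom_le] by (rule sum.cong) auto
  then show ?thesis by simp
qed

lemma map_poly_to_fract_power: "map_poly to_fract (f ^ n) = map_poly to_fract f ^ n"
  by (induction n) simp_all

lemma const_coef: "[:map_poly to_fract ([:a:] * [:0, 1:] ^ i):] = qS a * xS ^ i"
proof -
  have "map_poly to_fract ([:a:] * [:0, 1:] ^ i) = [:to_fract a:] * [:0, 1:] ^ i"
    unfolding fract_poly_mult map_poly_to_fract_power by (simp add: map_poly_pCons)
  moreover have "[:f ^ n:] = [:f:] ^ n" "[:f * g:] = [:f:] * [:g:]" for f g :: "int poly fract poly" and n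
    by (simp_all add: poly_const_pow)
  ultimately show ?thesis by (simp only: qS_def)
qed

lemma dp_embed_mult: "dp_embed (dp_mult u v) = dp_embed u * dp_embed v"
proof -
  let ?e = "\<lambda>u n. [:map_poly to_fract (Polynomial.coeff u n):]" and ?E = "dp_prod xS yS"
  have "dp_embed (Polynomial.monom ([:dp_coef n m i:] * [:0, 1:] ^ i * (Polynomial.coeff u n * Polynomial.coeff v m)) (n + m - i))
     = (?e u n * ?e v m) * (qS (dp_coef n m i) * xS ^ i * ?E (n + m - i))" for n m i
  proof -
    have *: "[:f * g:] = [:f:] * [:g:]" for f g :: "int poly fract poly" by simp
    show ?thesis
      unfolding dp_embed_monom fract_poly_mult[of _ "_ * _"] * const_coef
      by (simp only: fract_poly_mult * mult_ac)
  qed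
  then have "dp_embed (dp_mult u v) = (\<Sum>n\<le>degree u. \<Sum>m\<le>degree v. (?e u n * ?e v m) * (?E n * ?E m))"
    unfolding dp_mult_def dp_embed_sum dp_prod_mult sum_distrib_left by simp
  also have "\<dots> = dp_embed u * dp_embed v"
    unfolding dp_embed_def sum_product by (simp only: mult_ac)
  finally show ?thesis .
qed

text \<open>Monic in y and of degree n: the divided powers are triangular with respect to powers of
  y, which yields injectivity of \<open>dp_embed\<close> by looking at leading terms.\<close>

lemma degree_tw_prod: "degree (tw_prod xS yS n) \<le> n \<and> Polynomial.coeff (tw_prod xS yS n) n = 1"
proof (induction n)
  case (Suc n)
  have "yS - qS ([:0, 1:] ^ n) * xS = [:- ([:to_fract ([:0, 1:] ^ n):] * [:0, 1:]), 1:]"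
    by (simp add: qS_def)
  then have "tw_prod xS yS (Suc n) = [:- ([:to_fract ([:0, 1:] ^ n):] * [:0, 1:]), 1:] * tw_prod xS yS n"
    by (simp only: tw_prod_Suc mult.commute)
  then show ?case
    using Suc.IH by (auto simp: coeff_eq_0 intro!: degree_add_le degree_pCons_le order.trans[OF degree_smult_le])
qed (simp add: tw_prod_def)

lemma dp_embed_eq_0: "dp_embed u = 0 \<Longrightarrow> u = 0"
proof (rule ccontr)
  assume u: "dp_embed u = 0" "u \<noteq> 0"
  let ?e = "\<lambda>n. map_poly to_fract (Polynomial.coeff u n)"
  have c: "Polynomial.coeff ([:a:] * dp_prod xS yS n) k = a * [:inverse (to_fract (qfact n)):] * Polynomial.coeff (tw_prod xS yS n) k"
    for a n k
    by (simp add: dp_prod_def mult_ac)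
  have "0 = Polynomial.coeff (dp_embed u) (degree u)"
    by (simp add: u)
  also have "\<dots> = (\<Sum>n\<le>degree u. if n = degree u then ?e n * [:inverse (to_fract (qfact n)):] else 0)"
    unfolding dp_embed_def coeff_sum c
  proof (rule sum.cong[OF refl])
    fix n assume "n \<in> {..degree u}"
    then show "?e n * [:inverse (to_fract (qfact n)):] * Polynomial.coeff (tw_prod xS yS n) (degree u)
      = (if n = degree u then ?e n * [:inverse (to_fract (qfact n)):] else 0)"
      using degree_tw_prod[of n] by (auto simp: coeff_eq_0)
  qed
  also have "\<dots> = ?e (degree u) * [:inverse (to_fract (qfact (degree u))):]"
    by simp
  finally show False using u(2) by simp
qed

lemma dp_embed_eq_iff: "dp_embed u = dp_embed v \<longleftrightarrow> u = v"
  using dp_embed_eq_0[of "u - v"] dp_embed_diff[of u v] by auto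

lemma dp_embed_1: "dp_embed 1 = 1"
  using dp_embed_monom[of 1 0] by (simp add: dp_prod_def tw_prod_def pCons_one monom_0)

lemma dp_mult_comm: "dp_mult u v = dp_mult v u"
  by (simp only: dp_embed_eq_iff[symmetric] dp_embed_mult mult.commute)

lemma dp_mult_assoc: "dp_mult (dp_mult u v) w = dp_mult u (dp_mult v w)"
  by (simp only: dp_embed_eq_iff[symmetric] dp_embed_mult mult.assoc)

lemma dp_mult_1: "dp_mult 1 u = u"
  by (simp only: dp_embed_eq_iff[symmetric] dp_embed_mult dp_embed_1 mult_1)

text \<open>Multiplication by \<xi> + x - q^n x appends the factor that the next divided power
  requires. This is why \<xi>^(n) becomes (n)_q! \<xi>^[n].\<close>

lemma dp_mult_xi:
  "dp_mult (Polynomial.monom 1 1 + Polynomial.monom ([:0, 1:] - [:[:0, 1:] ^ n:] * [:0, 1:]) 0) (Polynomial.monom 1 n)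
    = Polynomial.monom [:qint (Suc n):] (Suc n)"
proof -
  have x: "[:map_poly to_fract ([:0, 1:] - [:[:0, 1:] ^ n:] * [:0, 1:]):] = xS - qS ([:0, 1:] ^ n) * xS"
    using const_coef[of "[:0, 1:] ^ n" 1] by (simp add: map_poly_pCons qS_def)
  have E: "dp_prod xS yS 0 = 1" "dp_prod xS yS 1 = yS - xS"
    by (simp_all add: dp_prod_def tw_prod_def qfact_Suc pCons_one)
  have "qS (qint (Suc n)) * dp_prod xS yS (Suc n) = (yS - qS ([:0, 1:] ^ n) * xS) * dp_prod xS yS n"
  proof -
    have "qS (qfact n) * (qS (qint (Suc n)) * dp_prod xS yS (Suc n)) = tw_prod xS yS (Suc n)"
      unfolding qfact_dp_prod[of "Suc n", symmetric] unfolding qfact_Suc qS_simps by (simp only: mult_ac)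
    also have "\<dots> = qS (qfact n) * ((yS - qS ([:0, 1:] ^ n) * xS) * dp_prod xS yS n)"
      unfolding tw_prod_Suc unfolding qfact_dp_prod[of n, symmetric] by (simp only: mult_ac)
    finally show ?thesis by (rule mult_left_cancel[THEN iffD1, rotated]) simp
  qed
  then show ?thesis
    unfolding dp_embed_eq_iff[symmetric] dp_embed_mult dp_embed_add dp_embed_monom x E
    by (simp add: map_poly_pCons qS_def pCons_one)
qed

text \<open>Index 0 is set apart because the empty sum would give 0, whereas the flip fixes
  \<xi>^[0] = 1.\<close>

definition dp_flip :: "nat \<Rightarrow> int poly poly poly" where
  "dp_flip n = (if n = 0 then 1 else \<Sum>k = 1..n. Polynomial.monom ([:flip_coef n k:] * [:0, 1:] ^ (n - k)) k)"

text \<open>The element x + \<xi>, which is y in the model and will be \<theta>(x). Its powers below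
  are taken with respect to \<open>dp_mult\<close>.\<close>

definition dp_y :: "int poly poly poly" where
  "dp_y = Polynomial.monom [:0, 1:] 0 + Polynomial.monom 1 1"

primrec dp_y_pow :: "nat \<Rightarrow> int poly poly poly" where
  "dp_y_pow 0 = 1"
| "dp_y_pow (Suc n) = dp_mult (dp_y_pow n) dp_y"

lemma dp_embed_y: "dp_embed dp_y = yS"
  unfolding dp_y_def dp_embed_add dp_embed_monom
  by (simp add: dp_prod_def tw_prod_def qfact_Suc map_poly_pCons pCons_one qS_def)

lemma dp_embed_y_pow: "dp_embed (dp_y_pow n) = yS ^ n"
  by (induction n) (simp_all only: dp_y_pow.simps dp_embed_1 dp_embed_mult dp_embed_y power_0 power_Suc2)

lemma dp_prod_flip':
  assumes "0 < n"
  shows "dp_prod y x n = (\<Sum>k = 1..n. qS (flip_coef n k) * x ^ (n - k) * dp_prod x y k)"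
proof -
  obtain m where m: "n = Suc m" using assms gr0_conv_Suc by auto
  show ?thesis
    unfolding m by (subst dp_prod_flip, rule sum.reindex_bij_witness[of _ "\<lambda>k. k - 1" Suc]) auto
qed

lemma dp_embed_flip: "dp_embed (dp_flip n) = dp_prod yS xS n"
proof (cases "n = 0")
  case False
  then show ?thesis
    unfolding dp_flip_def dp_prod_flip'[OF False[THEN neq0_conv[THEN iffD1]]]
    by (simp only: if_False dp_embed_sum dp_embed_monom const_coef)
qed (simp add: dp_flip_def dp_prod_def tw_prod_def dp_embed_1 pCons_one)

lemma dp_embed_const: "dp_embed (Polynomial.monom [:a:] 0) = qS a"
  unfolding dp_embed_monom by (simp add: dp_prod_def tw_prod_def map_poly_pCons qS_def pCons_one)

text \<open>The product rule of the model with x and y exchanged: the scalars x^i have turned into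
  powers of x + \<xi>. It will give multiplicativity of the flip on basis elements.\<close>

lemma dp_flip_mult:
  "dp_mult (dp_flip n) (dp_flip m) = (\<Sum>i\<le>m. dp_mult (Polynomial.monom [:dp_coef n m i:] 0) (dp_mult (dp_y_pow i) (dp_flip (n + m - i))))"
  unfolding dp_embed_eq_iff[symmetric] dp_embed_sum dp_embed_mult dp_embed_flip dp_prod_mult
    dp_embed_const dp_embed_y_pow by (simp only: mult.assoc)

text \<open>The flip expansion with x and y exchanged recovers the original divided power. Its
  scalars are powers of y, exactly what \<theta> makes of powers of x.\<close>

lemma dp_flip_flip:
  assumes "0 < n"
  shows "(\<Sum>k = 1..n. dp_mult (Polynomial.monom [:flip_coef n k:] 0) (dp_mult (dp_y_pow (n - k)) (dp_flip k)))
    = Polynomial.monom 1 n"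
  unfolding dp_embed_eq_iff[symmetric] dp_embed_sum dp_embed_mult dp_embed_flip
    dp_embed_const dp_embed_y_pow dp_embed_monom[of 1]
  by (subst dp_prod_flip'[OF assms, where y = xS and x = yS]) (simp only: mult.assoc fract_poly_1 pCons_one mult_1)

section \<open>Congruences and powers of ideals with two generators\<close>

text \<open>Carrier membership is built in, so that the congruence laws need no side
  conditions.\<close>

definition eqmod :: "('b, 'm) ring_scheme \<Rightarrow> 'b set \<Rightarrow> 'b \<Rightarrow> 'b \<Rightarrow> bool" where
  "eqmod B L a b \<longleftrightarrow> a \<in> carrier B \<and> b \<in> carrier B \<and> a \<ominus>\<^bsub>B\<^esub> b \<in> L"

lemma (in ideal) eqmod_coset: "eqmod R I a b \<longleftrightarrow> a \<in> carrier R \<and> b \<in> carrier R \<and> I +> a = I +> b"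
  using quotient_eq_iff_same_a_r_cos[OF ideal_axioms] by (auto simp: eqmod_def)

lemma eqmod_carrier: "eqmod B L a b \<Longrightarrow> a \<in> carrier B" "eqmod B L a b \<Longrightarrow> b \<in> carrier B"
  by (auto simp: eqmod_def)

lemma (in ideal) eqmod_refl [simp]: "a \<in> carrier R \<Longrightarrow> eqmod R I a a"
  and eqmod_sym: "eqmod R I a b \<Longrightarrow> eqmod R I b a"
  and eqmod_trans: "eqmod R I a b \<Longrightarrow> eqmod R I b c \<Longrightarrow> eqmod R I a c"
  by (auto simp: eqmod_coset)

lemma (in ideal) eqmod_add:
  assumes "eqmod R I a a'" "eqmod R I b b'"
  shows "eqmod R I (a \<oplus> b) (a' \<oplus> b')"
  using assms a_rcos_sum[of a b] a_rcos_sum[of a' b'] by (auto simp: eqmod_coset)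

lemma (in ideal) eqmod_mult:
  assumes "eqmod R I a a'" "eqmod R I b b'"
  shows "eqmod R I (a \<otimes> b) (a' \<otimes> b')"
  using assms rcoset_mult_add[of a b] rcoset_mult_add[of a' b'] by (auto simp: eqmod_coset)

lemma (in ideal) eqmod_pow: "eqmod R I a b \<Longrightarrow> eqmod R I (a [^] (n::nat)) (b [^] n)"
  by (induction n) (simp_all add: eqmod_mult)

lemma (in ideal) eqmod_zero_iff: "eqmod R I a \<zero> \<longleftrightarrow> a \<in> I"
  using Icarr by (auto simp: eqmod_def a_minus_def)

lemma (in ideal) eqmod_closed: "eqmod R I a b \<Longrightarrow> b \<in> I \<Longrightarrow> a \<in> I"
  using eqmod_zero_iff eqmod_trans by blast

lemma eqmod_mono: "eqmod B L a b \<Longrightarrow> L \<subseteq> L' \<Longrightarrow> eqmod B L' a b"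
  by (auto simp: eqmod_def)

lemma eqmod_hom:
  assumes "ring B" "ring C" "h \<in> ring_hom B C" "\<And>z. z \<in> L \<Longrightarrow> h z \<in> L'" "eqmod B L a b"
  shows "eqmod C L' (h a) (h b)"
proof -
  interpret h: ring_hom_ring B C h
    using assms by (intro ring_hom_ringI2)
  have "h (a \<ominus>\<^bsub>B\<^esub> b) = h a \<ominus>\<^bsub>C\<^esub> h b"
    unfolding a_minus_def using eqmod_carrier[OF assms(5)] by (simp only: h.hom_add h.hom_a_inv h.R.a_inv_closed)
  then show ?thesis
    using assms(4,5) eqmod_carrier[OF assms(5)] unfolding eqmod_def by (metis h.hom_closed)
qed

lemma (in ring) minus_eq_zero_iff:
  "a \<in> carrier R \<Longrightarrow> b \<in> carrier R \<Longrightarrow> a \<ominus> b = \<zero> \<longleftrightarrow> a = b"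
  using minus_equality[of a "\<ominus> b"] by (auto simp: a_minus_def r_neg)

lemma (in ring) eqmod_0_iff: "eqmod R {\<zero>} a b \<longleftrightarrow> a \<in> carrier R \<and> a = b"
  by (auto simp: eqmod_def minus_eq_zero_iff)

section \<open>Maps that are ring homomorphisms modulo an ideal\<close>

text \<open>Lifts and truncated Taylor expansions satisfy the ring laws only modulo L. This form
  allows working with representatives instead of cosets.\<close>

definition hom_mod :: "('a, 'm) ring_scheme \<Rightarrow> ('b, 'n) ring_scheme \<Rightarrow> 'b set \<Rightarrow> ('a \<Rightarrow> 'b) \<Rightarrow> bool" where
  "hom_mod A B L w \<longleftrightarrow> (\<forall>a\<in>carrier A. w a \<in> carrier B) \<and>
     (\<forall>a\<in>carrier A. \<forall>b\<in>carrier A. eqmod B L (w (a \<oplus>\<^bsub>A\<^esub> b)) (w a \<oplus>\<^bsub>B\<^esub> w b) \<and>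
        eqmod B L (w (a \<otimes>\<^bsub>A\<^esub> b)) (w a \<otimes>\<^bsub>B\<^esub> w b)) \<and>
     eqmod B L (w \<one>\<^bsub>A\<^esub>) \<one>\<^bsub>B\<^esub>"

lemma hom_modI:
  assumes "\<And>a. a \<in> carrier A \<Longrightarrow> w a \<in> carrier B"
    and "\<And>a b. a \<in> carrier A \<Longrightarrow> b \<in> carrier A \<Longrightarrow> eqmod B L (w (a \<oplus>\<^bsub>A\<^esub> b)) (w a \<oplus>\<^bsub>B\<^esub> w b)"
    and "\<And>a b. a \<in> carrier A \<Longrightarrow> b \<in> carrier A \<Longrightarrow> eqmod B L (w (a \<otimes>\<^bsub>A\<^esub> b)) (w a \<otimes>\<^bsub>B\<^esub> w b)"
    and "eqmod B L (w \<one>\<^bsub>A\<^esub>) \<one>\<^bsub>B\<^esub>"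
  shows "hom_mod A B L w"
  using assms by (simp add: hom_mod_def)

lemma hom_modD:
  assumes "hom_mod A B L w"
  shows "a \<in> carrier A \<Longrightarrow> w a \<in> carrier B"
    and "a \<in> carrier A \<Longrightarrow> b \<in> carrier A \<Longrightarrow> eqmod B L (w (a \<oplus>\<^bsub>A\<^esub> b)) (w a \<oplus>\<^bsub>B\<^esub> w b)"
    and "a \<in> carrier A \<Longrightarrow> b \<in> carrier A \<Longrightarrow> eqmod B L (w (a \<otimes>\<^bsub>A\<^esub> b)) (w a \<otimes>\<^bsub>B\<^esub> w b)"
    and "eqmod B L (w \<one>\<^bsub>A\<^esub>) \<one>\<^bsub>B\<^esub>"
  using assms by (simp_all add: hom_mod_def)

lemma hom_mod_mono: "hom_mod A B L w \<Longrightarrow> L \<subseteq> L' \<Longrightarrow> hom_mod A B L' w"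
  unfolding hom_mod_def by (meson eqmod_mono)

lemma (in ideal) hom_mod_coset:
  assumes "hom_mod A R I w"
  shows "(\<lambda>a. I +> w a) \<in> ring_hom A (R Quot I)"
proof (rule ring_hom_memI)
  fix a b assume ab: "a \<in> carrier A" "b \<in> carrier A"
  show "I +> w a \<in> carrier (R Quot I)"
    using hom_modD(1)[OF assms ab(1)] rcos_ring_hom ring_hom_closed by fastforce
  show "I +> w (a \<otimes>\<^bsub>A\<^esub> b) = (I +> w a) \<otimes>\<^bsub>R Quot I\<^esub> (I +> w b)"
    using hom_modD[OF assms] ab ring_hom_mult[OF rcos_ring_hom, of "w a" "w b"] by (auto simp: eqmod_coset)
  show "I +> w (a \<oplus>\<^bsub>A\<^esub> b) = (I +> w a) \<oplus>\<^bsub>R Quot I\<^esub> (I +> w b)"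
    using hom_modD[OF assms] ab ring_hom_add[OF rcos_ring_hom, of "w a" "w b"] by (auto simp: eqmod_coset)
next
  show "I +> w \<one>\<^bsub>A\<^esub> = \<one>\<^bsub>R Quot I\<^esub>"
    using hom_modD(4)[OF assms] ring_hom_one[OF rcos_ring_hom] by (auto simp: eqmod_coset)
qed

lemma (in ideal) hom_mod_ring_hom:
  assumes "w \<in> ring_hom A R" "ring A"
  shows "hom_mod A R I w"
proof -
  interpret A: ring A by fact
  interpret w: ring_hom_ring A R w using assms ring_axioms by (intro ring_hom_ringI2)
  show ?thesis by (rule hom_modI) simp_all
qed

section \<open>Ideals with two generators and powers of ideals\<close>

lemma (in cring) genideal_two:
  assumes "P \<in> carrier R" "Q \<in> carrier R"
  shows "Idl {P, Q} = {P \<otimes> a \<oplus> Q \<otimes> b | a b. a \<in> carrier R \<and> b \<in> carrier R}" (is "_ = ?S")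
proof
  have "ideal ?S R"
  proof (rule idealI)
    show "subgroup ?S (add_monoid R)"
    proof (rule add.subgroupI)
      show "?S \<subseteq> carrier R" using assms by auto
      have "P \<otimes> \<zero> \<oplus> Q \<otimes> \<zero> \<in> ?S" by blast
      then show "?S \<noteq> {}" by blast
    next
      fix a assume "a \<in> ?S"
      then obtain b c where "b \<in> carrier R" "c \<in> carrier R" "a = P \<otimes> b \<oplus> Q \<otimes> c" by blast
      moreover from this have "\<ominus> a = P \<otimes> (\<ominus> b) \<oplus> Q \<otimes> (\<ominus> c)"
        using assms by (simp add: minus_add r_minus)
      ultimately show "\<ominus> a \<in> ?S" by blast
    next
      fix a a' assume "a \<in> ?S" "a' \<in> ?S"
      then obtain b c b' c' where *: "b \<in> carrier R" "c \<in> carrier R" "a = P \<otimes> b \<oplus> Q \<otimes> c"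
        "b' \<in> carrier R" "c' \<in> carrier R" "a' = P \<otimes> b' \<oplus> Q \<otimes> c'" by blast
      then have "a \<oplus> a' = P \<otimes> (b \<oplus> b') \<oplus> Q \<otimes> (c \<oplus> c')"
        using assms by (simp add: r_distr a_ac)
      with * show "a \<oplus> a' \<in> ?S" by blast
    qed
  next
    fix a r assume "a \<in> ?S" and r: "r \<in> carrier R"
    then obtain b c where *: "b \<in> carrier R" "c \<in> carrier R" "a = P \<otimes> b \<oplus> Q \<otimes> c" by blast
    then have "r \<otimes> a = P \<otimes> (r \<otimes> b) \<oplus> Q \<otimes> (r \<otimes> c)" "a \<otimes> r = P \<otimes> (r \<otimes> b) \<oplus> Q \<otimes> (r \<otimes> c)"
      using assms r by (simp_all add: r_distr l_distr m_ac)
    with * r show "r \<otimes> a \<in> ?S" "a \<otimes> r \<in> ?S" by blast+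
  qed (rule ring_axioms)
  moreover have "P \<in> ?S" "Q \<in> ?S"
  proof -
    have "P = P \<otimes> \<one> \<oplus> Q \<otimes> \<zero>" "Q = P \<otimes> \<zero> \<oplus> Q \<otimes> \<one>" using assms by simp_all
    then show "P \<in> ?S" "Q \<in> ?S" using one_closed zero_closed by blast+
  qed
  ultimately show "Idl {P, Q} \<subseteq> ?S"
    by (intro genideal_minimal) auto
next
  interpret I: ideal "Idl {P, Q}" R using assms by (intro genideal_ideal) auto
  have "P \<in> Idl {P, Q}" "Q \<in> Idl {P, Q}" using assms genideal_self[of "{P, Q}"] by auto
  then show "?S \<subseteq> Idl {P, Q}" using I.I_r_closed by auto
qed

lemma (in ring) ideal_pow_ideal: "ideal J R \<Longrightarrow> ideal (ideal_pow R J n) R"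
  by (induction n) (simp_all add: oneideal ideal_prod_is_ideal)

lemma (in ring) ideal_pow_carrier: "ideal J R \<Longrightarrow> a \<in> ideal_pow R J n \<Longrightarrow> a \<in> carrier R"
  using ideal.Icarr ideal_pow_ideal by metis

lemma (in ring) ideal_pow_Suc_subset: "ideal J R \<Longrightarrow> ideal_pow R J (Suc n) \<subseteq> ideal_pow R J n"
  using ideal_prod_inter[OF ideal_pow_ideal] by auto

lemma (in ring) ideal_pow_antimono: "ideal J R \<Longrightarrow> m \<le> n \<Longrightarrow> ideal_pow R J n \<subseteq> ideal_pow R J m"
proof (induction n)
  case (Suc n)
  then show ?case using ideal_pow_Suc_subset[of J n] by (cases "m = Suc n") auto
qed simp

lemma (in ring) ideal_pow_1: "ideal J R \<Longrightarrow> ideal_pow R J (Suc 0) = J"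
proof -
  assume J: "ideal J R"
  then interpret J: ideal J R .
  have "j \<in> carrier R \<cdot>\<^bsub>R\<^esub> J" if "j \<in> J" for j
    using ideal_prod.prod[of \<one> "carrier R" j J R] that J.Icarr by auto
  then show ?thesis using ideal_prod_inter[OF oneideal J] by auto
qed

lemma (in cring) ideal_pow_mult:
  assumes "ideal J R" "a \<in> ideal_pow R J m" "b \<in> ideal_pow R J n"
  shows "a \<otimes> b \<in> ideal_pow R J (m + n)"
  using assms(3)
proof (induction n arbitrary: b)
  case 0
  then show ?case using ideal.I_r_closed[OF ideal_pow_ideal[OF assms(1)] assms(2)] by simp
next
  case (Suc n)
  have "b \<in> ideal_pow R J n \<cdot>\<^bsub>R\<^esub> J" using Suc.prems by simp
  then show ?case
  proof induction
    case (prod i j)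
    then have "a \<otimes> i \<otimes> j \<in> ideal_pow R J (m + Suc n)"
      using Suc.IH by (auto intro: ideal_prod.prod)
    moreover have "a \<in> carrier R" "i \<in> carrier R" "j \<in> carrier R"
      using ideal_pow_carrier[OF assms(1)] assms(2) prod ideal.Icarr[OF assms(1)] by auto
    ultimately show ?case by (simp add: m_assoc)
  next
    case (sum s1 s2)
    have "s1 \<in> carrier R" "s2 \<in> carrier R" "a \<in> carrier R"
      using sum.hyps ideal_pow_carrier[OF assms(1), of _ "Suc n"] ideal_pow_carrier[OF assms(1)] assms(2) by auto
    then show ?case
      using sum.IH ideal_prod.sum[of "a \<otimes> s1" R _ J "a \<otimes> s2"] by (simp add: r_distr)
  qed
qed

text \<open>One factor of each product is expanded in the generators and the rest is collected in
  the previous power. This is the induction principle for adic powers.\<close>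

lemma (in cring) ideal_pow_two:
  assumes "P \<in> carrier R" "Q \<in> carrier R"
  shows "z \<in> ideal_pow R (Idl {P, Q}) (Suc n) \<longleftrightarrow>
    (\<exists>a\<in>ideal_pow R (Idl {P, Q}) n. \<exists>b\<in>ideal_pow R (Idl {P, Q}) n. z = P \<otimes> a \<oplus> Q \<otimes> b)"
proof
  let ?J = "Idl {P, Q}"
  have J: "ideal ?J R" using assms by (intro genideal_ideal) auto
  interpret N: ideal "ideal_pow R ?J n" R by (rule ideal_pow_ideal[OF J])
  {
    assume "z \<in> ideal_pow R ?J (Suc n)"
    then have "z \<in> ideal_pow R ?J n \<cdot>\<^bsub>R\<^esub> ?J" by simp
    then show "\<exists>a\<in>ideal_pow R ?J n. \<exists>b\<in>ideal_pow R ?J n. z = P \<otimes> a \<oplus> Q \<otimes> b"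
    proof induction
      case (prod i j)
      have "j \<in> {P \<otimes> a \<oplus> Q \<otimes> b | a b. a \<in> carrier R \<and> b \<in> carrier R}"
        using prod(2) unfolding genideal_two[OF assms] .
      then obtain a b where ab: "a \<in> carrier R" "b \<in> carrier R" "j = P \<otimes> a \<oplus> Q \<otimes> b"
        by blast
      moreover have i: "i \<in> carrier R" using N.Icarr[OF prod(1)] .
      ultimately have "i \<otimes> j = P \<otimes> (i \<otimes> a) \<oplus> Q \<otimes> (i \<otimes> b)"
        using assms by (simp add: r_distr m_lcomm)
      then show ?case using N.I_r_closed prod(1) ab by blast
    next
      case (sum s1 s2)
      then obtain a b a' b' where *: "a \<in> ideal_pow R ?J n" "b \<in> ideal_pow R ?J n" "s1 = P \<otimes> a \<oplus> Q \<otimes> b"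
        "a' \<in> ideal_pow R ?J n" "b' \<in> ideal_pow R ?J n" "s2 = P \<otimes> a' \<oplus> Q \<otimes> b'" by blast
      moreover from * have "a \<in> carrier R" "b \<in> carrier R" "a' \<in> carrier R" "b' \<in> carrier R"
        using N.Icarr by auto
      ultimately have "s1 \<oplus> s2 = P \<otimes> (a \<oplus> a') \<oplus> Q \<otimes> (b \<oplus> b')"
        using assms by (simp add: r_distr a_ac)
      then show ?case using * by blast
    qed
  }
  {
    assume "\<exists>a\<in>ideal_pow R ?J n. \<exists>b\<in>ideal_pow R ?J n. z = P \<otimes> a \<oplus> Q \<otimes> b"
    then obtain a b where *: "a \<in> ideal_pow R ?J n" "b \<in> ideal_pow R ?J n" "z = P \<otimes> a \<oplus> Q \<otimes> b" by blast
    have "P \<in> ?J" "Q \<in> ?J" using assms genideal_self[of "{P, Q}"] by auto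
    then have "a \<otimes> P \<oplus> b \<otimes> Q \<in> ideal_pow R ?J n \<cdot>\<^bsub>R\<^esub> ?J"
      using * by (intro ideal_prod.sum ideal_prod.prod)
    then show "z \<in> ideal_pow R ?J (Suc n)"
      using * assms N.Icarr[of a] N.Icarr[of b] by (simp add: m_comm)
  }
qed

lemma hom_ideal_pow:
  assumes "ring B" "ring C" "h \<in> ring_hom B C" "ideal I B" "\<And>i. i \<in> I \<Longrightarrow> h i \<in> L"
    and "z \<in> ideal_pow B I n"
  shows "h z \<in> ideal_pow C L n"
proof -
  interpret h: ring_hom_ring B C h using assms by (intro ring_hom_ringI2)
  show ?thesis using assms(6)
  proof (induction n arbitrary: z)
    case 0
    then show ?case by simp
  next
    case (Suc n)
    have "z \<in> ideal_pow B I n \<cdot>\<^bsub>B\<^esub> I" using Suc.prems by simp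
    then show ?case
    proof induction
      case (prod i j)
      moreover have "i \<in> carrier B" "j \<in> carrier B"
        using prod h.R.ideal_pow_carrier[OF assms(4)] ideal.Icarr[OF assms(4)] by auto
      ultimately show ?case using Suc.IH assms(5) by (auto intro: ideal_prod.prod)
    next
      case (sum s1 s2)
      moreover have "s1 \<in> carrier B" "s2 \<in> carrier B"
        using sum.hyps h.R.ideal_pow_carrier[OF assms(4), of _ "Suc n"] by auto
      ultimately show ?case by (auto intro: ideal_prod.sum)
    qed
  qed
qed

lemma hom_genideal:
  assumes "ring B" "ring C" "h \<in> ring_hom B C" "S \<subseteq> carrier B" "ideal L C" "\<And>s. s \<in> S \<Longrightarrow> h s \<in> L"
    and "z \<in> Idl\<^bsub>B\<^esub> S"
  shows "h z \<in> L"
proof -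
  interpret h: ring_hom_ring B C h using assms by (intro ring_hom_ringI2)
  have "ideal {r \<in> carrier B. h r \<in> L} B"
    using h.ideal_vimage[OF assms(5)] .
  then have "Idl\<^bsub>B\<^esub> S \<subseteq> {r \<in> carrier B. h r \<in> L}"
    using assms(4,6) by (intro h.R.genideal_minimal) auto
  then show ?thesis using assms(7) by auto
qed

lemma (in cring) cgenideal_mult:
  assumes "a \<in> carrier R" "b \<in> carrier R" "y \<in> PIdl a" "z \<in> PIdl b"
  shows "y \<otimes> z \<in> PIdl (a \<otimes> b)"
proof -
  obtain r s where "r \<in> carrier R" "s \<in> carrier R" "y = r \<otimes> a" "z = s \<otimes> b"
    using assms by (auto simp: cgenideal_def)
  moreover from this have "y \<otimes> z = (r \<otimes> s) \<otimes> (a \<otimes> b)" using assms by (simp add: m_ac)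
  ultimately show ?thesis by (auto simp: cgenideal_def)
qed

section \<open>Limits of quotients and completions\<close>

locale quot_system = cring R for R (structure) +
  fixes K :: "nat \<Rightarrow> 'a set"
  assumes K_ideal: "ideal (K n) R" and K_Suc: "K (Suc n) \<subseteq> K n"
begin

lemma coset_eq_iff: "a \<in> carrier R \<Longrightarrow> b \<in> carrier R \<Longrightarrow> K n +> a = K n +> b \<longleftrightarrow> a \<ominus> b \<in> K n"
  using quotient_eq_iff_same_a_r_cos[OF K_ideal] by simp

lemma coset_self: "a \<in> carrier R \<Longrightarrow> a \<in> K n +> a"
  using K_ideal[of n] by (simp add: abelian_subgroup.a_rcos_self abelian_subgroupI3 ideal.axioms(1) is_abelian_group)

lemma coset_eqI: "a \<in> carrier R \<Longrightarrow> b \<in> K n +> a \<Longrightarrow> K n +> b = K n +> a"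
  using a_repr_independence[of b "K n" a] ideal.axioms(1)[OF K_ideal, of n] additive_subgroup.a_subgroup by fastforce

lemma carrier_Quot: "carrier (R Quot K n) = {K n +> a | a. a \<in> carrier R}"
  by (auto simp: FactRing_def A_RCOSETS_def')

lemma carrier_limitD: "s \<in> carrier (quot_limit R K) \<Longrightarrow> \<exists>b. b \<in> carrier R \<and> s n = K n +> b"
proof -
  assume "s \<in> carrier (quot_limit R K)"
  then have "s n \<in> carrier (R Quot K n)" by (simp add: quot_limit_def)
  then show ?thesis unfolding carrier_Quot by blast
qed

text \<open>Compatible cosets up to level n share a representative, namely any element of the one at
  level n. Limits are constructed and computed in this form.\<close>

lemma quot_limit_iff:
  "s \<in> carrier (quot_limit R K) \<longleftrightarrow> (\<forall>n. \<exists>b\<in>carrier R. \<forall>m\<le>n. s m = K m +> b)"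
proof
  assume s: "s \<in> carrier (quot_limit R K)"
  show "\<forall>n. \<exists>b\<in>carrier R. \<forall>m\<le>n. s m = K m +> b"
  proof
    fix n
    obtain b where b: "b \<in> carrier R" "s n = K n +> b"
      using carrier_limitD[OF s] by blast
    have "s m = K m +> b" if "m \<le> n" for m
    proof -
      have "s n \<subseteq> s m" using that
      proof (induction n)
        case (Suc n)
        then show ?case using s by (cases "m = Suc n") (auto simp: quot_limit_def)
      qed simp
      then have "b \<in> s m" using b coset_self by auto
      moreover obtain a where "a \<in> carrier R" "s m = K m +> a"
        using carrier_limitD[OF s] by blast
      ultimately show ?thesis using coset_eqI by auto
    qed
    with b show "\<exists>b\<in>carrier R. \<forall>m\<le>n. s m = K m +> b" by blast
  qed
next
  assume *: "\<forall>n. \<exists>b\<in>carrier R. \<forall>m\<le>n. s m = K m +> b"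
  have "s (Suc n) \<subseteq> s n" for n
  proof -
    obtain b where b: "b \<in> carrier R" "\<forall>m\<le>Suc n. s m = K m +> b" using * by blast
    then show ?thesis using K_Suc[of n] by (auto simp: a_r_coset_def')
  qed
  then show "s \<in> carrier (quot_limit R K)"
    using * carrier_Quot unfolding quot_limit_def by simp (metis (mono_tags, lifting) mem_Collect_eq order_refl)
qed

lemma quot_limit_rep:
  assumes "s \<in> carrier (quot_limit R K)"
  obtains b where "b \<in> carrier R" "\<And>m. m \<le> n \<Longrightarrow> s m = K m +> b"
  using assms unfolding quot_limit_iff by blast

lemma Quot_cring: "cring (R Quot K n)"
  using ideal.quotient_is_cring[OF K_ideal] is_cring by blast

lemma coset_ops:
  assumes "a \<in> carrier R" "b \<in> carrier R"
  shows "(K n +> a) \<otimes>\<^bsub>R Quot K n\<^esub> (K n +> b) = K n +> (a \<otimes> b)"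
    and "(K n +> a) \<oplus>\<^bsub>R Quot K n\<^esub> (K n +> b) = K n +> (a \<oplus> b)"
    and "\<one>\<^bsub>R Quot K n\<^esub> = K n +> \<one>" and "\<zero>\<^bsub>R Quot K n\<^esub> = K n +> \<zero>"
proof -
  have h: "(+>) (K n) \<in> ring_hom R (R Quot K n)" using ideal.rcos_ring_hom[OF K_ideal] .
  interpret h: ring_hom_ring R "R Quot K n" "(+>) (K n)"
    using h ring_axioms cring.axioms(1)[OF Quot_cring] by (intro ring_hom_ringI2)
  show "(K n +> a) \<otimes>\<^bsub>R Quot K n\<^esub> (K n +> b) = K n +> (a \<otimes> b)"
    "(K n +> a) \<oplus>\<^bsub>R Quot K n\<^esub> (K n +> b) = K n +> (a \<oplus> b)"
    "\<one>\<^bsub>R Quot K n\<^esub> = K n +> \<one>" "\<zero>\<^bsub>R Quot K n\<^esub> = K n +> \<zero>"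
    using assms by simp_all
qed

lemma quot_limit_cring: "cring (quot_limit R K)"
proof -
  let ?H = "quot_limit R K"
  have comp: "(s \<otimes>\<^bsub>?H\<^esub> t) n = s n \<otimes>\<^bsub>R Quot K n\<^esub> t n" "(s \<oplus>\<^bsub>?H\<^esub> t) n = s n \<oplus>\<^bsub>R Quot K n\<^esub> t n"
    "\<one>\<^bsub>?H\<^esub> n = \<one>\<^bsub>R Quot K n\<^esub>" "\<zero>\<^bsub>?H\<^esub> n = \<zero>\<^bsub>R Quot K n\<^esub>" for s t n
    by (simp_all add: quot_limit_def)
  have in_Quot: "s n \<in> carrier (R Quot K n)" if "s \<in> carrier ?H" for s n
    using that by (simp add: quot_limit_def)
  have mult: "s \<otimes>\<^bsub>?H\<^esub> t \<in> carrier ?H" and add: "s \<oplus>\<^bsub>?H\<^esub> t \<in> carrier ?H" if st: "s \<in> carrier ?H" "t \<in> carrier ?H" for s t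
  proof -
    have "\<exists>b\<in>carrier R. \<forall>m\<le>n. (s \<otimes>\<^bsub>?H\<^esub> t) m = K m +> b"
      and "\<exists>b\<in>carrier R. \<forall>m\<le>n. (s \<oplus>\<^bsub>?H\<^esub> t) m = K m +> b" for n
    proof -
      obtain b where b: "b \<in> carrier R" "\<And>m. m \<le> n \<Longrightarrow> s m = K m +> b" using quot_limit_rep[OF st(1)] by metis
      obtain c where c: "c \<in> carrier R" "\<And>m. m \<le> n \<Longrightarrow> t m = K m +> c" using quot_limit_rep[OF st(2)] by metis
      show "\<exists>b\<in>carrier R. \<forall>m\<le>n. (s \<otimes>\<^bsub>?H\<^esub> t) m = K m +> b"
        using b c by (intro bexI[of _ "b \<otimes> c"]) (auto simp: comp coset_ops)
      show "\<exists>b\<in>carrier R. \<forall>m\<le>n. (s \<oplus>\<^bsub>?H\<^esub> t) m = K m +> b"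
        using b c by (intro bexI[of _ "b \<oplus> c"]) (auto simp: comp coset_ops)
    qed
    then show "s \<otimes>\<^bsub>?H\<^esub> t \<in> carrier ?H" "s \<oplus>\<^bsub>?H\<^esub> t \<in> carrier ?H" unfolding quot_limit_iff by auto
  qed
  have one: "\<one>\<^bsub>?H\<^esub> \<in> carrier ?H" and zero: "\<zero>\<^bsub>?H\<^esub> \<in> carrier ?H"
    unfolding quot_limit_iff comp by (auto simp: coset_ops[OF one_closed one_closed])
  have neg: "\<exists>t\<in>carrier ?H. t \<oplus>\<^bsub>?H\<^esub> s = \<zero>\<^bsub>?H\<^esub>" if s: "s \<in> carrier ?H" for s
  proof (rule bexI[of _ "\<lambda>n. \<ominus>\<^bsub>R Quot K n\<^esub> s n"])
    show "(\<lambda>n. \<ominus>\<^bsub>R Quot K n\<^esub> s n) \<in> carrier ?H"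
      unfolding quot_limit_iff
    proof
      fix n
      obtain b where b: "b \<in> carrier R" "\<And>m. m \<le> n \<Longrightarrow> s m = K m +> b" using quot_limit_rep[OF s] by metis
      have "\<ominus>\<^bsub>R Quot K m\<^esub> s m = K m +> (\<ominus> b)" if "m \<le> n" for m
      proof -
        interpret h: ring_hom_ring R "R Quot K m" "(+>) (K m)"
          using ring_axioms cring.axioms(1)[OF Quot_cring] ideal.rcos_ring_hom[OF K_ideal] by (intro ring_hom_ringI2)
        show ?thesis using b(2)[OF that] h.hom_a_inv[OF b(1)] by simp
      qed
      then show "\<exists>b\<in>carrier R. \<forall>m\<le>n. \<ominus>\<^bsub>R Quot K m\<^esub> s m = K m +> b" using b(1) by blast
    qed
    show "(\<lambda>n. \<ominus>\<^bsub>R Quot K n\<^esub> s n) \<oplus>\<^bsub>?H\<^esub> s = \<zero>\<^bsub>?H\<^esub>"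
    proof
      fix n
      interpret Q: cring "R Quot K n" by (rule Quot_cring)
      show "((\<lambda>n. \<ominus>\<^bsub>R Quot K n\<^esub> s n) \<oplus>\<^bsub>?H\<^esub> s) n = \<zero>\<^bsub>?H\<^esub> n"
        unfolding comp using in_Quot[OF s, of n] by (simp add: Q.l_neg)
    qed
  qed
  show ?thesis
  proof (rule cringI)
    show "abelian_group ?H"
    proof (rule abelian_groupI)
      fix s t u assume st: "s \<in> carrier ?H" "t \<in> carrier ?H"
      show "s \<oplus>\<^bsub>?H\<^esub> t \<in> carrier ?H" using add st by blast
      show "s \<oplus>\<^bsub>?H\<^esub> t = t \<oplus>\<^bsub>?H\<^esub> s"
      proof
        fix n interpret Q: cring "R Quot K n" by (rule Quot_cring)
        show "(s \<oplus>\<^bsub>?H\<^esub> t) n = (t \<oplus>\<^bsub>?H\<^esub> s) n"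
          unfolding comp using in_Quot st by (simp add: Q.a_comm)
      qed
      show "\<zero>\<^bsub>?H\<^esub> \<oplus>\<^bsub>?H\<^esub> s = s"
      proof
        fix n interpret Q: cring "R Quot K n" by (rule Quot_cring)
        show "(\<zero>\<^bsub>?H\<^esub> \<oplus>\<^bsub>?H\<^esub> s) n = s n" unfolding comp using in_Quot st by simp
      qed
      assume u: "u \<in> carrier ?H"
      show "s \<oplus>\<^bsub>?H\<^esub> t \<oplus>\<^bsub>?H\<^esub> u = s \<oplus>\<^bsub>?H\<^esub> (t \<oplus>\<^bsub>?H\<^esub> u)"
      proof
        fix n interpret Q: cring "R Quot K n" by (rule Quot_cring)
        show "(s \<oplus>\<^bsub>?H\<^esub> t \<oplus>\<^bsub>?H\<^esub> u) n = (s \<oplus>\<^bsub>?H\<^esub> (t \<oplus>\<^bsub>?H\<^esub> u)) n"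
          unfolding comp using in_Quot st u by (simp add: Q.a_assoc)
      qed
    qed (use zero neg in auto)
    show "Group.comm_monoid ?H"
    proof (rule comm_monoidI)
      fix s t u assume st: "s \<in> carrier ?H" "t \<in> carrier ?H"
      show "s \<otimes>\<^bsub>?H\<^esub> t \<in> carrier ?H" using mult st by blast
      show "s \<otimes>\<^bsub>?H\<^esub> t = t \<otimes>\<^bsub>?H\<^esub> s"
      proof
        fix n interpret Q: cring "R Quot K n" by (rule Quot_cring)
        show "(s \<otimes>\<^bsub>?H\<^esub> t) n = (t \<otimes>\<^bsub>?H\<^esub> s) n"
          unfolding comp using in_Quot st by (simp add: Q.m_comm)
      qed
      show "\<one>\<^bsub>?H\<^esub> \<otimes>\<^bsub>?H\<^esub> s = s"
      proof
        fix n interpret Q: cring "R Quot K n" by (rule Quot_cring)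
        show "(\<one>\<^bsub>?H\<^esub> \<otimes>\<^bsub>?H\<^esub> s) n = s n" unfolding comp using in_Quot st by simp
      qed
      assume u: "u \<in> carrier ?H"
      show "s \<otimes>\<^bsub>?H\<^esub> t \<otimes>\<^bsub>?H\<^esub> u = s \<otimes>\<^bsub>?H\<^esub> (t \<otimes>\<^bsub>?H\<^esub> u)"
      proof
        fix n interpret Q: cring "R Quot K n" by (rule Quot_cring)
        show "(s \<otimes>\<^bsub>?H\<^esub> t \<otimes>\<^bsub>?H\<^esub> u) n = (s \<otimes>\<^bsub>?H\<^esub> (t \<otimes>\<^bsub>?H\<^esub> u)) n"
          unfolding comp using in_Quot st u by (simp add: Q.m_assoc)
      qed
    qed (use one in auto)
    fix s t u assume st: "s \<in> carrier ?H" "t \<in> carrier ?H" "u \<in> carrier ?H"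
    show "(s \<oplus>\<^bsub>?H\<^esub> t) \<otimes>\<^bsub>?H\<^esub> u = s \<otimes>\<^bsub>?H\<^esub> u \<oplus>\<^bsub>?H\<^esub> t \<otimes>\<^bsub>?H\<^esub> u"
    proof
      fix n interpret Q: cring "R Quot K n" by (rule Quot_cring)
      show "((s \<oplus>\<^bsub>?H\<^esub> t) \<otimes>\<^bsub>?H\<^esub> u) n = (s \<otimes>\<^bsub>?H\<^esub> u \<oplus>\<^bsub>?H\<^esub> t \<otimes>\<^bsub>?H\<^esub> u) n"
        unfolding comp using in_Quot st by (simp add: Q.l_distr)
    qed
  qed
qed

lemma to_quot_limit_hom: "to_quot_limit R K \<in> ring_hom R (quot_limit R K)"
proof (rule ring_hom_memI)
  fix a b assume "a \<in> carrier R" "b \<in> carrier R"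
  then show "to_quot_limit R K a \<in> carrier (quot_limit R K)"
    unfolding quot_limit_iff to_quot_limit_def by blast
  show "to_quot_limit R K (a \<otimes> b) = to_quot_limit R K a \<otimes>\<^bsub>quot_limit R K\<^esub> to_quot_limit R K b"
    "to_quot_limit R K (a \<oplus> b) = to_quot_limit R K a \<oplus>\<^bsub>quot_limit R K\<^esub> to_quot_limit R K b"
    using \<open>a \<in> carrier R\<close> \<open>b \<in> carrier R\<close> by (simp_all add: to_quot_limit_def quot_limit_def coset_ops)
next
  show "to_quot_limit R K \<one> = \<one>\<^bsub>quot_limit R K\<^esub>"
    by (simp add: to_quot_limit_def quot_limit_def coset_ops[OF one_closed one_closed])
qed

lemma proj_hom: "(\<lambda>s. s n) \<in> ring_hom (quot_limit R K) (R Quot K n)"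
  by (rule ring_hom_memI) (simp_all add: quot_limit_def)

end

section \<open>Adic topologies given by two generators, and their completions\<close>

text \<open>P and Q will be the images of p and q - 1 in the various rings.\<close>

locale adic_pair = cring R for R (structure) +
  fixes P Q :: 'a
  assumes P_closed [simp, intro]: "P \<in> carrier R" and Q_closed [simp, intro]: "Q \<in> carrier R"
begin

definition pw where "pw = ideal_pow R (Idl {P, Q})"

definition completed where "completed = completion R (Idl {P, Q})"

definition incl where "incl = to_completion R (Idl {P, Q})"

lemma J_ideal: "ideal (Idl {P, Q}) R"
  by (intro genideal_ideal) auto

lemma pw_ideal: "ideal (pw n) R"
  unfolding pw_def by (rule ideal_pow_ideal[OF J_ideal])

lemma pw_carrier: "a \<in> pw n \<Longrightarrow> a \<in> carrier R"
  using ideal.Icarr[OF pw_ideal] .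

lemma pw_0 [simp]: "pw 0 = carrier R"
  by (simp add: pw_def)

lemma pw_antimono: "m \<le> n \<Longrightarrow> pw n \<subseteq> pw m"
  unfolding pw_def by (rule ideal_pow_antimono[OF J_ideal])

lemma pw_Suc: "z \<in> pw (Suc n) \<longleftrightarrow> (\<exists>a\<in>pw n. \<exists>b\<in>pw n. z = P \<otimes> a \<oplus> Q \<otimes> b)"
  unfolding pw_def by (rule ideal_pow_two) auto

lemma pw_mult: "a \<in> pw m \<Longrightarrow> b \<in> pw n \<Longrightarrow> a \<otimes> b \<in> pw (m + n)"
  unfolding pw_def by (rule ideal_pow_mult[OF J_ideal])

lemma P_pw: "P \<in> pw (Suc 0)" and Q_pw: "Q \<in> pw (Suc 0)"
  unfolding pw_def ideal_pow_1[OF J_ideal] using genideal_self[of "{P, Q}"] by auto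

lemma pw_pow: "a \<in> pw k \<Longrightarrow> a [^] (n::nat) \<in> pw (k * n)"
proof (induction n)
  case (Suc n)
  then have "a [^] n \<otimes> a \<in> pw (k * n + k)" by (intro pw_mult) auto
  then show ?case by (simp add: add.commute)
qed simp

sublocale quot_system R pw
  by (intro quot_system.intro quot_system_axioms.intro pw_ideal pw_antimono is_cring) simp

lemma completed_eq: "completed = quot_limit R pw" "incl = to_quot_limit R pw"
  by (simp_all add: completed_def incl_def completion_def to_completion_def pw_def)

lemma completed_cring: "cring completed"
  unfolding completed_eq by (rule quot_limit_cring)

lemma incl_hom: "incl \<in> ring_hom R completed"
  unfolding completed_eq by (rule to_quot_limit_hom)

lemma incl_closed [simp]: "a \<in> carrier R \<Longrightarrow> incl a \<in> carrier completed"
  using incl_hom by (rule ring_hom_closed)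

lemma incl_apply: "incl a n = pw n +> a"
  by (simp add: completed_eq to_quot_limit_def)

end

text \<open>A second name for an adic pair. The completion is interpreted as an
  \<open>adic_pair\<close> only from here, so that no endless chain of completions of completions
  arises.\<close>

locale adic_hat = adic_pair

sublocale adic_hat \<subseteq> hat: adic_pair completed "incl P" "incl Q"
  by (intro adic_pair.intro completed_cring adic_pair_axioms.intro incl_closed P_closed Q_closed)

lemma adic_hatI: "adic_pair B P Q \<Longrightarrow> adic_hat B P Q"
  by (rule adic_hat.intro)

context adic_hat
begin

lemma hat_comp:
  assumes "s \<in> carrier completed" "t \<in> carrier completed"
  shows "(s \<oplus>\<^bsub>completed\<^esub> t) n = s n \<oplus>\<^bsub>R Quot pw n\<^esub> t n" "(s \<otimes>\<^bsub>completed\<^esub> t) n = s n \<otimes>\<^bsub>R Quot pw n\<^esub> t n"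
    "\<zero>\<^bsub>completed\<^esub> n = pw n +> \<zero>"
  unfolding completed_eq by (simp_all add: quot_limit_def coset_ops(4)[OF one_closed one_closed])

lemma hat_rep:
  assumes "s \<in> carrier completed"
  obtains b where "b \<in> carrier R" "\<And>m. m \<le> n \<Longrightarrow> s m = pw m +> b"
  using quot_limit_rep[of s n] assms unfolding completed_eq by metis

lemma hat_rep1:
  assumes "s \<in> carrier completed"
  obtains b where "b \<in> carrier R" "s m = pw m +> b"
  using carrier_limitD[of s m] assms unfolding completed_eq by blast

lemma hat_lincomb:
  assumes "u \<in> carrier completed" "v \<in> carrier completed" "u n = pw n +> a" "v n = pw n +> b"
    "a \<in> carrier R" "b \<in> carrier R"
  shows "(incl P \<otimes>\<^bsub>completed\<^esub> u \<oplus>\<^bsub>completed\<^esub> incl Q \<otimes>\<^bsub>completed\<^esub> v) n = pw n +> (P \<otimes> a \<oplus> Q \<otimes> b)"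
proof -
  have c: "incl P \<in> carrier completed" "incl Q \<in> carrier completed"
    "incl P \<otimes>\<^bsub>completed\<^esub> u \<in> carrier completed" "incl Q \<otimes>\<^bsub>completed\<^esub> v \<in> carrier completed"
    "P \<otimes> a \<in> carrier R" "Q \<otimes> b \<in> carrier R"
    using assms(1,2,5,6) by simp_all
  show ?thesis
    unfolding hat_comp(1)[OF c(3,4)] hat_comp(2)[OF c(1) assms(1)] hat_comp(2)[OF c(2) assms(2)] assms(3,4) incl_apply
      coset_ops(1)[OF P_closed assms(5)] coset_ops(1)[OF Q_closed assms(6)] coset_ops(2)[OF c(5,6)] ..
qed

lemma coset_zero_iff: "a \<in> carrier R \<Longrightarrow> pw n +> a = pw n +> \<zero> \<longleftrightarrow> a \<in> pw n"
  using coset_eq_iff[of a \<zero> n] by (simp only: zero_closed minus_eq minus_zero r_zero)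

text \<open>The powers of the ideal of the completion are the kernels of the projections because the
  ideal is finitely generated.\<close>

lemma hat_pw_iff: "z \<in> hat.pw m \<longleftrightarrow> z \<in> carrier completed \<and> z m = pw m +> \<zero>"
proof (induction m arbitrary: z)
  case 0
  have "z 0 = pw 0 +> \<zero>" if z: "z \<in> carrier completed"
  proof -
    obtain b where b: "b \<in> carrier R" "z 0 = pw 0 +> b" by (rule hat_rep1[OF z])
    then have "b \<in> pw 0" by simp
    then show ?thesis using b coset_zero_iff[of b 0] by metis
  qed
  then show ?case by auto
next
  case (Suc m)
  show ?case
  proof
    assume z: "z \<in> hat.pw (Suc m)"
    then obtain u v where uv: "u \<in> hat.pw m" "v \<in> hat.pw m" and zuv: "z = incl P \<otimes>\<^bsub>completed\<^esub> u \<oplus>\<^bsub>completed\<^esub> incl Q \<otimes>\<^bsub>completed\<^esub> v"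
      unfolding hat.pw_Suc by blast
    then have uvc: "u \<in> carrier completed" "v \<in> carrier completed" "u m = pw m +> \<zero>" "v m = pw m +> \<zero>"
      using Suc.IH by auto
    obtain a where a: "a \<in> carrier R" "\<And>k. k \<le> Suc m \<Longrightarrow> u k = pw k +> a" using hat_rep[OF uvc(1)] by metis
    obtain b where b: "b \<in> carrier R" "\<And>k. k \<le> Suc m \<Longrightarrow> v k = pw k +> b" using hat_rep[OF uvc(2)] by metis
    have "a \<in> pw m" "b \<in> pw m"
      using uvc(3,4) a(2)[of m] b(2)[of m] coset_zero_iff[OF a(1), of m] coset_zero_iff[OF b(1), of m] by simp_all
    then have "P \<otimes> a \<oplus> Q \<otimes> b \<in> pw (Suc m)" unfolding pw_Suc by blast
    then have "z (Suc m) = pw (Suc m) +> \<zero>"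
      unfolding zuv using hat_lincomb[OF uvc(1,2) a(2)[OF order_refl] b(2)[OF order_refl] a(1) b(1)] pw_carrier coset_zero_iff by metis
    then show "z \<in> carrier completed \<and> z (Suc m) = pw (Suc m) +> \<zero>"
      using hat.pw_carrier[OF z] by blast
  next
    assume z: "z \<in> carrier completed \<and> z (Suc m) = pw (Suc m) +> \<zero>"
    have "\<forall>n. \<exists>b. b \<in> carrier R \<and> (\<forall>k\<le>n. z k = pw k +> b)"
      using hat_rep z by metis
    then obtain b where b: "\<And>n. b n \<in> carrier R" "\<And>n k. k \<le> n \<Longrightarrow> z k = pw k +> b n" by metis
    \<comment> \<open>The approximations of z may start at 0 because z vanishes modulo J^(m+1),
      where J = (P, Q). Their successive differences lie in J^(m+j+1) and split as P u_j + Q v_j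
      with u_j, v_j in J^(m+j). The partial sums of the u_j and of the v_j converge, and z is P
      times one limit plus Q times the other.\<close>
    define c where "c j = (if j = 0 then \<zero> else b (Suc m + j))" for j
    have c: "c j \<in> carrier R" for j using b(1) by (simp add: c_def)
    have "c (Suc j) \<ominus> c j \<in> pw (Suc (m + j))" for j
    proof (cases "j = 0")
      case True
      have "b (Suc (Suc m)) \<in> pw (Suc m)"
        using z b(2)[of "Suc m" "Suc (Suc m)"] coset_zero_iff[OF b(1), of "Suc m"] by simp
      then show ?thesis using True b(1) by (simp add: c_def a_minus_def)
    next
      case False
      have "pw (Suc (m + j)) +> b (Suc m + Suc j) = pw (Suc (m + j)) +> b (Suc m + j)"
        using b(2)[of "Suc (m + j)" "Suc m + Suc j"] b(2)[of "Suc (m + j)" "Suc m + j"] by simp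
      then show ?thesis using False b(1) coset_eq_iff by (simp add: c_def)
    qed
    then have "\<forall>j. \<exists>u v. u \<in> pw (m + j) \<and> v \<in> pw (m + j) \<and> c (Suc j) \<ominus> c j = P \<otimes> u \<oplus> Q \<otimes> v"
      unfolding pw_Suc by blast
    then obtain u v where u: "\<And>j. u j \<in> pw (m + j)" and v: "\<And>j. v j \<in> pw (m + j)"
      and uv: "\<And>j. c (Suc j) \<ominus> c j = P \<otimes> u j \<oplus> Q \<otimes> v j" by metis
    define U where "U w i = finsum R w {..<i}" for w :: "nat \<Rightarrow> 'a" and i :: nat
    have uc: "u j \<in> carrier R" "v j \<in> carrier R" for j using u v pw_carrier by blast+
    have U_Suc: "U w (Suc i) = U w i \<oplus> w i" "U w i \<in> carrier R" if "\<And>j. w j \<in> carrier R" for w i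
      using that by (auto simp: U_def lessThan_Suc a_comm)
    have lim: "(\<lambda>n. pw n +> U w n) \<in> hat.pw m" if w: "\<And>j. w j \<in> pw (m + j)" for w
    proof -
      have wc: "w j \<in> carrier R" for j using w pw_carrier by blast
      have Uc: "U w i \<in> carrier R" for i
        by (rule U_Suc(2)) (rule wc)
      have US: "U w (Suc i) = U w i \<oplus> w i" for i
        by (rule U_Suc(1)) (rule wc)
      have step: "pw k +> U w n = pw k +> U w k" if "k \<le> n" for k n
        using that
      proof (induction n)
        case (Suc n)
        show ?case
        proof (cases "k = Suc n")
          case False
          then have "U w (Suc n) \<ominus> U w n \<in> pw k"
            using w[of n] pw_antimono[of k "m + n"] Suc.prems wc Uc
            by (auto simp: US a_minus_def a_ac r_neg r_neg1 r_neg2)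
          then have "pw k +> U w (Suc n) = pw k +> U w n"
            using coset_eq_iff[OF Uc Uc] by blast
          then show ?thesis using False Suc by simp
        qed simp
      qed simp
      have 1: "(\<lambda>n. pw n +> U w n) \<in> carrier completed"
        unfolding completed_eq quot_limit_iff using step Uc by metis
      interpret M: ideal "pw m" R by (rule pw_ideal)
      have "U w i \<in> pw m" for i
      proof (induction i)
        case (Suc i)
        then show ?case using w[of i] pw_antimono[of m "m + i"] by (auto simp: US)
      qed (simp add: U_def)
      with 1 show ?thesis unfolding Suc.IH using Uc by (simp add: coset_zero_iff)
    qed
    have Uc: "U u i \<in> carrier R" "U v i \<in> carrier R" for i
      by (rule U_Suc(2), rule uc)+
    have c_eq: "P \<otimes> U u i \<oplus> Q \<otimes> U v i = c i" for i
    proof (induction i)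
      case (Suc i)
      have U: "U u i \<in> carrier R" "U v i \<in> carrier R" "U u (Suc i) = U u i \<oplus> u i" "U v (Suc i) = U v i \<oplus> v i"
        using Uc by (auto intro!: U_Suc(1) uc)
      have "P \<otimes> U u (Suc i) \<oplus> Q \<otimes> U v (Suc i) = (P \<otimes> U u i \<oplus> Q \<otimes> U v i) \<oplus> (P \<otimes> u i \<oplus> Q \<otimes> v i)"
        using U uc by (simp add: r_distr a_ac)
      also have "\<dots> = c i \<oplus> (c (Suc i) \<ominus> c i)"
        by (simp only: uv Suc.IH)
      also have "\<dots> = c (Suc i)"
        using c[of i] c[of "Suc i"] a_lcomm[of "c i" "c (Suc i)" "\<ominus> c i"] by (simp add: minus_eq r_neg)
      finally show ?case .
    qed (simp add: U_def c_def)
    have "z = incl P \<otimes>\<^bsub>completed\<^esub> (\<lambda>n. pw n +> U u n) \<oplus>\<^bsub>completed\<^esub> incl Q \<otimes>\<^bsub>completed\<^esub> (\<lambda>n. pw n +> U v n)"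
    proof
      fix n
      have "z n = pw n +> c n"
      proof (cases "n = 0")
        case True
        have "b 0 \<in> pw 0" using b(1)[of 0] by simp
        then show ?thesis using True b(2)[of 0 0] coset_zero_iff[OF b(1), of 0 0] by (metis c_def order_refl)
      next
        case False
        then show ?thesis using b(2)[of n "Suc m + n"] by (simp add: c_def)
      qed
      then show "z n = (incl P \<otimes>\<^bsub>completed\<^esub> (\<lambda>n. pw n +> U u n) \<oplus>\<^bsub>completed\<^esub> incl Q \<otimes>\<^bsub>completed\<^esub> (\<lambda>n. pw n +> U v n)) n"
        using hat_lincomb[OF hat.pw_carrier[OF lim[OF u]] hat.pw_carrier[OF lim[OF v]] refl refl Uc, of n]
        by (simp only: c_eq)
    qed
    then show "z \<in> hat.pw (Suc m)"
      unfolding hat.pw_Suc using lim[OF u] lim[OF v] by blast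
  qed
qed

lemma incl_pw_iff: "b \<in> carrier R \<Longrightarrow> incl b \<in> hat.pw m \<longleftrightarrow> b \<in> pw m"
  by (simp add: hat_pw_iff incl_apply coset_zero_iff)

lemma hat_eqmod_iff:
  assumes "s \<in> carrier completed" "t \<in> carrier completed"
  shows "eqmod completed (hat.pw m) s t \<longleftrightarrow> s m = t m"
proof -
  interpret h: ring_hom_ring completed "R Quot pw m" "\<lambda>s. s m"
    using proj_hom[of m] hat.ring_axioms cring.axioms(1)[OF Quot_cring] unfolding completed_eq
    by (intro ring_hom_ringI2)
  have "(s \<ominus>\<^bsub>completed\<^esub> t) m = s m \<ominus>\<^bsub>R Quot pw m\<^esub> t m"
    using assms by (simp add: a_minus_def)
  moreover have "s m \<ominus>\<^bsub>R Quot pw m\<^esub> t m = pw m +> \<zero> \<longleftrightarrow> s m = t m"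
    using assms h.hom_closed[OF assms(1)] h.hom_closed[OF assms(2)] h.S.minus_eq_zero_iff coset_ops(4)[OF one_closed one_closed, of m]
    by metis
  ultimately show ?thesis using assms by (simp add: eqmod_def hat_pw_iff)
qed

lemma hat_dense:
  assumes "s \<in> carrier completed"
  obtains b where "b \<in> carrier R" "eqmod completed (hat.pw m) s (incl b)"
proof -
  obtain b where "b \<in> carrier R" "s m = pw m +> b" by (rule hat_rep1[OF assms])
  then show thesis using that hat_eqmod_iff assms by (auto simp: incl_apply)
qed

end

locale complete_adic_pair = adic_pair +
  assumes separated: "(\<And>m. z \<in> pw m) \<Longrightarrow> z = \<zero>"
    and complete: "(\<And>m. y m \<in> carrier R) \<Longrightarrow> (\<And>m. y (Suc m) \<ominus> y m \<in> pw m) \<Longrightarrow>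
      \<exists>z\<in>carrier R. \<forall>m. z \<ominus> y m \<in> pw m"
begin

lemma eq_if_eqmod: "(\<And>m. eqmod R (pw m) a b) \<Longrightarrow> a = b"
proof -
  assume *: "\<And>m. eqmod R (pw m) a b"
  then have "a \<ominus> b = \<zero>" using separated by (auto simp: eqmod_def)
  then show ?thesis using *[of 0] minus_eq_zero_iff by (auto simp: eqmod_def)
qed

lemma limit_exists:
  assumes "\<And>m. eqmod R (pw m) (y (Suc m)) (y m)"
  obtains z where "z \<in> carrier R" "\<And>m. eqmod R (pw m) z (y m)"
  using complete[of y] assms unfolding eqmod_def by blast

end

text \<open>As adic powers of the completion are kernels of projections, the limit of a Cauchy
  sequence of threads is its diagonal.\<close>

sublocale adic_hat \<subseteq> hat: complete_adic_pair completed "incl P" "incl Q"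
proof unfold_locales
  fix z assume *: "\<And>m. z \<in> hat.pw m"
  show "z = \<zero>\<^bsub>completed\<^esub>"
  proof
    fix n show "z n = \<zero>\<^bsub>completed\<^esub> n" using *[of n] hat_comp(3)[OF hat.zero_closed hat.zero_closed] by (simp add: hat_pw_iff)
  qed
next
  fix y assume y: "\<And>m::nat. y m \<in> carrier completed" "\<And>m. y (Suc m) \<ominus>\<^bsub>completed\<^esub> y m \<in> hat.pw m"
  have step: "y n k = y k k" if "k \<le> n" for k n
    using that
  proof (induction n)
    case (Suc n)
    show ?case
    proof (cases "k = Suc n")
      case False
      have "y (Suc n) \<ominus>\<^bsub>completed\<^esub> y n \<in> hat.pw k"
        using y(2)[of n] hat.pw_antimono[of k n] False Suc.prems by auto
      then have "y (Suc n) k = y n k" using hat_eqmod_iff y(1) by (simp add: eqmod_def)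
      then show ?thesis using Suc False by simp
    qed simp
  qed simp
  have "(\<lambda>m. y m m) \<in> carrier completed"
    unfolding completed_eq quot_limit_iff
  proof
    fix n
    obtain b where "b \<in> carrier R" "\<And>m. m \<le> n \<Longrightarrow> y n m = pw m +> b" using hat_rep[OF y(1)] by metis
    then show "\<exists>b\<in>carrier R. \<forall>m\<le>n. y m m = pw m +> b" using step by metis
  qed
  then show "\<exists>z\<in>carrier completed. \<forall>m. z \<ominus>\<^bsub>completed\<^esub> y m \<in> hat.pw m"
    using hat_eqmod_iff y(1) by (intro bexI[of _ "\<lambda>m. y m m"]) (auto simp: eqmod_def)
qed

text \<open>A Cauchy sequence converges in the completion, and its limit comes from R by
  bijectivity; the inclusion reflects congruences, so the limit is one in R.\<close>

lemma complete_adic_pairI: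
  fixes R (structure)
  assumes "adic_pair R P Q" "adic_complete R (Idl\<^bsub>R\<^esub> {P, Q})"
  shows "complete_adic_pair R P Q"
proof -
  interpret adic_hat R P Q by (rule adic_hatI) fact
  have bij: "bij_betw incl (carrier R) (carrier completed)"
    using assms(2) by (simp add: adic_complete_def incl_def completed_def)
  show ?thesis
  proof
    fix z assume *: "\<And>m. z \<in> pw m"
    then have "incl z m = incl \<zero> m" for m
      using coset_zero_iff[of z m] pw_carrier by (simp add: incl_apply)
    then have "incl z = incl \<zero>" by blast
    then show "z = \<zero>" using bij *[of 0] by (auto simp: bij_betw_def inj_on_def)
  next
    fix y assume y: "\<And>m::nat. y m \<in> carrier R" "\<And>m. y (Suc m) \<ominus> y m \<in> pw m"
    interpret i: ring_hom_ring R completed incl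
      using incl_hom ring_axioms hat.ring_axioms by (intro ring_hom_ringI2)
    have "incl (y (Suc m)) \<ominus>\<^bsub>completed\<^esub> incl (y m) \<in> hat.pw m" for m
      using incl_pw_iff[of "y (Suc m) \<ominus> y m" m] y by (simp add: a_minus_def)
    then obtain s where s: "s \<in> carrier completed" "\<And>m. s \<ominus>\<^bsub>completed\<^esub> incl (y m) \<in> hat.pw m"
      using hat.complete[of "\<lambda>m. incl (y m)"] y(1) by auto
    then obtain z where z: "z \<in> carrier R" "s = incl z" using bij by (auto simp: bij_betw_def)
    have "z \<ominus> y m \<in> pw m" for m
      using s(2)[of m] incl_pw_iff[of "z \<ominus> y m" m] y(1) z by (simp add: a_minus_def)
    then show "\<exists>z\<in>carrier R. \<forall>m. z \<ominus> y m \<in> pw m" using z by blast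
  qed
qed

text \<open>Continuity of a ring homomorphism is automatic once it matches the generators.\<close>

lemma pw_hom:
  assumes "adic_pair B P Q" "adic_pair C P' Q'" "h \<in> ring_hom B C" "h P = P'" "h Q = Q'"
    and "z \<in> adic_pair.pw B P Q n"
  shows "h z \<in> adic_pair.pw C P' Q' n"
proof -
  interpret B: adic_pair B P Q by fact
  interpret C: adic_pair C P' Q' by fact
  have "h i \<in> Idl\<^bsub>C\<^esub> {P', Q'}" if "i \<in> Idl\<^bsub>B\<^esub> {P, Q}" for i
    using hom_genideal[OF B.ring_axioms C.ring_axioms assms(3) _ C.J_ideal _ that]
      C.genideal_self[of "{P', Q'}"] assms(4,5) by auto
  then show ?thesis
    using hom_ideal_pow[OF B.ring_axioms C.ring_axioms assms(3) B.J_ideal, of "Idl\<^bsub>C\<^esub> {P', Q'}" z n] assms(6)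
    by (simp add: B.pw_def C.pw_def)
qed

text \<open>The value at a thread is the limit of the values at its representatives. It is
  determined by congruences at all levels, and the ring laws follow from that uniqueness.\<close>

lemma hom_extend:
  assumes "adic_pair B P Q" "complete_adic_pair C P' Q'" "h \<in> ring_hom B C" "h P = P'" "h Q = Q'"
  obtains g where "g \<in> ring_hom (adic_pair.completed B P Q) C" "\<And>b. b \<in> carrier B \<Longrightarrow> g (adic_pair.incl B P Q b) = h b"
proof -
  interpret B: adic_hat B P Q by (rule adic_hatI) fact
  interpret C: complete_adic_pair C P' Q' by fact
  interpret h: ring_hom_ring B C h using assms(3) B.ring_axioms C.ring_axioms by (intro ring_hom_ringI2)
  note hpw = pw_hom[where h = h, OF assms(1) C.adic_pair_axioms assms(3-5)]
  have heq: "eqmod C (C.pw m) (h a) (h b)" if "a \<in> carrier B" "b \<in> carrier B" "B.pw m +>\<^bsub>B\<^esub> a = B.pw m +>\<^bsub>B\<^esub> b" for a b m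
  proof (rule eqmod_hom[OF B.ring_axioms C.ring_axioms assms(3)])
    show "eqmod B (B.pw m) a b" using that B.coset_eq_iff by (simp add: eqmod_def)
  qed (rule hpw)
  let ?lim = "\<lambda>s t. \<forall>m. \<forall>b\<in>carrier B. s m = B.pw m +>\<^bsub>B\<^esub> b \<longrightarrow> eqmod C (C.pw m) t (h b)"
  have ex: "\<exists>t\<in>carrier C. ?lim s t" if s: "s \<in> carrier B.completed" for s
  proof -
    have "\<forall>n. \<exists>b. b \<in> carrier B \<and> (\<forall>m\<le>n. s m = B.pw m +>\<^bsub>B\<^esub> b)"
      using B.hat_rep[OF s] by metis
    then obtain b where b: "\<And>n. b n \<in> carrier B" "\<And>n m. m \<le> n \<Longrightarrow> s m = B.pw m +>\<^bsub>B\<^esub> b n" by metis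
    have "eqmod C (C.pw m) (h (b (Suc m))) (h (b m))" for m
      using heq[of "b (Suc m)" "b m" m] b(1) b(2)[of m "Suc m"] b(2)[of m m] by simp
    then obtain t where t: "t \<in> carrier C" "\<And>m. eqmod C (C.pw m) t (h (b m))"
      using C.limit_exists[of "\<lambda>m. h (b m)"] by blast
    have "eqmod C (C.pw m) t (h b')" if "b' \<in> carrier B" "s m = B.pw m +>\<^bsub>B\<^esub> b'" for m b'
      using ideal.eqmod_trans[OF C.pw_ideal t(2) heq[of "b m" b' m]] b(1) b(2)[of m m] that by simp
    then show ?thesis using t(1) by blast
  qed
  have uniq: "t = t'" if s: "s \<in> carrier B.completed" and "?lim s t" "?lim s t'" for s t t'
  proof (rule C.eq_if_eqmod)
    fix m
    obtain b where "b \<in> carrier B" "s m = B.pw m +>\<^bsub>B\<^esub> b" by (rule B.hat_rep1[OF s])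
    then have "eqmod C (C.pw m) t (h b)" "eqmod C (C.pw m) t' (h b)" using that by blast+
    then show "eqmod C (C.pw m) t t'"
      using ideal.eqmod_trans[OF C.pw_ideal] ideal.eqmod_sym[OF C.pw_ideal] by blast
  qed
  define g where "g s = (SOME t. t \<in> carrier C \<and> ?lim s t)" for s
  have g: "g s \<in> carrier C" "?lim s (g s)" if "s \<in> carrier B.completed" for s
    using someI_ex[of "\<lambda>t. t \<in> carrier C \<and> ?lim s t"] ex[OF that] unfolding g_def by blast+
  have gI: "g s = t" if "s \<in> carrier B.completed" "?lim s t" for s t
    using uniq[OF that(1) g(2)[OF that(1)] that(2)] .
  have incl: "g (B.incl b) = h b" if b: "b \<in> carrier B" for b
    using b by (intro gI) (auto simp: B.incl_apply intro!: heq)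
  have "g \<in> ring_hom B.completed C"
  proof (rule ring_hom_memI)
    fix s t assume st: "s \<in> carrier B.completed" "t \<in> carrier B.completed"
    show "g s \<in> carrier C" using g st by blast
    have main: "?lim (s \<otimes>\<^bsub>B.completed\<^esub> t) (g s \<otimes>\<^bsub>C\<^esub> g t) \<and> ?lim (s \<oplus>\<^bsub>B.completed\<^esub> t) (g s \<oplus>\<^bsub>C\<^esub> g t)"
    proof -
      have "eqmod C (C.pw m) (g s \<otimes>\<^bsub>C\<^esub> g t) (h d)" if d: "d \<in> carrier B" "(s \<otimes>\<^bsub>B.completed\<^esub> t) m = B.pw m +>\<^bsub>B\<^esub> d" for m d
      proof -
        obtain a where a: "a \<in> carrier B" "s m = B.pw m +>\<^bsub>B\<^esub> a" by (rule B.hat_rep1[OF st(1)])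
        obtain b where b: "b \<in> carrier B" "t m = B.pw m +>\<^bsub>B\<^esub> b" by (rule B.hat_rep1[OF st(2)])
        have "eqmod C (C.pw m) (g s \<otimes>\<^bsub>C\<^esub> g t) (h a \<otimes>\<^bsub>C\<^esub> h b)"
          using g(2)[OF st(1)] g(2)[OF st(2)] a b by (intro ideal.eqmod_mult[OF C.pw_ideal]) auto
        moreover have "eqmod C (C.pw m) (h (a \<otimes>\<^bsub>B\<^esub> b)) (h d)"
          using a b d st by (intro heq) (auto simp: B.hat_comp B.coset_ops)
        ultimately show ?thesis using a b ideal.eqmod_trans[OF C.pw_ideal] by simp
      qed
      moreover have "eqmod C (C.pw m) (g s \<oplus>\<^bsub>C\<^esub> g t) (h d)" if d: "d \<in> carrier B" "(s \<oplus>\<^bsub>B.completed\<^esub> t) m = B.pw m +>\<^bsub>B\<^esub> d" for m d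
      proof -
        obtain a where a: "a \<in> carrier B" "s m = B.pw m +>\<^bsub>B\<^esub> a" by (rule B.hat_rep1[OF st(1)])
        obtain b where b: "b \<in> carrier B" "t m = B.pw m +>\<^bsub>B\<^esub> b" by (rule B.hat_rep1[OF st(2)])
        have "eqmod C (C.pw m) (g s \<oplus>\<^bsub>C\<^esub> g t) (h a \<oplus>\<^bsub>C\<^esub> h b)"
          using g(2)[OF st(1)] g(2)[OF st(2)] a b by (intro ideal.eqmod_add[OF C.pw_ideal]) auto
        moreover have "eqmod C (C.pw m) (h (a \<oplus>\<^bsub>B\<^esub> b)) (h d)"
          using a b d st by (intro heq) (auto simp: B.hat_comp B.coset_ops)
        ultimately show ?thesis using a b ideal.eqmod_trans[OF C.pw_ideal] by simp
      qed
      ultimately show ?thesis by blast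
    qed
    show "g (s \<otimes>\<^bsub>B.completed\<^esub> t) = g s \<otimes>\<^bsub>C\<^esub> g t" "g (s \<oplus>\<^bsub>B.completed\<^esub> t) = g s \<oplus>\<^bsub>C\<^esub> g t"
      using main st by (auto intro!: gI)
  next
    show "g \<one>\<^bsub>B.completed\<^esub> = \<one>\<^bsub>C\<^esub>"
      using incl[OF B.one_closed] ring_hom_one[OF B.incl_hom] by simp
  qed
  with incl show thesis using that by blast
qed

text \<open>Only the images of the two generators matter for continuity.\<close>

lemma hom_eq_if_eq_on_incl:
  assumes "adic_pair B P Q" "complete_adic_pair C P' Q'"
    and "g \<in> ring_hom (adic_pair.completed B P Q) C" "g' \<in> ring_hom (adic_pair.completed B P Q) C"
    and "g (adic_pair.incl B P Q P) = P'" "g (adic_pair.incl B P Q Q) = Q'"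
    and "\<And>b. b \<in> carrier B \<Longrightarrow> g (adic_pair.incl B P Q b) = g' (adic_pair.incl B P Q b)"
    and "s \<in> carrier (adic_pair.completed B P Q)"
  shows "g s = g' s"
proof -
  interpret B: adic_hat B P Q by (rule adic_hatI) fact
  interpret C: complete_adic_pair C P' Q' by fact
  have P': "g' (B.incl P) = P'" "g' (B.incl Q) = Q'" using assms(5-7) by auto
  show ?thesis
  proof (rule C.eq_if_eqmod)
    fix m
    obtain b where b: "b \<in> carrier B" "eqmod B.completed (B.hat.pw m) s (B.incl b)"
      using B.hat_dense[OF assms(8)] by blast
    have 1: "eqmod C (C.pw m) (g s) (g (B.incl b))"
      using eqmod_hom[OF B.hat.ring_axioms C.ring_axioms assms(3) pw_hom[where h = g, OF B.hat.adic_pair_axioms C.adic_pair_axioms assms(3,5,6)] b(2)] .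
    have 2: "eqmod C (C.pw m) (g' s) (g' (B.incl b))"
      using eqmod_hom[OF B.hat.ring_axioms C.ring_axioms assms(4) pw_hom[where h = g', OF B.hat.adic_pair_axioms C.adic_pair_axioms assms(4) P'] b(2)] .
    show "eqmod C (C.pw m) (g s) (g' s)"
      by (rule ideal.eqmod_trans[OF C.pw_ideal 1[unfolded assms(7)[OF b(1)]] ideal.eqmod_sym[OF C.pw_ideal 2]])
  qed
qed

section \<open>Lifting along nilpotent ideals\<close>

lemma ring_hom_cringI2: "cring B \<Longrightarrow> cring C \<Longrightarrow> h \<in> ring_hom B C \<Longrightarrow> ring_hom_cring B C h"
  by (intro ring_hom_cring.intro ring_hom_cring_axioms.intro)

text \<open>Every element has a code, so the sets of codes of two distinct cosets are distinct; the
  quotient ring can thus be transported to sets of codes.\<close>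

lemma image_ring_coset_code:
  fixes B :: "('d, 'm) ring_scheme" and dec :: "'e \<Rightarrow> 'd"
  assumes "cring B" "ideal L B" "carrier B \<subseteq> range dec"
  defines "F \<equiv> \<lambda>b. {l. dec l \<in> L +>\<^bsub>B\<^esub> b}"
  shows "F \<in> ring_hom B (image_ring F B)" "cring (image_ring F B)"
    "\<And>a b. a \<in> carrier B \<Longrightarrow> b \<in> carrier B \<Longrightarrow> F a = F b \<longleftrightarrow> a \<ominus>\<^bsub>B\<^esub> b \<in> L"
proof -
  interpret B: cring B by fact
  interpret L: ideal L B by fact
  let ?C = "image_ring F B"
  show F_eq: "F a = F b \<longleftrightarrow> a \<ominus>\<^bsub>B\<^esub> b \<in> L" if "a \<in> carrier B" "b \<in> carrier B" for a b
  proof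
    assume "F a = F b"
    obtain l where "dec l = a" using assms(3) \<open>a \<in> carrier B\<close> by blast
    then have "l \<in> F a" using L.a_rcos_self[OF \<open>a \<in> carrier B\<close>] by (simp add: F_def)
    then have "l \<in> F b" using \<open>F a = F b\<close> by simp
    then have "a \<in> L +>\<^bsub>B\<^esub> b" using \<open>dec l = a\<close> by (simp add: F_def)
    then have "L +>\<^bsub>B\<^esub> b = L +>\<^bsub>B\<^esub> a"
      using B.a_repr_independence[OF _ that(2) L.a_subgroup] by blast
    then show "a \<ominus>\<^bsub>B\<^esub> b \<in> L"
      using B.quotient_eq_iff_same_a_r_cos[OF L.ideal_axioms that] by simp
  next
    assume "a \<ominus>\<^bsub>B\<^esub> b \<in> L"
    then have "L +>\<^bsub>B\<^esub> a = L +>\<^bsub>B\<^esub> b"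
      using B.quotient_eq_iff_same_a_r_cos[OF L.ideal_axioms that] by simp
    then show "F a = F b" by (simp add: F_def)
  qed
  have weak: "weak_ring_morphism F L B"
    by (intro weak_ring_morphismI F_eq L.ideal_axioms)
  show hom: "F \<in> ring_hom B ?C"
    by (rule B.weak_ring_morphism_is_hom[OF weak])
  interpret C: ring ?C by (rule B.image_ring_is_ring[OF weak])
  show "cring ?C"
  proof (intro cring.intro C.ring_axioms comm_monoid.intro C.monoid_axioms comm_monoid_axioms.intro)
    fix y z assume "y \<in> carrier ?C" "z \<in> carrier ?C"
    then obtain a b where "a \<in> carrier B" "b \<in> carrier B" "y = F a" "z = F b"
      by (auto simp: image_ring_carrier)
    then show "y \<otimes>\<^bsub>?C\<^esub> z = z \<otimes>\<^bsub>?C\<^esub> y"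
      using ring_hom_mult[OF hom] B.m_comm by metis
  qed
qed

lemma surj_hom_ideal_pow:
  assumes "ring B" "ring C" "F \<in> ring_hom B C" "carrier C = F ` carrier B" "ideal N B"
    and "z \<in> ideal_pow C (F ` N) n"
  shows "z \<in> F ` ideal_pow B N n"
proof -
  interpret F: ring_hom_ring B C F using assms by (intro ring_hom_ringI2)
  show ?thesis using assms(6)
  proof (induction n arbitrary: z)
    case 0
    then show ?case using assms(4) by simp
  next
    case (Suc n)
    have "z \<in> ideal_pow C (F ` N) n \<cdot>\<^bsub>C\<^esub> (F ` N)" using Suc.prems by simp
    then show ?case
    proof induction
      case (prod i j)
      obtain i' j' where ij: "i' \<in> ideal_pow B N n" "i = F i'" "j' \<in> N" "j = F j'"
        using Suc.IH[OF prod(1)] prod(2) by blast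
      then have "F (i' \<otimes>\<^bsub>B\<^esub> j') = i \<otimes>\<^bsub>C\<^esub> j"
        using F.R.ideal_pow_carrier[OF assms(5) ij(1)] ideal.Icarr[OF assms(5) ij(3)] by simp
      moreover have "i' \<otimes>\<^bsub>B\<^esub> j' \<in> ideal_pow B N (Suc n)" using ij by (auto intro: ideal_prod.prod)
      ultimately show ?case by (metis image_eqI)
    next
      case (sum s1 s2)
      obtain t1 t2 where t: "t1 \<in> ideal_pow B N (Suc n)" "s1 = F t1" "t2 \<in> ideal_pow B N (Suc n)" "s2 = F t2"
        using sum.IH by blast
      then have "F (t1 \<oplus>\<^bsub>B\<^esub> t2) = s1 \<oplus>\<^bsub>C\<^esub> s2"
        using F.R.ideal_pow_carrier[OF assms(5) t(1)] F.R.ideal_pow_carrier[OF assms(5) t(3)] by simp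
      moreover have "t1 \<oplus>\<^bsub>B\<^esub> t2 \<in> ideal_pow B N (Suc n)" using t by (auto intro: ideal_prod.sum)
      ultimately show ?case by (metis image_eqI)
    qed
  qed
qed

lemma surj_hom_ideal:
  assumes "ring B" "ring C" "F \<in> ring_hom B C" "carrier C = F ` carrier B" "ideal N B"
  shows "ideal (F ` N) C"
proof -
  interpret F: ring_hom_ring B C F using assms by (intro ring_hom_ringI2)
  interpret N: ideal N B by fact
  show ?thesis
  proof (rule idealI[OF F.S.ring_axioms])
    show "subgroup (F ` N) (add_monoid C)"
    proof (rule F.S.add.subgroupI)
      show "F ` N \<subseteq> carrier C" using N.Icarr by auto
      show "F ` N \<noteq> {}" using N.zero_closed by blast
    next
      fix a assume "a \<in> F ` N"
      then obtain n where "n \<in> N" "a = F n" by blast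
      then show "\<ominus>\<^bsub>C\<^esub> a \<in> F ` N"
        using F.hom_a_inv[of n] N.Icarr N.a_inv_closed by (metis image_eqI)
    next
      fix a b assume "a \<in> F ` N" "b \<in> F ` N"
      then obtain n n' where "n \<in> N" "a = F n" "n' \<in> N" "b = F n'" by blast
      then show "a \<oplus>\<^bsub>C\<^esub> b \<in> F ` N"
        using F.hom_add[of n n'] N.Icarr N.a_closed by (metis image_eqI)
    qed
  next
    fix a y assume "a \<in> F ` N" "y \<in> carrier C"
    then obtain n b where nb: "n \<in> N" "a = F n" "b \<in> carrier B" "y = F b" using assms(4) by blast
    then show "y \<otimes>\<^bsub>C\<^esub> a \<in> F ` N"
      using F.hom_mult[of b n] N.Icarr N.I_l_closed by (metis image_eqI)
    show "a \<otimes>\<^bsub>C\<^esub> y \<in> F ` N"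
      using nb F.hom_mult[of n b] N.Icarr N.I_r_closed by (metis image_eqI)
  qed
qed

lemma surj_hom_pw:
  assumes "adic_pair B P Q" "adic_pair C (F P) (F Q)" "F \<in> ring_hom B C" "carrier C = F ` carrier B"
    and "z \<in> adic_pair.pw C (F P) (F Q) n"
  shows "z \<in> F ` adic_pair.pw B P Q n"
proof -
  interpret B: adic_pair B P Q by fact
  interpret C: adic_pair C "F P" "F Q" by fact
  interpret F: ring_hom_ring B C F using assms(3) B.ring_axioms C.ring_axioms by (intro ring_hom_ringI2)
  show ?thesis using assms(5)
  proof (induction n arbitrary: z)
    case 0
    then show ?case using assms(4) by simp
  next
    case (Suc n)
    then obtain a b where ab: "a \<in> C.pw n" "b \<in> C.pw n" "z = F P \<otimes>\<^bsub>C\<^esub> a \<oplus>\<^bsub>C\<^esub> F Q \<otimes>\<^bsub>C\<^esub> b"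
      unfolding C.pw_Suc by blast
    obtain a' b' where ab': "a' \<in> B.pw n" "a = F a'" "b' \<in> B.pw n" "b = F b'"
      using Suc.IH ab by blast
    have "z = F (P \<otimes>\<^bsub>B\<^esub> a' \<oplus>\<^bsub>B\<^esub> Q \<otimes>\<^bsub>B\<^esub> b')"
      using ab(3) ab' B.pw_carrier[OF ab'(1)] B.pw_carrier[OF ab'(3)] by simp
    moreover have "P \<otimes>\<^bsub>B\<^esub> a' \<oplus>\<^bsub>B\<^esub> Q \<otimes>\<^bsub>B\<^esub> b' \<in> B.pw (Suc n)"
      unfolding B.pw_Suc using ab' by blast
    ultimately show ?case by blast
  qed
qed

section \<open>Lifting problems for an algebra with an etale coordinate\<close>

locale etale_algebra =
  R: cring R + A: cring A
  for R :: "('r, 'k) ring_scheme" and A :: "('a, 'm) ring_scheme" +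
  fixes \<eta> :: "'r \<Rightarrow> 'a" and x :: 'a and P Q :: 'r
  assumes eta_hom: "\<eta> \<in> ring_hom R A" and x_closed [simp]: "x \<in> carrier A"
    and PQ_closed: "P \<in> carrier R" "Q \<in> carrier R"
    and etale: "formally_etale (UP R) (Idl\<^bsub>UP R\<^esub> {up_ring.monom (UP R) P 0, up_ring.monom (UP R) Q 0}) A
      (UnivPoly.eval R A \<eta> x)"
begin

lemma eta_closed [simp]: "r \<in> carrier R \<Longrightarrow> \<eta> r \<in> carrier A"
  using eta_hom by (rule ring_hom_closed)

text \<open>The quotient of \<open>B\<close> by \<open>L\<close> is realised on sets of lists, a coset being replaced by the set of
  codes of its elements, so that it lies in the range of rings of \<^const>\<open>formally_etale\<close>.\<close>

lemma lift_problem: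
  fixes B :: "('d, 'n) ring_scheme" and dec :: "'a list \<Rightarrow> 'd"
  assumes "cring B" "carrier B \<subseteq> range dec" "ideal L B" "ideal N B" "L \<subseteq> N" "ideal_pow B N k \<subseteq> L"
    and w: "hom_mod A B L w" and s: "s \<in> carrier B" "s \<ominus>\<^bsub>B\<^esub> w x \<in> N"
    and pw: "ideal_pow B (Idl\<^bsub>B\<^esub> {w (\<eta> P), w (\<eta> Q)}) m \<subseteq> L"
  shows "\<exists>u. hom_mod A B L u \<and> (\<forall>r\<in>carrier R. eqmod B L (u (\<eta> r)) (w (\<eta> r))) \<and> eqmod B L (u x) s \<and>
      (\<forall>a\<in>carrier A. eqmod B N (u a) (w a))" (is ?ex)
    and "\<And>u u' a. hom_mod A B L u \<Longrightarrow> (\<forall>r\<in>carrier R. eqmod B L (u (\<eta> r)) (w (\<eta> r))) \<Longrightarrow> eqmod B L (u x) s \<Longrightarrow>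
      (\<forall>a\<in>carrier A. eqmod B N (u a) (w a)) \<Longrightarrow>
      hom_mod A B L u' \<Longrightarrow> (\<forall>r\<in>carrier R. eqmod B L (u' (\<eta> r)) (w (\<eta> r))) \<Longrightarrow> eqmod B L (u' x) s \<Longrightarrow>
      (\<forall>a\<in>carrier A. eqmod B N (u' a) (w a)) \<Longrightarrow> a \<in> carrier A \<Longrightarrow> eqmod B L (u a) (u' a)"
proof -
  interpret B: cring B by fact
  interpret L: ideal L B by fact
  interpret N: ideal N B by fact
  \<comment> \<open>The rings quantified over for R[X] live on sets of lists of pairs. Only the
    second components, which are elements of A, carry information here.\<close>
  define dec' :: "((nat \<Rightarrow> 'r) \<times> 'a) list \<Rightarrow> 'd" where "dec' l = dec (map snd l)" for l
  have dec': "carrier B \<subseteq> range dec'"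
  proof
    fix b assume "b \<in> carrier B"
    then obtain l where "b = dec l" using assms(2) by blast
    then have "b = dec' (map (Pair undefined) l)" by (simp add: dec'_def comp_def)
    then show "b \<in> range dec'" by blast
  qed
  define F where "F b = {l. dec' l \<in> L +>\<^bsub>B\<^esub> b}" for b
  have F_def': "F = (\<lambda>b. {l. dec' l \<in> L +>\<^bsub>B\<^esub> b})" by (simp add: F_def fun_eq_iff)
  define C where "C = image_ring F B"
  have F_hom: "F \<in> ring_hom B C" and C_cring: "cring C"
    and F_eq: "\<And>a b. a \<in> carrier B \<Longrightarrow> b \<in> carrier B \<Longrightarrow> F a = F b \<longleftrightarrow> a \<ominus>\<^bsub>B\<^esub> b \<in> L"
    using image_ring_coset_code[OF assms(1,3) dec'] unfolding C_def F_def' by blast+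
  have C_carrier: "carrier C = F ` carrier B" by (simp add: C_def image_ring_carrier)
  interpret C: cring C by fact
  interpret F: ring_hom_ring B C F using F_hom B.ring_axioms C.ring_axioms by (intro ring_hom_ringI2)
  have F_eqmod: "F a = F b \<longleftrightarrow> eqmod B L a b" if "a \<in> carrier B" "b \<in> carrier B" for a b
    using F_eq that by (simp add: eqmod_def)
  have F_zero: "F a = \<zero>\<^bsub>C\<^esub> \<longleftrightarrow> a \<in> L" if "a \<in> carrier B" for a
    using F_eq[OF that B.zero_closed] that by (simp add: a_minus_def)
  define N' where "N' = F ` N"
  have N': "ideal N' C"
    unfolding N'_def by (rule surj_hom_ideal[OF B.ring_axioms C.ring_axioms F_hom C_carrier assms(4)])
  interpret N': ideal N' C by (rule N')
  have F_N: "F a \<ominus>\<^bsub>C\<^esub> F b \<in> N' \<longleftrightarrow> eqmod B N a b" if ab: "a \<in> carrier B" "b \<in> carrier B" for a b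
  proof -
    have d: "F a \<ominus>\<^bsub>C\<^esub> F b = F (a \<ominus>\<^bsub>B\<^esub> b)" using ab by (simp add: a_minus_def)
    have "F (a \<ominus>\<^bsub>B\<^esub> b) \<in> N' \<Longrightarrow> a \<ominus>\<^bsub>B\<^esub> b \<in> N"
    proof -
      assume "F (a \<ominus>\<^bsub>B\<^esub> b) \<in> N'"
      then obtain n where n: "n \<in> N" "F (a \<ominus>\<^bsub>B\<^esub> b) = F n" by (auto simp: N'_def)
      then have "eqmod B L (a \<ominus>\<^bsub>B\<^esub> b) n" using F_eqmod N.Icarr ab by simp
      then have "eqmod B N (a \<ominus>\<^bsub>B\<^esub> b) n" by (rule eqmod_mono[OF _ assms(5)])
      then show ?thesis using n(1) by (rule N.eqmod_closed)
    qed
    then show ?thesis unfolding d eqmod_def using ab by (auto simp: N'_def)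
  qed
  have nilp: "ideal_pow C N' k = {\<zero>\<^bsub>C\<^esub>}"
  proof -
    have "z = \<zero>\<^bsub>C\<^esub>" if "z \<in> ideal_pow C N' k" for z
      using surj_hom_ideal_pow[OF B.ring_axioms C.ring_axioms F_hom C_carrier assms(4)] that assms(6) F_zero
      unfolding N'_def by (metis L.Icarr imageE subsetD)
    moreover have "\<zero>\<^bsub>C\<^esub> \<in> ideal_pow C N' k"
      using additive_subgroup.zero_closed[OF ideal.axioms(1)[OF C.ideal_pow_ideal[OF N']]] .
    ultimately show ?thesis by blast
  qed
  have Fw: "(\<lambda>a. F (u a)) \<in> ring_hom A C" if u: "hom_mod A B L u" for u
  proof (rule ring_hom_memI)
    fix a b assume ab: "a \<in> carrier A" "b \<in> carrier A"
    note uc = hom_modD(1)[OF u]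
    show "F (u a) \<in> carrier C" using uc ab by simp
    have "F (u (a \<otimes>\<^bsub>A\<^esub> b)) = F (u a \<otimes>\<^bsub>B\<^esub> u b)" "F (u (a \<oplus>\<^bsub>A\<^esub> b)) = F (u a \<oplus>\<^bsub>B\<^esub> u b)"
      using F_eqmod hom_modD(2,3)[OF u] ab eqmod_carrier by metis+
    then show "F (u (a \<otimes>\<^bsub>A\<^esub> b)) = F (u a) \<otimes>\<^bsub>C\<^esub> F (u b)" "F (u (a \<oplus>\<^bsub>A\<^esub> b)) = F (u a) \<oplus>\<^bsub>C\<^esub> F (u b)"
      using uc ab by simp_all
  next
    have "F (u \<one>\<^bsub>A\<^esub>) = F \<one>\<^bsub>B\<^esub>"
      using F_eqmod hom_modD(4)[OF u] eqmod_carrier by metis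
    then show "F (u \<one>\<^bsub>A\<^esub>) = \<one>\<^bsub>C\<^esub>" by simp
  qed
  \<comment> \<open>Through w the quotient becomes an R-algebra; sending X to the class of s makes
    it an algebra over R[X], and w modulo N is the map to be lifted.\<close>
  define \<kappa> where "\<kappa> = (\<lambda>a. F (w a)) \<circ> \<eta>"
  have \<kappa>_hom: "\<kappa> \<in> ring_hom R C"
    unfolding \<kappa>_def by (rule ring_hom_trans[OF eta_hom Fw[OF w]])
  interpret \<kappa>: ring_hom_cring R C \<kappa>
    by (intro ring_hom_cringI2 R.cring_axioms C.cring_axioms \<kappa>_hom)
  interpret UC: UP_pre_univ_prop R C \<kappa> "UP R"
    by (unfold_locales) simp
  interpret eta: ring_hom_cring R A \<eta>
    by (intro ring_hom_cringI2 R.cring_axioms A.cring_axioms eta_hom)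
  interpret UA: UP_pre_univ_prop R A \<eta> "UP R"
    by (unfold_locales) simp
  define g where "g = UnivPoly.eval R C \<kappa> (F s)"
  define ev where "ev = UnivPoly.eval R A \<eta> x"
  have Fs: "F s \<in> carrier C" using s by simp
  have g_hom: "g \<in> ring_hom (UP R) C" unfolding g_def by (rule UC.eval_ring_hom[OF Fs])
  have ev_hom: "ev \<in> ring_hom (UP R) A" unfolding ev_def by (rule UA.eval_ring_hom[OF x_closed])
  have g_const: "g (up_ring.monom (UP R) r 0) = \<kappa> r" if "r \<in> carrier R" for r
    unfolding g_def by (rule UC.eval_const[OF Fs that])
  have ev_const: "ev (up_ring.monom (UP R) r 0) = \<eta> r" if "r \<in> carrier R" for r
    unfolding ev_def by (rule UA.eval_const[OF x_closed that])
  have g_X: "g (up_ring.monom (UP R) \<one>\<^bsub>R\<^esub> 1) = F s"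
    unfolding g_def by (rule UC.eval_monom1[OF Fs])
  have ev_X: "ev (up_ring.monom (UP R) \<one>\<^bsub>R\<^esub> 1) = x"
    unfolding ev_def by (rule UA.eval_monom1[OF x_closed])
  let ?J = "Idl\<^bsub>UP R\<^esub> {up_ring.monom (UP R) P 0, up_ring.monom (UP R) Q 0}"
  \<comment> \<open>The m-th power of the ideal of R[X] lands in the m-th power of the ideal of
    w(\<eta> P) and w(\<eta> Q), which lies in L. So the target is discrete, as etaleness
    requires.\<close>
  have g_kill: "g b = \<zero>\<^bsub>C\<^esub>" if "b \<in> ideal_pow (UP R) ?J m" for b
  proof -
    interpret UJ: adic_pair "UP R" "up_ring.monom (UP R) P 0" "up_ring.monom (UP R) Q 0"
      using PQ_closed by unfold_locales auto
    have wc: "w (\<eta> P) \<in> carrier B" "w (\<eta> Q) \<in> carrier B"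
      using hom_modD(1)[OF w] PQ_closed by auto
    interpret BJ: adic_pair B "w (\<eta> P)" "w (\<eta> Q)"
      using wc by unfold_locales
    interpret CJ: adic_pair C "F (w (\<eta> P))" "F (w (\<eta> Q))"
      using wc by unfold_locales auto
    have "g b \<in> CJ.pw m"
    proof (rule pw_hom[OF UJ.adic_pair_axioms CJ.adic_pair_axioms g_hom])
      show "b \<in> UJ.pw m" using that by (simp add: UJ.pw_def)
    qed (use g_const PQ_closed in \<open>simp_all add: \<kappa>_def\<close>)
    then have "g b \<in> F ` BJ.pw m"
      by (rule surj_hom_pw[OF BJ.adic_pair_axioms CJ.adic_pair_axioms F_hom C_carrier])
    then obtain z where z: "z \<in> BJ.pw m" "g b = F z" by blast
    then have "z \<in> L" using pw unfolding BJ.pw_def by blast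
    then show ?thesis using F_zero[OF BJ.pw_carrier[OF z(1)]] z(2) by simp
  qed
  define v where "v = (\<lambda>a. N' +>\<^bsub>C\<^esub> F (w a))"
  have v_hom: "v \<in> ring_hom A (C Quot N')"
    using ring_hom_trans[OF Fw[OF w] N'.rcos_ring_hom] by (simp add: v_def comp_def)
  have coset_N': "N' +>\<^bsub>C\<^esub> y = N' +>\<^bsub>C\<^esub> z \<longleftrightarrow> y \<ominus>\<^bsub>C\<^esub> z \<in> N'" if "y \<in> carrier C" "z \<in> carrier C" for y z
    using C.quotient_eq_iff_same_a_r_cos[OF N' that] by simp
  \<comment> \<open>Both sides are homomorphisms on R[X]; they agree on constants by the choice of
    \<kappa>, and on X because s is congruent to w(x) modulo N.\<close>
  have v_ev: "v (ev b) = N' +>\<^bsub>C\<^esub> g b" if b: "b \<in> carrier (UP R)" for b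
  proof -
    interpret Q': cring "C Quot N'" by (rule N'.quotient_is_cring[OF C.cring_axioms])
    have hom: "(\<lambda>b. N' +>\<^bsub>C\<^esub> g b) \<in> ring_hom (UP R) (C Quot N')" "(\<lambda>b. v (ev b)) \<in> ring_hom (UP R) (C Quot N')"
      "(\<lambda>r. N' +>\<^bsub>C\<^esub> \<kappa> r) \<in> ring_hom R (C Quot N')"
      using ring_hom_trans[OF g_hom N'.rcos_ring_hom] ring_hom_trans[OF ev_hom v_hom]
        ring_hom_trans[OF \<kappa>_hom N'.rcos_ring_hom] by (simp_all add: comp_def)
    interpret h: ring_hom_cring R "C Quot N'" "\<lambda>r. N' +>\<^bsub>C\<^esub> \<kappa> r"
      by (intro ring_hom_cringI2 R.cring_axioms Q'.cring_axioms hom)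
    interpret UQ: UP_pre_univ_prop R "C Quot N'" "\<lambda>r. N' +>\<^bsub>C\<^esub> \<kappa> r" "UP R"
      by (unfold_locales) simp
    show ?thesis
    proof (rule UQ.UP_hom_unique[where Phi = "\<lambda>b. v (ev b)" and Psi = "\<lambda>b. N' +>\<^bsub>C\<^esub> g b" and s = "N' +>\<^bsub>C\<^esub> F s", OF _ _ _ _ _ _ b])
      show "ring_hom_cring (UP R) (C Quot N') (\<lambda>b. v (ev b))" "ring_hom_cring (UP R) (C Quot N') (\<lambda>b. N' +>\<^bsub>C\<^esub> g b)"
        by (intro ring_hom_cringI2 UC.UP_cring Q'.cring_axioms hom)+
      show "v (ev (up_ring.monom (UP R) \<one>\<^bsub>R\<^esub> (Suc 0))) = N' +>\<^bsub>C\<^esub> F s"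
      proof -
        have "eqmod B N s (w x)" using s hom_modD(1)[OF w x_closed] by (simp add: eqmod_def)
        then have "F (w x) \<ominus>\<^bsub>C\<^esub> F s \<in> N'"
          using F_N[of "w x" s] s hom_modD(1)[OF w x_closed] N.eqmod_sym by simp
        then show ?thesis using ev_X coset_N' s hom_modD(1)[OF w x_closed] by (simp add: v_def)
      qed
      show "N' +>\<^bsub>C\<^esub> g (up_ring.monom (UP R) \<one>\<^bsub>R\<^esub> (Suc 0)) = N' +>\<^bsub>C\<^esub> F s" using g_X by simp
      show "N' +>\<^bsub>C\<^esub> F s \<in> carrier (C Quot N')"
        using ring_hom_closed[OF N'.rcos_ring_hom Fs] .
      show "v (ev (up_ring.monom (UP R) r 0)) = N' +>\<^bsub>C\<^esub> \<kappa> r" if "r \<in> carrier R" for r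
        using ev_const[OF that] by (simp add: v_def \<kappa>_def)
      show "N' +>\<^bsub>C\<^esub> g (up_ring.monom (UP R) r 0) = N' +>\<^bsub>C\<^esub> \<kappa> r" if "r \<in> carrier R" for r
        using g_const[OF that] by simp
    qed
  qed
  have ex1: "\<exists>!u. u \<in> ring_hom A C \<and> u \<in> extensional (carrier A) \<and>
      (\<forall>b\<in>carrier (UP R). u (ev b) = g b) \<and> (\<forall>a\<in>carrier A. N' +>\<^bsub>C\<^esub> u a = v a)"
    by (rule etale[unfolded formally_etale_def, rule_format, of C N' g v, folded ev_def])
      (use C_cring N' nilp g_hom g_kill v_hom v_ev in blast)
  show ?ex
  proof -
    obtain u where u: "u \<in> ring_hom A C" "\<And>b. b \<in> carrier (UP R) \<Longrightarrow> u (ev b) = g b"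
      "\<And>a. a \<in> carrier A \<Longrightarrow> N' +>\<^bsub>C\<^esub> u a = v a"
      using ex1 by blast
    \<comment> \<open>Representatives of the lifted values obey the ring laws only modulo L, which
      is what \<open>hom_mod\<close> records.\<close>
    have "\<forall>a\<in>carrier A. \<exists>b\<in>carrier B. F b = u a"
      using ring_hom_closed[OF u(1)] unfolding C_carrier by (metis imageE)
    then obtain u' where u': "\<And>a. a \<in> carrier A \<Longrightarrow> u' a \<in> carrier B" "\<And>a. a \<in> carrier A \<Longrightarrow> F (u' a) = u a"
      by metis
    have "hom_mod A B L u'"
    proof (rule hom_modI)
      fix a b assume ab: "a \<in> carrier A" "b \<in> carrier A"
      show "u' a \<in> carrier B" using u' ab by simp
      have "F (u' (a \<oplus>\<^bsub>A\<^esub> b)) = F (u' a \<oplus>\<^bsub>B\<^esub> u' b)"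
        using u' ab ring_hom_add[OF u(1) ab] by simp
      then show "eqmod B L (u' (a \<oplus>\<^bsub>A\<^esub> b)) (u' a \<oplus>\<^bsub>B\<^esub> u' b)"
        using F_eqmod[of "u' (a \<oplus>\<^bsub>A\<^esub> b)" "u' a \<oplus>\<^bsub>B\<^esub> u' b"] u'(1) ab by simp
      have "F (u' (a \<otimes>\<^bsub>A\<^esub> b)) = F (u' a \<otimes>\<^bsub>B\<^esub> u' b)"
        using u' ab ring_hom_mult[OF u(1) ab] by simp
      then show "eqmod B L (u' (a \<otimes>\<^bsub>A\<^esub> b)) (u' a \<otimes>\<^bsub>B\<^esub> u' b)"
        using F_eqmod[of "u' (a \<otimes>\<^bsub>A\<^esub> b)" "u' a \<otimes>\<^bsub>B\<^esub> u' b"] u'(1) ab by simp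
    next
      have "F (u' \<one>\<^bsub>A\<^esub>) = F \<one>\<^bsub>B\<^esub>" using u' ring_hom_one[OF u(1)] by simp
      then show "eqmod B L (u' \<one>\<^bsub>A\<^esub>) \<one>\<^bsub>B\<^esub>" using F_eqmod[of "u' \<one>\<^bsub>A\<^esub>" "\<one>\<^bsub>B\<^esub>"] u'(1) by simp
    qed
    moreover have "eqmod B L (u' (\<eta> r)) (w (\<eta> r))" if r: "r \<in> carrier R" for r
    proof -
      have "F (u' (\<eta> r)) = F (w (\<eta> r))"
        using u(2)[of "up_ring.monom (UP R) r 0"] r u'(2) g_const ev_const by (simp add: \<kappa>_def)
      then show ?thesis using F_eqmod u'(1) hom_modD(1)[OF w] r by simp
    qed
    moreover have "eqmod B L (u' x) s"
    proof -
      have "F (u' x) = F s"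
        using u(2)[of "up_ring.monom (UP R) \<one>\<^bsub>R\<^esub> 1"] u'(2) g_X ev_X by simp
      then show ?thesis using F_eqmod u'(1) s by simp
    qed
    moreover have "eqmod B N (u' a) (w a)" if a: "a \<in> carrier A" for a
    proof -
      have "F (u' a) \<ominus>\<^bsub>C\<^esub> F (w a) \<in> N'"
        using u(3)[OF a] u'(2)[OF a] ring_hom_closed[OF u(1) a] hom_modD(1)[OF w a] coset_N'[of "u a" "F (w a)"]
        by (simp add: v_def)
      then show ?thesis using F_N[OF u'(1)[OF a] hom_modD(1)[OF w a]] by blast
    qed
    ultimately show ?thesis by blast
  qed
  \<comment> \<open>Conversely, a solution by representatives induces a lift into the coded ring; it
    is restricted to A so that uniqueness of extensional lifts applies.\<close>
  have lift_of: "restrict (\<lambda>a. F (u a)) (carrier A) \<in> ring_hom A C \<and> restrict (\<lambda>a. F (u a)) (carrier A) \<in> extensional (carrier A) \<and>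
      (\<forall>b\<in>carrier (UP R). restrict (\<lambda>a. F (u a)) (carrier A) (ev b) = g b) \<and>
      (\<forall>a\<in>carrier A. N' +>\<^bsub>C\<^esub> restrict (\<lambda>a. F (u a)) (carrier A) a = v a)"
    if u: "hom_mod A B L u" "\<forall>r\<in>carrier R. eqmod B L (u (\<eta> r)) (w (\<eta> r))" "eqmod B L (u x) s"
      "\<forall>a\<in>carrier A. eqmod B N (u a) (w a)" for u
  proof -
    have h: "restrict (\<lambda>a. F (u a)) (carrier A) \<in> ring_hom A C"
      using Fw[OF u(1)] by (auto simp: ring_hom_def)
    have hev: "(\<lambda>b. F (u (ev b))) \<in> ring_hom (UP R) C"
      using ring_hom_trans[OF ev_hom Fw[OF u(1)]] by (simp add: comp_def)
    have "F (u (ev b)) = g b" if b: "b \<in> carrier (UP R)" for b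
    proof (rule UC.UP_hom_unique[where Phi = "\<lambda>b. F (u (ev b))" and Psi = g and s = "F s", OF _ _ _ _ _ _ b Fs])
      show "ring_hom_cring (UP R) C (\<lambda>b. F (u (ev b)))" "ring_hom_cring (UP R) C g"
        by (intro ring_hom_cringI2 UC.UP_cring C.cring_axioms hev g_hom)+
      show "F (u (ev (up_ring.monom (UP R) \<one>\<^bsub>R\<^esub> (Suc 0)))) = F s"
        using ev_X u(3) F_eqmod eqmod_carrier by (metis One_nat_def)
      show "F (u (ev (up_ring.monom (UP R) r 0))) = \<kappa> r" if "r \<in> carrier R" for r
        using ev_const that u(2) F_eqmod eqmod_carrier unfolding \<kappa>_def comp_def by metis
    qed (use g_X g_const in auto)
    moreover have "ev b \<in> carrier A" if "b \<in> carrier (UP R)" for b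
      using ring_hom_closed[OF ev_hom that] .
    moreover have "N' +>\<^bsub>C\<^esub> F (u a) = v a" if a: "a \<in> carrier A" for a
      using u(4) a coset_N'[of "F (u a)" "F (w a)"] F_N[of "u a" "w a"] hom_modD(1)[OF u(1) a] hom_modD(1)[OF w a]
      by (simp add: v_def)
    ultimately show ?thesis using h by simp
  qed
  fix u u' a
  assume u: "hom_mod A B L u" "\<forall>r\<in>carrier R. eqmod B L (u (\<eta> r)) (w (\<eta> r))" "eqmod B L (u x) s"
      "\<forall>a\<in>carrier A. eqmod B N (u a) (w a)"
    and u': "hom_mod A B L u'" "\<forall>r\<in>carrier R. eqmod B L (u' (\<eta> r)) (w (\<eta> r))" "eqmod B L (u' x) s"
      "\<forall>a\<in>carrier A. eqmod B N (u' a) (w a)" and a: "a \<in> carrier A"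
  have "restrict (\<lambda>a. F (u a)) (carrier A) = restrict (\<lambda>a. F (u' a)) (carrier A)"
    using ex1 lift_of[OF u] lift_of[OF u'] by blast
  then have "F (u a) = F (u' a)" using a by (metis restrict_apply)
  then show "eqmod B L (u a) (u' a)"
    using F_eqmod hom_modD(1)[OF u(1) a] hom_modD(1)[OF u'(1) a] by simp
qed

text \<open>Both maps solve the lifting problem with base map u and prescribed value u(x) at
  x.\<close>

lemma lift_unique:
  fixes B :: "('d, 'n) ring_scheme" and dec :: "'a list \<Rightarrow> 'd"
  assumes "cring B" "carrier B \<subseteq> range dec" "ideal L B" "ideal N B" "L \<subseteq> N" "ideal_pow B N k \<subseteq> L"
    and "hom_mod A B L u" "hom_mod A B L u'"
    and "ideal_pow B (Idl\<^bsub>B\<^esub> {u (\<eta> P), u (\<eta> Q)}) m \<subseteq> L"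
    and "\<And>r. r \<in> carrier R \<Longrightarrow> eqmod B L (u' (\<eta> r)) (u (\<eta> r))" "eqmod B L (u' x) (u x)"
    and "\<And>a. a \<in> carrier A \<Longrightarrow> eqmod B N (u' a) (u a)" and "a \<in> carrier A"
  shows "eqmod B L (u' a) (u a)"
proof -
  interpret L: ideal L B by fact
  interpret N: ideal N B by fact
  have c: "u a \<in> carrier B" if "a \<in> carrier A" for a using hom_modD(1)[OF assms(7) that] .
  have x: "u x \<ominus>\<^bsub>B\<^esub> u x \<in> N" using N.eqmod_refl[OF c[OF x_closed]] by (simp add: eqmod_def)
  show ?thesis
  proof (rule lift_problem(2)[OF assms(1-7) c[OF x_closed] x assms(9)])
    show "hom_mod A B L u'" "hom_mod A B L u" "eqmod B L (u' x) (u x)" "a \<in> carrier A" by fact+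
    show "\<forall>r\<in>carrier R. eqmod B L (u' (\<eta> r)) (u (\<eta> r))" "\<forall>a\<in>carrier A. eqmod B N (u' a) (u a)"
      using assms(10,12) by blast+
    show "\<forall>r\<in>carrier R. eqmod B L (u (\<eta> r)) (u (\<eta> r))" "\<forall>a\<in>carrier A. eqmod B N (u a) (u a)" "eqmod B L (u x) (u x)"
      using c eta_closed by (auto intro: L.eqmod_refl N.eqmod_refl)
  qed
qed

end

section \<open>The ring of twisted divided polynomials\<close>

locale coef_alg = cring A for A (structure) +
  fixes c :: "int poly \<Rightarrow> 'a" and x :: 'a
  assumes x_closed [simp, intro]: "x \<in> carrier A"
    and c_closed [simp, intro]: "c f \<in> carrier A"
    and c_add: "c (f + g) = c f \<oplus> c g"
    and c_mult: "c (f * g) = c f \<otimes> c g"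
    and c_one [simp]: "c 1 = \<one>"
begin

lemma c_zero [simp]: "c 0 = \<zero>"
  using c_add[of 0 0] by simp

lemma c_uminus: "c (- f) = \<ominus> c f"
proof -
  have "c (- f) \<oplus> c f = \<zero>" using c_add[of "- f" f] by simp
  then show ?thesis by (simp add: minus_equality)
qed

lemma c_diff: "c (f - g) = c f \<ominus> c g"
  using c_add[of f "- g"] by (simp add: c_uminus a_minus_def)

text \<open>The evaluation \<int>[q][x] -> A at the given coordinate, by Horner's scheme.\<close>

definition evx :: "int poly poly \<Rightarrow> 'a" where
  "evx f = fold_coeffs (\<lambda>a r. c a \<oplus> x \<otimes> r) f \<zero>"

lemma evx_0 [simp]: "evx 0 = \<zero>"
  by (simp add: evx_def)

lemma evx_pCons: "evx (pCons a f) = c a \<oplus> x \<otimes> evx f"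
  by (cases "a = 0 \<and> f = 0") (auto simp: evx_def)

lemma evx_closed [simp, intro]: "evx f \<in> carrier A"
  by (induction f) (simp_all add: evx_pCons)

lemma evx_add: "evx (f + g) = evx f \<oplus> evx g"
proof (induction f g rule: poly_induct2)
  case (pCons a f b g)
  then show ?case by (simp add: evx_pCons c_add r_distr a_ac)
qed simp

lemma evx_smult: "evx (Polynomial.smult a f) = c a \<otimes> evx f"
  by (induction f) (simp_all add: evx_pCons c_mult r_distr m_lcomm)

lemma evx_mult: "evx (f * g) = evx f \<otimes> evx g"
  by (induction f) (simp_all add: evx_add evx_smult evx_pCons l_distr m_assoc)

lemma evx_const [simp]: "evx [:a:] = c a"
  by (simp add: evx_pCons)

lemma evx_1 [simp]: "evx 1 = \<one>"
  using evx_const[of 1] by (simp add: pCons_one)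

lemma evx_x [simp]: "evx [:0, 1:] = x"
  by (simp add: evx_pCons)

lemma evx_power: "evx (f ^ n) = evx f [^] n"
  by (induction n) (simp_all add: evx_mult m_comm)

lemma evx_sum: "finite S \<Longrightarrow> evx (sum f S) = finsum A (\<lambda>i. evx (f i)) S"
  by (induction S rule: finite_induct) (simp_all add: evx_add)

abbreviation U where "U \<equiv> UP A"
abbreviation D where "D \<equiv> dp_ring c A x"
abbreviation mon where "mon \<equiv> up_ring.monom (UP A)"

end

sublocale coef_alg \<subseteq> U: UP_cring A "UP A"
  by unfold_locales simp

context coef_alg
begin

lemma U_carrier: "u \<in> carrier U \<longleftrightarrow> (\<forall>n. u n \<in> carrier A) \<and> (\<exists>N. \<forall>n>N. u n = \<zero>)"
  by (auto simp: UP_def up_def bound_def Pi_def)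

lemma U_coeff: "u \<in> carrier U \<Longrightarrow> u n \<in> carrier A"
  by (simp add: U_carrier)

lemma U_add: "u \<in> carrier U \<Longrightarrow> v \<in> carrier U \<Longrightarrow> u \<oplus>\<^bsub>U\<^esub> v = (\<lambda>n. u n \<oplus> v n)"
  by (simp add: UP_def)

lemma U_zero: "\<zero>\<^bsub>U\<^esub> = (\<lambda>n. \<zero>)" and U_one: "\<one>\<^bsub>U\<^esub> = mon \<one> 0"
  by (simp_all add: UP_def fun_eq_iff)

lemma U_mon: "a \<in> carrier A \<Longrightarrow> mon a n = (\<lambda>i. if i = n then a else \<zero>)"
  by (simp add: UP_def)

lemma U_coeff_eq: "u \<in> carrier U \<Longrightarrow> up_ring.coeff U u n = u n"
  by (simp add: UP_def)

lemma D_simps [simp]: "carrier D = carrier U" "add D = add U" "zero D = zero U" "one D = one U"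
  "up_ring.monom D = mon" "up_ring.coeff D = up_ring.coeff U"
  by (simp_all add: dp_ring_def)

lemma U_induct [consumes 1, case_names monom add]:
  assumes "u \<in> carrier U" "\<And>a n. a \<in> carrier A \<Longrightarrow> Pr (mon a n)"
    and "\<And>u v. u \<in> carrier U \<Longrightarrow> v \<in> carrier U \<Longrightarrow> Pr u \<Longrightarrow> Pr v \<Longrightarrow> Pr (u \<oplus>\<^bsub>U\<^esub> v)"
  shows "Pr u"
proof -
  have "Pr (\<Oplus>\<^bsub>U\<^esub>i\<in>{..n}. mon (u i) i)" for n
  proof (induction n)
    case 0
    then show ?case using assms(1,2) U_coeff by simp
  next
    case (Suc n)
    then show ?case using assms(2,3) U_coeff[OF assms(1)] by (simp add: atMost_Suc)
  qed
  moreover have "(\<Oplus>\<^bsub>U\<^esub>i\<in>{..deg A u}. mon (u i) i) = u"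
    using U.up_repr[OF assms(1)] by (simp add: U_coeff_eq[OF assms(1)])
  ultimately show ?thesis by metis
qed

section \<open>Scalars and the product of twisted divided polynomials\<close>

definition scal :: "'a \<Rightarrow> (nat \<Rightarrow> 'a) \<Rightarrow> nat \<Rightarrow> 'a" where
  "scal a u = (\<lambda>n. a \<otimes> u n)"

lemma scal_closed [simp, intro]: "a \<in> carrier A \<Longrightarrow> u \<in> carrier U \<Longrightarrow> scal a u \<in> carrier U"
proof -
  assume a: "a \<in> carrier A" and u: "u \<in> carrier U"
  then obtain N where "\<forall>n>N. u n = \<zero>" by (auto simp: U_carrier)
  then have "\<forall>n>N. scal a u n = \<zero>" using a by (simp add: scal_def)
  then show ?thesis using a u by (auto simp: U_carrier scal_def)
qed

lemma scal_add: "a \<in> carrier A \<Longrightarrow> u \<in> carrier U \<Longrightarrow> v \<in> carrier U \<Longrightarrow> scal a (u \<oplus>\<^bsub>U\<^esub> v) = scal a u \<oplus>\<^bsub>U\<^esub> scal a v"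
  by (simp only: U_add[OF scal_closed scal_closed] U_add) (simp add: scal_def r_distr U_coeff)

lemma scal_mon: "a \<in> carrier A \<Longrightarrow> b \<in> carrier A \<Longrightarrow> scal a (mon b n) = mon (a \<otimes> b) n"
  by (auto simp: scal_def U_mon)

lemma scal_scal: "a \<in> carrier A \<Longrightarrow> b \<in> carrier A \<Longrightarrow> u \<in> carrier U \<Longrightarrow> scal a (scal b u) = scal (a \<otimes> b) u"
  by (simp add: scal_def m_assoc U_coeff)

lemma scal_one [simp]: "u \<in> carrier U \<Longrightarrow> scal \<one> u = u"
  by (simp add: scal_def U_coeff)

lemma U_const_mult: "a \<in> carrier A \<Longrightarrow> u \<in> carrier U \<Longrightarrow> mon a 0 \<otimes>\<^bsub>U\<^esub> u = scal a u"
proof -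
  assume a: "a \<in> carrier A" and u: "u \<in> carrier U"
  have "mon a 0 \<otimes>\<^bsub>U\<^esub> u = a \<odot>\<^bsub>U\<^esub> u" using U.monom_mult_is_smult[OF a u] .
  then show ?thesis using a u by (simp add: UP_def scal_def)
qed

text \<open>The index triples of degree k. The conditions i \<le> n and i \<le> m bound all entries
  by k, so the sum in the product is finite.\<close>

definition Tset :: "nat \<Rightarrow> (nat \<times> nat \<times> nat) set" where
  "Tset k = {(n, m, i). i \<le> n \<and> i \<le> m \<and> n + m - i = k}"

lemma finite_Tset [simp]: "finite (Tset k)"
proof (rule finite_subset)
  show "Tset k \<subseteq> {..k} \<times> {..k} \<times> {..k}" by (auto simp: Tset_def)
qed auto

definition dpc :: "nat \<Rightarrow> nat \<Rightarrow> nat \<Rightarrow> 'a" where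
  "dpc n m i = c (dp_coef n m i) \<otimes> x [^] i"

lemma dpc_closed [simp, intro]: "dpc n m i \<in> carrier A"
  by (simp add: dpc_def)

lemma D_mult: "u \<otimes>\<^bsub>D\<^esub> v = (\<lambda>k. finsum A (\<lambda>(n, m, i). dpc n m i \<otimes> (u n \<otimes> v m)) (Tset k))"
  by (simp add: dp_ring_def dpc_def Tset_def dp_coef_def)

lemma D_term_closed:
  "u \<in> carrier U \<Longrightarrow> v \<in> carrier U \<Longrightarrow> (\<lambda>(n, m, i). dpc n m i \<otimes> (u n \<otimes> v m)) \<in> S \<rightarrow> carrier A"
  by (auto simp: U_coeff)

lemma D_closed [simp, intro]:
  assumes u: "u \<in> carrier U" and v: "v \<in> carrier U"
  shows "u \<otimes>\<^bsub>D\<^esub> v \<in> carrier U"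
proof -
  obtain N where N: "\<And>n. n > N \<Longrightarrow> u n = \<zero>" using u by (auto simp: U_carrier)
  obtain M where M: "\<And>n. n > M \<Longrightarrow> v n = \<zero>" using v by (auto simp: U_carrier)
  have "(u \<otimes>\<^bsub>D\<^esub> v) k = \<zero>" if "k > N + M" for k
  proof -
    have "dpc n m i \<otimes> (u n \<otimes> v m) = \<zero>" if "(n, m, i) \<in> Tset k" for n m i
    proof -
      have "n > N \<or> m > M" using that \<open>k > N + M\<close> by (auto simp: Tset_def)
      then show ?thesis using N M U_coeff[OF u] U_coeff[OF v] by auto
    qed
    then have "(u \<otimes>\<^bsub>D\<^esub> v) k = (\<Oplus>t\<in>Tset k. \<zero>)"
      unfolding D_mult by (intro finsum_cong') auto
    then show ?thesis by simp
  qed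
  moreover have "(u \<otimes>\<^bsub>D\<^esub> v) k \<in> carrier A" for k
    unfolding D_mult by (rule finsum_closed) (rule D_term_closed[OF u v])
  ultimately show ?thesis unfolding U_carrier by blast
qed

lemma D_l_distr:
  assumes "u \<in> carrier U" "v \<in> carrier U" "w \<in> carrier U"
  shows "(u \<oplus>\<^bsub>U\<^esub> v) \<otimes>\<^bsub>D\<^esub> w = u \<otimes>\<^bsub>D\<^esub> w \<oplus>\<^bsub>U\<^esub> v \<otimes>\<^bsub>D\<^esub> w"
proof
  fix k
  have "((u \<oplus>\<^bsub>U\<^esub> v) \<otimes>\<^bsub>D\<^esub> w) k
    = (\<Oplus>t\<in>Tset k. (\<lambda>(n, m, i). dpc n m i \<otimes> (u n \<otimes> w m)) t \<oplus> (\<lambda>(n, m, i). dpc n m i \<otimes> (v n \<otimes> w m)) t)"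
    unfolding D_mult U_add[OF assms(1,2)]
    by (intro finsum_cong') (auto simp: U_coeff assms l_distr r_distr)
  also have "\<dots> = (u \<otimes>\<^bsub>D\<^esub> w) k \<oplus> (v \<otimes>\<^bsub>D\<^esub> w) k"
    unfolding D_mult by (intro finsum_addf D_term_closed assms)
  also have "\<dots> = (u \<otimes>\<^bsub>D\<^esub> w \<oplus>\<^bsub>U\<^esub> v \<otimes>\<^bsub>D\<^esub> w) k"
    using assms by (simp add: U_add)
  finally show "((u \<oplus>\<^bsub>U\<^esub> v) \<otimes>\<^bsub>D\<^esub> w) k = (u \<otimes>\<^bsub>D\<^esub> w \<oplus>\<^bsub>U\<^esub> v \<otimes>\<^bsub>D\<^esub> w) k" .
qed

text \<open>\<open>tw_coef\<close> is symmetric by its shape, and the q-factorials relating it to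
  \<open>dp_coef\<close> can be cancelled in \<int>[q].\<close>

lemma dp_coef_sym: "dp_coef n m i = dp_coef m n i"
proof (cases "i \<le> n \<and> i \<le> m")
  case True
  have "dp_coef n m i * (qfact n * qfact m) = tw_coef n m i * qfact (n + m - i)"
    using True by (intro dp_coef_tw_coef) auto
  also have "\<dots> = dp_coef m n i * (qfact m * qfact n)"
    using True dp_coef_tw_coef[of i m n] by (simp add: tw_coef_def add.commute mult_ac)
  finally show ?thesis by (simp add: mult.commute[of "qfact m"])
qed (auto simp: dp_coef_eq_0)

lemma D_m_comm:
  assumes "u \<in> carrier U" "v \<in> carrier U"
  shows "u \<otimes>\<^bsub>D\<^esub> v = v \<otimes>\<^bsub>D\<^esub> u"
proof
  fix k
  let ?sw = "\<lambda>(n, m, i). (m, n, i) :: nat \<times> nat \<times> nat"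
  have img: "Tset k = ?sw ` Tset k"
  proof -
    have "(n, m, i) \<in> ?sw ` Tset k" if "(n, m, i) \<in> Tset k" for n m i
      using that by (intro image_eqI[of _ _ "(m, n, i)"]) (auto simp: Tset_def add.commute)
    then show ?thesis by (auto simp: Tset_def add.commute)
  qed
  have inj: "inj_on ?sw (Tset k)" by (auto simp: inj_on_def)
  let ?f = "\<lambda>(n, m, i). dpc n m i \<otimes> (u n \<otimes> v m)"
  have "(u \<otimes>\<^bsub>D\<^esub> v) k = finsum A ?f (?sw ` Tset k)"
    unfolding D_mult by (subst img) simp
  also have "\<dots> = finsum A (\<lambda>t. ?f (?sw t)) (Tset k)"
    by (rule finsum_reindex[OF _ inj]) (rule D_term_closed[OF assms])
  also have "\<dots> = (v \<otimes>\<^bsub>D\<^esub> u) k"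
    unfolding D_mult
    by (intro finsum_cong') (auto simp: U_coeff assms dpc_def dp_coef_sym m_comm)
  finally show "(u \<otimes>\<^bsub>D\<^esub> v) k = (v \<otimes>\<^bsub>D\<^esub> u) k" .
qed

lemma D_scal:
  assumes "a \<in> carrier A" "u \<in> carrier U" "v \<in> carrier U"
  shows "scal a u \<otimes>\<^bsub>D\<^esub> v = scal a (u \<otimes>\<^bsub>D\<^esub> v)"
proof
  fix k
  have "(scal a u \<otimes>\<^bsub>D\<^esub> v) k = (\<Oplus>t\<in>Tset k. a \<otimes> (\<lambda>(n, m, i). dpc n m i \<otimes> (u n \<otimes> v m)) t)"
    unfolding D_mult scal_def by (intro finsum_cong') (auto simp: U_coeff assms m_assoc m_lcomm)
  also have "\<dots> = a \<otimes> (u \<otimes>\<^bsub>D\<^esub> v) k"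
    unfolding D_mult by (rule finsum_rdistr[symmetric]) (auto simp: assms U_coeff)
  finally show "(scal a u \<otimes>\<^bsub>D\<^esub> v) k = scal a (u \<otimes>\<^bsub>D\<^esub> v) k" by (simp add: scal_def)
qed

section \<open>Base change from the universal ring\<close>

text \<open>Coefficients in \<int>[q][x] are evaluated in A. This carries identities of the
  universal ring to every A, whatever its torsion.\<close>

definition umap :: "int poly poly poly \<Rightarrow> nat \<Rightarrow> 'a" where
  "umap u = (\<lambda>n. evx (Polynomial.coeff u n))"

lemma umap_closed [simp, intro]: "umap u \<in> carrier U"
  unfolding U_carrier umap_def by (auto intro!: exI[of _ "degree u"] simp: coeff_eq_0)

lemma umap_add: "umap (u + v) = umap u \<oplus>\<^bsub>U\<^esub> umap v"
  unfolding U_add[OF umap_closed umap_closed] by (simp add: umap_def evx_add)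

lemma umap_monom: "umap (Polynomial.monom f n) = mon (evx f) n"
  by (auto simp: umap_def U_mon)

lemma umap_1: "umap 1 = mon \<one> 0"
  using umap_monom[of 1 0] by simp

lemma umap_0: "umap 0 = \<zero>\<^bsub>U\<^esub>"
  by (simp add: umap_def U_zero)

lemma umap_sum: "finite S \<Longrightarrow> umap (sum f S) = finsum U (\<lambda>i. umap (f i)) S"
  by (induction S rule: finite_induct) (simp_all add: umap_add umap_0)

lemma dp_coef_nonzeroD: "dp_coef n m i \<noteq> 0 \<Longrightarrow> i \<le> n \<and> i \<le> m"
  by (rule ccontr) (auto simp: dp_coef_eq_0 not_le)

text \<open>The index sets differ: \<open>dp_mult\<close> stops at the degrees and does not require
  i \<le> n. The surplus terms vanish because a coefficient or \<open>dp_coef\<close> is 0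
  there.\<close>

lemma coeff_dp_mult:
  "Polynomial.coeff (dp_mult u v) k = (\<Sum>(n, m, i)\<in>Tset k.
     [:dp_coef n m i:] * [:0, 1:] ^ i * (Polynomial.coeff u n * Polynomial.coeff v m))"
proof -
  let ?g = "\<lambda>(n, m, i). [:dp_coef n m i:] * [:0, 1:] ^ i * (Polynomial.coeff u n * Polynomial.coeff v m)"
  let ?S = "SIGMA n:{..degree u}. SIGMA m:{..degree v}. {..m}"
  have "Polynomial.coeff (dp_mult u v) k
    = (\<Sum>n\<le>degree u. \<Sum>m\<le>degree v. \<Sum>i\<le>m. if n + m - i = k then ?g (n, m, i) else 0)"
    by (simp add: dp_mult_def coeff_sum cong: if_cong del: mult_pCons_left)
  also have "\<dots> = (\<Sum>(n, m, i)\<in>?S. if n + m - i = k then ?g (n, m, i) else 0)"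
    by (simp add: sum.Sigma split_def)
  also have "\<dots> = (\<Sum>t\<in>Tset k. ?g t)"
  proof (rule sum.mono_neutral_cong)
    show "\<And>t. t \<in> Tset k - ?S \<Longrightarrow> ?g t = 0"
      by (auto simp: Tset_def intro: le_degree)
    show "\<And>t. t \<in> ?S - Tset k \<Longrightarrow> (case t of (n, m, i) \<Rightarrow> if n + m - i = k then ?g (n, m, i) else 0) = 0"
      by (auto simp: Tset_def split: if_splits dest!: dp_coef_nonzeroD)
    show "\<And>t. t \<in> ?S \<inter> Tset k \<Longrightarrow> (case t of (n, m, i) \<Rightarrow> if n + m - i = k then ?g (n, m, i) else 0) = ?g t"
      by (auto simp: Tset_def)
  qed auto
  finally show ?thesis .
qed

lemma umap_mult: "umap (dp_mult u v) = umap u \<otimes>\<^bsub>D\<^esub> umap v"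
proof
  fix k
  have "umap (dp_mult u v) k = (\<Oplus>t\<in>Tset k. evx (case t of (n, m, i) \<Rightarrow>
     [:dp_coef n m i:] * [:0, 1:] ^ i * (Polynomial.coeff u n * Polynomial.coeff v m)))"
    unfolding umap_def coeff_dp_mult by (rule evx_sum) simp
  also have "\<dots> = (umap u \<otimes>\<^bsub>D\<^esub> umap v) k"
    unfolding D_mult
    by (intro finsum_cong')
      (auto simp: umap_def evx_mult evx_power evx_smult dpc_def m_assoc simp del: mult_pCons_left)
  finally show "umap (dp_mult u v) k = (umap u \<otimes>\<^bsub>D\<^esub> umap v) k" .
qed

definition eps :: "nat \<Rightarrow> nat \<Rightarrow> 'a" where "eps n = mon \<one> n"

lemma eps_closed [simp, intro]: "eps n \<in> carrier U"
  by (simp add: eps_def)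

lemma umap_eps: "umap (Polynomial.monom 1 n) = eps n"
  by (simp add: umap_monom eps_def)

lemma mon_eps: "a \<in> carrier A \<Longrightarrow> mon a n = scal a (eps n)"
  by (simp add: eps_def scal_mon)

lemma D_mon_mult:
  assumes "a \<in> carrier A" "b \<in> carrier A"
  shows "mon a n \<otimes>\<^bsub>D\<^esub> mon b m = scal (a \<otimes> b) (eps n \<otimes>\<^bsub>D\<^esub> eps m)"
proof -
  have "mon a n \<otimes>\<^bsub>D\<^esub> mon b m = scal a (scal b (eps m) \<otimes>\<^bsub>D\<^esub> eps n)"
    using assms by (simp add: mon_eps D_scal D_m_comm[of "eps n"])
  also have "\<dots> = scal (a \<otimes> b) (eps n \<otimes>\<^bsub>D\<^esub> eps m)"
    using assms by (simp add: D_scal scal_scal D_m_comm[of "eps n"])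
  finally show ?thesis .
qed

lemma D_const_mult:
  assumes "a \<in> carrier A" "u \<in> carrier U"
  shows "mon a 0 \<otimes>\<^bsub>D\<^esub> u = scal a u"
  using assms(2)
proof (induction u rule: U_induct)
  case (monom b n)
  have "eps 0 \<otimes>\<^bsub>D\<^esub> eps n = eps n"
    using umap_mult[of "Polynomial.monom 1 0" "Polynomial.monom 1 n"] by (simp add: dp_mult_1 umap_eps umap_monom umap_1 eps_def)
  then show ?case
    unfolding D_mon_mult[OF assms(1) monom] using assms(1) monom by (simp add: scal_scal mon_eps)
next
  case (add u v)
  have "mon a 0 \<otimes>\<^bsub>D\<^esub> (u \<oplus>\<^bsub>U\<^esub> v) = mon a 0 \<otimes>\<^bsub>D\<^esub> u \<oplus>\<^bsub>U\<^esub> mon a 0 \<otimes>\<^bsub>D\<^esub> v"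
    using add assms(1) D_l_distr[of u v "mon a 0"] by (simp add: D_m_comm[of "mon a 0"])
  then show ?case using add assms(1) by (simp add: scal_add)
qed

text \<open>By A-bilinearity associativity need only be tested on the \<xi>^[n], and those are
  images from the universal ring.\<close>

lemma D_m_assoc:
  assumes "u \<in> carrier U" "v \<in> carrier U" "w \<in> carrier U"
  shows "(u \<otimes>\<^bsub>D\<^esub> v) \<otimes>\<^bsub>D\<^esub> w = u \<otimes>\<^bsub>D\<^esub> (v \<otimes>\<^bsub>D\<^esub> w)"
proof -
  have r_distr: "w \<otimes>\<^bsub>D\<^esub> (u \<oplus>\<^bsub>U\<^esub> v) = w \<otimes>\<^bsub>D\<^esub> u \<oplus>\<^bsub>U\<^esub> w \<otimes>\<^bsub>D\<^esub> v"
    if "u \<in> carrier U" "v \<in> carrier U" "w \<in> carrier U" for u v w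
    using D_l_distr[OF that] that by (simp add: D_m_comm[of w])
  have r_scal: "u \<otimes>\<^bsub>D\<^esub> scal a v = scal a (u \<otimes>\<^bsub>D\<^esub> v)" if "a \<in> carrier A" "u \<in> carrier U" "v \<in> carrier U" for a u v
    using D_scal[OF that(1,3,2)] that by (simp add: D_m_comm[of u])
  have eps: "(eps n \<otimes>\<^bsub>D\<^esub> eps m) \<otimes>\<^bsub>D\<^esub> eps k = eps n \<otimes>\<^bsub>D\<^esub> (eps m \<otimes>\<^bsub>D\<^esub> eps k)" for n m k
    unfolding umap_eps[symmetric] umap_mult[symmetric] by (simp only: dp_mult_assoc)
  show ?thesis
    using assms(1)
  proof (induction u rule: U_induct)
    case (monom a n)
    show ?case using assms(2)
    proof (induction v rule: U_induct)
      case (monom b m)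
      show ?case using assms(3)
      proof (induction w rule: U_induct)
        case (monom d k)
        then show ?case using \<open>a \<in> carrier A\<close> \<open>b \<in> carrier A\<close>
          by (simp add: mon_eps D_scal r_scal scal_scal eps m_ac)
      next
        case (add w w')
        then show ?case using \<open>a \<in> carrier A\<close> \<open>b \<in> carrier A\<close> by (simp add: r_distr)
      qed
    next
      case (add v v')
      then show ?case using \<open>a \<in> carrier A\<close> assms(3) by (simp add: r_distr D_l_distr)
    qed
  next
    case (add u u')
    then show ?case using assms(2,3) by (simp add: D_l_distr)
  qed
qed

lemma D_cring: "cring D"
proof (rule cringI)
  show "abelian_group D"
    by (rule abelian_groupI) (auto simp: U.P.a_ac intro: U.UP_l_neg_ex)
  show "Group.comm_monoid D"
  proof (rule comm_monoidI)
    fix u v w assume uv: "u \<in> carrier D" "v \<in> carrier D"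
    show "\<one>\<^bsub>D\<^esub> \<otimes>\<^bsub>D\<^esub> u = u"
      using uv unfolding D_simps U_one by (simp only: D_const_mult one_closed scal_one)
    show "u \<otimes>\<^bsub>D\<^esub> v = v \<otimes>\<^bsub>D\<^esub> u" using uv D_m_comm by simp
    show "u \<otimes>\<^bsub>D\<^esub> v \<in> carrier D" using uv by simp
    assume "w \<in> carrier D"
    then show "u \<otimes>\<^bsub>D\<^esub> v \<otimes>\<^bsub>D\<^esub> w = u \<otimes>\<^bsub>D\<^esub> (v \<otimes>\<^bsub>D\<^esub> w)" using uv D_m_assoc by simp
  qed simp
qed (simp add: D_l_distr)

end

sublocale coef_alg \<subseteq> D: cring "dp_ring c A x"
  by (rule D_cring)

context coef_alg
begin

section \<open>The map from A[\<xi>] to twisted divided polynomials\<close>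

definition con :: "'a \<Rightarrow> nat \<Rightarrow> 'a" where "con a = mon a 0"

lemma con_closed [simp, intro]: "a \<in> carrier A \<Longrightarrow> con a \<in> carrier U"
  by (simp add: con_def)

lemma con_hom_U: "con \<in> ring_hom A U"
  unfolding con_def using U.const_ring_hom by simp

lemma con_hom_D: "con \<in> ring_hom A D"
proof (rule ring_hom_memI)
  fix a b assume ab: "a \<in> carrier A" "b \<in> carrier A"
  then show "con (a \<otimes> b) = con a \<otimes>\<^bsub>D\<^esub> con b" by (simp add: con_def D_const_mult scal_mon)
  show "con (a \<oplus> b) = con a \<oplus>\<^bsub>D\<^esub> con b" using ring_hom_add[OF con_hom_U ab] by simp
qed (auto simp: con_def)

lemma con_D: "a \<in> carrier A \<Longrightarrow> u \<in> carrier U \<Longrightarrow> con a \<otimes>\<^bsub>D\<^esub> u = scal a u"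
  by (simp add: con_def D_const_mult)

lemma con_U: "a \<in> carrier A \<Longrightarrow> u \<in> carrier U \<Longrightarrow> con a \<otimes>\<^bsub>U\<^esub> u = scal a u"
  by (simp add: con_def U_const_mult)

definition X :: "nat \<Rightarrow> 'a" where "X = mon \<one> 1"

lemma X_closed [simp, intro]: "X \<in> carrier U"
  by (simp add: X_def)

abbreviation tp where "tp n \<equiv> twisted_pow c A x n"

definition tfac :: "nat \<Rightarrow> nat \<Rightarrow> 'a" where
  "tfac i = X \<oplus>\<^bsub>U\<^esub> con (x \<ominus> c ([:0, 1:] ^ i) \<otimes> x)"

lemma tfac_closed [simp, intro]: "tfac i \<in> carrier U"
  by (simp add: tfac_def)

lemma tp_eq: "tp n = (\<Otimes>\<^bsub>U\<^esub>i\<in>{..<n}. tfac i)"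
  by (simp add: twisted_pow_def tfac_def X_def con_def)

lemma tp_0 [simp]: "tp 0 = \<one>\<^bsub>U\<^esub>"
  by (simp add: tp_eq)

lemma tp_closed [simp, intro]: "tp n \<in> carrier U"
  unfolding tp_eq by (rule U.P.finprod_closed) auto

lemma tp_Suc: "tp (Suc n) = tp n \<otimes>\<^bsub>U\<^esub> tfac n"
  unfolding tp_eq lessThan_Suc by (subst U.P.finprod_insert) (auto simp: U.P.m_comm Pi_def intro!: U.P.finprod_closed)

text \<open>Evaluation at \<xi>^[1], in order to have a concrete form of
  \<open>up_to_dp\<close>.\<close>

definition hh :: "(nat \<Rightarrow> 'a) \<Rightarrow> nat \<Rightarrow> 'a" where
  "hh = UnivPoly.eval A D con (eps 1)"

lemma UD: "UP_pre_univ_prop A D con"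
  by (intro UP_pre_univ_prop.intro UP_cring.intro ring_hom_cringI2 cring_axioms D_cring con_hom_D)

lemma hh_hom: "hh \<in> ring_hom U D"
  unfolding hh_def by (rule UP_pre_univ_prop.eval_ring_hom[OF UD]) simp

lemma hh_con: "a \<in> carrier A \<Longrightarrow> hh (con a) = con a"
  unfolding hh_def using UP_pre_univ_prop.eval_const[OF UD, of "eps 1" a] by (simp add: con_def)

lemma hh_X: "hh X = eps 1"
  unfolding hh_def using UP_pre_univ_prop.eval_monom1[OF UD, of "eps 1"] by (simp add: X_def)

text \<open>Each new factor of \<xi>^(n) acts by the base change of
  \<open>dp_mult_xi\<close>.\<close>

lemma hh_tp: "hh (tp n) = mon (c (qfact n)) n"
proof (induction n)
  case 0
  then show ?case using ring_hom_one[OF hh_hom] by simp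
next
  case (Suc n)
  have "hh (tp (Suc n)) = hh (tp n) \<otimes>\<^bsub>D\<^esub> hh (tfac n)"
    unfolding tp_Suc by (rule ring_hom_mult[OF hh_hom]) auto
  also have "hh (tfac n) = eps 1 \<oplus>\<^bsub>U\<^esub> con (x \<ominus> c ([:0, 1:] ^ n) \<otimes> x)"
    unfolding tfac_def using ring_hom_add[OF hh_hom] by (simp add: hh_con hh_X)
  also have "\<dots> = umap (Polynomial.monom 1 1 + Polynomial.monom ([:0, 1:] - [:[:0, 1:] ^ n:] * [:0, 1:]) 0)"
  proof -
    have "evx ([:0, 1:] - [:[:0, 1:] ^ n:] * [:0, 1:]) = x \<ominus> c ([:0, 1:] ^ n) \<otimes> x"
      using evx_add[of "[:0, 1:]" "- ([:[:0, 1:] ^ n:] * [:0, 1:])"] evx_smult[of "- ([:0, 1:] ^ n)" "[:0, 1:]"]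
      by (simp add: evx_pCons c_uminus a_minus_def m_comm r_minus)
    then show ?thesis by (simp only: umap_add umap_monom evx_1 eps_def con_def)
  qed
  also have "hh (tp n) \<otimes>\<^bsub>D\<^esub> \<dots> = scal (c (qfact n)) (eps n \<otimes>\<^bsub>D\<^esub> \<dots>)"
    by (simp add: Suc.IH mon_eps D_scal)
  also have "eps n \<otimes>\<^bsub>D\<^esub> umap (Polynomial.monom 1 1 + Polynomial.monom ([:0, 1:] - [:[:0, 1:] ^ n:] * [:0, 1:]) 0) = mon (c (qint (Suc n))) (Suc n)"
    unfolding umap_eps[symmetric] umap_mult[symmetric]
    by (subst dp_mult_comm) (simp only: dp_mult_xi umap_monom evx_const)
  also have "scal (c (qfact n)) \<dots> = mon (c (qfact (Suc n))) (Suc n)"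
    by (simp add: scal_mon qfact_Suc c_mult m_comm)
  finally show ?case .
qed

text \<open>Uniqueness holds because \<xi>^(1) = \<xi>, so the prescribed value for n = 1 already
  fixes the image of \<xi>.\<close>

lemma up_to_dp_eq: "up_to_dp c A x = hh"
  unfolding up_to_dp_def
proof (rule the_equality)
  have "hh \<in> extensional (carrier U)"
    unfolding hh_def by (rule U.eval_extensional)
  then show "hh \<in> ring_hom U D \<and> hh \<in> extensional (carrier U) \<and>
      (\<forall>a\<in>carrier A. hh (mon a 0) = up_ring.monom D a 0) \<and> (\<forall>n. hh (tp n) = up_ring.monom D (c (qfact n)) n)"
    using hh_hom hh_con hh_tp by (simp add: con_def)
next
  fix h assume h: "h \<in> ring_hom U D \<and> h \<in> extensional (carrier U) \<and>
      (\<forall>a\<in>carrier A. h (mon a 0) = up_ring.monom D a 0) \<and> (\<forall>n. h (tp n) = up_ring.monom D (c (qfact n)) n)"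
  have "tp 1 = X"
  proof -
    have "x \<ominus> c ([:0, 1:] ^ 0) \<otimes> x = \<zero>" by (simp add: minus_eq_zero_iff)
    then have "tfac 0 = X" by (simp add: tfac_def con_def U.monom_zero)
    then show ?thesis using tp_Suc[of 0] by simp
  qed
  then have hX: "h X = eps 1" using h by (metis D_simps(5) eps_def c_one qfact_Suc qfact_0 qint_Suc_0 mult_1 One_nat_def)
  interpret P: UP_pre_univ_prop A D con "UP A" by (rule UD) simp
  have "h u = hh u" if "u \<in> carrier U" for u
  proof (rule P.UP_hom_unique[where Phi = h and Psi = hh and s = "eps 1", OF _ _ _ _ _ _ that])
    show "ring_hom_cring U D h" "ring_hom_cring U D hh"
      using h hh_hom by (auto intro: ring_hom_cringI2 U.UP_cring D_cring)
  qed (use hX h hh_X hh_con in \<open>auto simp: X_def con_def\<close>)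
  moreover have "hh \<in> extensional (carrier U)"
    unfolding hh_def by (rule U.eval_extensional)
  ultimately show "h = hh" using h by (intro extensionalityI[of h "carrier U" hh]) auto
qed

end

section \<open>Newton expansions\<close>

context coef_alg
begin

lemma scal_apply: "scal a u n = a \<otimes> u n"
  by (simp add: scal_def)

lemma U_add_apply: "u \<in> carrier U \<Longrightarrow> v \<in> carrier U \<Longrightarrow> (u \<oplus>\<^bsub>U\<^esub> v) n = u n \<oplus> v n"
  by (simp add: U_add)

lemma U_one_apply: "\<one>\<^bsub>U\<^esub> n = (if n = 0 then \<one> else \<zero>)"
  by (simp add: UP_def)

lemma U_coeff_mult_X:
  assumes "u \<in> carrier U"
  shows "(u \<otimes>\<^bsub>U\<^esub> X) (Suc k) = u k"
proof -
  have "(X \<otimes>\<^bsub>U\<^esub> u) (Suc k) = up_ring.coeff U (mon \<one> 1 \<otimes>\<^bsub>U\<^esub> u) (k + 1)"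
    using assms by (simp add: U_coeff_eq X_def)
  also have "\<dots> = u k"
    using U.coeff_monom_mult[OF one_closed assms, of 1 k] assms by (simp add: U_coeff_eq U_coeff)
  finally show ?thesis using assms by (simp add: U.P.m_comm)
qed

lemma U_coeff_mult_tfac:
  assumes "u \<in> carrier U"
  shows "(u \<otimes>\<^bsub>U\<^esub> tfac i) (Suc k) = u k \<oplus> (x \<ominus> c ([:0, 1:] ^ i) \<otimes> x) \<otimes> u (Suc k)"
proof -
  have "u \<otimes>\<^bsub>U\<^esub> tfac i = u \<otimes>\<^bsub>U\<^esub> X \<oplus>\<^bsub>U\<^esub> scal (x \<ominus> c ([:0, 1:] ^ i) \<otimes> x) u"
    using assms by (simp add: tfac_def U.P.r_distr con_U U.P.m_comm[of u "con _"])
  then show ?thesis using assms by (simp add: U_add_apply U_coeff_mult_X scal_apply)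
qed

text \<open>A block of k consecutive factors beginning with the one of index n. The variable start
  permits expansions after division by \<xi>^(n) or by a single factor.\<close>

definition tps :: "nat \<Rightarrow> nat \<Rightarrow> nat \<Rightarrow> 'a" where
  "tps n k = rec_nat \<one>\<^bsub>U\<^esub> (\<lambda>i t. t \<otimes>\<^bsub>U\<^esub> tfac (n + i)) k"

lemma tps_0 [simp]: "tps n 0 = \<one>\<^bsub>U\<^esub>"
  and tps_Suc: "tps n (Suc k) = tps n k \<otimes>\<^bsub>U\<^esub> tfac (n + k)"
  by (simp_all add: tps_def)

lemma tps_closed [simp, intro]: "tps n k \<in> carrier U"
  by (induction k) (simp_all add: tps_Suc)

lemma tps_tp: "tps 0 k = tp k"
  by (induction k) (simp_all add: tps_Suc tp_Suc)

lemma tp_add: "tp n \<otimes>\<^bsub>U\<^esub> tps n k = tp (n + k)"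
proof (induction k)
  case (Suc k)
  have "tp n \<otimes>\<^bsub>U\<^esub> tps n (Suc k) = (tp n \<otimes>\<^bsub>U\<^esub> tps n k) \<otimes>\<^bsub>U\<^esub> tfac (n + k)"
    by (simp add: tps_Suc U.P.m_assoc)
  then show ?case by (simp add: Suc tp_Suc)
qed simp

lemma tps_Suc_shift: "tps n (Suc k) = tfac n \<otimes>\<^bsub>U\<^esub> tps (Suc n) k"
proof (induction k)
  case (Suc k)
  have "tps n (Suc (Suc k)) = tfac n \<otimes>\<^bsub>U\<^esub> tps (Suc n) k \<otimes>\<^bsub>U\<^esub> tfac (n + Suc k)"
    using Suc by (simp add: tps_Suc)
  then show ?case by (simp add: U.P.m_assoc tps_Suc[of "Suc n"])
qed (simp add: tps_Suc)

lemma tps_coeff: "tps n k k = \<one> \<and> (\<forall>j>k. tps n k j = \<zero>)"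
proof (induction k)
  case 0
  then show ?case by (simp add: U_one_apply)
next
  case (Suc k)
  then have "tps n (Suc k) (Suc k) = \<one>"
    by (simp add: tps_Suc U_coeff_mult_tfac)
  moreover have "tps n (Suc k) j = \<zero>" if j: "j > Suc k" for j
  proof -
    obtain i where "j = Suc i" "i > k" using j by (cases j) auto
    then show ?thesis using Suc by (simp add: tps_Suc U_coeff_mult_tfac)
  qed
  ultimately show ?case by blast
qed

text \<open>A Newton interpolation sum in the monic basis \<open>tps n k\<close>, cut off at length
  N.\<close>

definition nsum :: "nat \<Rightarrow> (nat \<Rightarrow> 'a) \<Rightarrow> nat \<Rightarrow> nat \<Rightarrow> 'a" where
  "nsum n v N = rec_nat \<zero>\<^bsub>U\<^esub> (\<lambda>k s. s \<oplus>\<^bsub>U\<^esub> scal (v k) (tps n k)) N"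

lemma nsum_0 [simp]: "nsum n v 0 = \<zero>\<^bsub>U\<^esub>"
  and nsum_Suc: "nsum n v (Suc N) = nsum n v N \<oplus>\<^bsub>U\<^esub> scal (v N) (tps n N)"
  by (simp_all add: nsum_def)

lemma nsum_closed [simp, intro]: "(\<And>k. v k \<in> carrier A) \<Longrightarrow> nsum n v N \<in> carrier U"
  by (induction N) (simp_all add: nsum_Suc)

lemma nsum_cong: "(\<And>k. k < N \<Longrightarrow> v k = w k) \<Longrightarrow> nsum n v N = nsum n w N"
  by (induction N) (simp_all add: nsum_Suc)

lemma nsum_diff:
  assumes "\<And>k. v k \<in> carrier A" "\<And>k. w k \<in> carrier A"
  shows "nsum n (\<lambda>k. v k \<ominus> w k) N = nsum n v N \<ominus>\<^bsub>U\<^esub> nsum n w N"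
proof (induction N)
  case 0
  then show ?case by (simp add: U.P.minus_eq)
next
  case (Suc N)
  have s: "scal (v N \<ominus> w N) (tps n N) = scal (v N) (tps n N) \<ominus>\<^bsub>U\<^esub> scal (w N) (tps n N)"
  proof -
    have "con (v N \<ominus> w N) = con (v N) \<ominus>\<^bsub>U\<^esub> con (w N)"
      using assms ring_hom_ring.axioms
      by (simp add: a_minus_def U.P.minus_eq con_def)
    then have "con (v N \<ominus> w N) \<otimes>\<^bsub>U\<^esub> tps n N = con (v N) \<otimes>\<^bsub>U\<^esub> tps n N \<ominus>\<^bsub>U\<^esub> con (w N) \<otimes>\<^bsub>U\<^esub> tps n N"
      using assms by (simp add: U.P.minus_eq U.P.l_distr U.P.l_minus)
    then show ?thesis using assms by (simp add: con_U)
  qed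
  have c: "nsum n v N \<in> carrier U" "nsum n w N \<in> carrier U" "scal (v N) (tps n N) \<in> carrier U" "scal (w N) (tps n N) \<in> carrier U"
    using assms by auto
  show ?case
    unfolding nsum_Suc Suc.IH s using c by (simp add: U.P.minus_eq U.P.minus_add U.P.a_ac)
qed

text \<open>The basis is monic of increasing degree, so the top coefficient of the sum is the last
  Newton coefficient; then the length drops by one.\<close>

lemma nsum_eq_0:
  assumes "\<And>k. v k \<in> carrier A" "nsum n v N = \<zero>\<^bsub>U\<^esub>" "k < N"
  shows "v k = \<zero>"
  using assms(2,3)
proof (induction N)
  case (Suc N)
  have low: "nsum n v M j = \<zero>" if "M \<le> j" for M j
    using that
  proof (induction M)
    case (Suc M)
    then show ?case using tps_coeff[of n M] assms(1) by (simp add: nsum_Suc U_add_apply scal_apply)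
  qed (simp add: U_zero)
  have "nsum n v (Suc N) N = v N"
    using low[of N N] tps_coeff[of n N] assms(1) by (simp add: nsum_Suc U_add_apply scal_apply)
  then have vN: "v N = \<zero>" using Suc.prems by (simp add: U_zero)
  then have "scal (v N) (tps n N) = \<zero>\<^bsub>U\<^esub>" by (simp add: scal_def U_zero U_coeff)
  then have "nsum n v N = \<zero>\<^bsub>U\<^esub>" using Suc.prems assms(1) by (simp add: nsum_Suc)
  then show ?case using Suc vN by (cases "k = N") auto
qed simp

lemma nsum_pad:
  assumes "\<And>k. v k \<in> carrier A" "\<And>k. k \<ge> M \<Longrightarrow> v k = \<zero>" "M \<le> N"
  shows "nsum n v N = nsum n v M"
  using assms(3)
proof (induction rule: dec_induct)
  case (step N)
  then have "scal (v N) (tps n N) = \<zero>\<^bsub>U\<^esub>" using assms(2)[of N] by (simp add: scal_def U_zero U_coeff)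
  then show ?case using step assms(1) by (simp add: nsum_Suc)
qed simp

text \<open>Subtract the leading coefficient times a monic basis element and descend. No coefficient
  leaves the ideal I on the way, which ties Newton expansions to the adic topology.\<close>

lemma newton_exists:
  assumes "ideal I A" "u \<in> carrier U" "\<And>j. u j \<in> I" "\<And>j. j \<ge> N \<Longrightarrow> u j = \<zero>"
  shows "\<exists>v. (\<forall>k. v k \<in> I) \<and> (\<forall>k\<ge>N. v k = \<zero>) \<and> u = nsum n v N"
  using assms(2-4)
proof (induction N arbitrary: u)
  case 0
  interpret I: ideal I A by fact
  from 0 show ?case by (intro exI[of _ "\<lambda>_. \<zero>"]) (auto simp: U_zero fun_eq_iff)
next
  case (Suc N)
  interpret I: ideal I A by fact
  let ?t = "scal (u N) (tps n N)"
  let ?u = "u \<ominus>\<^bsub>U\<^esub> ?t"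
  have uN: "u N \<in> carrier A" using Suc.prems(1) by (rule U_coeff)
  have coeff: "?u j = u j \<ominus> u N \<otimes> tps n N j" for j
  proof -
    have "?u j = up_ring.coeff U ?u j" using Suc.prems(1) uN by (simp add: U_coeff_eq)
    also have "\<dots> = up_ring.coeff U u j \<ominus> up_ring.coeff U ?t j"
      using Suc.prems(1) uN by (intro U.coeff_minus) auto
    finally show ?thesis using Suc.prems(1) uN by (simp add: U_coeff_eq scal_apply)
  qed
  have t: "tps n N j \<in> carrier A" for j by (rule U_coeff) simp
  have 1: "?u \<in> carrier U" using Suc.prems(1) uN by simp
  have 2: "?u j \<in> I" for j
    unfolding coeff unfolding minus_eq[of "u j"] using Suc.prems(2)[of j] Suc.prems(2)[of N] t[of j] by (intro I.a_closed I.a_inv_closed I.I_r_closed)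
  have 3: "?u j = \<zero>" if "j \<ge> N" for j
  proof (cases "j = N")
    case True
    then show ?thesis unfolding coeff using tps_coeff[of n N] uN by (simp add: minus_eq r_neg)
  next
    case False
    then show ?thesis using that Suc.prems(3)[of j] tps_coeff[of n N] uN unfolding coeff by (simp add: minus_eq)
  qed
  obtain v where v: "\<And>k. v k \<in> I" "\<And>k. k \<ge> N \<Longrightarrow> v k = \<zero>" "?u = nsum n v N"
    using Suc.IH[OF 1 2 3] by blast
  let ?v = "v(N := u N)"
  have "nsum n ?v (Suc N) = nsum n v N \<oplus>\<^bsub>U\<^esub> ?t"
    unfolding nsum_Suc by (simp add: nsum_cong[of N ?v v])
  also have "\<dots> = u"
    unfolding v(3)[symmetric] using Suc.prems(1) uN by (simp add: U.P.minus_eq U.P.a_assoc U.P.l_neg)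
  finally have "u = nsum n ?v (Suc N)" ..
  moreover have "\<forall>k. ?v k \<in> I" using v(1) Suc.prems(2) by simp
  moreover have "\<forall>k\<ge>Suc N. ?v k = \<zero>" using v(2) by simp
  ultimately show ?case by blast
qed

lemma newton_exists':
  assumes "ideal I A" "u \<in> carrier U" "\<And>j. u j \<in> I"
  obtains v N where "\<And>k. v k \<in> I" "\<And>k. k \<ge> N \<Longrightarrow> v k = \<zero>" "\<And>M. M \<ge> N \<Longrightarrow> u = nsum n v M"
proof -
  obtain N where N: "\<And>j. j > N \<Longrightarrow> u j = \<zero>" using assms(2) by (auto simp: U_carrier)
  obtain v where v: "\<And>k. v k \<in> I" "\<And>k. k \<ge> Suc N \<Longrightarrow> v k = \<zero>" "u = nsum n v (Suc N)"
    using newton_exists[OF assms, of "Suc N"] N by (metis Suc_le_eq)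
  have vc: "v k \<in> carrier A" for k using v(1) ideal.Icarr[OF assms(1)] by blast
  have "u = nsum n v M" if "M \<ge> Suc N" for M
    using nsum_pad[of v "Suc N" M n] vc v(2,3) that by simp
  then show thesis using that v by blast
qed

text \<open>Blocks of factors concatenate, so multiplication by \<xi>^(n) shifts Newton coefficients
  by n.\<close>

lemma tp_nsum:
  assumes "\<And>k. a k \<in> carrier A"
  shows "tp n \<otimes>\<^bsub>U\<^esub> nsum n a N = nsum 0 (\<lambda>k. if k < n then \<zero> else a (k - n)) (n + N)"
proof (induction N)
  case 0
  have "nsum 0 (\<lambda>k. if k < n then \<zero> else a (k - n)) n = nsum 0 (\<lambda>_. \<zero>) n"
    by (rule nsum_cong) simp
  also have "\<dots> = \<zero>\<^bsub>U\<^esub>"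
    using nsum_pad[of "\<lambda>_. \<zero>" 0 n 0] by simp
  finally show ?case by simp
next
  case (Suc N)
  have "tp n \<otimes>\<^bsub>U\<^esub> scal (a N) (tps n N) = scal (a N) (tp (n + N))"
  proof -
    have "tp n \<otimes>\<^bsub>U\<^esub> (con (a N) \<otimes>\<^bsub>U\<^esub> tps n N) = con (a N) \<otimes>\<^bsub>U\<^esub> (tp n \<otimes>\<^bsub>U\<^esub> tps n N)"
      using assms by (simp add: U.P.m_lcomm)
    then show ?thesis using assms by (simp add: con_U tp_add)
  qed
  then show ?case using Suc assms by (simp add: nsum_Suc U.P.r_distr tps_tp)
qed

lemma tp_dvd: "n \<le> k \<Longrightarrow> tp k \<in> PIdl\<^bsub>U\<^esub> (tp n)"
proof -
  assume "n \<le> k"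
  then have "tp k = tps n (k - n) \<otimes>\<^bsub>U\<^esub> tp n"
    using tp_add[of n "k - n"] U.P.m_comm[of "tp n" "tps n (k - n)"] by simp
  then show ?thesis unfolding cgenideal_def using tps_closed by blast
qed

end

section \<open>The adic topology on the coefficient ring and on polynomials\<close>

locale adic_alg = coef_alg +
  fixes p :: nat
  assumes p_pos: "0 < p"
    and A_complete: "complete_adic_pair A (c [:int p:]) (c [:-1, 1:])"

sublocale adic_alg \<subseteq> Ap: complete_adic_pair A "c [:int p:]" "c [:-1, 1:]"
  by (rule A_complete)

sublocale adic_alg \<subseteq> Up: adic_pair "UP A" "con (c [:int p:])" "con (c [:-1, 1:])"
  by (intro adic_pair.intro adic_pair_axioms.intro U.UP_cring con_closed c_closed)

sublocale adic_alg \<subseteq> Dp: adic_hat "dp_ring c A x" "con (c [:int p:])" "con (c [:-1, 1:])"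
  by (intro adic_hatI adic_pair.intro adic_pair_axioms.intro D_cring) (simp_all only: D_simps con_closed c_closed)

context adic_alg
begin

lemma con_pw_U: "a \<in> Ap.pw m \<Longrightarrow> con a \<in> Up.pw m"
  by (rule pw_hom[where h = con, OF Ap.adic_pair_axioms Up.adic_pair_axioms con_hom_U refl refl])

lemma con_pw_D: "a \<in> Ap.pw m \<Longrightarrow> con a \<in> Dp.pw m"
  by (rule pw_hom[where h = con, OF Ap.adic_pair_axioms Dp.adic_pair_axioms con_hom_D refl refl])

lemma scal_pw_D: "a \<in> Ap.pw m \<Longrightarrow> u \<in> carrier U \<Longrightarrow> scal a u \<in> Dp.pw m"
  using ideal.I_r_closed[OF Dp.pw_ideal con_pw_D, of a m u] con_D[of a u] Ap.pw_carrier[of a m] by simp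

lemma pw_U_coeff: "z \<in> Up.pw m \<Longrightarrow> z j \<in> Ap.pw m"
proof (induction m arbitrary: z)
  case 0
  then show ?case by (simp add: U_coeff)
next
  case (Suc m)
  then obtain a b where ab: "a \<in> Up.pw m" "b \<in> Up.pw m" "z = con (c [:int p:]) \<otimes>\<^bsub>U\<^esub> a \<oplus>\<^bsub>U\<^esub> con (c [:-1, 1:]) \<otimes>\<^bsub>U\<^esub> b"
    unfolding Up.pw_Suc by blast
  then have "z j = c [:int p:] \<otimes> a j \<oplus> c [:-1, 1:] \<otimes> b j"
    using Up.pw_carrier[OF ab(1)] Up.pw_carrier[OF ab(2)]
    by (simp add: con_U U_add[OF scal_closed scal_closed]) (simp add: scal_def)
  then show ?case unfolding Ap.pw_Suc using Suc.IH ab by blast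
qed

text \<open>The neighbourhood (\<xi>^(n)) + (p, q-1)^m of 0 in A[\<xi>]; lifts will be known only
  modulo such ideals.\<close>

definition Lid :: "nat \<Rightarrow> nat \<Rightarrow> (nat \<Rightarrow> 'a) set" where
  "Lid n m = PIdl\<^bsub>U\<^esub> (tp n) <+>\<^bsub>U\<^esub> Up.pw m"

lemma Lid_ideal: "ideal (Lid n m) U"
  unfolding Lid_def by (intro U.P.add_ideals U.P.cgenideal_ideal tp_closed Up.pw_ideal)

lemma Lid_iff: "u \<in> Lid n m \<longleftrightarrow> (\<exists>w\<in>carrier U. \<exists>z\<in>Up.pw m. u = tp n \<otimes>\<^bsub>U\<^esub> w \<oplus>\<^bsub>U\<^esub> z)"
proof -
  have "u \<in> Lid n m \<longleftrightarrow> (\<exists>w\<in>carrier U. \<exists>z\<in>Up.pw m. u = w \<otimes>\<^bsub>U\<^esub> tp n \<oplus>\<^bsub>U\<^esub> z)"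
    unfolding Lid_def set_add_def' cgenideal_def by blast
  moreover have "w \<otimes>\<^bsub>U\<^esub> tp n = tp n \<otimes>\<^bsub>U\<^esub> w" if "w \<in> carrier U" for w
    using that by (simp add: U.P.m_comm)
  ultimately show ?thesis by metis
qed

lemma PIdl_Lid: "PIdl\<^bsub>U\<^esub> (tp n) \<subseteq> Lid n m"
proof
  fix u assume "u \<in> PIdl\<^bsub>U\<^esub> (tp n)"
  then obtain w where w: "w \<in> carrier U" "u = w \<otimes>\<^bsub>U\<^esub> tp n" by (auto simp: cgenideal_def)
  then have "u = tp n \<otimes>\<^bsub>U\<^esub> w \<oplus>\<^bsub>U\<^esub> \<zero>\<^bsub>U\<^esub>" by (simp add: U.P.m_comm)
  moreover have "\<zero>\<^bsub>U\<^esub> \<in> Up.pw m" using additive_subgroup.zero_closed[OF ideal.axioms(1)[OF Up.pw_ideal]] .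
  ultimately show "u \<in> Lid n m" unfolding Lid_iff using w by blast
qed

lemma pw_Lid: "Up.pw m \<subseteq> Lid n m"
proof
  fix z assume z: "z \<in> Up.pw m"
  then have "z = tp n \<otimes>\<^bsub>U\<^esub> \<zero>\<^bsub>U\<^esub> \<oplus>\<^bsub>U\<^esub> z" using Up.pw_carrier[OF z] by simp
  then show "z \<in> Lid n m" unfolding Lid_iff using z by blast
qed

lemma Lid_antimono:
  assumes "n \<le> n'" "m \<le> m'"
  shows "Lid n' m' \<subseteq> Lid n m"
proof
  interpret L: ideal "Lid n m" U by (rule Lid_ideal)
  fix u assume "u \<in> Lid n' m'"
  then obtain w z where wz: "w \<in> carrier U" "z \<in> Up.pw m'" "u = tp n' \<otimes>\<^bsub>U\<^esub> w \<oplus>\<^bsub>U\<^esub> z"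
    unfolding Lid_iff by blast
  have "tp n' \<in> Lid n m" using tp_dvd[OF assms(1)] PIdl_Lid by blast
  moreover have "z \<in> Lid n m" using wz(2) Up.pw_antimono[OF assms(2)] pw_Lid by blast
  ultimately show "u \<in> Lid n m" using wz L.I_r_closed L.a_closed by simp
qed

text \<open>In a Newton expansion the multiple of \<xi>^(n) starts at index n, and the other summand
  has all its coefficients in (p, q-1)^m. By uniqueness only the latter is seen below n.\<close>

lemma nsum_Lid:
  assumes "\<And>k. v k \<in> carrier A" "nsum 0 v n \<in> Lid n m" "k < n"
  shows "v k \<in> Ap.pw m"
proof -
  obtain w z where wz: "w \<in> carrier U" "z \<in> Up.pw m" "nsum 0 v n = tp n \<otimes>\<^bsub>U\<^esub> w \<oplus>\<^bsub>U\<^esub> z"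
    using assms(2) unfolding Lid_iff by blast
  have zc: "z \<in> carrier U" using Up.pw_carrier[OF wz(2)] .
  obtain a N where a: "\<And>k. a k \<in> carrier A" "\<And>k. k \<ge> N \<Longrightarrow> a k = \<zero>" "\<And>M. M \<ge> N \<Longrightarrow> w = nsum n a M"
    using newton_exists'[OF oneideal wz(1) U_coeff[OF wz(1)]] by metis
  obtain b N' where b: "\<And>k. b k \<in> Ap.pw m" "\<And>k. k \<ge> N' \<Longrightarrow> b k = \<zero>" "\<And>M. M \<ge> N' \<Longrightarrow> z = nsum 0 b M"
    using newton_exists'[OF Ap.pw_ideal zc pw_U_coeff[OF wz(2)]] by metis
  have bc: "b k \<in> carrier A" for k using Ap.pw_carrier[OF b(1)] .
  define M where "M = max N N'"
  let ?v = "\<lambda>k. if k < n then v k else \<zero>" and ?a = "\<lambda>k. if k < n then \<zero> else a (k - n)"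
  have vc: "?v k \<in> carrier A" and ac: "?a k \<in> carrier A" for k using assms(1) a(1) by auto
  have v': "nsum 0 ?v (n + M) = nsum 0 v n"
  proof -
    have "nsum 0 ?v (n + M) = nsum 0 ?v n" using vc by (intro nsum_pad) auto
    also have "\<dots> = nsum 0 v n" by (rule nsum_cong) simp
    finally show ?thesis .
  qed
  have a': "nsum 0 ?a (n + M) = tp n \<otimes>\<^bsub>U\<^esub> w"
    using a(3)[of M] tp_nsum[OF a(1), where n = n and N = M] by (simp add: M_def)
  have b': "nsum 0 b (n + M) = z" using b(3)[of "n + M"] by (simp add: M_def)
  have "nsum 0 (\<lambda>k. (?v k \<ominus> ?a k) \<ominus> b k) (n + M) = (nsum 0 ?v (n + M) \<ominus>\<^bsub>U\<^esub> nsum 0 ?a (n + M)) \<ominus>\<^bsub>U\<^esub> nsum 0 b (n + M)"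
    using nsum_diff[where v = "\<lambda>k. ?v k \<ominus> ?a k" and w = b] nsum_diff[where v = ?v and w = ?a] vc ac bc by simp
  also have "\<dots> = \<zero>\<^bsub>U\<^esub>"
  proof -
    have "tp n \<otimes>\<^bsub>U\<^esub> w \<in> carrier U" using wz by simp
    then show ?thesis unfolding v' a' b' wz(3) using zc
      by (simp add: U.P.minus_eq U.P.a_ac U.P.r_neg U.P.r_neg1 U.P.r_neg2)
  qed
  finally have "(?v k \<ominus> ?a k) \<ominus> b k = \<zero>"
    using nsum_eq_0[of "\<lambda>k. (?v k \<ominus> ?a k) \<ominus> b k" 0 "n + M" k] vc ac bc assms(3) by simp
  then have "v k = b k" using assms(1,3) bc minus_eq_zero_iff[of "v k" "b k"] by (simp add: a_minus_def)
  then show ?thesis using b(1) by simp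
qed

lemma nsum_high:
  assumes "\<And>k. v k \<in> carrier A" "n \<le> N"
  shows "eqmod U (PIdl\<^bsub>U\<^esub> (tp n)) (nsum 0 v N) (nsum 0 v n)"
proof -
  interpret I: ideal "PIdl\<^bsub>U\<^esub> (tp n)" U by (intro U.P.cgenideal_ideal tp_closed)
  show ?thesis using assms(2)
  proof (induction rule: dec_induct)
    case base
    then show ?case using assms(1) by (intro I.eqmod_refl nsum_closed)
  next
    case (step N)
    have "scal (v N) (tps 0 N) \<in> PIdl\<^bsub>U\<^esub> (tp n)"
      using I.I_l_closed[OF tp_dvd[of n N], of "con (v N)"] step assms(1) by (simp add: con_U tps_tp)
    then have "eqmod U (PIdl\<^bsub>U\<^esub> (tp n)) (nsum 0 v N \<oplus>\<^bsub>U\<^esub> scal (v N) (tps 0 N)) (nsum 0 v n \<oplus>\<^bsub>U\<^esub> \<zero>\<^bsub>U\<^esub>)"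
      using step I.eqmod_zero_iff by (intro I.eqmod_add) auto
    then show ?case using assms(1) by (simp add: nsum_Suc)
  qed
qed

text \<open>The ideal (\<xi>^(n)) is closed: modulo it only the first n Newton coefficients matter,
  and these lie in every power of (p, q-1), hence vanish because A is separated.\<close>

lemma Inter_Lid:
  assumes "u \<in> carrier U" "\<And>m. m \<ge> n \<Longrightarrow> u \<in> Lid n m"
  shows "u \<in> PIdl\<^bsub>U\<^esub> (tp n)"
proof -
  interpret I: ideal "PIdl\<^bsub>U\<^esub> (tp n)" U by (intro U.P.cgenideal_ideal tp_closed)
  obtain v N where v: "\<And>k. v k \<in> carrier A" "\<And>M. M \<ge> N \<Longrightarrow> u = nsum 0 v M"
    using newton_exists'[OF oneideal assms(1) U_coeff[OF assms(1)]] by metis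
  have eq: "eqmod U (PIdl\<^bsub>U\<^esub> (tp n)) u (nsum 0 v n)"
    using nsum_high[OF v(1), of n "max n N"] v(2)[of "max n N"] by simp
  have "v k = \<zero>" if k: "k < n" for k
  proof (rule Ap.separated)
    fix m
    let ?m = "max n m"
    interpret L: ideal "Lid n ?m" U by (rule Lid_ideal)
    have "nsum 0 v n \<in> Lid n ?m"
      using L.eqmod_closed[OF L.eqmod_sym[OF eqmod_mono[OF eq PIdl_Lid]]] assms(2)[of ?m] by simp
    then have "v k \<in> Ap.pw ?m" using nsum_Lid[where v = v and n = n and m = ?m and k = k, OF v(1) _ k] by blast
    then show "v k \<in> Ap.pw m" using Ap.pw_antimono[of m ?m] by auto
  qed
  then have "nsum 0 v n = nsum 0 (\<lambda>_. \<zero>) n" by (intro nsum_cong) simp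
  also have "\<dots> = \<zero>\<^bsub>U\<^esub>" using nsum_pad[of "\<lambda>_. \<zero>" 0 n 0] by simp
  finally show ?thesis using eq I.eqmod_zero_iff by simp
qed

section \<open>Topological nilpotence of \<xi> and of the q-factorials\<close>

lemma q_minus_pw: "c ([:0, 1:] ^ i) \<ominus> \<one> \<in> Ap.pw 1"
proof -
  interpret I: ideal "Ap.pw 1" A by (rule Ap.pw_ideal)
  have "c ([:0, 1:] ^ i) \<ominus> \<one> = c [:-1, 1:] \<otimes> c (qint i)"
    using c_diff[of "[:0, 1:] ^ i" 1] by (simp only: c_mult[symmetric] qint_mult_q_minus_1 c_one)
  then show ?thesis using I.I_r_closed Ap.Q_pw by simp
qed

text \<open>The shift x - q^i x is a multiple of q - 1, so all factors of \<xi>^(n) reduce to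
  \<xi>.\<close>

lemma tfac_X: "eqmod U (Up.pw 1) (tfac i) X"
proof -
  interpret I: ideal "Ap.pw 1" A by (rule Ap.pw_ideal)
  interpret J: ideal "Up.pw 1" U by (rule Up.pw_ideal)
  have "x \<ominus> c ([:0, 1:] ^ i) \<otimes> x = \<ominus> ((c ([:0, 1:] ^ i) \<ominus> \<one>) \<otimes> x)"
    by (simp add: minus_eq l_distr l_minus minus_add a_comm)
  then have "x \<ominus> c ([:0, 1:] ^ i) \<otimes> x \<in> Ap.pw 1"
    using I.a_inv_closed[OF I.I_r_closed[OF q_minus_pw[of i] x_closed]] by simp
  then have "con (x \<ominus> c ([:0, 1:] ^ i) \<otimes> x) \<in> Up.pw 1" by (rule con_pw_U)
  then have "eqmod U (Up.pw 1) (X \<oplus>\<^bsub>U\<^esub> con (x \<ominus> c ([:0, 1:] ^ i) \<otimes> x)) (X \<oplus>\<^bsub>U\<^esub> \<zero>\<^bsub>U\<^esub>)"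
    by (intro J.eqmod_add J.eqmod_refl) (simp_all only: J.eqmod_zero_iff X_closed)
  then show ?thesis by (simp add: tfac_def)
qed

lemma tp_X: "eqmod U (Up.pw 1) (tp n) (X [^]\<^bsub>U\<^esub> n)"
proof -
  interpret J: ideal "Up.pw 1" U by (rule Up.pw_ideal)
  show ?thesis
  proof (induction n)
    case (Suc n)
    then show ?case using tfac_X by (simp only: tp_Suc U.P.nat_pow_Suc) (intro J.eqmod_mult)
  qed (use J.eqmod_refl[OF U.UP_one_closed] in simp)
qed

text \<open>Modulo \<xi>^(n) the power \<xi>^n equals the difference \<xi>^n - \<xi>^(n), an element
  of (p, q-1); its m-th power lies in (p, q-1)^m.\<close>

lemma X_pow_Lid: "X [^]\<^bsub>U\<^esub> (n * m) \<in> Lid n m"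
proof -
  interpret L: ideal "Lid n m" U by (rule Lid_ideal)
  let ?z = "X [^]\<^bsub>U\<^esub> n \<ominus>\<^bsub>U\<^esub> tp n"
  interpret J: ideal "Up.pw 1" U by (rule Up.pw_ideal)
  have z: "?z \<in> Up.pw 1" using J.eqmod_sym[OF tp_X] by (simp add: eqmod_def)
  have "tp n \<in> Lid n m" using tp_dvd[of n n] PIdl_Lid by blast
  then have "eqmod U (Lid n m) (tp n \<oplus>\<^bsub>U\<^esub> ?z) (\<zero>\<^bsub>U\<^esub> \<oplus>\<^bsub>U\<^esub> ?z)"
    by (intro L.eqmod_add L.eqmod_refl) (simp_all add: L.eqmod_zero_iff)
  moreover have "tp n \<oplus>\<^bsub>U\<^esub> ?z = X [^]\<^bsub>U\<^esub> n"
    using U.P.a_lcomm[of "tp n" "X [^]\<^bsub>U\<^esub> n" "\<ominus>\<^bsub>U\<^esub> tp n"] by (simp add: U.P.minus_eq U.P.r_neg)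
  ultimately have "eqmod U (Lid n m) (X [^]\<^bsub>U\<^esub> n) ?z" by simp
  then have "eqmod U (Lid n m) ((X [^]\<^bsub>U\<^esub> n) [^]\<^bsub>U\<^esub> m) (?z [^]\<^bsub>U\<^esub> m)" by (rule L.eqmod_pow)
  moreover have "?z [^]\<^bsub>U\<^esub> m \<in> Lid n m" using Up.pw_pow[OF z, of m] pw_Lid by auto
  ultimately have "(X [^]\<^bsub>U\<^esub> n) [^]\<^bsub>U\<^esub> m \<in> Lid n m" by (rule L.eqmod_closed)
  then show ?thesis by (simp add: U.P.nat_pow_pow)
qed

text \<open>Among the factors of (n)_q! are (p)_q, (2p)_q, ..., (mp)_q, each in (p, q-1). Hence the
  images of \<xi>^(n) tend to 0 in the divided power ring.\<close>

lemma c_qfact_pw: "p * m \<le> n \<Longrightarrow> c (qfact n) \<in> Ap.pw m"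
proof (induction m arbitrary: n)
  case 0
  then show ?case by simp
next
  case (Suc m)
  have dvd: "c (qfact b) \<in> Ap.pw k" if ab: "a \<le> b" "c (qfact a) \<in> Ap.pw k" for a b k
  proof -
    interpret I: ideal "Ap.pw k" A by (rule Ap.pw_ideal)
    obtain d where "qfact b = qfact a * qfact (b - a) * d" using qfact_dvd[OF ab(1)] by (auto simp: dvd_def)
    then have "c (qfact b) = c (qfact a) \<otimes> c (qfact (b - a) * d)" by (simp only: c_mult mult.assoc)
    then show ?thesis using ab(2) I.I_r_closed by simp
  qed
  \<comment> \<open>With l = p (m+1) - 1 the last factor (l+1)_q lies in (p, q-1), while (l)_q! is
    covered by induction.\<close>
  obtain l where l: "p * Suc m = Suc l" using p_pos by (metis Suc_pred mult_pos_pos zero_less_Suc)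
  have "p * m \<le> l" using l p_pos by (cases p) auto
  then have 1: "c (qfact l) \<in> Ap.pw m" by (rule Suc.IH)
  have 2: "c (qint (Suc l)) \<in> Ap.pw (Suc 0)"
  proof -
    interpret I: ideal "Ap.pw (Suc 0)" A by (rule Ap.pw_ideal)
    obtain g where "qint (Suc l) = [:int (Suc l):] + [:-1, 1:] * g" by (rule qint_in_pq)
    moreover have "[:int (Suc l):] = [:int p:] * [:int (Suc m):]" unfolding l[symmetric] by (simp add: algebra_simps)
    ultimately have "c (qint (Suc l)) = c [:int p:] \<otimes> c [:int (Suc m):] \<oplus> c [:-1, 1:] \<otimes> c g"
      by (simp only: c_add c_mult)
    then show ?thesis using Ap.P_pw Ap.Q_pw I.I_r_closed I.a_closed by simp
  qed
  have "c (qfact (Suc l)) \<in> Ap.pw (Suc m)"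
    using Ap.pw_mult[OF 2 1] by (simp add: qfact_Suc c_mult)
  then show ?case using dvd[of "p * Suc m" n] Suc.prems l by simp
qed

lemma hh_tp_pw: "p * m \<le> n \<Longrightarrow> hh (tp n) \<in> Dp.pw m"
  using scal_pw_D[OF c_qfact_pw, of m n "eps n"] by (simp add: hh_tp mon_eps)

lemma hh_pw: "z \<in> Up.pw m \<Longrightarrow> hh z \<in> Dp.pw m"
  by (rule pw_hom[where h = hh, OF Up.adic_pair_axioms Dp.adic_pair_axioms hh_hom]) (simp_all add: hh_con)

lemma hh_closed [simp, intro]: "u \<in> carrier U \<Longrightarrow> hh u \<in> carrier U"
  using ring_hom_closed[OF hh_hom] by simp

lemma hh_PIdl_pw:
  assumes "p * m \<le> n" "z \<in> PIdl\<^bsub>U\<^esub> (tp n)"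
  shows "hh z \<in> Dp.pw m"
proof -
  interpret I: ideal "Dp.pw m" D by (rule Dp.pw_ideal)
  obtain w where "w \<in> carrier U" "z = w \<otimes>\<^bsub>U\<^esub> tp n" using assms(2) by (auto simp: cgenideal_def)
  then show ?thesis
    using ring_hom_mult[OF hh_hom, of w "tp n"] I.I_l_closed[OF hh_tp_pw[OF assms(1)], of "hh w"] by simp
qed

end

section \<open>The Taylor expansion\<close>

text \<open>In a product of elements of (t) + L every term with a factor from L stays in L, so only
  the power of t counts.\<close>

lemma (in cring) principal_nilpotent:
  assumes "ideal L R" "t \<in> carrier R" "z \<in> ideal_pow R (PIdl t <+>\<^bsub>R\<^esub> L) k"
  shows "z \<in> PIdl (t [^] k) <+>\<^bsub>R\<^esub> L"
proof -
  interpret L: ideal L R by fact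
  have mem: "z \<in> PIdl s <+>\<^bsub>R\<^esub> L \<longleftrightarrow> (\<exists>a\<in>carrier R. \<exists>l\<in>L. z = a \<otimes> s \<oplus> l)" for z s
    unfolding set_add_def' cgenideal_def by blast
  interpret S: ideal "PIdl t <+>\<^bsub>R\<^esub> L" R
    by (intro add_ideals cgenideal_ideal assms)
  show ?thesis using assms(3)
  proof (induction k arbitrary: z)
    case 0
    have "z = z \<otimes> t [^] (0::nat) \<oplus> \<zero>" "z \<in> carrier R" using 0 by simp_all
    then show ?case unfolding mem using L.zero_closed by blast
  next
    case (Suc k)
    have "z \<in> ideal_pow R (PIdl t <+>\<^bsub>R\<^esub> L) k \<cdot>\<^bsub>R\<^esub> (PIdl t <+>\<^bsub>R\<^esub> L)" using Suc.prems by simp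
    then show ?case
    proof induction
      case (prod i j)
      obtain a l where a: "a \<in> carrier R" "l \<in> L" "i = a \<otimes> t [^] k \<oplus> l" using Suc.IH[OF prod(1)] unfolding mem by blast
      obtain b l' where b: "b \<in> carrier R" "l' \<in> L" "j = b \<otimes> t \<oplus> l'" using prod(2) unfolding mem by blast
      have c: "l \<in> carrier R" "l' \<in> carrier R" using a b by auto
      have "i \<otimes> j = (a \<otimes> b) \<otimes> t [^] Suc k \<oplus> ((a \<otimes> t [^] k) \<otimes> l' \<oplus> l \<otimes> (b \<otimes> t \<oplus> l'))"
        unfolding a(3) b(3) using a(1) b(1) c assms(2) by (simp add: l_distr r_distr m_ac a_ac)
      moreover have "(a \<otimes> t [^] k) \<otimes> l' \<oplus> l \<otimes> (b \<otimes> t \<oplus> l') \<in> L"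
        using a b c assms(2) by (intro L.a_closed L.I_l_closed L.I_r_closed) auto
      ultimately show ?case unfolding mem using a b by blast
    next
      case (sum s1 s2)
      interpret T: ideal "PIdl (t [^] Suc k) <+>\<^bsub>R\<^esub> L" R
        using assms by (intro add_ideals cgenideal_ideal nat_pow_closed)
      show ?case using sum by (intro T.a_closed)
    qed
  qed
qed

lemma (in cring) principal_nilpotent':
  assumes "ideal L R" "t \<in> carrier R" "t [^] (k::nat) \<in> L"
  shows "ideal_pow R (PIdl t <+>\<^bsub>R\<^esub> L) k \<subseteq> L"
proof
  interpret L: ideal L R by fact
  fix z assume "z \<in> ideal_pow R (PIdl t <+>\<^bsub>R\<^esub> L) k"
  then have "z \<in> PIdl (t [^] k) <+>\<^bsub>R\<^esub> L" by (rule principal_nilpotent[OF assms(1,2)])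
  then obtain a l where "a \<in> carrier R" "l \<in> L" "z = a \<otimes> t [^] k \<oplus> l"
    unfolding set_add_def' cgenideal_def by blast
  then show "z \<in> L" using assms(3) L.I_l_closed by (simp add: L.a_closed)
qed

lemma (in ring) ideal_add_supsets:
  assumes "ideal I R" "ideal L R"
  shows "I \<subseteq> I <+>\<^bsub>R\<^esub> L" "L \<subseteq> I <+>\<^bsub>R\<^esub> L"
proof -
  interpret I: ideal I R by fact
  interpret L: ideal L R by fact
  show "I \<subseteq> I <+>\<^bsub>R\<^esub> L"
  proof
    fix a assume "a \<in> I"
    then have "a = a \<oplus> \<zero>" by simp
    then show "a \<in> I <+>\<^bsub>R\<^esub> L" unfolding set_add_def' using \<open>a \<in> I\<close> L.zero_closed by blast
  qed
  show "L \<subseteq> I <+>\<^bsub>R\<^esub> L"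
  proof
    fix a assume "a \<in> L"
    then have "a = \<zero> \<oplus> a" by simp
    then show "a \<in> I <+>\<^bsub>R\<^esub> L" unfolding set_add_def' using \<open>a \<in> L\<close> I.zero_closed by blast
  qed
qed

lemma (in ring) ideal_add_subset:
  assumes "ideal K R" "I \<subseteq> K" "L \<subseteq> K"
  shows "I <+>\<^bsub>R\<^esub> L \<subseteq> K"
proof -
  interpret K: ideal K R by fact
  show ?thesis unfolding set_add_def' using assms(2,3) K.a_closed by blast
qed

text \<open>P and Q are preimages in R of p and q - 1. By \<open>c_eta\<close> the scalars from
  \<int>[q] come from R, so maps fixing the image of R fix q.\<close>

locale taylor = adic_alg A c x p + E: etale_algebra R A \<eta> x P Q
  for A :: "('a, 'm) ring_scheme" (structure) and c :: "int poly \<Rightarrow> 'a" and x :: 'a and p :: nat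
    and R :: "('r, 'k) ring_scheme" and \<eta> :: "'r \<Rightarrow> 'a" and P Q :: 'r +
  assumes eta_P: "\<eta> P = c [:int p:]" and eta_Q: "\<eta> Q = c [:-1, 1:]"
    and c_eta: "\<exists>r\<in>carrier R. c f = \<eta> r"
begin

text \<open>The ideal (\<xi>) + \<open>Lid m m\<close>, modulo which a lift has to agree with the
  inclusion of constants.\<close>

definition Ndl :: "nat \<Rightarrow> (nat \<Rightarrow> 'a) set" where
  "Ndl m = PIdl\<^bsub>U\<^esub> X <+>\<^bsub>U\<^esub> Lid m m"

lemma PIdl_X_ideal: "ideal (PIdl\<^bsub>U\<^esub> X) U"
  by (intro U.P.cgenideal_ideal X_closed)

lemma PIdl_tp_ideal: "ideal (PIdl\<^bsub>U\<^esub> (tp n)) U"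
  by (intro U.P.cgenideal_ideal tp_closed)

lemma Ndl_ideal: "ideal (Ndl m) U"
  unfolding Ndl_def by (intro U.P.add_ideals PIdl_X_ideal Lid_ideal)

lemma Lid_Ndl: "Lid m m \<subseteq> Ndl m"
  unfolding Ndl_def by (rule U.P.ideal_add_supsets[OF PIdl_X_ideal Lid_ideal])

lemma X_Ndl: "X \<in> Ndl m"
proof -
  have "X \<in> PIdl\<^bsub>U\<^esub> X" by (rule U.P.cgenideal_self) simp
  then show ?thesis unfolding Ndl_def using U.P.ideal_add_supsets(1)[OF PIdl_X_ideal Lid_ideal] by blast
qed

text \<open>Polynomials are coded by coefficient lists, as the lifting lemma demands.\<close>

definition decU :: "'a list \<Rightarrow> nat \<Rightarrow> 'a" where
  "decU l = (\<lambda>i. if i < length l then l ! i else \<zero>)"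

lemma decU: "carrier U \<subseteq> range decU"
proof
  fix u assume "u \<in> carrier U"
  then obtain N where N: "\<And>n. n > N \<Longrightarrow> u n = \<zero>" by (auto simp: U_carrier)
  have "u = decU (map u [0..<Suc N])"
    using N by (auto simp: decU_def fun_eq_iff simp del: upt_Suc)
  then show "u \<in> range decU" by blast
qed

lemma con_hom_mod: "ideal L U \<Longrightarrow> hom_mod A U L con"
  by (rule ideal.hom_mod_ring_hom[OF _ con_hom_U]) (auto intro: ring_axioms)

definition theta_cond :: "nat \<Rightarrow> ('a \<Rightarrow> nat \<Rightarrow> 'a) \<Rightarrow> bool" where
  "theta_cond m u \<longleftrightarrow> hom_mod A U (Lid m m) u \<and> (\<forall>r\<in>carrier R. eqmod U (Lid m m) (u (\<eta> r)) (con (\<eta> r))) \<and>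
     eqmod U (Lid m m) (u x) (con x \<oplus>\<^bsub>U\<^esub> X) \<and> (\<forall>a\<in>carrier A. eqmod U (Ndl m) (u a) (con a))"

lemma theta_lift:
  "\<exists>u. theta_cond m u"
  "theta_cond m u \<Longrightarrow> theta_cond m u' \<Longrightarrow> a \<in> carrier A \<Longrightarrow> eqmod U (Lid m m) (u a) (u' a)"
proof -
  have nilp: "ideal_pow U (Ndl m) (m * m) \<subseteq> Lid m m"
    unfolding Ndl_def by (rule U.P.principal_nilpotent'[OF Lid_ideal X_closed X_pow_Lid])
  have s: "con x \<oplus>\<^bsub>U\<^esub> X \<in> carrier U" by simp
  have "con x \<oplus>\<^bsub>U\<^esub> X \<ominus>\<^bsub>U\<^esub> con x = X"
    using U.P.a_comm[of "con x" X] by (simp add: U.P.minus_eq U.P.a_assoc U.P.r_neg)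
  then have s': "con x \<oplus>\<^bsub>U\<^esub> X \<ominus>\<^bsub>U\<^esub> con x \<in> Ndl m" using X_Ndl by simp
  have pw: "ideal_pow U (Idl\<^bsub>U\<^esub> {con (\<eta> P), con (\<eta> Q)}) m \<subseteq> Lid m m"
    unfolding eta_P eta_Q using pw_Lid[of m m] by (simp add: Up.pw_def)
  note lift = E.lift_problem[OF U.UP_cring decU Lid_ideal Ndl_ideal Lid_Ndl nilp con_hom_mod[OF Lid_ideal] s s' pw]
  show "\<exists>u. theta_cond m u" unfolding theta_cond_def by (rule lift(1))
  show "theta_cond m u \<Longrightarrow> theta_cond m u' \<Longrightarrow> a \<in> carrier A \<Longrightarrow> eqmod U (Lid m m) (u a) (u' a)"
    unfolding theta_cond_def by (rule lift(2)) blast+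
qed

definition th :: "nat \<Rightarrow> 'a \<Rightarrow> nat \<Rightarrow> 'a" where
  "th m = (SOME u. theta_cond m u)"

lemma th: "theta_cond m (th m)"
  unfolding th_def by (rule someI_ex[OF theta_lift(1)])

lemma th_closed [simp, intro]: "a \<in> carrier A \<Longrightarrow> th m a \<in> carrier U"
  by (rule hom_modD(1)[OF th[unfolded theta_cond_def, THEN conjunct1]])

lemma Ndl_antimono: "n \<le> m \<Longrightarrow> Ndl m \<subseteq> Ndl n"
proof -
  assume "n \<le> m"
  then have "Lid m m \<subseteq> Ndl n" using Lid_antimono[of n m n m] Lid_Ndl[of n] by blast
  moreover have "PIdl\<^bsub>U\<^esub> X \<subseteq> Ndl n"
    unfolding Ndl_def by (rule U.P.ideal_add_supsets[OF PIdl_X_ideal Lid_ideal])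
  ultimately show ?thesis
    unfolding Ndl_def[of m] by (intro U.P.ideal_add_subset Ndl_ideal)
qed

lemma theta_cond_antimono:
  assumes "theta_cond m u" "n \<le> m"
  shows "theta_cond n u"
proof -
  have L: "Lid m m \<subseteq> Lid n n" using Lid_antimono assms(2) by blast
  have u: "hom_mod A U (Lid m m) u" "eqmod U (Lid m m) (u x) (con x \<oplus>\<^bsub>U\<^esub> X)"
    "\<And>r. r \<in> carrier R \<Longrightarrow> eqmod U (Lid m m) (u (\<eta> r)) (con (\<eta> r))"
    "\<And>a. a \<in> carrier A \<Longrightarrow> eqmod U (Ndl m) (u a) (con a)"
    using assms(1) unfolding theta_cond_def by simp_all
  show ?thesis
    unfolding theta_cond_def
    by (intro conjI ballI hom_mod_mono[OF u(1) L] eqmod_mono[OF u(2) L] eqmod_mono[OF u(3) L]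
        eqmod_mono[OF u(4) Ndl_antimono[OF assms(2)]])
qed

lemma th_compat: "n \<le> m \<Longrightarrow> a \<in> carrier A \<Longrightarrow> eqmod U (Lid n n) (th m a) (th n a)"
  by (rule theta_lift(2)[OF theta_cond_antimono[OF th] th])

lemma th_coords:
  "\<exists>v. (\<forall>k. v k \<in> carrier A) \<and> (a \<in> carrier A \<longrightarrow> eqmod U (Lid m m) (th m a) (nsum 0 v m))"
proof (cases "a \<in> carrier A")
  case True
  obtain v N where v: "\<And>k. v k \<in> carrier A" "\<And>M. M \<ge> N \<Longrightarrow> th m a = nsum 0 v M"
    using newton_exists'[OF oneideal th_closed[OF True] U_coeff[OF th_closed[OF True]]] by metis
  have "eqmod U (PIdl\<^bsub>U\<^esub> (tp m)) (th m a) (nsum 0 v m)"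
    using nsum_high[OF v(1), of m "max m N"] v(2)[of "max m N"] by simp
  then have "eqmod U (Lid m m) (th m a) (nsum 0 v m)" by (rule eqmod_mono[OF _ PIdl_Lid])
  then show ?thesis using v(1) by blast
qed auto

definition vc :: "nat \<Rightarrow> 'a \<Rightarrow> nat \<Rightarrow> 'a" where
  "vc m a = (SOME v. (\<forall>k. v k \<in> carrier A) \<and> (a \<in> carrier A \<longrightarrow> eqmod U (Lid m m) (th m a) (nsum 0 v m)))"

lemma vc_closed [simp, intro]: "vc m a k \<in> carrier A"
  and vc_th: "a \<in> carrier A \<Longrightarrow> eqmod U (Lid m m) (th m a) (nsum 0 (vc m a) m)"
  using someI_ex[OF th_coords[of a m]] unfolding vc_def by blast+

text \<open>Consecutive lifts agree modulo \<open>Lid m m\<close> by uniqueness, and such a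
  congruence determines the first m Newton coefficients modulo (p, q-1)^m.\<close>

lemma vc_compat:
  assumes "a \<in> carrier A" "k < m"
  shows "eqmod A (Ap.pw m) (vc (Suc m) a k) (vc m a k)"
proof -
  interpret L: ideal "Lid m m" U by (rule Lid_ideal)
  have "eqmod U (Lid m m) (nsum 0 (vc (Suc m) a) m) (nsum 0 (vc (Suc m) a) (Suc m))"
    by (rule L.eqmod_sym[OF eqmod_mono[OF nsum_high PIdl_Lid]]) auto
  moreover have "eqmod U (Lid m m) (nsum 0 (vc (Suc m) a) (Suc m)) (th (Suc m) a)"
    by (rule L.eqmod_sym[OF eqmod_mono[OF vc_th[OF assms(1)] Lid_antimono]]) simp_all
  ultimately have 1: "eqmod U (Lid m m) (nsum 0 (vc (Suc m) a) m) (th (Suc m) a)"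
    by (rule L.eqmod_trans)
  have "eqmod U (Lid m m) (nsum 0 (vc (Suc m) a) m) (nsum 0 (vc m a) m)"
    by (rule L.eqmod_trans[OF 1 L.eqmod_trans[OF th_compat[OF _ assms(1)] vc_th[OF assms(1)]]]) simp
  then have "nsum 0 (\<lambda>k. vc (Suc m) a k \<ominus> vc m a k) m \<in> Lid m m"
    by (subst nsum_diff) (auto simp: eqmod_def)
  then have "vc (Suc m) a k \<ominus> vc m a k \<in> Ap.pw m"
    by (rule nsum_Lid[where v = "\<lambda>k. vc (Suc m) a k \<ominus> vc m a k", OF _ _ assms(2), rotated]) simp
  then show ?thesis by (simp add: eqmod_def)
qed

lemma tc_exists:
  assumes "a \<in> carrier A"
  shows "\<exists>t. t \<in> carrier A \<and> (\<forall>m>k. eqmod A (Ap.pw m) t (vc m a k))"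
proof -
  \<comment> \<open>The coefficient of index k is controlled only from level k + 1 on. The maximum
    freezes the sequence below that level and makes it Cauchy throughout.\<close>
  have "eqmod A (Ap.pw m) (vc (max (Suc m) (Suc k)) a k) (vc (max m (Suc k)) a k)" for m
  proof (cases "m > k")
    case True
    then have "max (Suc m) (Suc k) = Suc m" "max m (Suc k) = m" by auto
    then show ?thesis using vc_compat[OF assms True] by simp
  next
    case False
    then have "max (Suc m) (Suc k) = Suc k" "max m (Suc k) = Suc k" by auto
    then show ?thesis by (simp add: ideal.eqmod_refl[OF Ap.pw_ideal])
  qed
  then obtain t where t: "t \<in> carrier A" "\<And>m. eqmod A (Ap.pw m) t (vc (max m (Suc k)) a k)"
    using Ap.limit_exists[of "\<lambda>m. vc (max m (Suc k)) a k"] by blast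
  have "eqmod A (Ap.pw m) t (vc m a k)" if "m > k" for m
    using t(2)[of m] that by (simp add: max_absorb1 Suc_le_eq)
  then show ?thesis using t(1) by blast
qed

text \<open>\<open>tc a k\<close> is the coefficient of \<open>\<xi>\<^sup>(\<^sup>k\<^sup>)\<close> in the Taylor expansion of \<open>a\<close>.\<close>

definition tc :: "'a \<Rightarrow> nat \<Rightarrow> 'a" where
  "tc a k = (if a \<in> carrier A then SOME t. t \<in> carrier A \<and> (\<forall>m>k. eqmod A (Ap.pw m) t (vc m a k)) else \<zero>)"

lemma tc_closed [simp, intro]: "tc a k \<in> carrier A"
  using someI_ex[OF tc_exists, of a k] by (auto simp: tc_def)

lemma tc_vc: "a \<in> carrier A \<Longrightarrow> k < m \<Longrightarrow> eqmod A (Ap.pw m) (tc a k) (vc m a k)"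
  using someI_ex[OF tc_exists, of a k] by (auto simp: tc_def)

text \<open>The Taylor expansion truncated before \<xi>^(n), with coefficients that depend neither
  on n nor on a level of approximation.\<close>

definition T :: "nat \<Rightarrow> 'a \<Rightarrow> nat \<Rightarrow> 'a" where
  "T n a = nsum 0 (tc a) n"

lemma T_closed [simp, intro]: "T n a \<in> carrier U"
  by (simp add: T_def nsum_closed)

lemma nsum_pw:
  assumes "\<And>k. k < n \<Longrightarrow> eqmod A (Ap.pw m) (v k) (w k)"
  shows "eqmod U (Up.pw m) (nsum i v n) (nsum i w n)"
proof -
  interpret I: ideal "Up.pw m" U by (rule Up.pw_ideal)
  interpret J: ideal "Ap.pw m" A by (rule Ap.pw_ideal)
  show ?thesis using assms
  proof (induction n)
    case 0
    show ?case unfolding nsum_0 by (rule I.eqmod_refl) simp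
  next
    case (Suc n)
    have vw: "v n \<in> carrier A" "w n \<in> carrier A" "v n \<ominus> w n \<in> Ap.pw m"
      using Suc.prems[of n] by (auto simp: eqmod_def)
    have cs: "con (v n) \<ominus>\<^bsub>U\<^esub> con (w n) = con (v n \<ominus> w n)"
      using vw by (simp add: a_minus_def U.P.minus_eq con_def)
    have "eqmod U (Up.pw m) (con (v n)) (con (w n))"
      using vw con_pw_U[OF vw(3)] unfolding eqmod_def cs by simp
    then have "eqmod U (Up.pw m) (con (v n) \<otimes>\<^bsub>U\<^esub> tps i n) (con (w n) \<otimes>\<^bsub>U\<^esub> tps i n)"
      by (intro I.eqmod_mult I.eqmod_refl tps_closed)
    then have "eqmod U (Up.pw m) (scal (v n) (tps i n)) (scal (w n) (tps i n))"
      using vw by (simp add: con_U)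
    then show ?case unfolding nsum_Suc using Suc by (intro I.eqmod_add) auto
  qed
qed

lemma T_high: "n \<le> m \<Longrightarrow> eqmod U (PIdl\<^bsub>U\<^esub> (tp n)) (T m a) (T n a)"
  unfolding T_def by (rule nsum_high) auto

text \<open>Truncation costs a multiple of \<xi>^(n), replacing limits by approximate coefficients
  costs (p, q-1)^m, and \<open>Lid n m\<close> contains both errors.\<close>

lemma T_th:
  assumes "a \<in> carrier A" "n \<le> m"
  shows "eqmod U (Lid n m) (T n a) (th m a)"
proof -
  interpret L: ideal "Lid n m" U by (rule Lid_ideal)
  have L: "Lid m m \<subseteq> Lid n m" using Lid_antimono[OF assms(2) order_refl] .
  have 1: "eqmod U (Lid n m) (T n a) (T m a)"
    by (rule L.eqmod_sym[OF eqmod_mono[OF T_high[OF assms(2)] PIdl_Lid]])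
  have 2: "eqmod U (Lid n m) (T m a) (nsum 0 (vc m a) m)"
    unfolding T_def by (rule eqmod_mono[OF nsum_pw[OF tc_vc[OF assms(1)]] pw_Lid])
  have 3: "eqmod U (Lid n m) (nsum 0 (vc m a) m) (th m a)"
    by (rule L.eqmod_sym[OF eqmod_mono[OF vc_th[OF assms(1)] L]])
  show ?thesis by (rule L.eqmod_trans[OF 1 L.eqmod_trans[OF 2 3]])
qed

text \<open>Closedness of (\<xi>^(n)) merges the congruences at all levels m into one. The
  properties of the approximate lifts pass to \<open>T\<close> in this way.\<close>

lemma eqmod_tp_if_Lid:
  assumes "\<And>m. m \<ge> n \<Longrightarrow> m \<ge> 1 \<Longrightarrow> eqmod U (Lid n m) u v"
  shows "eqmod U (PIdl\<^bsub>U\<^esub> (tp n)) u v"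
proof -
  have uv: "u \<in> carrier U" "v \<in> carrier U" using assms[of "Suc n"] by (auto simp: eqmod_def)
  have "u \<ominus>\<^bsub>U\<^esub> v \<in> Lid n m" if "m \<ge> n" for m
    using assms[of "Suc m"] that Lid_antimono[of n n m "Suc m"] by (auto simp: eqmod_def)
  then have "u \<ominus>\<^bsub>U\<^esub> v \<in> PIdl\<^bsub>U\<^esub> (tp n)"
    using uv by (intro Inter_Lid) auto
  then show ?thesis using uv by (simp add: eqmod_def)
qed

lemma tp_1: "tp 1 = X"
proof -
  have "x \<ominus> c ([:0, 1:] ^ 0) \<otimes> x = \<zero>" by (simp add: minus_eq_zero_iff)
  then have "tfac 0 = X" by (simp add: tfac_def con_def U.monom_zero)
  then show ?thesis using tp_Suc[of 0] by simp
qed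

lemma T_hom_mod: "hom_mod A U (PIdl\<^bsub>U\<^esub> (tp n)) (T n)"
proof (rule hom_modI)
  note th_hom = th[unfolded theta_cond_def, THEN conjunct1]
  fix a b assume ab: "a \<in> carrier A" "b \<in> carrier A"
  show "T n a \<in> carrier U" by simp
  show "eqmod U (PIdl\<^bsub>U\<^esub> (tp n)) (T n (a \<oplus> b)) (T n a \<oplus>\<^bsub>U\<^esub> T n b)"
  proof (rule eqmod_tp_if_Lid)
    fix m assume m: "n \<le> m" "1 \<le> m"
    interpret L: ideal "Lid n m" U by (rule Lid_ideal)
    have L: "Lid m m \<subseteq> Lid n m" using Lid_antimono[OF m(1) order_refl] .
    have "eqmod U (Lid n m) (T n (a \<oplus> b)) (th m a \<oplus>\<^bsub>U\<^esub> th m b)"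
      using L.eqmod_trans[OF T_th[OF _ m(1)] eqmod_mono[OF hom_modD(2)[OF th_hom ab] L]] ab by simp
    moreover have "eqmod U (Lid n m) (th m a \<oplus>\<^bsub>U\<^esub> th m b) (T n a \<oplus>\<^bsub>U\<^esub> T n b)"
      using ab m by (intro L.eqmod_add L.eqmod_sym[OF T_th]) auto
    ultimately show "eqmod U (Lid n m) (T n (a \<oplus> b)) (T n a \<oplus>\<^bsub>U\<^esub> T n b)" by (rule L.eqmod_trans)
  qed
  show "eqmod U (PIdl\<^bsub>U\<^esub> (tp n)) (T n (a \<otimes> b)) (T n a \<otimes>\<^bsub>U\<^esub> T n b)"
  proof (rule eqmod_tp_if_Lid)
    fix m assume m: "n \<le> m" "1 \<le> m"
    interpret L: ideal "Lid n m" U by (rule Lid_ideal)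
    have L: "Lid m m \<subseteq> Lid n m" using Lid_antimono[OF m(1) order_refl] .
    have "eqmod U (Lid n m) (T n (a \<otimes> b)) (th m a \<otimes>\<^bsub>U\<^esub> th m b)"
      using L.eqmod_trans[OF T_th[OF _ m(1)] eqmod_mono[OF hom_modD(3)[OF th_hom ab] L]] ab by simp
    moreover have "eqmod U (Lid n m) (th m a \<otimes>\<^bsub>U\<^esub> th m b) (T n a \<otimes>\<^bsub>U\<^esub> T n b)"
      using ab m by (intro L.eqmod_mult L.eqmod_sym[OF T_th]) auto
    ultimately show "eqmod U (Lid n m) (T n (a \<otimes> b)) (T n a \<otimes>\<^bsub>U\<^esub> T n b)" by (rule L.eqmod_trans)
  qed
next
  show "eqmod U (PIdl\<^bsub>U\<^esub> (tp n)) (T n \<one>) \<one>\<^bsub>U\<^esub>"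
  proof (rule eqmod_tp_if_Lid)
    fix m assume m: "n \<le> m" "1 \<le> m"
    interpret L: ideal "Lid n m" U by (rule Lid_ideal)
    have L: "Lid m m \<subseteq> Lid n m" using Lid_antimono[OF m(1) order_refl] .
    show "eqmod U (Lid n m) (T n \<one>) \<one>\<^bsub>U\<^esub>"
      using L.eqmod_trans[OF T_th[OF _ m(1)] eqmod_mono[OF hom_modD(4)[OF th[unfolded theta_cond_def, THEN conjunct1]] L]] by simp
  qed
qed

lemma T_eta:
  assumes "r \<in> carrier R"
  shows "eqmod U (PIdl\<^bsub>U\<^esub> (tp n)) (T n (\<eta> r)) (con (\<eta> r))"
proof (rule eqmod_tp_if_Lid)
  fix m assume m: "n \<le> m" "1 \<le> m"
  have "eqmod U (Lid m m) (th m (\<eta> r)) (con (\<eta> r))" using th[of m] assms by (auto simp: theta_cond_def)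
  from ideal.eqmod_trans[OF Lid_ideal T_th[OF _ m(1)] eqmod_mono[OF this Lid_antimono[OF m(1) order_refl]]]
  show "eqmod U (Lid n m) (T n (\<eta> r)) (con (\<eta> r))" using assms by simp
qed

lemma T_x: "eqmod U (PIdl\<^bsub>U\<^esub> (tp n)) (T n x) (con x \<oplus>\<^bsub>U\<^esub> X)"
proof (rule eqmod_tp_if_Lid)
  fix m assume m: "n \<le> m" "1 \<le> m"
  have "eqmod U (Lid m m) (th m x) (con x \<oplus>\<^bsub>U\<^esub> X)" using th[of m] by (auto simp: theta_cond_def)
  from ideal.eqmod_trans[OF Lid_ideal T_th[OF _ m(1)] eqmod_mono[OF this Lid_antimono[OF m(1) order_refl]]]
  show "eqmod U (Lid n m) (T n x) (con x \<oplus>\<^bsub>U\<^esub> X)" by simp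
qed

lemma T_con:
  assumes "a \<in> carrier A" "1 \<le> n"
  shows "eqmod U (PIdl\<^bsub>U\<^esub> X) (T n a) (con a)"
proof -
  have "eqmod U (PIdl\<^bsub>U\<^esub> (tp 1)) (T n a) (con a)"
  proof (rule eqmod_tp_if_Lid)
    fix m :: nat assume m: "1 \<le> m" "1 \<le> m"
    interpret L: ideal "Lid 1 m" U by (rule Lid_ideal)
    have "Ndl m \<subseteq> Lid 1 m"
      unfolding Ndl_def tp_1[symmetric]
      by (intro U.P.ideal_add_subset Lid_ideal PIdl_Lid Lid_antimono m order_refl)
    moreover have "eqmod U (Ndl m) (th m a) (con a)" using th[of m] assms by (auto simp: theta_cond_def)
    ultimately have 1: "eqmod U (Lid 1 m) (th m a) (con a)" by (blast intro: eqmod_mono)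
    have 2: "eqmod U (Lid 1 m) (T n a) (T 1 a)"
      by (rule eqmod_mono[OF T_high[OF assms(2)] PIdl_Lid])
    show "eqmod U (Lid 1 m) (T n a) (con a)"
      by (rule L.eqmod_trans[OF 2 L.eqmod_trans[OF T_th[OF assms(1) m(1)] 1]])
  qed
  then show ?thesis by (simp only: tp_1)
qed

section \<open>The endomorphism \<open>\<sigma>\<close>\<close>

text \<open>Modulo (p, q-1)^m the element q - 1 is nilpotent, so uniqueness of lifts makes the two
  maps agree at every level; A is separated.\<close>

lemma A_hom_unique:
  assumes u: "u \<in> ring_hom A A" and u': "u' \<in> ring_hom A A"
    and "\<And>r. r \<in> carrier R \<Longrightarrow> u (\<eta> r) = \<eta> r" "\<And>r. r \<in> carrier R \<Longrightarrow> u' (\<eta> r) = \<eta> r" "u x = u' x"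
    and d: "\<And>a. a \<in> carrier A \<Longrightarrow> u a \<ominus> a \<in> PIdl (c [:-1, 1:])" "\<And>a. a \<in> carrier A \<Longrightarrow> u' a \<ominus> a \<in> PIdl (c [:-1, 1:])"
    and a: "a \<in> carrier A"
  shows "u a = u' a"
proof (rule Ap.eq_if_eqmod)
  fix m
  let ?t = "c [:-1, 1:]"
  let ?N = "PIdl ?t <+>\<^bsub>A\<^esub> Ap.pw m"
  interpret L: ideal "Ap.pw m" A by (rule Ap.pw_ideal)
  interpret T: ideal "PIdl ?t" A by (rule cgenideal_ideal) simp
  interpret N: ideal ?N A by (intro add_ideals cgenideal_ideal Ap.pw_ideal c_closed)
  have uc: "u a \<in> carrier A" "u' a \<in> carrier A" if "a \<in> carrier A" for a
    using ring_hom_closed[OF u that] ring_hom_closed[OF u' that] .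
  have "?t [^] m \<in> Ap.pw m" using Ap.pw_pow[OF Ap.Q_pw, of m] by simp
  then have nilp: "ideal_pow A ?N m \<subseteq> Ap.pw m"
    by (intro principal_nilpotent' Ap.pw_ideal c_closed)
  \<comment> \<open>Elements of A are coded by one-element lists.\<close>
  have hd: "carrier A \<subseteq> range hd"
  proof
    fix b :: 'a
    have "b = hd [b]" by simp
    then show "b \<in> range hd" by (rule range_eqI)
  qed
  have etac: "u' (\<eta> P) = c [:int p:]" "u' (\<eta> Q) = c [:-1, 1:]"
    using assms(4)[OF E.PQ_closed(1)] assms(4)[OF E.PQ_closed(2)] unfolding eta_P eta_Q .
  show "eqmod A (Ap.pw m) (u a) (u' a)"
  proof (rule E.lift_unique[where u = u' and u' = u and a = a and m = m, OF is_cring hd Ap.pw_ideal N.ideal_axioms ideal_add_supsets(2)[OF T.ideal_axioms L.ideal_axioms] nilp])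
    show "hom_mod A A (Ap.pw m) u'" "hom_mod A A (Ap.pw m) u"
      using u u' ring_axioms by (auto intro: L.hom_mod_ring_hom)
    show "ideal_pow A (Idl {u' (\<eta> P), u' (\<eta> Q)}) m \<subseteq> Ap.pw m"
      unfolding etac by (simp add: Ap.pw_def)
    show "eqmod A (Ap.pw m) (u (\<eta> r)) (u' (\<eta> r))" if "r \<in> carrier R" for r
      using assms(3,4) that by simp
    show "eqmod A (Ap.pw m) (u x) (u' x)" using assms(5) uc by simp
    show "eqmod A ?N (u b) (u' b)" if b: "b \<in> carrier A" for b
    proof -
      have "eqmod A (PIdl ?t) (u b) b" "eqmod A (PIdl ?t) (u' b) b"
        using d b uc by (auto simp: eqmod_def)
      then have "eqmod A (PIdl ?t) (u b) (u' b)" using T.eqmod_trans T.eqmod_sym by blast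
      then show ?thesis by (rule eqmod_mono[OF _ ideal_add_supsets(1)[OF T.ideal_axioms L.ideal_axioms]])
    qed
  qed (rule a)
qed

section \<open>Evaluation at \<xi> = (q^i - 1) x\<close>

text \<open>The point is the zero of \<xi> + x - q^i x, so evaluation kills \<xi>^(n) for all n >
  i.\<close>

definition evr :: "nat \<Rightarrow> (nat \<Rightarrow> 'a) \<Rightarrow> 'a" where
  "evr i = UnivPoly.eval A A id (c ([:0, 1:] ^ i) \<otimes> x \<ominus> x)"

lemma UAA: "UP_pre_univ_prop A A id"
  by (intro UP_pre_univ_prop.intro UP_cring.intro ring_hom_cringI2 cring_axioms) (auto simp: ring_hom_def)

lemma evr_hom: "evr i \<in> ring_hom U A"
  unfolding evr_def by (rule UP_pre_univ_prop.eval_ring_hom[OF UAA]) simp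

lemma evr_closed [simp, intro]: "u \<in> carrier U \<Longrightarrow> evr i u \<in> carrier A"
  using ring_hom_closed[OF evr_hom] .

lemma evr_con: "a \<in> carrier A \<Longrightarrow> evr i (con a) = a"
  unfolding evr_def con_def using UP_pre_univ_prop.eval_const[OF UAA, of "c ([:0, 1:] ^ i) \<otimes> x \<ominus> x" a] by simp

lemma evr_X: "evr i X = c ([:0, 1:] ^ i) \<otimes> x \<ominus> x"
  unfolding evr_def X_def using UP_pre_univ_prop.eval_monom1[OF UAA, of "c ([:0, 1:] ^ i) \<otimes> x \<ominus> x"] by simp

lemma evr_tfac: "evr i (tfac i) = \<zero>"
proof -
  have "evr i (tfac i) = (c ([:0, 1:] ^ i) \<otimes> x \<ominus> x) \<oplus> (x \<ominus> c ([:0, 1:] ^ i) \<otimes> x)"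
    unfolding tfac_def using ring_hom_add[OF evr_hom] by (simp add: evr_X evr_con)
  also have "\<dots> = \<zero>"
    by (simp add: minus_eq a_ac r_neg r_neg1 r_neg2)
  finally show ?thesis .
qed

lemma evr_tp:
  assumes "i < n" "z \<in> PIdl\<^bsub>U\<^esub> (tp n)"
  shows "evr i z = \<zero>"
proof -
  have "evr i (tp n) = \<zero>" using assms(1)
  proof (induction n)
    case (Suc n)
    have "evr i (tp (Suc n)) = evr i (tp n) \<otimes> evr i (tfac n)"
      unfolding tp_Suc by (rule ring_hom_mult[OF evr_hom]) auto
    then show ?case using Suc evr_tfac[of i] by (cases "i = n") auto
  qed simp
  moreover obtain w where "w \<in> carrier U" "z = w \<otimes>\<^bsub>U\<^esub> tp n" using assms(2) by (auto simp: cgenideal_def)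
  ultimately show ?thesis using ring_hom_mult[OF evr_hom, of w "tp n"] by simp
qed

text \<open>In the Newton basis that starts with \<open>tfac i\<close>, every term except the
  constant one is divisible by it; the constant term is therefore the value at the zero.\<close>

lemma evr_zero_tfac:
  assumes "u \<in> carrier U" "evr i u = \<zero>"
  shows "u \<in> PIdl\<^bsub>U\<^esub> (tfac i)"
proof -
  interpret I: ideal "PIdl\<^bsub>U\<^esub> (tfac i)" U by (intro U.P.cgenideal_ideal tfac_closed)
  obtain v N where v: "\<And>k. v k \<in> carrier A" "\<And>M. M \<ge> N \<Longrightarrow> u = nsum i v M"
    using newton_exists'[OF oneideal assms(1) U_coeff[OF assms(1)]] by metis
  have "eqmod U (PIdl\<^bsub>U\<^esub> (tfac i)) (nsum i v (Suc M)) (con (v 0))" for M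
  proof (induction M)
    case 0
    have "nsum i v (Suc 0) = con (v 0)"
      using v(1) con_U[of "v 0" "\<one>\<^bsub>U\<^esub>"] by (simp add: nsum_Suc)
    then show ?case using v(1) by simp
  next
    case (Suc M)
    have "tps i (Suc M) \<in> PIdl\<^bsub>U\<^esub> (tfac i)"
      unfolding tps_Suc_shift using I.I_r_closed U.P.cgenideal_self[of "tfac i"] by simp
    then have "scal (v (Suc M)) (tps i (Suc M)) \<in> PIdl\<^bsub>U\<^esub> (tfac i)"
      using I.I_l_closed[of "tps i (Suc M)" "con (v (Suc M))"] v(1) by (simp add: con_U)
    then have "eqmod U (PIdl\<^bsub>U\<^esub> (tfac i)) (nsum i v (Suc M) \<oplus>\<^bsub>U\<^esub> scal (v (Suc M)) (tps i (Suc M))) (con (v 0) \<oplus>\<^bsub>U\<^esub> \<zero>\<^bsub>U\<^esub>)"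
      using Suc I.eqmod_zero_iff by (intro I.eqmod_add) auto
    then show ?case using v(1) by (simp add: nsum_Suc[of _ _ "Suc M"])
  qed
  then have eq: "eqmod U (PIdl\<^bsub>U\<^esub> (tfac i)) u (con (v 0))" using v(2)[of "Suc N"] by simp
  have kill: "evr i z = \<zero>" if z: "z \<in> PIdl\<^bsub>U\<^esub> (tfac i)" for z
  proof -
    obtain w where "w \<in> carrier U" "z = w \<otimes>\<^bsub>U\<^esub> tfac i" using z unfolding cgenideal_def by blast
    then show ?thesis using ring_hom_mult[OF evr_hom, of w "tfac i"] evr_tfac[of i] by simp
  qed
  have "eqmod A {\<zero>} (evr i u) (evr i (con (v 0)))"
    by (rule eqmod_hom[OF U.P.ring_axioms ring_axioms evr_hom _ eq]) (simp add: kill)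
  then have "v 0 = \<zero>" using assms(2) v(1) by (simp add: eqmod_0_iff evr_con)
  then have "con (v 0) = \<zero>\<^bsub>U\<^esub>" by (simp add: con_def)
  then show ?thesis using eq I.eqmod_zero_iff by simp
qed

text \<open>This is the i-th power of \<sigma>, as \<open>sigma_pow\<close> shows. Length i + 1
  suffices because \<xi>^(i+1) vanishes at the point.\<close>

definition sg :: "nat \<Rightarrow> 'a \<Rightarrow> 'a" where
  "sg i a = evr i (T (Suc i) a)"

lemma sg_T:
  assumes "i < n"
  shows "evr i (T n a) = sg i a"
proof -
  have "eqmod A {\<zero>} (evr i (T n a)) (evr i (T (Suc i) a))"
    by (rule eqmod_hom[OF U.P.ring_axioms ring_axioms evr_hom _ T_high[of "Suc i" n a]])
      (use assms evr_tp[of i "Suc i"] in auto)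
  then show ?thesis by (simp add: eqmod_0_iff sg_def)
qed

lemma evr_eq:
  assumes "eqmod U (PIdl\<^bsub>U\<^esub> (tp (Suc i))) u v"
  shows "evr i u = evr i v"
proof -
  have "eqmod A {\<zero>} (evr i u) (evr i v)"
    by (rule eqmod_hom[OF U.P.ring_axioms ring_axioms evr_hom _ assms]) (use evr_tp[of i "Suc i"] in auto)
  then show ?thesis by (simp add: eqmod_0_iff)
qed

lemma sg_hom: "sg i \<in> ring_hom A A"
proof (rule ring_hom_memI)
  fix a b assume ab: "a \<in> carrier A" "b \<in> carrier A"
  show "sg i a \<in> carrier A" by (simp add: sg_def)
  show "sg i (a \<otimes> b) = sg i a \<otimes> sg i b"
    unfolding sg_def using evr_eq[OF hom_modD(3)[OF T_hom_mod ab]] ring_hom_mult[OF evr_hom] by simp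
  show "sg i (a \<oplus> b) = sg i a \<oplus> sg i b"
    unfolding sg_def using evr_eq[OF hom_modD(2)[OF T_hom_mod ab]] ring_hom_add[OF evr_hom] by simp
next
  show "sg i \<one> = \<one>"
    unfolding sg_def using evr_eq[OF hom_modD(4)[OF T_hom_mod]] ring_hom_one[OF evr_hom] by simp
qed

lemma sg_eta: "r \<in> carrier R \<Longrightarrow> sg i (\<eta> r) = \<eta> r"
  unfolding sg_def using evr_eq[OF T_eta] by (simp add: evr_con)

lemma sg_x: "sg i x = c ([:0, 1:] ^ i) \<otimes> x"
proof -
  have "sg i x = x \<oplus> (c ([:0, 1:] ^ i) \<otimes> x \<ominus> x)"
    unfolding sg_def using evr_eq[OF T_x] ring_hom_add[OF evr_hom] by (simp add: evr_con evr_X)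
  also have "\<dots> = c ([:0, 1:] ^ i) \<otimes> x"
    using a_lcomm[of x "c ([:0, 1:] ^ i) \<otimes> x" "\<ominus> x"] by (simp add: minus_eq r_neg)
  finally show ?thesis .
qed

lemma sg_cong:
  assumes a: "a \<in> carrier A"
  shows "sg i a \<ominus> a \<in> PIdl (c [:-1, 1:])"
proof -
  interpret I: ideal "PIdl (c [:-1, 1:])" A by (intro cgenideal_ideal c_closed)
  have "c ([:0, 1:] ^ i) \<ominus> \<one> = c [:-1, 1:] \<otimes> c (qint i)"
    using c_diff[of "[:0, 1:] ^ i" 1] by (simp only: c_mult[symmetric] qint_mult_q_minus_1 c_one)
  moreover have "c ([:0, 1:] ^ i) \<otimes> x \<ominus> x = (c ([:0, 1:] ^ i) \<ominus> \<one>) \<otimes> x"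
    by (simp add: minus_eq l_distr l_minus)
  ultimately have r: "c ([:0, 1:] ^ i) \<otimes> x \<ominus> x \<in> PIdl (c [:-1, 1:])"
    using I.I_r_closed cgenideal_self[of "c [:-1, 1:]"] by simp
  have kill: "evr i z \<in> PIdl (c [:-1, 1:])" if z: "z \<in> PIdl\<^bsub>U\<^esub> X" for z
  proof -
    obtain w where "w \<in> carrier U" "z = w \<otimes>\<^bsub>U\<^esub> X" using z unfolding cgenideal_def by blast
    then show ?thesis using ring_hom_mult[OF evr_hom, of w X] I.I_l_closed[OF r] by (simp add: evr_X)
  qed
  have "eqmod A (PIdl (c [:-1, 1:])) (evr i (T (Suc i) a)) (evr i (con a))"
    by (rule eqmod_hom[OF U.P.ring_axioms ring_axioms evr_hom kill T_con[OF a]]) simp_all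
  then show ?thesis using a by (simp add: eqmod_def sg_def evr_con)
qed

abbreviation sigma where "sigma \<equiv> q_endo R c A \<eta> x"

text \<open>Existence comes from the Taylor expansion, uniqueness from etaleness.\<close>

lemma sigma_eq: "sigma = restrict (sg 1) (carrier A)"
  unfolding q_endo_def
proof (rule the_equality)
  show "restrict (sg 1) (carrier A) \<in> ring_hom A A \<and> restrict (sg 1) (carrier A) \<in> extensional (carrier A) \<and>
     (\<forall>r\<in>carrier R. restrict (sg 1) (carrier A) (\<eta> r) = \<eta> r) \<and>
     restrict (sg 1) (carrier A) x = c [:0, 1:] \<otimes> x \<and>
     (\<forall>a\<in>carrier A. restrict (sg 1) (carrier A) a \<ominus> a \<in> PIdl (c [:-1, 1:]))"
    using sg_hom[of 1] sg_eta[of _ 1] sg_x[of 1] sg_cong[of _ 1] by (auto simp: ring_hom_def)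
next
  fix s assume s: "s \<in> ring_hom A A \<and> s \<in> extensional (carrier A) \<and> (\<forall>r\<in>carrier R. s (\<eta> r) = \<eta> r) \<and>
     s x = c [:0, 1:] \<otimes> x \<and> (\<forall>a\<in>carrier A. s a \<ominus> a \<in> PIdl (c [:-1, 1:]))"
  have "s a = restrict (sg 1) (carrier A) a" if a: "a \<in> carrier A" for a
    using A_hom_unique[of s "sg 1" a] s sg_hom[of 1] sg_eta[of _ 1] sg_x[of 1] sg_cong[of _ 1] a by simp
  then show "s = restrict (sg 1) (carrier A)" using s by (intro extensionalityI[of s "carrier A"]) auto
qed

lemma sigma_hom: "sigma \<in> ring_hom A A"
  unfolding sigma_eq using sg_hom[of 1] by (auto simp: ring_hom_def)

lemma sigma_pow_hom: "sigma ^^ i \<in> ring_hom A A"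
proof (induction i)
  case (Suc i)
  then show ?case unfolding funpow.simps by (rule ring_hom_trans[OF _ sigma_hom])
qed (auto simp: ring_hom_def)

text \<open>Both sides fix the image of R, send x to q^i x and are the identity modulo q - 1. The
  iteration on x uses that \<sigma> fixes the scalars from \<int>[q].\<close>

lemma sigma_pow:
  assumes "a \<in> carrier A"
  shows "(sigma ^^ i) a = sg i a"
proof -
  interpret I: ideal "PIdl (c [:-1, 1:])" A by (intro cgenideal_ideal c_closed)
  have eta: "sigma (\<eta> r) = \<eta> r" if "r \<in> carrier R" for r
    using sg_eta[OF that, of 1] that by (simp add: sigma_eq)
  have eta_i: "(sigma ^^ i) (\<eta> r) = \<eta> r" if "r \<in> carrier R" for r i
    using that by (induction i) (simp_all add: eta)
  have sx: "sigma x = c [:0, 1:] \<otimes> x" using sg_x[of 1] by (simp add: sigma_eq)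
  have sc: "sigma (c f) = c f" for f using c_eta[of f] eta by auto
  have x_i: "(sigma ^^ i) x = c ([:0, 1:] ^ i) \<otimes> x" for i
  proof (induction i)
    case (Suc i)
    have "(sigma ^^ Suc i) x = c ([:0, 1:] ^ i) \<otimes> (c [:0, 1:] \<otimes> x)"
      using Suc ring_hom_mult[OF sigma_hom, of "c ([:0, 1:] ^ i)" x] by (simp add: sc sx)
    also have "\<dots> = c ([:0, 1:] ^ Suc i) \<otimes> x"
      by (simp only: power_Suc2 c_mult m_assoc c_closed x_closed)
    finally show ?case .
  qed simp
  have closed: "(sigma ^^ i) a \<in> carrier A" if "a \<in> carrier A" for a i
    using ring_hom_closed[OF sigma_pow_hom that] .
  have cong: "eqmod A (PIdl (c [:-1, 1:])) ((sigma ^^ i) a) a" if a: "a \<in> carrier A" for a i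
  proof (induction i)
    case (Suc i)
    have "eqmod A (PIdl (c [:-1, 1:])) (sigma ((sigma ^^ i) a)) ((sigma ^^ i) a)"
      using sg_cong[OF closed[OF a], of 1 i] closed[OF a] ring_hom_closed[OF sigma_hom]
      unfolding eqmod_def by (simp add: sigma_eq)
    then show ?case using Suc I.eqmod_trans by simp
  qed (use a in simp)
  show ?thesis
    by (rule A_hom_unique[OF sigma_pow_hom sg_hom])
      (use eta_i sg_eta x_i sg_x cong sg_cong assms in \<open>auto simp: eqmod_def\<close>)
qed

end

section \<open>Tensor products\<close>

lemma (in ring) quotient_universal:
  assumes "ideal K R" "ring C" "L \<in> ring_hom R C" "\<And>u. u \<in> K \<Longrightarrow> L u = \<zero>\<^bsub>C\<^esub>"
  obtains h where "h \<in> ring_hom (R Quot K) C" "\<And>u. u \<in> carrier R \<Longrightarrow> h (K +> u) = L u"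
proof -
  interpret K: ideal K R by fact
  interpret C: ring C by fact
  have eq: "L u = L v" if "u \<in> carrier R" "v \<in> carrier R" "K +> u = K +> v" for u v
  proof -
    have "eqmod R K u v" using that K.eqmod_coset by blast
    then have "eqmod C {\<zero>\<^bsub>C\<^esub>} (L u) (L v)"
      by (rule eqmod_hom[OF ring_axioms C.ring_axioms assms(3), rotated]) (simp add: assms(4))
    then show ?thesis by (simp add: C.eqmod_0_iff)
  qed
  define h where "h z = L (SOME u. u \<in> carrier R \<and> z = K +> u)" for z
  have h: "h (K +> u) = L u" if "u \<in> carrier R" for u
  proof -
    have "\<exists>v. v \<in> carrier R \<and> K +> u = K +> v" using that by blast
    from someI_ex[OF this] show ?thesis unfolding h_def using eq that by metis
  qed
  have rep: "\<exists>u\<in>carrier R. z = K +> u" if "z \<in> carrier (R Quot K)" for z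
    using that unfolding FactRing_def A_RCOSETS_def' by auto
  note q = K.rcos_ring_hom
  have "h \<in> ring_hom (R Quot K) C"
  proof (rule ring_hom_memI)
    fix y z assume "y \<in> carrier (R Quot K)" "z \<in> carrier (R Quot K)"
    then obtain u v where uv: "u \<in> carrier R" "y = K +> u" "v \<in> carrier R" "z = K +> v"
      using rep by metis
    show "h y \<in> carrier C" using uv ring_hom_closed[OF assms(3)] h by simp
    have "y \<otimes>\<^bsub>R Quot K\<^esub> z = K +> (u \<otimes> v)" "y \<oplus>\<^bsub>R Quot K\<^esub> z = K +> (u \<oplus> v)"
      using ring_hom_mult[OF q uv(1,3)] ring_hom_add[OF q uv(1,3)] uv by simp_all
    then show "h (y \<otimes>\<^bsub>R Quot K\<^esub> z) = h y \<otimes>\<^bsub>C\<^esub> h z" "h (y \<oplus>\<^bsub>R Quot K\<^esub> z) = h y \<oplus>\<^bsub>C\<^esub> h z"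
      using h uv ring_hom_mult[OF assms(3)] ring_hom_add[OF assms(3)] by simp_all
  next
    have "\<one>\<^bsub>R Quot K\<^esub> = K +> \<one>" using ring_hom_one[OF q] by simp
    then show "h \<one>\<^bsub>R Quot K\<^esub> = \<one>\<^bsub>C\<^esub>" using h ring_hom_one[OF assms(3)] by simp
  qed
  then show thesis using that h by blast
qed

context abelian_group
begin

lemma int_add_pow_closed: "a \<in> carrier G \<Longrightarrow> [(k :: int)] \<cdot>\<^bsub>G\<^esub> a \<in> carrier G"
  using group.int_pow_closed[OF a_group, of a k] by (simp add: add_pow_def)

lemma int_add_pow_add: "a \<in> carrier G \<Longrightarrow> [(i + j :: int)] \<cdot>\<^bsub>G\<^esub> a = [i] \<cdot>\<^bsub>G\<^esub> a \<oplus> [j] \<cdot>\<^bsub>G\<^esub> a"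
  using group.int_pow_mult[OF a_group, of a i j] by (simp add: add_pow_def)

lemma int_add_pow_mult: "a \<in> carrier G \<Longrightarrow> [(i * j :: int)] \<cdot>\<^bsub>G\<^esub> a = [i] \<cdot>\<^bsub>G\<^esub> ([j] \<cdot>\<^bsub>G\<^esub> a)"
  using group.int_pow_pow[OF a_group, of a j i] by (simp add: add_pow_def mult.commute)

lemma int_add_pow_0: "[(0 :: int)] \<cdot>\<^bsub>G\<^esub> a = \<zero>"
  by (simp add: add_pow_def)

lemma int_add_pow_1: "a \<in> carrier G \<Longrightarrow> [(1 :: int)] \<cdot>\<^bsub>G\<^esub> a = a"
  using group.int_pow_1[OF a_group, of a] by (simp add: add_pow_def)

end

section \<open>Monoid algebras over the integers\<close>

locale int_monoid_algebra = Group.comm_monoid G for G (structure)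
begin

abbreviation F where "F \<equiv> monoid_algebra \<Z> G"
abbreviation sing where "sing \<equiv> single \<Z>"

lemma F_carrier: "u \<in> carrier F \<longleftrightarrow> (\<forall>g. g \<notin> carrier G \<longrightarrow> u g = 0) \<and> finite {g. u g \<noteq> 0}"
  by (simp add: monoid_algebra_def)

lemma F_add: "u \<oplus>\<^bsub>F\<^esub> v = (\<lambda>g. u g + v g)" and F_zero: "\<zero>\<^bsub>F\<^esub> = (\<lambda>g. 0)"
  by (simp_all add: monoid_algebra_def)

lemma sing_apply: "sing g n h = (if h = g then n else 0)"
  by (simp add: single_def)

lemma F_one: "\<one>\<^bsub>F\<^esub> = sing \<one> 1"
  by (simp add: monoid_algebra_def single_def fun_eq_iff)

lemma sing_closed [simp, intro]: "g \<in> carrier G \<Longrightarrow> sing g n \<in> carrier F"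
  unfolding F_carrier sing_apply by auto

lemma sing_add: "sing g n \<oplus>\<^bsub>F\<^esub> sing g m = sing g (n + m)"
  by (simp add: F_add sing_apply fun_eq_iff)

text \<open>Any finite sets containing the supports may serve as index sets, which provides common
  ones for several elements.\<close>

lemma F_mult:
  assumes "finite S" "finite T" "{g. u g \<noteq> 0} \<subseteq> S" "{g. v g \<noteq> 0} \<subseteq> T"
  shows "(u \<otimes>\<^bsub>F\<^esub> v) k = (\<Sum>g\<in>S. \<Sum>h\<in>T. if g \<otimes> h = k then u g * v h else 0)"
proof -
  let ?W = "{(g, h). u g \<noteq> 0 \<and> v h \<noteq> 0 \<and> g \<otimes> h = k}"
  have W: "?W \<subseteq> S \<times> T" using assms by auto
  have "(u \<otimes>\<^bsub>F\<^esub> v) k = (\<Sum>(g, h)\<in>?W. u g * v h)"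
    by (simp add: monoid_algebra_def int_finsum_eq)
  also have "\<dots> = (\<Sum>(g, h)\<in>S \<times> T. if g \<otimes> h = k then u g * v h else 0)"
    by (rule sum.mono_neutral_cong_left) (use assms W in auto)
  also have "\<dots> = (\<Sum>g\<in>S. \<Sum>h\<in>T. if g \<otimes> h = k then u g * v h else 0)"
    by (simp add: sum.cartesian_product)
  finally show ?thesis .
qed

lemma F_add_closed:
  assumes "u \<in> carrier F" "v \<in> carrier F"
  shows "u \<oplus>\<^bsub>F\<^esub> v \<in> carrier F"
proof -
  have "{g. u g + v g \<noteq> 0} \<subseteq> {g. u g \<noteq> 0} \<union> {g. v g \<noteq> 0}" by auto
  then have "finite {g. u g + v g \<noteq> 0}"
    using assms unfolding F_carrier by (meson finite_UnI finite_subset)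
  then show ?thesis using assms unfolding F_add F_carrier by auto
qed

lemma F_induct [consumes 1, case_names sing add]:
  assumes "u \<in> carrier F" "\<And>g n. g \<in> carrier G \<Longrightarrow> Pr (sing g n)"
    and "\<And>u v. u \<in> carrier F \<Longrightarrow> v \<in> carrier F \<Longrightarrow> Pr u \<Longrightarrow> Pr v \<Longrightarrow> Pr (u \<oplus>\<^bsub>F\<^esub> v)"
  shows "Pr u"
proof -
  have "Pr u" if "finite S" "u \<in> carrier F" "{g. u g \<noteq> 0} \<subseteq> S" for S u
    using that
  proof (induction S arbitrary: u rule: finite_induct)
    case empty
    then have "u = sing \<one> 0" by (auto simp: sing_apply fun_eq_iff)
    then show ?case using assms(2)[of \<one> 0] by simp
  next
    case (insert g S)
    show ?case
    proof (cases "u g = 0")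
      case True
      then show ?thesis using insert by (intro insert.IH) auto
    next
      case False
      then have g: "g \<in> carrier G" using insert.prems(1) unfolding F_carrier by blast
      let ?v = "u(g := 0)"
      have "{h. ?v h \<noteq> 0} \<subseteq> {h. u h \<noteq> 0}" by auto
      then have v: "?v \<in> carrier F"
        using insert.prems(1) finite_subset unfolding F_carrier by (metis fun_upd_apply)
      have "{h. ?v h \<noteq> 0} \<subseteq> S" using insert.prems(2) by auto
      then have "Pr ?v" using insert.IH v by blast
      moreover have "u = sing g (u g) \<oplus>\<^bsub>F\<^esub> ?v" by (auto simp: F_add sing_apply fun_eq_iff)
      ultimately show ?thesis using assms(3)[OF sing_closed[OF g, of "u g"] v assms(2)[OF g]] by simp
    qed
  qed
  then show ?thesis using assms(1) unfolding F_carrier by (metis F_carrier assms(1) order_refl)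
qed

lemma F_l_distr:
  assumes "u \<in> carrier F" "v \<in> carrier F" "w \<in> carrier F"
  shows "(u \<oplus>\<^bsub>F\<^esub> v) \<otimes>\<^bsub>F\<^esub> w = u \<otimes>\<^bsub>F\<^esub> w \<oplus>\<^bsub>F\<^esub> v \<otimes>\<^bsub>F\<^esub> w"
proof
  fix k
  let ?S = "{g. u g \<noteq> 0} \<union> {g. v g \<noteq> 0}" and ?T = "{g. w g \<noteq> 0}"
  have fin: "finite ?S" "finite ?T" using assms unfolding F_carrier by auto
  have "((u \<oplus>\<^bsub>F\<^esub> v) \<otimes>\<^bsub>F\<^esub> w) k = (\<Sum>g\<in>?S. \<Sum>h\<in>?T. if g \<otimes> h = k then (u \<oplus>\<^bsub>F\<^esub> v) g * w h else 0)"
    by (rule F_mult[OF fin]) (auto simp: F_add)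
  also have "\<dots> = (\<Sum>g\<in>?S. \<Sum>h\<in>?T. (if g \<otimes> h = k then u g * w h else 0) + (if g \<otimes> h = k then v g * w h else 0))"
    by (intro sum.cong refl) (simp add: F_add distrib_right)
  also have "\<dots> = (u \<otimes>\<^bsub>F\<^esub> w) k + (v \<otimes>\<^bsub>F\<^esub> w) k"
    by (simp add: sum.distrib F_mult[OF fin])
  finally show "((u \<oplus>\<^bsub>F\<^esub> v) \<otimes>\<^bsub>F\<^esub> w) k = (u \<otimes>\<^bsub>F\<^esub> w \<oplus>\<^bsub>F\<^esub> v \<otimes>\<^bsub>F\<^esub> w) k" by (simp add: F_add)
qed

lemma F_m_comm:
  assumes "u \<in> carrier F" "v \<in> carrier F"
  shows "u \<otimes>\<^bsub>F\<^esub> v = v \<otimes>\<^bsub>F\<^esub> u"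
proof
  fix k
  let ?S = "{g. u g \<noteq> 0}" and ?T = "{g. v g \<noteq> 0}"
  have fin: "finite ?S" "finite ?T" and G: "?S \<subseteq> carrier G" "?T \<subseteq> carrier G"
    using assms unfolding F_carrier by auto
  have "(u \<otimes>\<^bsub>F\<^esub> v) k = (\<Sum>g\<in>?S. \<Sum>h\<in>?T. if g \<otimes> h = k then u g * v h else 0)"
    by (rule F_mult[OF fin]) auto
  also have "\<dots> = (\<Sum>h\<in>?T. \<Sum>g\<in>?S. if g \<otimes> h = k then u g * v h else 0)"
    by (rule sum.swap)
  also have "\<dots> = (\<Sum>h\<in>?T. \<Sum>g\<in>?S. if h \<otimes> g = k then v h * u g else 0)"
  proof (intro sum.cong refl)
    fix h g assume "h \<in> ?T" "g \<in> ?S"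
    then have "g \<otimes> h = h \<otimes> g" using G m_comm by blast
    then show "(if g \<otimes> h = k then u g * v h else 0) = (if h \<otimes> g = k then v h * u g else 0)" by simp
  qed
  also have "\<dots> = (v \<otimes>\<^bsub>F\<^esub> u) k"
    by (rule F_mult[OF fin(2,1), symmetric]) auto
  finally show "(u \<otimes>\<^bsub>F\<^esub> v) k = (v \<otimes>\<^bsub>F\<^esub> u) k" .
qed

lemma sing_mult: "sing g n \<otimes>\<^bsub>F\<^esub> sing h m = sing (g \<otimes> h) (n * m)"
proof
  fix k
  show "(sing g n \<otimes>\<^bsub>F\<^esub> sing h m) k = sing (g \<otimes> h) (n * m) k"
    by (subst F_mult[of "{g}" "{h}"]) (auto simp: sing_apply)
qed

lemma F_mult_closed:
  assumes "u \<in> carrier F" "v \<in> carrier F"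
  shows "u \<otimes>\<^bsub>F\<^esub> v \<in> carrier F"
  using assms(1)
proof (induction u rule: F_induct)
  case (sing g n)
  show ?case using assms(2)
  proof (induction v rule: F_induct)
    case (sing h m)
    then show ?case using \<open>g \<in> carrier G\<close> by (simp add: sing_mult)
  next
    case (add v w)
    then have "sing g n \<otimes>\<^bsub>F\<^esub> (v \<oplus>\<^bsub>F\<^esub> w) = sing g n \<otimes>\<^bsub>F\<^esub> v \<oplus>\<^bsub>F\<^esub> sing g n \<otimes>\<^bsub>F\<^esub> w"
      using F_l_distr[of v w "sing g n"] \<open>g \<in> carrier G\<close> F_add_closed
      by (simp add: F_m_comm[of "sing g n"])
    then show ?case using add F_add_closed by simp
  qed
next
  case (add u w)
  then show ?case using F_l_distr[of u w v] assms(2) F_add_closed by simp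
qed

lemma F_cring: "cring F"
proof -
  have r_distr: "w \<otimes>\<^bsub>F\<^esub> (u \<oplus>\<^bsub>F\<^esub> v) = w \<otimes>\<^bsub>F\<^esub> u \<oplus>\<^bsub>F\<^esub> w \<otimes>\<^bsub>F\<^esub> v"
    if "u \<in> carrier F" "v \<in> carrier F" "w \<in> carrier F" for u v w
    using F_l_distr[OF that] that F_add_closed by (simp add: F_m_comm[of w])
  have assoc: "u \<otimes>\<^bsub>F\<^esub> v \<otimes>\<^bsub>F\<^esub> w = u \<otimes>\<^bsub>F\<^esub> (v \<otimes>\<^bsub>F\<^esub> w)"
    if u: "u \<in> carrier F" and v: "v \<in> carrier F" and w: "w \<in> carrier F" for u v w
    using u
  proof (induction u rule: F_induct)
    case (sing g n)
    show ?case using v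
    proof (induction v rule: F_induct)
      case (sing h m)
      show ?case using w
      proof (induction w rule: F_induct)
        case (sing k l)
        then show ?case using \<open>g \<in> carrier G\<close> \<open>h \<in> carrier G\<close> by (simp add: sing_mult m_assoc mult.assoc)
      next
        case (add w w')
        then show ?case using \<open>g \<in> carrier G\<close> \<open>h \<in> carrier G\<close> by (simp add: r_distr F_mult_closed)
      qed
    next
      case (add v v')
      then show ?case using \<open>g \<in> carrier G\<close> w by (simp add: r_distr F_l_distr F_mult_closed)
    qed
  next
    case (add u u')
    then show ?case using v w by (simp add: F_l_distr F_mult_closed)
  qed
  have one: "\<one>\<^bsub>F\<^esub> \<otimes>\<^bsub>F\<^esub> u = u" if "u \<in> carrier F" for u
    using that
  proof (induction u rule: F_induct)
    case (sing g n)
    then show ?case by (simp add: F_one sing_mult)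
  next
    case (add u v)
    then show ?case by (simp add: F_one r_distr)
  qed
  show ?thesis
  proof (rule cringI)
    show "abelian_group F"
    proof (rule abelian_groupI)
      fix u assume u: "u \<in> carrier F"
      show "\<exists>v\<in>carrier F. v \<oplus>\<^bsub>F\<^esub> u = \<zero>\<^bsub>F\<^esub>"
      proof (rule bexI[of _ "\<lambda>g. - u g"])
        show "(\<lambda>g. - u g) \<in> carrier F" using u unfolding F_carrier by simp
      qed (simp add: F_add F_zero)
    qed (use F_add_closed in \<open>auto simp: F_carrier F_zero F_add add_ac\<close>)
    show "Group.comm_monoid F"
    proof (rule comm_monoidI)
      fix u v w assume uv: "u \<in> carrier F" "v \<in> carrier F"
      show "u \<otimes>\<^bsub>F\<^esub> v \<in> carrier F" "\<one>\<^bsub>F\<^esub> \<otimes>\<^bsub>F\<^esub> u = u" "u \<otimes>\<^bsub>F\<^esub> v = v \<otimes>\<^bsub>F\<^esub> u"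
        using uv by (simp_all only: F_mult_closed one F_m_comm[OF uv])
      assume "w \<in> carrier F"
      then show "u \<otimes>\<^bsub>F\<^esub> v \<otimes>\<^bsub>F\<^esub> w = u \<otimes>\<^bsub>F\<^esub> (v \<otimes>\<^bsub>F\<^esub> w)" using assoc uv by simp
    qed (simp add: F_one)
  qed (simp add: F_l_distr)
qed

text \<open>The universal property of \<int>[G]: the additive extension is multiplicative because
  this can be tested on integer multiples of monoid elements.\<close>

lemma lift_to_ring:
  assumes "cring C" "\<And>g. g \<in> carrier G \<Longrightarrow> \<psi> g \<in> carrier C" "\<psi> \<one> = \<one>\<^bsub>C\<^esub>"
    and "\<And>g h. g \<in> carrier G \<Longrightarrow> h \<in> carrier G \<Longrightarrow> \<psi> (g \<otimes> h) = \<psi> g \<otimes>\<^bsub>C\<^esub> \<psi> h"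
  obtains L where "L \<in> ring_hom F C" "\<And>g. g \<in> carrier G \<Longrightarrow> L (sing g 1) = \<psi> g"
proof -
  interpret C: cring C by fact
  interpret F: cring F by (rule F_cring)
  define L where "L u = finsum C (\<lambda>g. [u g] \<cdot>\<^bsub>C\<^esub> \<psi> g) {g. u g \<noteq> 0}" for u :: "'a \<Rightarrow> int"
  have L_sup: "L u = finsum C (\<lambda>g. [u g] \<cdot>\<^bsub>C\<^esub> \<psi> g) S" if "finite S" "S \<subseteq> carrier G" "{g. u g \<noteq> 0} \<subseteq> S" for u S
    unfolding L_def
    by (rule C.add.finprod_mono_neutral_cong_left) (use that assms(2) in \<open>auto simp: C.int_add_pow_0 intro!: C.int_add_pow_closed\<close>)
  have L_closed: "L u \<in> carrier C" if "u \<in> carrier F" for u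
    unfolding L_def using that assms(2) unfolding F_carrier
    by (intro C.finsum_closed) (auto intro!: C.int_add_pow_closed)
  have L_add: "L (u \<oplus>\<^bsub>F\<^esub> v) = L u \<oplus>\<^bsub>C\<^esub> L v" if uv: "u \<in> carrier F" "v \<in> carrier F" for u v
  proof -
    let ?S = "{g. u g \<noteq> 0} \<union> {g. v g \<noteq> 0}"
    have S: "finite ?S" "?S \<subseteq> carrier G" using uv unfolding F_carrier by auto
    have "L (u \<oplus>\<^bsub>F\<^esub> v) = finsum C (\<lambda>g. [(u \<oplus>\<^bsub>F\<^esub> v) g] \<cdot>\<^bsub>C\<^esub> \<psi> g) ?S"
      by (rule L_sup[OF S]) (auto simp: F_add)
    also have "\<dots> = finsum C (\<lambda>g. [u g] \<cdot>\<^bsub>C\<^esub> \<psi> g \<oplus>\<^bsub>C\<^esub> [v g] \<cdot>\<^bsub>C\<^esub> \<psi> g) ?S"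
      using S(2) assms(2)
      by (intro C.finsum_cong') (auto simp: F_add C.int_add_pow_add intro!: C.int_add_pow_closed)
    also have "\<dots> = finsum C (\<lambda>g. [u g] \<cdot>\<^bsub>C\<^esub> \<psi> g) ?S \<oplus>\<^bsub>C\<^esub> finsum C (\<lambda>g. [v g] \<cdot>\<^bsub>C\<^esub> \<psi> g) ?S"
      using S(2) assms(2) by (intro C.finsum_addf) (auto intro!: C.int_add_pow_closed)
    also have "\<dots> = L u \<oplus>\<^bsub>C\<^esub> L v"
      using L_sup[OF S, of u] L_sup[OF S, of v] by auto
    finally show ?thesis .
  qed
  have L_sing: "L (sing g n) = [n] \<cdot>\<^bsub>C\<^esub> \<psi> g" if "g \<in> carrier G" for g n
  proof -
    have "L (sing g n) = finsum C (\<lambda>h. [sing g n h] \<cdot>\<^bsub>C\<^esub> \<psi> h) {g}"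
      using that by (intro L_sup) (auto simp: sing_apply)
    then show ?thesis using assms(2)[OF that] by (simp add: sing_apply C.int_add_pow_closed)
  qed
  have L_one: "L (sing g 1) = \<psi> g" if "g \<in> carrier G" for g
    using L_sing[OF that, of 1] assms(2)[OF that] by (simp add: C.int_add_pow_1)
  have L_mult: "L (u \<otimes>\<^bsub>F\<^esub> v) = L u \<otimes>\<^bsub>C\<^esub> L v" if u: "u \<in> carrier F" and v: "v \<in> carrier F" for u v
    using u
  proof (induction u rule: F_induct)
    case (sing g n)
    show ?case using v
    proof (induction v rule: F_induct)
      case (sing h m)
      have c: "\<psi> g \<in> carrier C" "\<psi> h \<in> carrier C" using assms(2) \<open>g \<in> carrier G\<close> sing by auto
      have "L (sing g n \<otimes>\<^bsub>F\<^esub> sing h m) = [(n * m)] \<cdot>\<^bsub>C\<^esub> (\<psi> g \<otimes>\<^bsub>C\<^esub> \<psi> h)"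
        using \<open>g \<in> carrier G\<close> sing by (simp add: sing_mult L_sing assms(4))
      also have "\<dots> = [n] \<cdot>\<^bsub>C\<^esub> ([m] \<cdot>\<^bsub>C\<^esub> (\<psi> g \<otimes>\<^bsub>C\<^esub> \<psi> h))"
        using c by (simp add: C.int_add_pow_mult)
      also have "\<dots> = ([n] \<cdot>\<^bsub>C\<^esub> \<psi> g) \<otimes>\<^bsub>C\<^esub> ([m] \<cdot>\<^bsub>C\<^esub> \<psi> h)"
        using C.add_pow_ldistr_int[OF c(1) C.int_add_pow_closed[OF c(2)], of n m] C.add_pow_rdistr_int[OF c, of m] by simp
      finally show ?case using \<open>g \<in> carrier G\<close> sing by (simp add: L_sing)
    next
      case (add v w)
      then show ?case using \<open>g \<in> carrier G\<close> by (simp add: F.r_distr L_add L_closed C.r_distr)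
    qed
  next
    case (add u w)
    then show ?case using v by (simp add: F.l_distr L_add L_closed C.l_distr)
  qed
  have "L \<in> ring_hom F C"
    by (rule ring_hom_memI) (simp_all add: L_closed L_mult L_add F_one L_one assms(3))
  then show thesis using that L_one by blast
qed

end

section \<open>Tensor products as quotients of monoid algebras\<close>

locale tensor = R: cring R + B: cring B + C: cring C
  for R :: "('r, 'k) ring_scheme" and B :: "('b, 'm) ring_scheme" and C :: "('c, 'n) ring_scheme" +
  fixes \<beta> :: "'r \<Rightarrow> 'b" and \<gamma> :: "'r \<Rightarrow> 'c"
  assumes beta: "\<beta> \<in> ring_hom R B" and gamma: "\<gamma> \<in> ring_hom R C"

sublocale tensor \<subseteq> M: int_monoid_algebra "B \<times>\<times> C"
proof -
  interpret BC: monoid "B \<times>\<times> C" by (rule DirProd_monoid) unfold_locales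
  show "int_monoid_algebra (B \<times>\<times> C)"
    by unfold_locales (auto simp: DirProd_def B.m_comm C.m_comm)
qed

context tensor
begin

definition K where "K = Idl\<^bsub>M.F\<^esub> (tensor_rel R B \<beta> C \<gamma>)"

abbreviation E where "E \<equiv> tensor_ring R B \<beta> C \<gamma>"
abbreviation pt where "pt \<equiv> pure_tensor R B \<beta> C \<gamma>"
abbreviation e where "e b c \<equiv> single \<Z> (b, c) 1"

interpretation F: cring M.F by (rule M.F_cring)

lemma beta_closed: "r \<in> carrier R \<Longrightarrow> \<beta> r \<in> carrier B" and gamma_closed: "r \<in> carrier R \<Longrightarrow> \<gamma> r \<in> carrier C"
  using ring_hom_closed[OF beta] ring_hom_closed[OF gamma] by auto

lemma e_closed: "b \<in> carrier B \<Longrightarrow> c \<in> carrier C \<Longrightarrow> e b c \<in> carrier M.F"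
  by (rule M.sing_closed) (simp add: DirProd_def)

lemma rel_carrier: "tensor_rel R B \<beta> C \<gamma> \<subseteq> carrier M.F"
  unfolding tensor_rel_def Let_def using e_closed beta_closed gamma_closed by auto

lemma K_ideal: "ideal K M.F"
  unfolding K_def by (rule F.genideal_ideal[OF rel_carrier])

lemma E_eq: "E = M.F Quot K" and pt_eq: "pt b c = K +>\<^bsub>M.F\<^esub> e b c"
  by (simp_all add: tensor_ring_def pure_tensor_def K_def Let_def)

lemma E_cring: "cring E"
  unfolding E_eq by (rule ideal.quotient_is_cring[OF K_ideal M.F_cring])

interpretation E: cring E by (rule E_cring)

lemma q_hom: "(+>\<^bsub>M.F\<^esub>) K \<in> ring_hom M.F E"
  unfolding E_eq by (rule ideal.rcos_ring_hom[OF K_ideal])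

lemma pt_closed [simp, intro]: "b \<in> carrier B \<Longrightarrow> c \<in> carrier C \<Longrightarrow> pt b c \<in> carrier E"
  unfolding pt_eq using ring_hom_closed[OF q_hom e_closed] .

lemma rel_eq:
  assumes "u \<ominus>\<^bsub>M.F\<^esub> v \<in> tensor_rel R B \<beta> C \<gamma>" "u \<in> carrier M.F" "v \<in> carrier M.F"
  shows "K +>\<^bsub>M.F\<^esub> u = K +>\<^bsub>M.F\<^esub> v"
proof -
  have "u \<ominus>\<^bsub>M.F\<^esub> v \<in> K" using F.genideal_self[OF rel_carrier] assms(1) unfolding K_def by blast
  then show ?thesis using F.quotient_eq_iff_same_a_r_cos[OF K_ideal assms(2,3)] by simp
qed

lemma pt_add_left:
  assumes "b \<in> carrier B" "b' \<in> carrier B" "c \<in> carrier C"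
  shows "pt (b \<oplus>\<^bsub>B\<^esub> b') c = pt b c \<oplus>\<^bsub>E\<^esub> pt b' c"
proof -
  have "K +>\<^bsub>M.F\<^esub> e (b \<oplus>\<^bsub>B\<^esub> b') c = K +>\<^bsub>M.F\<^esub> (e b c \<oplus>\<^bsub>M.F\<^esub> e b' c)"
    by (rule rel_eq) (use assms e_closed in \<open>auto simp: tensor_rel_def Let_def\<close>)
  then show ?thesis unfolding pt_eq using ring_hom_add[OF q_hom] e_closed assms by simp
qed

lemma pt_add_right:
  assumes "b \<in> carrier B" "c \<in> carrier C" "c' \<in> carrier C"
  shows "pt b (c \<oplus>\<^bsub>C\<^esub> c') = pt b c \<oplus>\<^bsub>E\<^esub> pt b c'"
proof -
  have "K +>\<^bsub>M.F\<^esub> e b (c \<oplus>\<^bsub>C\<^esub> c') = K +>\<^bsub>M.F\<^esub> (e b c \<oplus>\<^bsub>M.F\<^esub> e b c')"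
    by (rule rel_eq) (use assms e_closed in \<open>auto simp: tensor_rel_def Let_def\<close>)
  then show ?thesis unfolding pt_eq using ring_hom_add[OF q_hom] e_closed assms by simp
qed

lemma pt_scal:
  assumes "r \<in> carrier R" "b \<in> carrier B" "c \<in> carrier C"
  shows "pt (\<beta> r \<otimes>\<^bsub>B\<^esub> b) c = pt b (\<gamma> r \<otimes>\<^bsub>C\<^esub> c)"
proof -
  have "K +>\<^bsub>M.F\<^esub> e (\<beta> r \<otimes>\<^bsub>B\<^esub> b) c = K +>\<^bsub>M.F\<^esub> e b (\<gamma> r \<otimes>\<^bsub>C\<^esub> c)"
    by (rule rel_eq) (use assms e_closed beta_closed gamma_closed in \<open>auto simp: tensor_rel_def Let_def\<close>)
  then show ?thesis unfolding pt_eq .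
qed

lemma pt_mult:
  assumes "b \<in> carrier B" "b' \<in> carrier B" "c \<in> carrier C" "c' \<in> carrier C"
  shows "pt (b \<otimes>\<^bsub>B\<^esub> b') (c \<otimes>\<^bsub>C\<^esub> c') = pt b c \<otimes>\<^bsub>E\<^esub> pt b' c'"
proof -
  have "e (b \<otimes>\<^bsub>B\<^esub> b') (c \<otimes>\<^bsub>C\<^esub> c') = e b c \<otimes>\<^bsub>M.F\<^esub> e b' c'"
    by (subst M.sing_mult) (simp add: DirProd_def)
  then show ?thesis unfolding pt_eq using ring_hom_mult[OF q_hom] e_closed assms by simp
qed

lemma pt_one: "pt \<one>\<^bsub>B\<^esub> \<one>\<^bsub>C\<^esub> = \<one>\<^bsub>E\<^esub>"
proof -
  have "e \<one>\<^bsub>B\<^esub> \<one>\<^bsub>C\<^esub> = \<one>\<^bsub>M.F\<^esub>" by (subst M.F_one) (simp add: DirProd_def)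
  then show ?thesis unfolding pt_eq using ring_hom_one[OF q_hom] by simp
qed

lemma left_hom: "(\<lambda>b. pt b \<one>\<^bsub>C\<^esub>) \<in> ring_hom B E"
  by (rule ring_hom_memI) (use pt_mult[of _ _ "\<one>\<^bsub>C\<^esub>" "\<one>\<^bsub>C\<^esub>"] in \<open>simp_all add: pt_add_left pt_one\<close>)

lemma right_hom: "(\<lambda>c. pt \<one>\<^bsub>B\<^esub> c) \<in> ring_hom C E"
  by (rule ring_hom_memI) (use pt_mult[of "\<one>\<^bsub>B\<^esub>" "\<one>\<^bsub>B\<^esub>"] in \<open>simp_all add: pt_add_right pt_one\<close>)

lemma pt_split: "b \<in> carrier B \<Longrightarrow> c \<in> carrier C \<Longrightarrow> pt b c = pt b \<one>\<^bsub>C\<^esub> \<otimes>\<^bsub>E\<^esub> pt \<one>\<^bsub>B\<^esub> c"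
  using pt_mult[of b "\<one>\<^bsub>B\<^esub>" "\<one>\<^bsub>C\<^esub>" c] by simp

lemma pt_R: "r \<in> carrier R \<Longrightarrow> pt (\<beta> r) \<one>\<^bsub>C\<^esub> = pt \<one>\<^bsub>B\<^esub> (\<gamma> r)"
  using pt_scal[of r "\<one>\<^bsub>B\<^esub>" "\<one>\<^bsub>C\<^esub>"] beta_closed gamma_closed by simp

text \<open>An integer multiple of a pure tensor is again pure, the integer being absorbed in the
  left factor. Hence sums of pure tensors exhaust the ring.\<close>

lemma E_induct [consumes 1, case_names pure add]:
  assumes "z \<in> carrier E" "\<And>b c. b \<in> carrier B \<Longrightarrow> c \<in> carrier C \<Longrightarrow> Pr (pt b c)"
    and "\<And>y z. y \<in> carrier E \<Longrightarrow> z \<in> carrier E \<Longrightarrow> Pr y \<Longrightarrow> Pr z \<Longrightarrow> Pr (y \<oplus>\<^bsub>E\<^esub> z)"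
  shows "Pr z"
proof -
  interpret q: ring_hom_ring M.F E "(+>\<^bsub>M.F\<^esub>) K"
    by (intro ring_hom_ringI2 F.ring_axioms E.ring_axioms q_hom)
  have nat_sing: "\<exists>b'\<in>carrier B. K +>\<^bsub>M.F\<^esub> single \<Z> (b, c) (int n) = pt b' c" if bc: "b \<in> carrier B" "c \<in> carrier C" for b c n
  proof (induction n)
    case 0
    have z: "pt \<zero>\<^bsub>B\<^esub> c = \<zero>\<^bsub>E\<^esub>"
      using pt_add_left[of "\<zero>\<^bsub>B\<^esub>" "\<zero>\<^bsub>B\<^esub>" c] bc by simp
    have "single \<Z> (b, c) (int 0) = \<zero>\<^bsub>M.F\<^esub>" by (simp add: M.F_zero M.sing_apply fun_eq_iff)
    then have "K +>\<^bsub>M.F\<^esub> single \<Z> (b, c) (int 0) = pt \<zero>\<^bsub>B\<^esub> c" unfolding z by simp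
    then show ?case by blast
  next
    case (Suc n)
    then obtain b' where b': "b' \<in> carrier B" "K +>\<^bsub>M.F\<^esub> single \<Z> (b, c) (int n) = pt b' c" by blast
    have s: "single \<Z> (b, c) (int n) \<in> carrier M.F" using bc by (intro M.sing_closed) (simp add: DirProd_def)
    have "single \<Z> (b, c) (int (Suc n)) = single \<Z> (b, c) (int n) \<oplus>\<^bsub>M.F\<^esub> e b c"
      by (simp add: M.sing_add add.commute)
    then have "K +>\<^bsub>M.F\<^esub> single \<Z> (b, c) (int (Suc n)) = pt b' c \<oplus>\<^bsub>E\<^esub> pt b c"
      using q.hom_add[OF s e_closed[OF bc]] b'(2) by (simp add: pt_eq)
    also have "\<dots> = pt (b' \<oplus>\<^bsub>B\<^esub> b) c" using pt_add_left[OF b'(1) bc] by simp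
    finally show ?case using b' bc by blast
  qed
  have int_sing: "\<exists>b'\<in>carrier B. K +>\<^bsub>M.F\<^esub> single \<Z> (b, c) n = pt b' c" if bc: "b \<in> carrier B" "c \<in> carrier C" for b c n
  proof (cases n rule: int_cases2)
    case (nonneg m)
    then show ?thesis using nat_sing[OF bc] by simp
  next
    case (nonpos m)
    obtain b' where b': "b' \<in> carrier B" "K +>\<^bsub>M.F\<^esub> single \<Z> (b, c) (int m) = pt b' c" using nat_sing[OF bc] by blast
    have s: "single \<Z> (b, c) k \<in> carrier M.F" for k using bc by (intro M.sing_closed) (simp add: DirProd_def)
    have "single \<Z> (b, c) n \<oplus>\<^bsub>M.F\<^esub> single \<Z> (b, c) (int m) = \<zero>\<^bsub>M.F\<^esub>"
      by (simp add: M.sing_add nonpos M.F_zero M.sing_apply fun_eq_iff)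
    then have 1: "(K +>\<^bsub>M.F\<^esub> single \<Z> (b, c) n) \<oplus>\<^bsub>E\<^esub> pt b' c = \<zero>\<^bsub>E\<^esub>"
      using q.hom_add[OF s s, of n "int m"] b'(2) by simp
    have 2: "pt (\<ominus>\<^bsub>B\<^esub> b') c \<oplus>\<^bsub>E\<^esub> pt b' c = \<zero>\<^bsub>E\<^esub>"
      using pt_add_left[of "\<ominus>\<^bsub>B\<^esub> b'" b' c] pt_add_left[of "\<zero>\<^bsub>B\<^esub>" "\<zero>\<^bsub>B\<^esub>" c] b'(1) bc by (simp add: B.l_neg)
    have "K +>\<^bsub>M.F\<^esub> single \<Z> (b, c) n = \<ominus>\<^bsub>E\<^esub> pt b' c"
      using E.minus_equality[OF 1] q.hom_closed[OF s] b' bc by simp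
    also have "\<dots> = pt (\<ominus>\<^bsub>B\<^esub> b') c"
      using E.minus_equality[OF 2] b' bc by simp
    finally show ?thesis using b' by blast
  qed
  obtain u where u: "u \<in> carrier M.F" "z = K +>\<^bsub>M.F\<^esub> u"
    using assms(1) unfolding E_eq FactRing_def A_RCOSETS_def' by auto
  have "Pr (K +>\<^bsub>M.F\<^esub> u)" using u(1)
  proof (induction u rule: M.F_induct)
    case (sing g n)
    then obtain b c where "g = (b, c)" "b \<in> carrier B" "c \<in> carrier C" by (auto simp: DirProd_def)
    then show ?case using int_sing[of b c n] assms(2) by auto
  next
    case (add u v)
    then show ?case using assms(3) q.hom_add q.hom_closed by simp
  qed
  then show ?thesis using u by simp
qed

text \<open>The map (b, c) -> f(b) g(c) is multiplicative, extends to the monoid algebra and kills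
  the three families of relations.\<close>

lemma tensor_universal:
  assumes S: "cring S" and f: "f \<in> ring_hom B S" and g: "g \<in> ring_hom C S"
    and fg: "\<And>r. r \<in> carrier R \<Longrightarrow> f (\<beta> r) = g (\<gamma> r)"
  obtains h where "h \<in> ring_hom E S" "\<And>b c. b \<in> carrier B \<Longrightarrow> c \<in> carrier C \<Longrightarrow> h (pt b c) = f b \<otimes>\<^bsub>S\<^esub> g c"
proof -
  interpret S: cring S by fact
  interpret f: ring_hom_ring B S f by (intro ring_hom_ringI2 B.ring_axioms S.ring_axioms f)
  interpret g: ring_hom_ring C S g by (intro ring_hom_ringI2 C.ring_axioms S.ring_axioms g)
  let ?\<psi> = "\<lambda>(b, c). f b \<otimes>\<^bsub>S\<^esub> g c"
  obtain L where L: "L \<in> ring_hom M.F S" "\<And>d. d \<in> carrier (B \<times>\<times> C) \<Longrightarrow> L (single \<Z> d 1) = ?\<psi> d"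
    by (rule M.lift_to_ring[OF S, of ?\<psi>]) (auto simp: DirProd_def S.m_ac)
  interpret L: ring_hom_ring M.F S L by (intro ring_hom_ringI2 F.ring_axioms S.ring_axioms L)
  have Le: "L (e b c) = f b \<otimes>\<^bsub>S\<^esub> g c" if "b \<in> carrier B" "c \<in> carrier C" for b c
    using L(2)[of "(b, c)"] that by (simp add: DirProd_def)
  have diff: "L (u \<ominus>\<^bsub>M.F\<^esub> v) = \<zero>\<^bsub>S\<^esub>" if "u \<in> carrier M.F" "v \<in> carrier M.F" "L u = L v" for u v
    using that by (simp add: a_minus_def S.r_neg)
  have rel: "L t = \<zero>\<^bsub>S\<^esub>" if t: "t \<in> tensor_rel R B \<beta> C \<gamma>" for t
    using t unfolding tensor_rel_def Let_def
  proof (elim UnE CollectE exE conjE)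
    fix b b' c assume "b \<in> carrier B" "b' \<in> carrier B" "c \<in> carrier C"
      and t: "t = e (b \<oplus>\<^bsub>B\<^esub> b') c \<ominus>\<^bsub>M.F\<^esub> (e b c \<oplus>\<^bsub>M.F\<^esub> e b' c)"
    then show ?thesis unfolding t using e_closed
      by (intro diff) (simp_all add: Le S.l_distr)
  next
    fix b c c' assume "b \<in> carrier B" "c \<in> carrier C" "c' \<in> carrier C"
      and t: "t = e b (c \<oplus>\<^bsub>C\<^esub> c') \<ominus>\<^bsub>M.F\<^esub> (e b c \<oplus>\<^bsub>M.F\<^esub> e b c')"
    then show ?thesis unfolding t using e_closed
      by (intro diff) (simp_all add: Le S.r_distr)
  next
    fix r b c assume "r \<in> carrier R" "b \<in> carrier B" "c \<in> carrier C"
      and t: "t = e (\<beta> r \<otimes>\<^bsub>B\<^esub> b) c \<ominus>\<^bsub>M.F\<^esub> e b (\<gamma> r \<otimes>\<^bsub>C\<^esub> c)"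
    then show ?thesis unfolding t using e_closed beta_closed gamma_closed
      by (intro diff) (simp_all add: Le fg S.m_ac)
  qed
  have "K \<subseteq> {u \<in> carrier M.F. L u \<in> {\<zero>\<^bsub>S\<^esub>}}"
    unfolding K_def using L.ideal_vimage[OF S.zeroideal] rel rel_carrier by (intro F.genideal_minimal) auto
  then have K0: "L u = \<zero>\<^bsub>S\<^esub>" if "u \<in> K" for u using that by blast
  obtain h where h: "h \<in> ring_hom (M.F Quot K) S" "\<And>u. u \<in> carrier M.F \<Longrightarrow> h (K +>\<^bsub>M.F\<^esub> u) = L u"
    using F.quotient_universal[OF K_ideal S.ring_axioms L(1) K0] by blast
  show thesis
    by (rule that[of h]) (use h Le e_closed in \<open>simp_all add: E_eq pt_eq\<close>)
qed

lemma tensor_hom_eq: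
  assumes "ring S" "h \<in> ring_hom E S" "h' \<in> ring_hom E S"
    and "\<And>b c. b \<in> carrier B \<Longrightarrow> c \<in> carrier C \<Longrightarrow> h (pt b c) = h' (pt b c)" and "z \<in> carrier E"
  shows "h z = h' z"
  using assms(5)
proof (induction z rule: E_induct)
  case (add y z)
  then show ?case using ring_hom_add[OF assms(2)] ring_hom_add[OF assms(3)] by simp
qed (rule assms(4))

lemma E_subset_range:
  assumes "\<And>b c. b \<in> carrier B \<Longrightarrow> c \<in> carrier C \<Longrightarrow> pt b c \<in> W" "\<And>y z. y \<in> W \<Longrightarrow> z \<in> W \<Longrightarrow> y \<oplus>\<^bsub>E\<^esub> z \<in> W"
  shows "carrier E \<subseteq> W"
proof
  fix z assume "z \<in> carrier E"
  then show "z \<in> W" by (induction z rule: E_induct) (use assms in auto)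
qed

end

context
  fixes E :: "('e, 'm) ring_scheme" and pt :: "'a \<Rightarrow> 'a \<Rightarrow> 'e"
begin

text \<open>A list \<open>[b\<^sub>1, c\<^sub>1, b\<^sub>2, c\<^sub>2, \<dots>]\<close> codes \<open>b\<^sub>1 \<otimes> c\<^sub>1 + b\<^sub>2 \<otimes> c\<^sub>2 + \<dots>\<close>.\<close>

fun dec_tensor :: "'a list \<Rightarrow> 'e" where
  "dec_tensor (b # c # l) = pt b c \<oplus>\<^bsub>E\<^esub> dec_tensor l"
| "dec_tensor _ = \<zero>\<^bsub>E\<^esub>"

end

text \<open>Even-length lists over A code all sums of pure tensors, so the tensor ring is admissible
  as a target of lifting problems.\<close>

lemma self_tensor_range:
  fixes A :: "('a, 'm) ring_scheme"
  assumes "tensor R A A \<eta> \<eta>"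
  shows "carrier (self_tensor R A \<eta>) \<subseteq> range (dec_tensor (self_tensor R A \<eta>) (self_pure R A \<eta>))"
proof -
  interpret tensor R A A \<eta> \<eta> by fact
  interpret E: cring E by (rule E_cring)
  let ?dec = "dec_tensor E pt"
  let ?S = "{l :: 'a list. set l \<subseteq> carrier A \<and> even (length l)}"
  have ind: "?dec l \<in> carrier E \<and> (\<forall>l'. ?dec l' \<in> carrier E \<longrightarrow> ?dec (l @ l') = ?dec l \<oplus>\<^bsub>E\<^esub> ?dec l')" if "l \<in> ?S" for l
    using that
  proof (induction l rule: induct_list012)
    case (3 a b l)
    then show ?case using pt_closed[of a b] by (simp add: E.a_assoc)
  qed simp_all
  have "carrier E \<subseteq> ?dec ` ?S"
  proof (rule E_subset_range)
    fix b c assume "b \<in> carrier A" "c \<in> carrier A"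
    then show "pt b c \<in> ?dec ` ?S" by (intro image_eqI[of _ _ "[b, c]"]) simp_all
  next
    fix y z assume "y \<in> ?dec ` ?S" "z \<in> ?dec ` ?S"
    then obtain k l where kl: "k \<in> ?S" "y = ?dec k" "l \<in> ?S" "z = ?dec l" by blast
    then have "y \<oplus>\<^bsub>E\<^esub> z = ?dec (k @ l)" using ind by simp
    moreover have "k @ l \<in> ?S" using kl by simp
    ultimately show "y \<oplus>\<^bsub>E\<^esub> z \<in> ?dec ` ?S" by blast
  qed
  then show ?thesis by blast
qed

section \<open>The diagonal ideal and the Taylor map\<close>

lemma (in ring) surj_Quot: "ideal K R \<Longrightarrow> carrier (R Quot K) = (+>) K ` carrier R"
  unfolding FactRing_def A_RCOSETS_def' by auto

lemma (in ideal) coset_zero_iff_mem: "a \<in> carrier R \<Longrightarrow> I +> a = \<zero>\<^bsub>R Quot I\<^esub> \<longleftrightarrow> a \<in> I"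
  using ring_hom_zero[OF rcos_ring_hom ring_axioms quotient_is_ring] eqmod_coset[of a \<zero>] eqmod_zero_iff[of a] by auto

context taylor
begin

abbreviation W where "W \<equiv> self_tensor R A \<eta>"
abbreviation pt where "pt \<equiv> self_pure R A \<eta>"

end

sublocale taylor \<subseteq> Pt: tensor R A A \<eta> \<eta>
  by (intro tensor.intro tensor_axioms.intro E.R.cring_axioms is_cring E.eta_hom)

sublocale taylor \<subseteq> W: cring "self_tensor R A \<eta>"
  by (rule Pt.E_cring)

sublocale taylor \<subseteq> Wp: adic_hat "self_tensor R A \<eta>" "self_pure R A \<eta> (c [:int p:]) \<one>" "self_pure R A \<eta> (c [:-1, 1:]) \<one>"
  by (intro adic_hatI adic_pair.intro adic_pair_axioms.intro Pt.E_cring Pt.pt_closed c_closed one_closed)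

context taylor
begin

lemma U_hom_eq:
  assumes "cring S" "f \<in> ring_hom U S" "g \<in> ring_hom U S" "f X = g X"
    and "\<And>a. a \<in> carrier A \<Longrightarrow> f (con a) = g (con a)" and "u \<in> carrier U"
  shows "f u = g u"
proof -
  interpret S: cring S by fact
  interpret f: ring_hom_ring U S f by (intro ring_hom_ringI2 U.P.ring_axioms S.ring_axioms assms)
  interpret g: ring_hom_ring U S g by (intro ring_hom_ringI2 U.P.ring_axioms S.ring_axioms assms)
  have mon_eq: "mon a n = con a \<otimes>\<^bsub>U\<^esub> X [^]\<^bsub>U\<^esub> n" if "a \<in> carrier A" for a n
  proof (induction n)
    case 0
    then show ?case using that by (simp add: con_def)
  next
    case (Suc n)
    have "mon a (Suc n) = mon a n \<otimes>\<^bsub>U\<^esub> X"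
      unfolding X_def using U.monom_mult[of a \<one> n 1] that by simp
    also have "\<dots> = con a \<otimes>\<^bsub>U\<^esub> (X [^]\<^bsub>U\<^esub> n \<otimes>\<^bsub>U\<^esub> X)"
      unfolding Suc using that by (intro U.P.m_assoc con_closed U.P.nat_pow_closed X_closed)
    finally show ?case by simp
  qed
  show ?thesis using assms(6)
  proof (induction u rule: U_induct)
    case (monom a n)
    then show ?case using assms(4,5) by (simp add: mon_eq f.hom_nat_pow g.hom_nat_pow)
  next
    case (add u v)
    then show ?case by simp
  qed
qed

text \<open>Resolves the definite descriptions by which \<open>tensor_mult\<close> and
  \<open>q_endo_tensor\<close> are defined: values on pure tensors determine the map, and
  extensionality determines the function.\<close>

lemma tensor_the:
  assumes S: "ring S" and h: "h \<in> ring_hom W S"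
    and Fab: "\<And>a b. a \<in> carrier A \<Longrightarrow> b \<in> carrier A \<Longrightarrow> h (pt a b) = F a b"
  shows "(THE h. h \<in> ring_hom W S \<and> h \<in> extensional (carrier W) \<and>
    (\<forall>a\<in>carrier A. \<forall>b\<in>carrier A. h (pt a b) = F a b)) = restrict h (carrier W)"
proof (rule the_equality)
  have "restrict h (carrier W) \<in> ring_hom W S"
    using h by (auto simp: ring_hom_def)
  then show "restrict h (carrier W) \<in> ring_hom W S \<and> restrict h (carrier W) \<in> extensional (carrier W) \<and>
    (\<forall>a\<in>carrier A. \<forall>b\<in>carrier A. restrict h (carrier W) (pt a b) = F a b)"
    using Fab by simp
next
  fix g assume g: "g \<in> ring_hom W S \<and> g \<in> extensional (carrier W) \<and>
    (\<forall>a\<in>carrier A. \<forall>b\<in>carrier A. g (pt a b) = F a b)"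
  have "g z = h z" if "z \<in> carrier W" for z
    by (rule Pt.tensor_hom_eq[OF S _ h _ that]) (use g Fab in auto)
  then show "g = restrict h (carrier W)"
    using g by (intro extensionalityI[of g "carrier W"]) auto
qed

abbreviation mu where "mu \<equiv> tensor_mult R A \<eta>"
abbreviation sP where "sP \<equiv> q_endo_tensor R c A \<eta> x"
abbreviation dI where "dI \<equiv> diag_ideal R A \<eta>"
abbreviation tw where "tw \<equiv> twisted_ideal R c A \<eta> x"

lemma mu: "mu \<in> ring_hom W A" and mu_pt: "a \<in> carrier A \<Longrightarrow> b \<in> carrier A \<Longrightarrow> mu (pt a b) = a \<otimes> b"
proof -
  have id: "id \<in> ring_hom A A" by (simp add: ring_hom_def)
  obtain h where h: "h \<in> ring_hom W A" "\<And>a b. a \<in> carrier A \<Longrightarrow> b \<in> carrier A \<Longrightarrow> h (pt a b) = id a \<otimes> id b"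
    by (rule Pt.tensor_universal[OF is_cring id id]) auto
  then have eq: "mu = restrict h (carrier W)"
    unfolding tensor_mult_def using tensor_the[OF ring_axioms h(1), of "(\<otimes>)"] by simp
  show "mu \<in> ring_hom W A" unfolding eq using h(1) by (auto simp: ring_hom_def)
  show "a \<in> carrier A \<Longrightarrow> b \<in> carrier A \<Longrightarrow> mu (pt a b) = a \<otimes> b" unfolding eq using h(2) by simp
qed

lemma dI_iff: "z \<in> dI \<longleftrightarrow> z \<in> carrier W \<and> mu z = \<zero>"
  unfolding diag_ideal_def a_kernel_def' by blast

lemma dI_ideal: "ideal dI W"
proof -
  interpret h: ring_hom_ring W A mu by (intro ring_hom_ringI2 W.ring_axioms ring_axioms mu)
  show ?thesis unfolding diag_ideal_def by (rule h.kernel_is_ideal)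
qed

lemma dI_diff: "a \<in> carrier A \<Longrightarrow> eqmod W dI (pt \<one> a) (pt a \<one>)"
proof -
  assume a: "a \<in> carrier A"
  interpret h: ring_hom_ring W A mu by (intro ring_hom_ringI2 W.ring_axioms ring_axioms mu)
  show "eqmod W dI (pt \<one> a) (pt a \<one>)"
    unfolding eqmod_def using a by (simp add: dI_iff mu_pt a_minus_def r_neg)
qed

lemma sP: "sP \<in> ring_hom W W" and sP_pt: "a \<in> carrier A \<Longrightarrow> b \<in> carrier A \<Longrightarrow> sP (pt a b) = pt (sigma a) b"
proof -
  have sc: "sigma a \<in> carrier A" if "a \<in> carrier A" for a using ring_hom_closed[OF sigma_hom that] .
  have eta: "pt (sigma (\<eta> r)) \<one> = pt \<one> (\<eta> r)" if "r \<in> carrier R" for r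
    using that sg_eta[OF that, of 1] Pt.pt_R[OF that] by (simp add: sigma_eq)
  have f: "(\<lambda>a. pt (sigma a) \<one>) \<in> ring_hom A W"
    using ring_hom_trans[OF sigma_hom Pt.left_hom] by (simp add: comp_def)
  obtain h where h: "h \<in> ring_hom W W"
    "\<And>a b. a \<in> carrier A \<Longrightarrow> b \<in> carrier A \<Longrightarrow> h (pt a b) = pt (sigma a) \<one> \<otimes>\<^bsub>W\<^esub> pt \<one> b"
    by (rule Pt.tensor_universal[OF W.is_cring f Pt.right_hom eta]) auto
  have h2: "h (pt a b) = pt (sigma a) b" if "a \<in> carrier A" "b \<in> carrier A" for a b
    using h(2)[OF that] Pt.pt_split[OF sc[OF that(1)] that(2)] by simp
  have eq: "sP = restrict h (carrier W)"
    unfolding q_endo_tensor_def by (rule tensor_the[OF W.ring_axioms h(1) h2])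
  show "sP \<in> ring_hom W W" unfolding eq using h(1) by (auto simp: ring_hom_def)
  show "a \<in> carrier A \<Longrightarrow> b \<in> carrier A \<Longrightarrow> sP (pt a b) = pt (sigma a) b" unfolding eq using h2 by simp
qed

lemma sP_pow: "sP ^^ i \<in> ring_hom W W"
proof (induction i)
  case (Suc i)
  then show ?case unfolding funpow.simps by (rule ring_hom_trans[OF _ sP])
qed (auto simp: ring_hom_def)

lemma sP_pow_closed [simp, intro]: "z \<in> carrier W \<Longrightarrow> (sP ^^ i) z \<in> carrier W"
  by (rule ring_hom_closed[OF sP_pow])

lemma sg_closed [simp, intro]: "a \<in> carrier A \<Longrightarrow> sg i a \<in> carrier A"
  by (rule ring_hom_closed[OF sg_hom])

lemma sP_pow_pt:
  assumes "a \<in> carrier A" "b \<in> carrier A"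
  shows "(sP ^^ i) (pt a b) = pt (sg i a) b"
proof -
  have "(sP ^^ i) (pt a b) = pt ((sigma ^^ i) a) b"
  proof (induction i)
    case (Suc i)
    then show ?case using sP_pt[OF ring_hom_closed[OF sigma_pow_hom assms(1)] assms(2), of i] by simp
  qed simp
  then show ?thesis using sigma_pow[OF assms(1)] by simp
qed

lemma sP_image_carrier: "(sP ^^ i) ` dI \<subseteq> carrier W"
  using dI_iff by auto

lemma tw_ideal: "ideal (tw n) W"
proof (induction n)
  case 0
  show ?case using dI_ideal by simp
next
  case (Suc n)
  have "ideal (Idl\<^bsub>W\<^esub> ((sP ^^ Suc n) ` dI)) W"
    by (rule W.genideal_ideal[OF sP_image_carrier])
  then show ?case unfolding twisted_ideal.simps(2) by (rule W.ideal_prod_is_ideal[OF Suc])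
qed

lemma tw_mult:
  assumes "i \<in> tw n" "z \<in> dI"
  shows "i \<otimes>\<^bsub>W\<^esub> (sP ^^ Suc n) z \<in> tw (Suc n)"
proof -
  have "(sP ^^ Suc n) z \<in> Idl\<^bsub>W\<^esub> ((sP ^^ Suc n) ` dI)"
    using W.genideal_self[OF sP_image_carrier] assms(2) by blast
  then show ?thesis unfolding twisted_ideal.simps(2) by (rule ideal_prod.prod[OF assms(1)])
qed

section \<open>Quotients of A[\<xi>] and a retraction from the tensor product\<close>

abbreviation Kq where "Kq n \<equiv> PIdl\<^bsub>U\<^esub> (tp n)"
abbreviation Uq where "Uq n \<equiv> U Quot Kq n"
abbreviation cq where "cq n \<equiv> (+>\<^bsub>U\<^esub>) (Kq n)"

lemma Uq_cring: "cring (Uq n)"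
  by (rule ideal.quotient_is_cring[OF PIdl_tp_ideal U.UP_cring])

lemma cq_hom: "cq n \<in> ring_hom U (Uq n)"
  by (rule ideal.rcos_ring_hom[OF PIdl_tp_ideal])

lemma cq_eq_iff: "u \<in> carrier U \<Longrightarrow> v \<in> carrier U \<Longrightarrow> cq n u = cq n v \<longleftrightarrow> eqmod U (Kq n) u v"
  using ideal.eqmod_coset[OF PIdl_tp_ideal, of n u v] by blast

lemma cq_carrier: "carrier (Uq n) = cq n ` carrier U"
  by (rule U.P.surj_Quot[OF PIdl_tp_ideal])

text \<open>The map a \<otimes> b -> a T(b) respects the tensor relations because T fixes the image
  of R modulo \<xi>^(n). By \<open>psi_h0\<close> it is a retraction for \<xi> -> 1 \<otimes> x - x
  \<otimes> 1.\<close>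

lemma psi_exists:
  "\<exists>h. h \<in> ring_hom W (Uq n) \<and> (\<forall>a\<in>carrier A. \<forall>b\<in>carrier A. h (pt a b) = cq n (con a \<otimes>\<^bsub>U\<^esub> T n b))"
proof -
  have f: "(\<lambda>a. cq n (con a)) \<in> ring_hom A (Uq n)"
    using ring_hom_trans[OF con_hom_U cq_hom] by (simp add: comp_def)
  have g: "(\<lambda>a. cq n (T n a)) \<in> ring_hom A (Uq n)"
    by (rule ideal.hom_mod_coset[OF PIdl_tp_ideal T_hom_mod])
  have fg: "cq n (con (\<eta> r)) = cq n (T n (\<eta> r))" if "r \<in> carrier R" for r
    using ideal.eqmod_sym[OF PIdl_tp_ideal T_eta[OF that]] that by (simp add: cq_eq_iff)
  obtain h where h: "h \<in> ring_hom W (Uq n)"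
    "\<And>a b. a \<in> carrier A \<Longrightarrow> b \<in> carrier A \<Longrightarrow> h (pt a b) = cq n (con a) \<otimes>\<^bsub>Uq n\<^esub> cq n (T n b)"
    by (rule Pt.tensor_universal[OF Uq_cring f g fg]) auto
  have "h (pt a b) = cq n (con a \<otimes>\<^bsub>U\<^esub> T n b)" if "a \<in> carrier A" "b \<in> carrier A" for a b
    using h(2)[OF that] ring_hom_mult[OF cq_hom con_closed[OF that(1)] T_closed] by simp
  then show ?thesis using h(1) by blast
qed

definition psi where
  "psi n = (SOME h. h \<in> ring_hom W (Uq n) \<and> (\<forall>a\<in>carrier A. \<forall>b\<in>carrier A. h (pt a b) = cq n (con a \<otimes>\<^bsub>U\<^esub> T n b)))"

lemma psi: "psi n \<in> ring_hom W (Uq n)"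
  and psi_pt: "a \<in> carrier A \<Longrightarrow> b \<in> carrier A \<Longrightarrow> psi n (pt a b) = cq n (con a \<otimes>\<^bsub>U\<^esub> T n b)"
  using someI_ex[OF psi_exists[of n]] unfolding psi_def by blast+

text \<open>Evaluation at \<open>\<xi> = (q\<^sup>k - 1) x\<close> turns \<open>psi n\<close> into \<open>a \<otimes> b \<mapsto> a \<sigma>\<^sup>k(b)\<close>.\<close>

lemma psi_sP:
  assumes z: "z \<in> dI" and k: "k < n" and u: "u \<in> carrier U" "psi n ((sP ^^ k) z) = cq n u"
  shows "u \<in> PIdl\<^bsub>U\<^esub> (tfac k)"
proof -
  have zc: "z \<in> carrier W" "mu z = \<zero>" using z dI_iff by auto
  obtain ev where ev: "ev \<in> ring_hom (Uq n) A" "\<And>u. u \<in> carrier U \<Longrightarrow> ev (cq n u) = evr k u"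
    by (rule U.P.quotient_universal[OF PIdl_tp_ideal ring_axioms evr_hom]) (use evr_tp[OF k] in auto)
  have h1: "(\<lambda>z. ev (psi n ((sP ^^ k) z))) \<in> ring_hom W A"
    using ring_hom_trans[OF ring_hom_trans[OF sP_pow psi] ev(1)] by (simp add: comp_def)
  have h2: "(\<lambda>z. sg k (mu z)) \<in> ring_hom W A"
    using ring_hom_trans[OF mu sg_hom] by (simp add: comp_def)
  have "ev (psi n ((sP ^^ k) z)) = sg k (mu z)"
  proof (rule Pt.tensor_hom_eq[OF ring_axioms h1 h2 _ zc(1)])
    fix a b assume ab: "a \<in> carrier A" "b \<in> carrier A"
    have "ev (psi n ((sP ^^ k) (pt a b))) = evr k (con (sg k a) \<otimes>\<^bsub>U\<^esub> T n b)"
      using ab ev(2) by (simp add: sP_pow_pt psi_pt)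
    also have "\<dots> = sg k a \<otimes> sg k b"
      using ab ring_hom_mult[OF evr_hom, of "con (sg k a)" "T n b"] by (simp add: evr_con sg_T[OF k])
    also have "\<dots> = sg k (mu (pt a b))"
      using ab ring_hom_mult[OF sg_hom] by (simp add: mu_pt)
    finally show "ev (psi n ((sP ^^ k) (pt a b))) = sg k (mu (pt a b))" .
  qed
  then have "evr k u = sg k \<zero>" using ev(2)[OF u(1)] u(2) zc by simp
  also have "\<dots> = \<zero>" by (rule ring_hom_zero[OF sg_hom ring_axioms ring_axioms])
  finally show ?thesis by (rule evr_zero_tfac[OF u(1)])
qed

definition psi_pre :: "nat \<Rightarrow> (nat \<Rightarrow> 'a) set \<Rightarrow> ('a \<times> 'a \<Rightarrow> int) set set" where
  "psi_pre n M = {z \<in> carrier W. psi n z \<in> cq n ` M}"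

lemma psi_pre_ideal:
  assumes "ideal M U"
  shows "ideal (psi_pre n M) W"
proof -
  interpret S: cring "Uq n" by (rule Uq_cring)
  interpret h: ring_hom_ring W "Uq n" "psi n" by (intro ring_hom_ringI2 W.ring_axioms S.ring_axioms psi)
  show ?thesis unfolding psi_pre_def
    by (rule h.ideal_vimage[OF surj_hom_ideal[OF U.P.ring_axioms S.ring_axioms cq_hom cq_carrier assms]])
qed

lemma sP_psi_pre:
  assumes "z \<in> dI" "k < n"
  shows "(sP ^^ k) z \<in> psi_pre n (PIdl\<^bsub>U\<^esub> (tfac k))"
proof -
  have zc: "(sP ^^ k) z \<in> carrier W" using assms(1) dI_iff by auto
  then have "psi n ((sP ^^ k) z) \<in> carrier (Uq n)" by (rule ring_hom_closed[OF psi])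
  then obtain u where u: "u \<in> carrier U" "psi n ((sP ^^ k) z) = cq n u" unfolding cq_carrier by blast
  have "u \<in> PIdl\<^bsub>U\<^esub> (tfac k)" by (rule psi_sP[OF assms u])
  then show ?thesis unfolding psi_pre_def using zc u(2) by blast
qed

text \<open>The i-th twist of I goes into the ideal of the single factor \<open>tfac i\<close>, and
  products of such ideals go into the ideal of the product of the factors.\<close>

lemma tw_psi_pre:
  assumes "z \<in> tw k" "k < n"
  shows "z \<in> psi_pre n (Kq (Suc k))"
  using assms
proof (induction k arbitrary: z)
  case 0
  have "tp (Suc 0) = tfac 0" using tp_Suc[of 0] by simp
  then show ?case using sP_psi_pre[of z 0 n] 0 by simp
next
  case (Suc k)
  interpret V: ideal "psi_pre n (Kq (Suc (Suc k)))" W by (rule psi_pre_ideal[OF PIdl_tp_ideal])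
  have gen: "Idl\<^bsub>W\<^esub> ((sP ^^ Suc k) ` dI) \<subseteq> psi_pre n (PIdl\<^bsub>U\<^esub> (tfac (Suc k)))"
    by (rule W.genideal_minimal[OF psi_pre_ideal[OF U.P.cgenideal_ideal[OF tfac_closed]]])
      (use sP_psi_pre[OF _ Suc.prems(2)] in \<open>unfold image_subset_iff, blast\<close>)
  have "z \<in> ideal_prod W (tw k) (Idl\<^bsub>W\<^esub> ((sP ^^ Suc k) ` dI))" using Suc.prems(1) by simp
  then show ?case
  proof induction
    case (prod i j)
    have i: "i \<in> psi_pre n (Kq (Suc k))" using Suc.IH[OF prod(1)] Suc.prems(2) by simp
    have j: "j \<in> psi_pre n (PIdl\<^bsub>U\<^esub> (tfac (Suc k)))" using gen prod(2) by blast
    obtain u v where uv: "u \<in> Kq (Suc k)" "psi n i = cq n u" "v \<in> PIdl\<^bsub>U\<^esub> (tfac (Suc k))" "psi n j = cq n v"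
      "i \<in> carrier W" "j \<in> carrier W"
      using i j unfolding psi_pre_def by blast
    have c: "u \<in> carrier U" "v \<in> carrier U"
      using ideal.Icarr[OF PIdl_tp_ideal uv(1)] ideal.Icarr[OF U.P.cgenideal_ideal[OF tfac_closed] uv(3)] .
    have "psi n (i \<otimes>\<^bsub>W\<^esub> j) = cq n (u \<otimes>\<^bsub>U\<^esub> v)"
      using ring_hom_mult[OF psi uv(5,6)] ring_hom_mult[OF cq_hom c] uv(2,4) by simp
    moreover have "u \<otimes>\<^bsub>U\<^esub> v \<in> Kq (Suc (Suc k))"
      unfolding tp_Suc[of "Suc k"] by (rule U.P.cgenideal_mult[OF tp_closed tfac_closed uv(1,3)])
    moreover have "i \<otimes>\<^bsub>W\<^esub> j \<in> carrier W" using uv(5,6) by simp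
    ultimately show ?case unfolding psi_pre_def by blast
  next
    case (sum s1 s2)
    then show ?case by (intro V.a_closed)
  qed
qed

lemma psi_tw:
  assumes "z \<in> tw n"
  shows "psi (Suc n) z = \<zero>\<^bsub>Uq (Suc n)\<^esub>"
proof -
  obtain u where "u \<in> Kq (Suc n)" "psi (Suc n) z = cq (Suc n) u"
    using tw_psi_pre[OF assms, of "Suc n"] unfolding psi_pre_def by blast
  then show ?thesis
    using ideal.coset_zero_iff_mem[OF PIdl_tp_ideal, of u "Suc n"] ideal.Icarr[OF PIdl_tp_ideal] by auto
qed

definition delta where "delta = pt \<one> x \<ominus>\<^bsub>W\<^esub> pt x \<one>"

lemma delta_closed [simp, intro]: "delta \<in> carrier W"
  by (simp add: delta_def)

definition h0 :: "(nat \<Rightarrow> 'a) \<Rightarrow> ('a \<times> 'a \<Rightarrow> int) set" where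
  "h0 = UnivPoly.eval A W (\<lambda>a. pt a \<one>) delta"

lemma UW: "UP_pre_univ_prop A W (\<lambda>a. pt a \<one>)"
  by (intro UP_pre_univ_prop.intro UP_cring.intro ring_hom_cringI2 cring_axioms Pt.E_cring Pt.left_hom)

lemma h0_hom: "h0 \<in> ring_hom U W"
  unfolding h0_def by (rule UP_pre_univ_prop.eval_ring_hom[OF UW delta_closed])

lemma h0_con: "a \<in> carrier A \<Longrightarrow> h0 (con a) = pt a \<one>"
  unfolding h0_def using UP_pre_univ_prop.eval_const[OF UW delta_closed, of a] by (simp add: con_def)

lemma h0_X: "h0 X = delta"
  unfolding h0_def using UP_pre_univ_prop.eval_monom1[OF UW delta_closed] by (simp add: X_def)

lemma h0_closed [simp, intro]: "u \<in> carrier U \<Longrightarrow> h0 u \<in> carrier W"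
  by (rule ring_hom_closed[OF h0_hom])

text \<open>Both sides are homomorphisms over A, and at \<xi> the left one gives T(x) - x, which is
  \<xi> modulo \<xi>^(n).\<close>

lemma psi_h0:
  assumes "u \<in> carrier U"
  shows "psi n (h0 u) = cq n u"
proof (rule U_hom_eq[OF Uq_cring _ cq_hom _ _ assms])
  interpret S: cring "Uq n" by (rule Uq_cring)
  interpret K: ideal "Kq n" U by (rule PIdl_tp_ideal)
  interpret h: ring_hom_ring W "Uq n" "psi n" by (intro ring_hom_ringI2 W.ring_axioms S.ring_axioms psi)
  interpret q: ring_hom_ring U "Uq n" "cq n" by (intro ring_hom_ringI2 U.P.ring_axioms S.ring_axioms cq_hom)
  show "(\<lambda>u. psi n (h0 u)) \<in> ring_hom U (Uq n)"
    using ring_hom_trans[OF h0_hom psi] by (simp add: comp_def)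
  have con1: "con \<one> = \<one>\<^bsub>U\<^esub>" by (rule ring_hom_one[OF con_hom_U])
  have one: "cq n (T n \<one>) = cq n \<one>\<^bsub>U\<^esub>"
    using hom_modD(4)[OF T_hom_mod] by (simp only: cq_eq_iff T_closed U.P.one_closed)
  have pa: "psi n (pt a \<one>) = cq n (con a)" if "a \<in> carrier A" for a
    using psi_pt[OF that one_closed, of n] one q.hom_mult[OF con_closed[OF that] T_closed, of n \<one>]
      q.hom_mult[OF con_closed[OF that] U.P.one_closed] that by simp
  have px: "psi n (pt \<one> x) = cq n (con x \<oplus>\<^bsub>U\<^esub> X)"
  proof -
    have "cq n (T n x) = cq n (con x \<oplus>\<^bsub>U\<^esub> X)"
      by (rule cq_eq_iff[THEN iffD2, OF _ _ T_x]) simp_all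
    then show ?thesis using psi_pt[OF one_closed x_closed, of n] by (simp add: con1)
  qed
  show "psi n (h0 X) = cq n X"
  proof -
    have "psi n (h0 X) = cq n (con x \<oplus>\<^bsub>U\<^esub> X) \<ominus>\<^bsub>Uq n\<^esub> cq n (con x)"
      unfolding h0_X delta_def W.minus_eq by (simp add: pa px S.minus_eq)
    also have "\<dots> = cq n (con x \<oplus>\<^bsub>U\<^esub> X \<ominus>\<^bsub>U\<^esub> con x)" by (simp add: U.P.minus_eq S.minus_eq)
    also have "con x \<oplus>\<^bsub>U\<^esub> X \<ominus>\<^bsub>U\<^esub> con x = X"
      using U.P.a_comm[of "con x" X] by (simp add: U.P.minus_eq U.P.a_assoc U.P.r_neg)
    finally show ?thesis .
  qed
  show "psi n (h0 (con a)) = cq n (con a)" if "a \<in> carrier A" for a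
    using pa[OF that] by (simp add: h0_con that)
qed

lemma psi_pw:
  assumes "z \<in> Wp.pw m"
  shows "psi n z \<in> cq n ` Up.pw m"
proof -
  interpret S: cring "Uq n" by (rule Uq_cring)
  have Up: "adic_pair U (con (c [:int p:])) (con (c [:-1, 1:]))" by (rule Up.adic_pair_axioms)
  have Sp: "adic_pair (Uq n) (cq n (con (c [:int p:]))) (cq n (con (c [:-1, 1:])))"
    by (intro adic_pair.intro adic_pair_axioms.intro Uq_cring ring_hom_closed[OF cq_hom] con_closed c_closed)
  have "psi n (pt (c f) \<one>) = cq n (con (c f))" for f
    using psi_h0[of "con (c f)" n] by (simp add: h0_con)
  then have "psi n z \<in> adic_pair.pw (Uq n) (cq n (con (c [:int p:]))) (cq n (con (c [:-1, 1:]))) m"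
    using pw_hom[OF Wp.adic_pair_axioms Sp psi _ _ assms] by blast
  then show ?thesis by (rule surj_hom_pw[OF Up Sp cq_hom cq_carrier])
qed

text \<open>Applying \<open>psi\<close>, which kills I^(n+1), to the approximations places u in
  (\<xi>^(n+1)) + (p, q-1)^m for every m, and (\<xi>^(n+1)) is closed.\<close>

lemma h0_injective:
  assumes u: "u \<in> carrier U" and ex: "\<And>m. \<exists>s\<in>tw n. eqmod W (Wp.pw m) (h0 u) s"
  shows "u \<in> Kq (Suc n)"
proof (rule Inter_Lid[OF u])
  fix m
  interpret S: cring "Uq (Suc n)" by (rule Uq_cring)
  interpret K: ideal "Kq (Suc n)" U by (rule PIdl_tp_ideal)
  interpret L: ideal "Lid (Suc n) m" U by (rule Lid_ideal)
  interpret h: ring_hom_ring W "Uq (Suc n)" "psi (Suc n)" by (intro ring_hom_ringI2 W.ring_axioms S.ring_axioms psi)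
  obtain s where s: "s \<in> tw n" "eqmod W (Wp.pw m) (h0 u) s" using ex by blast
  have sc: "s \<in> carrier W" by (rule ideal.Icarr[OF tw_ideal s(1)])
  have "psi (Suc n) (h0 u \<ominus>\<^bsub>W\<^esub> s) = cq (Suc n) u"
    using psi_tw[OF s(1)] sc u psi_h0[OF u] ring_hom_closed[OF cq_hom u] by (simp add: W.minus_eq)
  moreover have "psi (Suc n) (h0 u \<ominus>\<^bsub>W\<^esub> s) \<in> cq (Suc n) ` Up.pw m"
    using s(2) unfolding eqmod_def by (intro psi_pw) blast
  ultimately obtain z where z: "z \<in> Up.pw m" "cq (Suc n) u = cq (Suc n) z" by auto
  then have "eqmod U (Kq (Suc n)) u z" using cq_eq_iff[OF u Up.pw_carrier[OF z(1)]] by simp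
  then have "eqmod U (Lid (Suc n) m) u z" by (rule eqmod_mono[OF _ PIdl_Lid])
  then show "u \<in> Lid (Suc n) m" by (rule L.eqmod_closed) (use pw_Lid z(1) in blast)
qed

end

context taylor
begin

abbreviation Wt where "Wt \<equiv> pt (c [:-1, 1:]) \<one>"

lemma sP_pow_cong:
  assumes "z \<in> carrier W"
  shows "eqmod W (PIdl\<^bsub>W\<^esub> Wt) ((sP ^^ i) z) z"
  using assms
proof (induction z rule: Pt.E_induct)
  case (pure a b)
  have "sg i a \<ominus> a \<in> PIdl (c [:-1, 1:])" by (rule sg_cong[OF pure(1)])
  then obtain w where w: "w \<in> carrier A" "sg i a \<ominus> a = w \<otimes> c [:-1, 1:]" unfolding cgenideal_def by blast
  have "pt (sg i a) b \<ominus>\<^bsub>W\<^esub> pt a b = pt (sg i a \<ominus> a) b"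
  proof -
    have "sg i a = (sg i a \<ominus> a) \<oplus> a" using pure by (simp add: minus_eq a_assoc l_neg)
    then have "pt (sg i a) b = pt (sg i a \<ominus> a) b \<oplus>\<^bsub>W\<^esub> pt a b"
      using Pt.pt_add_left[of "sg i a \<ominus> a" a b] pure by simp
    then show ?thesis using pure by (simp add: W.minus_eq W.a_assoc W.r_neg)
  qed
  also have "\<dots> = pt w b \<otimes>\<^bsub>W\<^esub> Wt"
    unfolding w(2) using Pt.pt_mult[of w "c [:-1, 1:]" b \<one>] w(1) pure by simp
  finally have "pt (sg i a) b \<ominus>\<^bsub>W\<^esub> pt a b \<in> PIdl\<^bsub>W\<^esub> Wt"
    unfolding cgenideal_def using w(1) pure by blast
  then show ?case using pure by (simp add: sP_pow_pt eqmod_def)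
next
  case (add y z)
  interpret J: ideal "PIdl\<^bsub>W\<^esub> Wt" W by (intro W.cgenideal_ideal Wp.Q_closed)
  show ?case unfolding ring_hom_add[OF sP_pow add(1,2)] by (rule J.eqmod_add[OF add(3,4)])
qed

text \<open>The factor of index i is sent to \<sigma>^i(1 \<otimes> x - x \<otimes> 1), because
  \<sigma>^i multiplies the left x by q^i. The product is thus visibly in I \<sigma>(I) ...
  \<sigma>^n(I).\<close>

lemma h0_tp: "h0 (tp (Suc n)) \<in> tw n"
proof -
  have xd: "pt \<one> x \<ominus>\<^bsub>W\<^esub> pt x \<one> \<in> dI" using dI_diff[OF x_closed] by (simp add: eqmod_def)
  have fac: "h0 (tfac i) = (sP ^^ i) delta" for i
  proof -
    interpret s: ring_hom_ring W W "sP ^^ i" by (intro ring_hom_ringI2 W.ring_axioms sP_pow)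
    interpret h: ring_hom_ring U W h0 by (intro ring_hom_ringI2 U.P.ring_axioms W.ring_axioms h0_hom)
    interpret l: ring_hom_ring A W "\<lambda>a. pt a \<one>" by (intro ring_hom_ringI2 ring_axioms W.ring_axioms Pt.left_hom)
    have "h0 (tfac i) = delta \<oplus>\<^bsub>W\<^esub> pt (x \<ominus> c ([:0, 1:] ^ i) \<otimes> x) \<one>"
      unfolding tfac_def by (simp add: h0_X h0_con)
    also have "\<dots> = pt \<one> x \<oplus>\<^bsub>W\<^esub> (\<ominus>\<^bsub>W\<^esub> pt x \<one> \<oplus>\<^bsub>W\<^esub> (pt x \<one> \<oplus>\<^bsub>W\<^esub> \<ominus>\<^bsub>W\<^esub> pt (c ([:0, 1:] ^ i) \<otimes> x) \<one>))"
      unfolding delta_def W.minus_eq minus_eq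
      using l.hom_add[of x "\<ominus> (c ([:0, 1:] ^ i) \<otimes> x)"] l.hom_a_inv[of "c ([:0, 1:] ^ i) \<otimes> x"]
      by (simp add: W.a_assoc)
    also have "\<dots> = pt \<one> x \<ominus>\<^bsub>W\<^esub> pt (c ([:0, 1:] ^ i) \<otimes> x) \<one>"
      by (simp add: W.minus_eq W.r_neg1)
    also have "\<dots> = (sP ^^ i) delta"
      unfolding delta_def W.minus_eq
      using ring_hom_one[OF sg_hom, of i] by (simp add: sP_pow_pt sg_x)
    finally show ?thesis .
  qed
  have dl: "delta \<in> dI" using xd by (simp add: delta_def)
  show ?thesis
  proof (induction n)
    case 0
    have "tp (Suc 0) = tfac 0" using tp_Suc[of 0] by simp
    then show ?case using fac[of 0] dl by simp
  next
    case (Suc n)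
    have "h0 (tp (Suc (Suc n))) = h0 (tp (Suc n)) \<otimes>\<^bsub>W\<^esub> (sP ^^ Suc n) delta"
      unfolding tp_Suc[of "Suc n"] fac[symmetric] by (rule ring_hom_mult[OF h0_hom tp_closed tfac_closed])
    then show ?case using tw_mult[OF Suc dl] by simp
  qed
qed

lemma h0_Kq: "z \<in> Kq (Suc n) \<Longrightarrow> h0 z \<in> tw n"
proof -
  interpret t: ideal "tw n" W by (rule tw_ideal)
  assume "z \<in> Kq (Suc n)"
  then obtain w where w: "w \<in> carrier U" "z = w \<otimes>\<^bsub>U\<^esub> tp (Suc n)" unfolding cgenideal_def by blast
  show "h0 z \<in> tw n" unfolding w(2) ring_hom_mult[OF h0_hom w(1) tp_closed]
    by (rule t.I_l_closed[OF h0_tp h0_closed[OF w(1)]])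
qed

text \<open>Modulo \<open>q - 1\<close> there is no difference between the powers of \<open>I\<close> and the twisted powers.\<close>

lemma diag_power:
  assumes L: "ideal L W" "PIdl\<^bsub>W\<^esub> Wt \<subseteq> L"
    and "z \<in> ideal_pow W (dI <+>\<^bsub>W\<^esub> L) (Suc k)"
  shows "\<exists>t\<in>tw k. eqmod W L z t"
  using assms(3)
proof (induction k arbitrary: z)
  case 0
  interpret L: ideal L W by (rule L(1))
  have "z \<in> dI <+>\<^bsub>W\<^esub> L" using 0 W.ideal_pow_1[OF W.add_ideals[OF dI_ideal L(1)]] by simp
  then obtain i l where il: "i \<in> dI" "l \<in> L" "z = i \<oplus>\<^bsub>W\<^esub> l" unfolding set_add_def' by blast
  have ic: "i \<in> carrier W" using il(1) dI_iff by blast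
  have "eqmod W L (i \<oplus>\<^bsub>W\<^esub> l) (i \<oplus>\<^bsub>W\<^esub> \<zero>\<^bsub>W\<^esub>)"
    by (rule L.eqmod_add[OF L.eqmod_refl[OF ic] L.eqmod_zero_iff[THEN iffD2, OF il(2)]])
  then have "eqmod W L z i" using il(3) ic by simp
  then show ?case using il(1) by auto
next
  case (Suc k)
  interpret L: ideal L W by (rule L(1))
  interpret t: ideal "tw (Suc k)" W by (rule tw_ideal)
  have "z \<in> ideal_prod W (ideal_pow W (dI <+>\<^bsub>W\<^esub> L) (Suc k)) (dI <+>\<^bsub>W\<^esub> L)" using Suc.prems by simp
  then show ?case
  proof induction
    case (prod i j)
    obtain s where s: "s \<in> tw k" "eqmod W L i s" using Suc.IH[OF prod(1)] by blast
    obtain z l where zl: "z \<in> dI" "l \<in> L" "j = z \<oplus>\<^bsub>W\<^esub> l" using prod(2) unfolding set_add_def' by blast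
    have zc: "z \<in> carrier W" using zl(1) dI_iff by blast
    have "eqmod W L (z \<oplus>\<^bsub>W\<^esub> l) (z \<oplus>\<^bsub>W\<^esub> \<zero>\<^bsub>W\<^esub>)"
      by (rule L.eqmod_add[OF L.eqmod_refl[OF zc] L.eqmod_zero_iff[THEN iffD2, OF zl(2)]])
    then have 1: "eqmod W L j z" using zl(3) zc by simp
    have 2: "eqmod W L z ((sP ^^ Suc k) z)"
      by (rule L.eqmod_sym[OF eqmod_mono[OF sP_pow_cong[OF zc] L(2)]])
    have "eqmod W L (i \<otimes>\<^bsub>W\<^esub> j) (s \<otimes>\<^bsub>W\<^esub> (sP ^^ Suc k) z)"
      by (rule L.eqmod_mult[OF s(2) L.eqmod_trans[OF 1 2]])
    then show ?case using tw_mult[OF s(1) zl(1)] by blast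
  next
    case (sum s1 s2)
    then obtain t1 t2 where "t1 \<in> tw (Suc k)" "eqmod W L s1 t1" "t2 \<in> tw (Suc k)" "eqmod W L s2 t2" by blast
    then show ?case using L.eqmod_add[of s1 t1 s2 t2] t.a_closed[of t1 t2] by blast
  qed
qed

text \<open>The two maps agree on x and modulo I, and uniqueness of lifts is applied twice. With q -
  1 added to the target ideal, \<open>diag_power\<close> makes I nilpotent and gives agreement
  there; this is then lifted along q - 1, whose m-th power lies in (p, q-1)^m.\<close>

lemma h0_T:
  assumes f: "f \<in> carrier A"
  shows "eqmod W (tw n <+>\<^bsub>W\<^esub> Wp.pw m) (h0 (T (Suc n) f)) (pt \<one> f)"
proof -
  define L where "L = tw n <+>\<^bsub>W\<^esub> Wp.pw m"
  define L1 where "L1 = PIdl\<^bsub>W\<^esub> Wt <+>\<^bsub>W\<^esub> L"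
  define N1 where "N1 = dI <+>\<^bsub>W\<^esub> L1"
  have WtI: "ideal (PIdl\<^bsub>W\<^esub> Wt) W" by (intro W.cgenideal_ideal Wp.Q_closed)
  have L: "ideal L W" unfolding L_def by (intro W.add_ideals tw_ideal Wp.pw_ideal)
  have L1: "ideal L1 W" unfolding L1_def by (intro W.add_ideals WtI L)
  have N1: "ideal N1 W" unfolding N1_def by (intro W.add_ideals dI_ideal L1)
  note sub = W.ideal_add_supsets[OF tw_ideal[of n] Wp.pw_ideal[of m], folded L_def]
  note sub1 = W.ideal_add_supsets[OF WtI L, folded L1_def]
  note sub2 = W.ideal_add_supsets[OF dI_ideal L1, folded N1_def]
  interpret L: ideal L W by (rule L)
  interpret L1: ideal L1 W by (rule L1)
  interpret N1: ideal N1 W by (rule N1)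
  have nil1: "ideal_pow W N1 (Suc n) \<subseteq> L1"
  proof
    fix z assume "z \<in> ideal_pow W N1 (Suc n)"
    then obtain t where t: "t \<in> tw n" "eqmod W L1 z t"
      using diag_power[OF L1 sub1(1)] unfolding N1_def by blast
    show "z \<in> L1" by (rule L1.eqmod_closed[OF t(2)]) (use t(1) sub(1) sub1(2) in blast)
  qed
  have "Wt [^]\<^bsub>W\<^esub> m \<in> Wp.pw m" using Wp.pw_pow[OF Wp.Q_pw, of m] by simp
  then have nil: "ideal_pow W L1 m \<subseteq> L"
    unfolding L1_def using sub(2) by (intro W.principal_nilpotent'[OF L Wp.Q_closed]) blast
  let ?u = "\<lambda>a. h0 (T (Suc n) a)"
  have h0_eq: "eqmod W L (h0 u) (h0 v)" if "eqmod U (Kq (Suc n)) u v" for u v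
    by (rule eqmod_hom[OF U.P.ring_axioms W.ring_axioms h0_hom _ that]) (use h0_Kq sub(1) in blast)
  have hom: "hom_mod A W L ?u"
  proof (rule hom_modI)
    fix a b assume ab: "a \<in> carrier A" "b \<in> carrier A"
    show "?u a \<in> carrier W" by simp
    show "eqmod W L (?u (a \<oplus> b)) (?u a \<oplus>\<^bsub>W\<^esub> ?u b)"
      using h0_eq[OF hom_modD(2)[OF T_hom_mod ab]] ring_hom_add[OF h0_hom] by simp
    show "eqmod W L (?u (a \<otimes> b)) (?u a \<otimes>\<^bsub>W\<^esub> ?u b)"
      using h0_eq[OF hom_modD(3)[OF T_hom_mod ab]] ring_hom_mult[OF h0_hom] by simp
  next
    show "eqmod W L (?u \<one>) \<one>\<^bsub>W\<^esub>"
      using h0_eq[OF hom_modD(4)[OF T_hom_mod]] ring_hom_one[OF h0_hom] by simp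
  qed
  have hom': "hom_mod A W L (pt \<one>)"
    by (rule L.hom_mod_ring_hom[OF Pt.right_hom ring_axioms])
  have pw: "ideal_pow W (Idl\<^bsub>W\<^esub> {pt \<one> (\<eta> P), pt \<one> (\<eta> Q)}) m \<subseteq> L"
  proof -
    have "pt \<one> (\<eta> P) = pt (c [:int p:]) \<one>" "pt \<one> (\<eta> Q) = Wt"
      using Pt.pt_R[OF E.PQ_closed(1)] Pt.pt_R[OF E.PQ_closed(2)] unfolding eta_P eta_Q by simp_all
    then show ?thesis using sub(2) by (simp add: Wp.pw_def)
  qed
  have eta: "eqmod W L (?u (\<eta> r)) (pt \<one> (\<eta> r))" if "r \<in> carrier R" for r
    using h0_eq[OF T_eta[OF that]] that by (simp add: h0_con Pt.pt_R[OF that])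
  have "h0 (con x \<oplus>\<^bsub>U\<^esub> X) = pt x \<one> \<oplus>\<^bsub>W\<^esub> delta"
    using ring_hom_add[OF h0_hom con_closed[OF x_closed] X_closed] by (simp add: h0_con h0_X)
  also have "\<dots> = pt \<one> x"
    unfolding delta_def using W.a_lcomm[of "pt x \<one>" "pt \<one> x" "\<ominus>\<^bsub>W\<^esub> pt x \<one>"]
    by (simp add: W.minus_eq W.r_neg)
  finally have xx: "eqmod W L (?u x) (pt \<one> x)" using h0_eq[OF T_x] by simp
  have dd: "eqmod W dI (?u a) (pt \<one> a)" if a: "a \<in> carrier A" for a
  proof -
    interpret I: ideal dI W by (rule dI_ideal)
    have "h0 z \<in> dI" if "z \<in> PIdl\<^bsub>U\<^esub> X" for z
      using h0_Kq[of z 0] that tp_1 by simp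
    then have "eqmod W dI (h0 (T (Suc n) a)) (h0 (con a))"
      by (rule eqmod_hom[OF U.P.ring_axioms W.ring_axioms h0_hom _ T_con[OF a]]) simp_all
    then show ?thesis
      using I.eqmod_trans[OF _ I.eqmod_sym[OF dI_diff[OF a]]] by (simp add: h0_con a)
  qed
  \<comment> \<open>First stage: agreement modulo I improves to agreement modulo \<open>L1\<close>,
    the ideal \<open>L\<close> enlarged by q - 1.\<close>
  have st1: "eqmod W L1 (?u a) (pt \<one> a)" if a: "a \<in> carrier A" for a
    by (rule E.lift_unique[where u' = ?u and u = "pt \<one>" and a = a and m = m,
          OF W.is_cring self_tensor_range[OF Pt.tensor_axioms] L1 N1 sub2(2) nil1 hom_mod_mono[OF hom' sub1(2)]
            hom_mod_mono[OF hom sub1(2)] _ eqmod_mono[OF eta sub1(2)] eqmod_mono[OF xx sub1(2)]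
            eqmod_mono[OF dd sub2(1)] a])
      (use pw sub1(2) in auto)
  show ?thesis unfolding L_def[symmetric]
    by (rule E.lift_unique[where u' = ?u and u = "pt \<one>" and a = f and m = m,
          OF W.is_cring self_tensor_range[OF Pt.tensor_axioms] L L1 sub1(2) nil hom' hom pw eta xx st1 f])
qed

section \<open>Closures in the completed tensor product and the preimage of 1 \<otimes> f\<close>

abbreviation What where "What \<equiv> Wp.completed"

text \<open>The closure of the image of I^(n+1), described by components;
  \<open>twisted_closure_eq\<close> identifies it.\<close>

definition ctw :: "nat \<Rightarrow> (nat \<Rightarrow> ('a \<times> 'a \<Rightarrow> int) set set) set" where
  "ctw n = {y \<in> carrier What. \<forall>m. y m \<in> (+>\<^bsub>W\<^esub>) (Wp.pw m) ` tw n}"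

lemma ctw_ideal: "ideal (ctw n) What"
proof -
  let ?C = "\<lambda>m. {y \<in> carrier What. y m \<in> (+>\<^bsub>W\<^esub>) (Wp.pw m) ` tw n}"
  have "ideal (?C m) What" for m
  proof -
    have Q: "cring (W Quot Wp.pw m)" by (rule Wp.Quot_cring)
    have pr: "(\<lambda>s. s m) \<in> ring_hom What (W Quot Wp.pw m)"
      unfolding Wp.completed_eq by (rule Wp.proj_hom)
    interpret Q: cring "W Quot Wp.pw m" by (rule Q)
    interpret h: ring_hom_ring What "W Quot Wp.pw m" "\<lambda>s. s m"
      by (intro ring_hom_ringI2 Wp.hat.ring_axioms Q.ring_axioms pr)
    show ?thesis
      by (rule h.ideal_vimage[OF surj_hom_ideal[OF W.ring_axioms Q.ring_axioms
            ideal.rcos_ring_hom[OF Wp.pw_ideal] W.surj_Quot[OF Wp.pw_ideal] tw_ideal]])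
  qed
  then have "ideal (\<Inter>m\<in>UNIV. ?C m) What" by (intro Wp.hat.i_Intersect) auto
  moreover have "(\<Inter>m\<in>UNIV. ?C m) = ctw n" by (auto simp: ctw_def)
  ultimately show ?thesis by simp
qed

lemma tensor_hat_eq: "tensor_hat p R c A \<eta> = What"
  and to_tensor_hat_eq: "to_completion W (tensor_ideal p R c A \<eta>) = Wp.incl"
  and tensor_hat_pure_eq: "tensor_hat_pure p R c A \<eta> a b = Wp.incl (pt a b)"
  by (simp_all add: tensor_hat_def tensor_hat_pure_def Wp.completed_def Wp.incl_def tensor_ideal_def pq_ideal_def)

lemma twisted_closure_eq: "twisted_closure p R c A \<eta> x n = ctw n"
proof -
  have pw: "ideal_pow What (Idl\<^bsub>What\<^esub> {Wp.incl (pt (c [:int p:]) \<one>), Wp.incl Wt}) m = Wp.hat.pw m" for m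
    by (simp add: Wp.hat.pw_def)
  have iff: "y \<ominus>\<^bsub>What\<^esub> Wp.incl s \<in> Wp.hat.pw m \<longleftrightarrow> y m = Wp.pw m +>\<^bsub>W\<^esub> s"
    if "y \<in> carrier What" "s \<in> tw n" for y s m
  proof -
    have s: "Wp.incl s \<in> carrier What" using ideal.Icarr[OF tw_ideal that(2)] by simp
    show ?thesis using Wp.hat_eqmod_iff[OF that(1) s, of m] that(1) s
      by (simp add: eqmod_def Wp.incl_apply)
  qed
  show ?thesis
    unfolding twisted_closure_def adic_closure_def pq_ideal_def tensor_hat_pure_eq tensor_hat_eq to_tensor_hat_eq pw ctw_def
    using iff by (auto simp: image_iff)
qed

lemma incl_ctw_iff:
  assumes "u \<in> carrier W"
  shows "Wp.incl u \<in> ctw n \<longleftrightarrow> (\<forall>m. \<exists>s\<in>tw n. eqmod W (Wp.pw m) u s)"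
proof -
  have "Wp.pw m +>\<^bsub>W\<^esub> u = Wp.pw m +>\<^bsub>W\<^esub> s \<longleftrightarrow> eqmod W (Wp.pw m) u s" if "s \<in> tw n" for s m
    using ideal.eqmod_coset[OF Wp.pw_ideal] assms ideal.Icarr[OF tw_ideal that] by blast
  then show ?thesis using assms by (auto simp: ctw_def Wp.incl_apply image_iff)
qed

definition Phi :: "(nat \<Rightarrow> (nat \<Rightarrow> 'a) set) \<Rightarrow> nat \<Rightarrow> (nat \<Rightarrow> ('a \<times> 'a \<Rightarrow> int) set set) set" where
  "Phi s = (\<lambda>n. \<Union>b\<in>s n. ctw n +>\<^bsub>What\<^esub> UnivPoly.eval A What (\<lambda>a. Wp.incl (pt a \<one>)) (Wp.incl (pt \<one> x) \<ominus>\<^bsub>What\<^esub> Wp.incl (pt x \<one>)) b)"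

lemma Phi_eq: "q_series_to_tensor p R c A \<eta> x = Phi"
  by (simp add: fun_eq_iff q_series_to_tensor_def quot_limit_map_def Let_def tensor_hat_eq tensor_hat_pure_eq
      twisted_closure_eq Phi_def)

lemma eval_What:
  assumes "b \<in> carrier U"
  shows "UnivPoly.eval A What (\<lambda>a. Wp.incl (pt a \<one>)) (Wp.incl (pt \<one> x) \<ominus>\<^bsub>What\<^esub> Wp.incl (pt x \<one>)) b = Wp.incl (h0 b)"
proof -
  interpret i: ring_hom_ring W What Wp.incl by (intro ring_hom_ringI2 W.ring_axioms Wp.hat.ring_axioms Wp.incl_hom)
  let ?d = "Wp.incl (pt \<one> x) \<ominus>\<^bsub>What\<^esub> Wp.incl (pt x \<one>)"
  have d: "?d \<in> carrier What" by simp
  have l: "(\<lambda>a. Wp.incl (pt a \<one>)) \<in> ring_hom A What"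
    using ring_hom_trans[OF Pt.left_hom Wp.incl_hom] by (simp add: comp_def)
  have UH: "UP_pre_univ_prop A What (\<lambda>a. Wp.incl (pt a \<one>))"
    by (intro UP_pre_univ_prop.intro UP_cring.intro ring_hom_cringI2 cring_axioms Wp.hat.is_cring l)
  show ?thesis
  proof (rule U_hom_eq[OF Wp.hat.is_cring UP_pre_univ_prop.eval_ring_hom[OF UH d] _ _ _ assms])
    show "(\<lambda>b. Wp.incl (h0 b)) \<in> ring_hom U What"
      using ring_hom_trans[OF h0_hom Wp.incl_hom] by (simp add: comp_def)
    show "UnivPoly.eval A What (\<lambda>a. Wp.incl (pt a \<one>)) ?d X = Wp.incl (h0 X)"
    proof -
      have "Wp.incl delta = ?d" by (simp add: delta_def W.minus_eq Wp.hat.minus_eq)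
      then show ?thesis using UP_pre_univ_prop.eval_monom1[OF UH d] unfolding h0_X by (simp add: X_def)
    qed
    show "UnivPoly.eval A What (\<lambda>a. Wp.incl (pt a \<one>)) ?d (con a) = Wp.incl (h0 (con a))" if "a \<in> carrier A" for a
      using UP_pre_univ_prop.eval_const[OF UH d that] h0_con[OF that] by (simp add: con_def)
  qed
qed

lemma q_series_quot_system: "quot_system U (\<lambda>n. Kq (Suc n))"
proof (intro quot_system.intro quot_system_axioms.intro U.UP_cring)
  show "ideal (Kq (Suc n)) U" for n by (rule PIdl_tp_ideal)
  show "Kq (Suc (Suc n)) \<subseteq> Kq (Suc n)" for n
    by (intro U.P.cgenideal_minimal PIdl_tp_ideal tp_dvd) simp
qed

lemma q_series_eq: "q_series c A x = quot_limit U (\<lambda>n. Kq (Suc n))"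
  by (simp add: q_series_def q_series_ideal_def[abs_def])

lemma coset_Kq:
  assumes "u \<in> carrier U" "b \<in> cq n u"
  shows "b \<in> carrier U" "eqmod U (Kq n) b u"
proof -
  interpret K: ideal "Kq n" U by (rule PIdl_tp_ideal)
  obtain k where k: "k \<in> Kq n" "b = k \<oplus>\<^bsub>U\<^esub> u" using assms(2) unfolding a_r_coset_def' by blast
  show b: "b \<in> carrier U" using k K.Icarr assms(1) by simp
  have "b \<ominus>\<^bsub>U\<^esub> u = k" using k K.Icarr assms(1) by (simp add: U.P.minus_eq U.P.a_assoc U.P.r_neg)
  then show "eqmod U (Kq n) b u" using b assms(1) k(1) by (simp add: eqmod_def)
qed

text \<open>At level n the difference of two representatives maps into the closure of I^(n+1), so it
  lies in (\<xi>^(n+1)) by \<open>h0_injective\<close>.\<close>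

lemma Phi_inj: "inj_on Phi (carrier (q_series c A x))"
proof (rule inj_onI)
  interpret S: quot_system U "\<lambda>n. Kq (Suc n)" by (rule q_series_quot_system)
  interpret i: ring_hom_ring W What Wp.incl by (intro ring_hom_ringI2 W.ring_axioms Wp.hat.ring_axioms Wp.incl_hom)
  interpret h: ring_hom_ring U W h0 by (intro ring_hom_ringI2 U.P.ring_axioms W.ring_axioms h0_hom)
  fix s t assume st: "s \<in> carrier (q_series c A x)" "t \<in> carrier (q_series c A x)" "Phi s = Phi t"
  show "s = t"
  proof
    fix n
    interpret C: ideal "ctw n" What by (rule ctw_ideal)
    interpret K: ideal "Kq (Suc n)" U by (rule PIdl_tp_ideal)
    obtain u where u: "u \<in> carrier U" "s n = cq (Suc n) u" using S.carrier_limitD[of s n] st(1) unfolding q_series_eq by blast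
    obtain v where v: "v \<in> carrier U" "t n = cq (Suc n) v" using S.carrier_limitD[of t n] st(2) unfolding q_series_eq by blast
    have "u \<in> s n" unfolding u(2) by (rule S.coset_self[OF u(1)])
    moreover have "Wp.incl (h0 u) \<in> ctw n +>\<^bsub>What\<^esub> Wp.incl (h0 u)"
      by (rule C.a_rcos_self) (use u(1) in simp)
    ultimately have "Wp.incl (h0 u) \<in> Phi s n" unfolding Phi_def by (intro UN_I[of u]) (simp_all only: eval_What[OF u(1)])
    then have "Wp.incl (h0 u) \<in> Phi t n" using st(3) by simp
    then obtain b where b: "b \<in> t n" "Wp.incl (h0 u) \<in> ctw n +>\<^bsub>What\<^esub> UnivPoly.eval A What (\<lambda>a. Wp.incl (pt a \<one>)) (Wp.incl (pt \<one> x) \<ominus>\<^bsub>What\<^esub> Wp.incl (pt x \<one>)) b"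
      unfolding Phi_def by blast
    have bU: "b \<in> carrier U" "eqmod U (Kq (Suc n)) b v" using coset_Kq[OF v(1)] b(1) unfolding v(2) by blast+
    have "Wp.incl (h0 u) \<in> ctw n +>\<^bsub>What\<^esub> Wp.incl (h0 b)" using b(2) unfolding eval_What[OF bU(1)] .
    then obtain y where y: "y \<in> ctw n" "Wp.incl (h0 u) = y \<oplus>\<^bsub>What\<^esub> Wp.incl (h0 b)" unfolding a_r_coset_def' by blast
    have yc: "y \<in> carrier What" using y(1) C.Icarr by blast
    have "Wp.incl (h0 (u \<ominus>\<^bsub>U\<^esub> b)) = Wp.incl (h0 u) \<ominus>\<^bsub>What\<^esub> Wp.incl (h0 b)"
      using u(1) bU(1) by (simp add: U.P.minus_eq Wp.hat.minus_eq)
    also have "\<dots> = y" unfolding y(2) using yc bU(1) by (simp add: Wp.hat.minus_eq Wp.hat.a_assoc Wp.hat.r_neg)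
    finally have "Wp.incl (h0 (u \<ominus>\<^bsub>U\<^esub> b)) \<in> ctw n" using y(1) by simp
    then have "u \<ominus>\<^bsub>U\<^esub> b \<in> Kq (Suc n)"
      using incl_ctw_iff[of "h0 (u \<ominus>\<^bsub>U\<^esub> b)" n] u(1) bU(1) by (intro h0_injective) auto
    then have "eqmod U (Kq (Suc n)) u b" using u(1) bU(1) by (simp add: eqmod_def)
    then have "eqmod U (Kq (Suc n)) u v" using bU(2) by (rule K.eqmod_trans)
    then show "s n = t n" unfolding u(2) v(2) using u(1) v(1) by (simp add: cq_eq_iff)
  qed
qed

lemma tser_carrier: "(\<lambda>n. cq (Suc n) (T (Suc n) f)) \<in> carrier (q_series c A x)"
proof -
  interpret S: quot_system U "\<lambda>n. Kq (Suc n)" by (rule q_series_quot_system)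
  show ?thesis unfolding q_series_eq S.quot_limit_iff
  proof
    fix n
    have "cq (Suc m) (T (Suc m) f) = cq (Suc m) (T (Suc n) f)" if "m \<le> n" for m
    proof -
      have "eqmod U (Kq (Suc m)) (T (Suc n) f) (T (Suc m) f)" using that by (intro T_high) simp
      then have "cq (Suc m) (T (Suc n) f) = cq (Suc m) (T (Suc m) f)"
        by (rule cq_eq_iff[THEN iffD2, OF T_closed T_closed])
      then show ?thesis by (rule sym)
    qed
    then show "\<exists>b\<in>carrier U. \<forall>m\<le>n. cq (Suc m) (T (Suc m) f) = cq (Suc m) b"
      using T_closed by blast
  qed
qed

text \<open>At level n this is \<open>h0_T\<close> for all m at once: an element of I^(n+1) + (p,
  q-1)^m for every m is in the closure.\<close>

lemma tser_Phi:
  assumes f: "f \<in> carrier A"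
  shows "Phi (\<lambda>n. cq (Suc n) (T (Suc n) f)) = to_quot_limit What ctw (Wp.incl (pt \<one> f))"
proof
  interpret i: ring_hom_ring W What Wp.incl by (intro ring_hom_ringI2 W.ring_axioms Wp.hat.ring_axioms Wp.incl_hom)
  fix n
  interpret C: ideal "ctw n" What by (rule ctw_ideal)
  interpret S: quot_system U "\<lambda>n. Kq (Suc n)" by (rule q_series_quot_system)
  have "eqmod W (tw n <+>\<^bsub>W\<^esub> Wp.pw m) (h0 b) (pt \<one> f)" if b: "b \<in> cq (Suc n) (T (Suc n) f)" for b m
  proof -
    interpret L: ideal "tw n <+>\<^bsub>W\<^esub> Wp.pw m" W by (intro W.add_ideals tw_ideal Wp.pw_ideal)
    have "h0 z \<in> tw n <+>\<^bsub>W\<^esub> Wp.pw m" if "z \<in> Kq (Suc n)" for z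
      using W.ideal_add_supsets(1)[OF tw_ideal[of n] Wp.pw_ideal[of m]] h0_Kq[OF that] by blast
    then have "eqmod W (tw n <+>\<^bsub>W\<^esub> Wp.pw m) (h0 b) (h0 (T (Suc n) f))"
      by (rule eqmod_hom[OF U.P.ring_axioms W.ring_axioms h0_hom _ coset_Kq(2)[OF T_closed b]])
    then show ?thesis using h0_T[OF f] by (rule L.eqmod_trans)
  qed
  then have mem: "\<exists>s\<in>tw n. eqmod W (Wp.pw m) (h0 b \<ominus>\<^bsub>W\<^esub> pt \<one> f) s" if b: "b \<in> cq (Suc n) (T (Suc n) f)" for b m
  proof -
    interpret J: ideal "Wp.pw m" W by (rule Wp.pw_ideal)
    have bc: "b \<in> carrier U" by (rule coset_Kq(1)[OF T_closed b])
    have "h0 b \<ominus>\<^bsub>W\<^esub> pt \<one> f \<in> tw n <+>\<^bsub>W\<^esub> Wp.pw m"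
      using \<open>\<And>m b. b \<in> cq (Suc n) (T (Suc n) f) \<Longrightarrow> eqmod W (tw n <+>\<^bsub>W\<^esub> Wp.pw m) (h0 b) (pt \<one> f)\<close>[OF b]
      by (simp add: eqmod_def)
    then obtain s l where sl: "s \<in> tw n" "l \<in> Wp.pw m" "h0 b \<ominus>\<^bsub>W\<^esub> pt \<one> f = s \<oplus>\<^bsub>W\<^esub> l"
      unfolding set_add_def' by blast
    have sc: "s \<in> carrier W" by (rule ideal.Icarr[OF tw_ideal sl(1)])
    have "eqmod W (Wp.pw m) (s \<oplus>\<^bsub>W\<^esub> l) (s \<oplus>\<^bsub>W\<^esub> \<zero>\<^bsub>W\<^esub>)"
      by (rule J.eqmod_add[OF J.eqmod_refl[OF sc] J.eqmod_zero_iff[THEN iffD2, OF sl(2)]])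
    then show ?thesis using sl sc by auto
  qed
  have eq: "ctw n +>\<^bsub>What\<^esub> Wp.incl (h0 b) = ctw n +>\<^bsub>What\<^esub> Wp.incl (pt \<one> f)" if b: "b \<in> cq (Suc n) (T (Suc n) f)" for b
  proof -
    have bc: "b \<in> carrier U" by (rule coset_Kq(1)[OF T_closed b])
    have "Wp.incl (h0 b \<ominus>\<^bsub>W\<^esub> pt \<one> f) \<in> ctw n"
      using incl_ctw_iff[of "h0 b \<ominus>\<^bsub>W\<^esub> pt \<one> f" n] mem[OF b] bc f by simp
    then have "eqmod What (ctw n) (Wp.incl (h0 b)) (Wp.incl (pt \<one> f))"
      unfolding eqmod_def using bc f by (simp add: W.minus_eq Wp.hat.minus_eq)
    then show ?thesis using C.eqmod_coset by blast
  qed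
  have self: "T (Suc n) f \<in> cq (Suc n) (T (Suc n) f)" by (rule S.coset_self[OF T_closed])
  have "Phi (\<lambda>n. cq (Suc n) (T (Suc n) f)) n = (\<Union>b\<in>cq (Suc n) (T (Suc n) f). ctw n +>\<^bsub>What\<^esub> Wp.incl (h0 b))"
    unfolding Phi_def by (intro SUP_cong refl) (simp add: eval_What[OF coset_Kq(1)[OF T_closed]])
  also have "\<dots> = ctw n +>\<^bsub>What\<^esub> Wp.incl (pt \<one> f)"
    using self eq by auto
  finally show "Phi (\<lambda>n. cq (Suc n) (T (Suc n) f)) n = to_quot_limit What ctw (Wp.incl (pt \<one> f)) n"
    by (simp add: to_quot_limit_def)
qed

section \<open>The q-Taylor map with values in the completed divided power ring\<close>

abbreviation H where "H \<equiv> Dp.completed"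
abbreviation ic where "ic \<equiv> Dp.incl"
abbreviation HJ where "HJ \<equiv> Dp.hat.pw"

lemma dp_hat_eq: "dp_hat p c A x = H" and to_dp_hat_eq: "to_dp_hat p c A x = ic"
  and dp_hat_monom_eq: "dp_hat_monom p c A x a n = ic (mon a n)"
  and dp_hat_pow: "ideal_pow H (dp_hat_ideal p c A x) = HJ"
proof -
  have m: "up_ring.monom D = mon" by (simp add: dp_ring_def)
  show h: "dp_hat p c A x = H" and t: "to_dp_hat p c A x = ic"
    unfolding dp_hat_def to_dp_hat_def dp_ideal_def pq_ideal_def Dp.completed_def Dp.incl_def m by (simp_all add: con_def)
  show "dp_hat_monom p c A x a n = ic (mon a n)"
    unfolding dp_hat_monom_def t m ..
  show "ideal_pow H (dp_hat_ideal p c A x) = HJ"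
    unfolding dp_hat_ideal_def pq_ideal_def dp_hat_monom_def h t m Dp.hat.pw_def by (simp add: con_def)
qed

lemma ic_eqmod: "eqmod D (Dp.pw m) u v \<Longrightarrow> eqmod H (HJ m) (ic u) (ic v)"
  by (rule eqmod_hom[OF D.ring_axioms Dp.hat.ring_axioms Dp.incl_hom])
    (use Dp.incl_pw_iff Dp.pw_carrier in auto)

lemma hh_eqmod: "p * m \<le> n \<Longrightarrow> eqmod U (Kq n) u v \<Longrightarrow> eqmod D (Dp.pw m) (hh u) (hh v)"
  by (rule eqmod_hom[OF U.P.ring_axioms D.ring_axioms hh_hom hh_PIdl_pw])

abbreviation theta where "theta \<equiv> q_taylor p R c A \<eta> x"

text \<open>The value is the limit of the images of the truncated expansions. Truncating at n \<ge>
  p m costs only (p, q-1)^m, since \<xi>^(n) is sent to (n)_q! \<xi>^[n].\<close>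

lemma theta:
  assumes f: "f \<in> carrier A"
  shows "theta f \<in> carrier H" "\<And>m n. p * m \<le> n \<Longrightarrow> eqmod H (HJ m) (theta f) (ic (hh (T n f)))"
proof -
  let ?s = "\<lambda>n. cq (Suc n) (T (Suc n) f)"
  \<comment> \<open>\<open>inv_into\<close> is evaluated by injectivity at the known
    preimage.\<close>
  have inv: "inv_into (carrier (q_series c A x)) (q_series_to_tensor p R c A \<eta> x)
      (to_quot_limit (tensor_hat p R c A \<eta>) (twisted_closure p R c A \<eta> x) (tensor_hat_pure p R c A \<eta> \<one> f)) = ?s"
    unfolding Phi_eq tensor_hat_eq tensor_hat_pure_eq twisted_closure_eq[abs_def] tser_Phi[OF f, symmetric]
    by (rule inv_into_f_f[OF Phi_inj tser_carrier])
  have HI: "ideal (HJ m) H" for m by (rule Dp.hat.pw_ideal)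
  have step: "eqmod H (HJ m) (ic (hh (T n f))) (ic (hh (T k f)))" if "p * m \<le> k" "k \<le> n" for m n k
    by (rule ic_eqmod[OF hh_eqmod[OF that(1) T_high[OF that(2)]]])
  have "eqmod H (HJ m) (ic (hh (T (p * Suc m) f))) (ic (hh (T (p * m) f)))" for m
    by (rule step) auto
  then obtain y where y: "y \<in> carrier H" "\<And>m. eqmod H (HJ m) y (ic (hh (T (p * m) f)))"
    using Dp.hat.limit_exists[of "\<lambda>m. ic (hh (T (p * m) f))"] by blast
  have y2: "eqmod H (HJ m) y (ic (hh (T n f)))" if "p * m \<le> n" for m n
    by (rule ideal.eqmod_trans[OF HI y(2) ideal.eqmod_sym[OF HI step[OF order_refl that]]])
  have y3: "eqmod H (HJ m) y (ic (hh b))" if "p * m \<le> n" "b \<in> ?s n" for m n b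
  proof -
    have "eqmod U (Kq (Suc n)) (T (Suc n) f) b"
      by (rule ideal.eqmod_sym[OF PIdl_tp_ideal coset_Kq(2)[OF T_closed that(2)]])
    moreover have n: "p * m \<le> Suc n" using that(1) by simp
    ultimately have "eqmod H (HJ m) (ic (hh (T (Suc n) f))) (ic (hh b))"
      by (intro ic_eqmod hh_eqmod[OF n])
    with y2[OF n] show ?thesis by (rule ideal.eqmod_trans[OF HI])
  qed
  have "theta f = y"
    unfolding q_taylor_def inv q_series_to_dp_def dp_hat_eq dp_hat_pow to_dp_hat_eq up_to_dp_eq
  proof (rule the_equality)
    show "y \<in> carrier H \<and> (\<forall>m. \<exists>N. \<forall>n\<ge>N. \<forall>b\<in>?s n. y \<ominus>\<^bsub>H\<^esub> ic (hh b) \<in> HJ m)"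
      using y(1) y3 unfolding eqmod_def by blast
  next
    fix z assume z: "z \<in> carrier H \<and> (\<forall>m. \<exists>N. \<forall>n\<ge>N. \<forall>b\<in>?s n. z \<ominus>\<^bsub>H\<^esub> ic (hh b) \<in> HJ m)"
    show "z = y"
    proof (rule Dp.hat.eq_if_eqmod)
      fix m
      obtain N where N: "\<And>n b. n \<ge> N \<Longrightarrow> b \<in> ?s n \<Longrightarrow> z \<ominus>\<^bsub>H\<^esub> ic (hh b) \<in> HJ m" using z by blast
      let ?n = "max N (p * m)"
      interpret S: quot_system U "\<lambda>n. Kq (Suc n)" by (rule q_series_quot_system)
      have self: "T (Suc ?n) f \<in> ?s ?n" by (rule S.coset_self[OF T_closed])
      have "eqmod H (HJ m) z (ic (hh (T (Suc ?n) f)))"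
        unfolding eqmod_def using N[OF max.cobounded1 self] z by simp
      moreover have "eqmod H (HJ m) y (ic (hh (T (Suc ?n) f)))" by (rule y3[OF max.cobounded2 self])
      ultimately show "eqmod H (HJ m) z y"
        by (rule ideal.eqmod_trans[OF HI _ ideal.eqmod_sym[OF HI]])
    qed
  qed
  then show "theta f \<in> carrier H" "\<And>m n. p * m \<le> n \<Longrightarrow> eqmod H (HJ m) (theta f) (ic (hh (T n f)))"
    using y(1) y2 by simp_all
qed

end

section \<open>The flip map\<close>

lemma dp_mult_monom:
  "dp_mult (Polynomial.monom 1 n) (Polynomial.monom 1 m) =
    (\<Sum>i\<le>m. Polynomial.monom ([:dp_coef n m i:] * [:0, 1:] ^ i) (n + m - i))"
proof -
  let ?t = "\<lambda>n m i. Polynomial.monom ([:dp_coef n m i:] * [:0, 1:] ^ i) (n + m - i)"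
  have "dp_mult (Polynomial.monom 1 n) (Polynomial.monom 1 m)
      = (\<Sum>n'\<le>n. \<Sum>m'\<le>m. if m' = m then if n' = n then \<Sum>i\<le>m. ?t n m i else 0 else 0)"
    unfolding dp_mult_def degree_monom_eq[OF one_neq_zero]
    by (intro sum.cong refl) (simp del: mult_pCons_left mult_pCons_right)
  also have "\<dots> = (\<Sum>i\<le>m. ?t n m i)" by simp
  finally show ?thesis .
qed

context taylor
begin

abbreviation fl where "fl n \<equiv> umap (dp_flip n)"

lemma HJ_ideal: "ideal (HJ m) H" by (rule Dp.hat.pw_ideal)

lemma theta_closed [simp, intro]: "a \<in> carrier A \<Longrightarrow> theta a \<in> carrier H"
  by (rule theta(1))

lemma theta_eqI:
  assumes "a \<in> carrier A" "z \<in> carrier H" "\<And>m. eqmod H (HJ m) (ic (hh (T (p * m) a))) z"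
  shows "theta a = z"
  by (rule Dp.hat.eq_if_eqmod, rule ideal.eqmod_trans[OF HJ_ideal theta(2)[OF assms(1) order_refl] assms(3)])

lemma ic_hom: "ic \<in> ring_hom D H"
  by (rule Dp.incl_hom)

lemma ic_closed [simp, intro]: "u \<in> carrier U \<Longrightarrow> ic u \<in> carrier H"
  using ring_hom_closed[OF ic_hom, of u] by simp

lemma ic_add: "u \<in> carrier U \<Longrightarrow> v \<in> carrier U \<Longrightarrow> ic (u \<oplus>\<^bsub>U\<^esub> v) = ic u \<oplus>\<^bsub>H\<^esub> ic v"
  using ring_hom_add[OF ic_hom, of u v] by simp

lemma ic_mult: "u \<in> carrier U \<Longrightarrow> v \<in> carrier U \<Longrightarrow> ic (u \<otimes>\<^bsub>D\<^esub> v) = ic u \<otimes>\<^bsub>H\<^esub> ic v"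
  using ring_hom_mult[OF ic_hom, of u v] by simp

lemma hh_add: "u \<in> carrier U \<Longrightarrow> v \<in> carrier U \<Longrightarrow> hh (u \<oplus>\<^bsub>U\<^esub> v) = hh u \<oplus>\<^bsub>U\<^esub> hh v"
  using ring_hom_add[OF hh_hom, of u v] by simp

lemma hh_mult: "u \<in> carrier U \<Longrightarrow> v \<in> carrier U \<Longrightarrow> hh (u \<otimes>\<^bsub>U\<^esub> v) = hh u \<otimes>\<^bsub>D\<^esub> hh v"
  using ring_hom_mult[OF hh_hom, of u v] by simp

lemma ic_hh_eqmod: "eqmod U (Kq (p * m)) u v \<Longrightarrow> eqmod H (HJ m) (ic (hh u)) (ic (hh v))"
  by (rule ic_eqmod[OF hh_eqmod[OF order_refl]])

lemma theta_add:
  assumes "a \<in> carrier A" "b \<in> carrier A"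
  shows "theta (a \<oplus> b) = theta a \<oplus>\<^bsub>H\<^esub> theta b"
proof (rule theta_eqI)
  fix m
  have 1: "eqmod H (HJ m) (ic (hh (T (p * m) (a \<oplus> b)))) (ic (hh (T (p * m) a)) \<oplus>\<^bsub>H\<^esub> ic (hh (T (p * m) b)))"
    using ic_hh_eqmod[OF hom_modD(2)[OF T_hom_mod assms]] by (simp add: hh_add ic_add)
  have 2: "eqmod H (HJ m) (theta a \<oplus>\<^bsub>H\<^esub> theta b) (ic (hh (T (p * m) a)) \<oplus>\<^bsub>H\<^esub> ic (hh (T (p * m) b)))"
    by (rule ideal.eqmod_add[OF HJ_ideal theta(2)[OF assms(1) order_refl] theta(2)[OF assms(2) order_refl]])
  show "eqmod H (HJ m) (ic (hh (T (p * m) (a \<oplus> b)))) (theta a \<oplus>\<^bsub>H\<^esub> theta b)"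
    by (rule ideal.eqmod_trans[OF HJ_ideal 1 ideal.eqmod_sym[OF HJ_ideal 2]])
qed (use assms in simp_all)

lemma theta_mult:
  assumes "a \<in> carrier A" "b \<in> carrier A"
  shows "theta (a \<otimes> b) = theta a \<otimes>\<^bsub>H\<^esub> theta b"
proof (rule theta_eqI)
  fix m
  have 1: "eqmod H (HJ m) (ic (hh (T (p * m) (a \<otimes> b)))) (ic (hh (T (p * m) a)) \<otimes>\<^bsub>H\<^esub> ic (hh (T (p * m) b)))"
    using ic_hh_eqmod[OF hom_modD(3)[OF T_hom_mod assms]] by (simp add: hh_mult ic_mult)
  have 2: "eqmod H (HJ m) (theta a \<otimes>\<^bsub>H\<^esub> theta b) (ic (hh (T (p * m) a)) \<otimes>\<^bsub>H\<^esub> ic (hh (T (p * m) b)))"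
    by (rule ideal.eqmod_mult[OF HJ_ideal theta(2)[OF assms(1) order_refl] theta(2)[OF assms(2) order_refl]])
  show "eqmod H (HJ m) (ic (hh (T (p * m) (a \<otimes> b)))) (theta a \<otimes>\<^bsub>H\<^esub> theta b)"
    by (rule ideal.eqmod_trans[OF HJ_ideal 1 ideal.eqmod_sym[OF HJ_ideal 2]])
qed (use assms in simp_all)

lemma theta_eta: "r \<in> carrier R \<Longrightarrow> theta (\<eta> r) = ic (con (\<eta> r))"
  by (rule theta_eqI) (use ic_hh_eqmod[OF T_eta[of r]] in \<open>simp_all add: hh_con\<close>)

lemma theta_c: "theta (c f) = ic (con (c f))"
  using c_eta[of f] theta_eta by auto

lemma theta_x: "theta x = ic (con x \<oplus>\<^bsub>U\<^esub> eps 1)"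
proof (rule theta_eqI)
  fix m
  have "hh (con x \<oplus>\<^bsub>U\<^esub> X) = con x \<oplus>\<^bsub>U\<^esub> eps 1"
    using hh_add[OF con_closed[OF x_closed] X_closed] unfolding hh_X hh_con[OF x_closed] .
  then show "eqmod H (HJ m) (ic (hh (T (p * m) x))) (ic (con x \<oplus>\<^bsub>U\<^esub> eps 1))"
    using ic_hh_eqmod[OF T_x[of "p * m"]] by simp
qed simp_all

lemma ic_con_one: "ic (con \<one>) = \<one>\<^bsub>H\<^esub>"
  using ring_hom_one[OF ic_hom] ring_hom_one[OF con_hom_D] by simp

lemma theta_one: "theta \<one> = \<one>\<^bsub>H\<^esub>"
  using theta_c[of 1] ic_con_one by simp

lemma theta_hom: "theta \<in> ring_hom A H"
  by (rule ring_hom_memI) (simp_all add: theta_add theta_mult theta_one)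

lemma theta_zero: "theta \<zero> = \<zero>\<^bsub>H\<^esub>"
  by (rule ring_hom_zero[OF theta_hom ring_axioms Dp.hat.ring_axioms])

lemma umap_y: "umap dp_y = con x \<oplus>\<^bsub>U\<^esub> eps 1"
  unfolding dp_y_def umap_add umap_monom by (simp add: con_def eps_def del: One_nat_def)

text \<open>On polynomials in x with coefficients from \<int>[q] the map is determined by x -> x +
  \<xi>, so its values are base changed from the universal ring.\<close>

lemma theta_evx: "theta (evx ([:g:] * [:0, 1:] ^ i)) = ic (umap (dp_mult (Polynomial.monom [:g:] 0) (dp_y_pow i)))"
proof -
  have pow: "theta (x [^] i) = ic (umap (dp_y_pow i))"
  proof (induction i)
    case 0
    have "theta (x [^] (0::nat)) = \<one>\<^bsub>H\<^esub>" by (simp add: theta_one)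
    also have "\<dots> = ic (umap (dp_y_pow 0))" unfolding dp_y_pow.simps umap_1 con_def[symmetric] ic_con_one ..
    finally show ?case .
  next
    case (Suc i)
    then show ?case
      by (simp add: theta_mult theta_x umap_mult ic_mult umap_y del: One_nat_def)
  qed
  have "theta (evx ([:g:] * [:0, 1:] ^ i)) = ic (con (c g)) \<otimes>\<^bsub>H\<^esub> ic (umap (dp_y_pow i))"
    unfolding evx_mult evx_const evx_power evx_x by (simp add: theta_mult theta_c pow)
  also have "\<dots> = ic (umap (dp_mult (Polynomial.monom [:g:] 0) (dp_y_pow i)))"
  proof -
    have "umap (Polynomial.monom [:g:] 0) = con (c g)" by (simp add: umap_monom con_def)
    then show ?thesis by (simp add: umap_mult ic_mult)
  qed
  finally show ?thesis .
qed

section \<open>The flip on the uncompleted ring\<close>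

text \<open>The \<theta>-semilinear extension from basis elements. Supports are finite, so no
  convergence is involved yet.\<close>

definition tau0 :: "(nat \<Rightarrow> 'a) \<Rightarrow> nat \<Rightarrow> (nat \<Rightarrow> 'a) set" where
  "tau0 u = finsum H (\<lambda>n. theta (u n) \<otimes>\<^bsub>H\<^esub> ic (fl n)) {n. u n \<noteq> \<zero>}"

lemma tau0_sup:
  assumes "u \<in> carrier U" "finite S" "{n. u n \<noteq> \<zero>} \<subseteq> S"
  shows "tau0 u = finsum H (\<lambda>n. theta (u n) \<otimes>\<^bsub>H\<^esub> ic (fl n)) S"
  unfolding tau0_def
  by (rule Dp.hat.add.finprod_mono_neutral_cong_left)
    (use assms U_coeff[OF assms(1)] in \<open>auto simp: theta_zero\<close>)

lemma finite_supp: "u \<in> carrier U \<Longrightarrow> finite {n. u n \<noteq> \<zero>}"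
proof -
  assume "u \<in> carrier U"
  then obtain N where "\<And>n. n > N \<Longrightarrow> u n = \<zero>" by (auto simp: U_carrier)
  then have "{n. u n \<noteq> \<zero>} \<subseteq> {..N}" by (auto simp: not_less[symmetric])
  then show ?thesis by (rule finite_subset) simp
qed

lemma tau0_closed [simp, intro]: "u \<in> carrier U \<Longrightarrow> tau0 u \<in> carrier H"
  unfolding tau0_def by (intro Dp.hat.finsum_closed) (auto simp: U_coeff)

lemma tau0_add:
  assumes "u \<in> carrier U" "v \<in> carrier U"
  shows "tau0 (u \<oplus>\<^bsub>U\<^esub> v) = tau0 u \<oplus>\<^bsub>H\<^esub> tau0 v"
proof -
  let ?S = "{n. u n \<noteq> \<zero>} \<union> {n. v n \<noteq> \<zero>}"
  have S: "finite ?S" using finite_supp assms by simp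
  have uv: "u n \<in> carrier A" "v n \<in> carrier A" for n using U_coeff assms by auto
  have "tau0 (u \<oplus>\<^bsub>U\<^esub> v) = finsum H (\<lambda>n. theta ((u \<oplus>\<^bsub>U\<^esub> v) n) \<otimes>\<^bsub>H\<^esub> ic (fl n)) ?S"
    using assms by (intro tau0_sup S) (auto simp: U_add_apply)
  also have "\<dots> = finsum H (\<lambda>n. theta (u n) \<otimes>\<^bsub>H\<^esub> ic (fl n) \<oplus>\<^bsub>H\<^esub> theta (v n) \<otimes>\<^bsub>H\<^esub> ic (fl n)) ?S"
    using assms uv by (intro Dp.hat.finsum_cong') (auto simp: U_add_apply theta_add Dp.hat.l_distr)
  also have "\<dots> = finsum H (\<lambda>n. theta (u n) \<otimes>\<^bsub>H\<^esub> ic (fl n)) ?S \<oplus>\<^bsub>H\<^esub> finsum H (\<lambda>n. theta (v n) \<otimes>\<^bsub>H\<^esub> ic (fl n)) ?S"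
    using uv by (intro Dp.hat.finsum_addf) auto
  also have "\<dots> = tau0 u \<oplus>\<^bsub>H\<^esub> tau0 v"
    using tau0_sup[OF assms(1) S] tau0_sup[OF assms(2) S] by auto
  finally show ?thesis .
qed

lemma tau0_mon:
  assumes "a \<in> carrier A"
  shows "tau0 (mon a n) = theta a \<otimes>\<^bsub>H\<^esub> ic (fl n)"
proof -
  have "tau0 (mon a n) = finsum H (\<lambda>k. theta (mon a n k) \<otimes>\<^bsub>H\<^esub> ic (fl k)) {n}"
    by (rule tau0_sup[OF U.monom_closed[OF assms]]) (auto simp: U_mon[OF assms])
  then show ?thesis using assms by (simp add: U_mon)
qed

lemma fl_0: "fl 0 = con \<one>"
  by (simp add: dp_flip_def umap_1 con_def)

lemma tau0_con: "a \<in> carrier A \<Longrightarrow> tau0 (con a) = theta a"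
  using tau0_mon[of a 0] by (simp add: fl_0 ic_con_one con_def[symmetric])

lemma tau0_eps: "tau0 (eps n) = ic (fl n)"
  using tau0_mon[of \<one> n] by (simp add: eps_def theta_one)

lemma tau0_zero: "tau0 \<zero>\<^bsub>U\<^esub> = \<zero>\<^bsub>H\<^esub>"
  by (simp add: tau0_def U_zero)

lemma ic_zero: "ic \<zero>\<^bsub>U\<^esub> = \<zero>\<^bsub>H\<^esub>"
  using ring_hom_zero[OF ic_hom D.ring_axioms Dp.hat.ring_axioms] by simp

lemma umap_sum_hom:
  assumes "finite S"
  shows "ic (umap (sum f S)) = finsum H (\<lambda>i. ic (umap (f i))) S"
    and "tau0 (umap (sum f S)) = finsum H (\<lambda>i. tau0 (umap (f i))) S"
  using assms
  by (induction S rule: finite_induct)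
    (simp_all add: umap_0 ic_zero tau0_zero umap_add ic_add tau0_add)

lemma tau0_monom:
  "tau0 (umap (Polynomial.monom ([:g:] * [:0, 1:] ^ i) k)) =
    ic (umap (dp_mult (Polynomial.monom [:g:] 0) (dp_mult (dp_y_pow i) (dp_flip k))))"
  unfolding umap_monom tau0_mon[OF evx_closed] theta_evx
  by (simp add: ic_mult[symmetric] umap_mult[symmetric] dp_mult_assoc)

text \<open>In the product of two basis elements \<theta> turns the scalars x^i into powers of x +
  \<xi>, and the result is the exchanged product rule \<open>dp_flip_mult\<close>.\<close>

lemma tau0_eps_mult: "tau0 (eps n \<otimes>\<^bsub>D\<^esub> eps m) = ic (fl n) \<otimes>\<^bsub>H\<^esub> ic (fl m)"
proof -
  have "tau0 (eps n \<otimes>\<^bsub>D\<^esub> eps m) = tau0 (umap (dp_mult (Polynomial.monom 1 n) (Polynomial.monom 1 m)))"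
    unfolding umap_mult umap_eps ..
  also have "\<dots> = ic (umap (dp_mult (dp_flip n) (dp_flip m)))"
    unfolding dp_mult_monom dp_flip_mult umap_sum_hom[OF finite_atMost] tau0_monom ..
  also have "\<dots> = ic (fl n) \<otimes>\<^bsub>H\<^esub> ic (fl m)"
    unfolding umap_mult by (rule ic_mult) auto
  finally show ?thesis .
qed

text \<open>The scalars x^(n-k) of the flip become powers of x + \<xi> under \<theta>, so this is
  the base change of \<open>dp_flip_flip\<close>.\<close>

lemma tau0_fl:
  assumes "0 < n"
  shows "tau0 (fl n) = ic (eps n)"
proof -
  have "tau0 (fl n) = finsum H (\<lambda>k. ic (umap (dp_mult (Polynomial.monom [:flip_coef n k:] 0) (dp_mult (dp_y_pow (n - k)) (dp_flip k))))) {1..n}"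
    using assms unfolding dp_flip_def[of n] by (simp only: neq0_conv if_False umap_sum_hom finite_atLeastAtMost tau0_monom less_not_refl2[of 0 n] split: if_splits)
  also have "\<dots> = ic (umap (Polynomial.monom 1 n))"
    unfolding umap_sum_hom(1)[OF finite_atLeastAtMost, symmetric] dp_flip_flip[OF assms] ..
  finally show ?thesis unfolding umap_eps .
qed

lemma tau0_scal:
  assumes "a \<in> carrier A" "u \<in> carrier U"
  shows "tau0 (scal a u) = theta a \<otimes>\<^bsub>H\<^esub> tau0 u"
  using assms(2)
proof (induction u rule: U_induct)
  case (monom b n)
  then show ?case using assms(1) by (simp add: scal_mon tau0_mon theta_mult Dp.hat.m_assoc)
next
  case (add u v)
  then show ?case using assms(1) by (simp add: scal_add tau0_add Dp.hat.r_distr)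
qed

text \<open>Semilinearity reduces the claim to products of basis elements.\<close>

lemma tau0_mult:
  assumes "u \<in> carrier U" "v \<in> carrier U"
  shows "tau0 (u \<otimes>\<^bsub>D\<^esub> v) = tau0 u \<otimes>\<^bsub>H\<^esub> tau0 v"
  using assms(1)
proof (induction u rule: U_induct)
  case (monom a n)
  note a = monom
  show ?case using assms(2)
  proof (induction v rule: U_induct)
    case (monom b m)
    have "tau0 (mon a n \<otimes>\<^bsub>D\<^esub> mon b m) = theta (a \<otimes> b) \<otimes>\<^bsub>H\<^esub> (ic (fl n) \<otimes>\<^bsub>H\<^esub> ic (fl m))"
      unfolding D_mon_mult[OF a monom] using a monom by (simp add: tau0_scal tau0_eps_mult)
    also have "\<dots> = tau0 (mon a n) \<otimes>\<^bsub>H\<^esub> tau0 (mon b m)"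
      using a monom by (simp add: tau0_mon theta_mult Dp.hat.m_ac)
    finally show ?case .
  next
    case (add v w)
    have mc: "mon a n \<in> carrier U" using a by simp
    have "tau0 (mon a n \<otimes>\<^bsub>D\<^esub> (v \<oplus>\<^bsub>U\<^esub> w)) = tau0 (mon a n \<otimes>\<^bsub>D\<^esub> v \<oplus>\<^bsub>U\<^esub> mon a n \<otimes>\<^bsub>D\<^esub> w)"
      using D.r_distr[of v w "mon a n"] add(1,2) mc by simp
    also have "\<dots> = tau0 (mon a n \<otimes>\<^bsub>D\<^esub> v) \<oplus>\<^bsub>H\<^esub> tau0 (mon a n \<otimes>\<^bsub>D\<^esub> w)"
      using mc add(1,2) by (intro tau0_add D_closed)
    also have "\<dots> = tau0 (mon a n) \<otimes>\<^bsub>H\<^esub> tau0 (v \<oplus>\<^bsub>U\<^esub> w)"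
      using add mc by (simp add: tau0_add Dp.hat.r_distr)
    finally show ?case .
  qed
next
  case (add u w)
  have "tau0 ((u \<oplus>\<^bsub>U\<^esub> w) \<otimes>\<^bsub>D\<^esub> v) = tau0 (u \<otimes>\<^bsub>D\<^esub> v) \<oplus>\<^bsub>H\<^esub> tau0 (w \<otimes>\<^bsub>D\<^esub> v)"
    unfolding D_l_distr[OF add(1,2) assms(2)] using add(1,2) assms(2) by (intro tau0_add D_closed)
  then show ?case using add assms(2) by (simp add: tau0_add Dp.hat.l_distr)
qed

lemma tau0_hom: "tau0 \<in> ring_hom D H"
proof (rule ring_hom_memI)
  have "\<one>\<^bsub>D\<^esub> = con \<one>" using ring_hom_one[OF con_hom_D] by simp
  then show "tau0 \<one>\<^bsub>D\<^esub> = \<one>\<^bsub>H\<^esub>" by (simp add: tau0_con theta_one del: D_simps)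
qed (simp_all add: tau0_mult tau0_add)

section \<open>The flip on the completion\<close>

text \<open>As a ring homomorphism fixing p and q - 1 the flip is continuous, hence extends.\<close>

lemma tau_exists: "\<exists>g. g \<in> ring_hom H H \<and> (\<forall>u\<in>carrier U. g (ic u) = tau0 u)"
proof -
  obtain g where "g \<in> ring_hom H H" "\<And>u. u \<in> carrier D \<Longrightarrow> g (ic u) = tau0 u"
    by (rule hom_extend[where h = tau0, OF Dp.adic_pair_axioms Dp.hat.complete_adic_pair_axioms tau0_hom])
      (auto simp: tau0_con theta_c)
  then show ?thesis by auto
qed

definition tau where
  "tau = (SOME g. g \<in> ring_hom H H \<and> (\<forall>u\<in>carrier U. g (ic u) = tau0 u))"

lemma tau_hom: "tau \<in> ring_hom H H" and tau_ic: "u \<in> carrier U \<Longrightarrow> tau (ic u) = tau0 u"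
  using someI_ex[OF tau_exists] unfolding tau_def by blast+

lemma tau_closed [simp, intro]: "y \<in> carrier H \<Longrightarrow> tau y \<in> carrier H"
  by (rule ring_hom_closed[OF tau_hom])

lemma tau_HJ: "z \<in> HJ m \<Longrightarrow> tau z \<in> HJ m"
  by (rule pw_hom[where h = tau, OF Dp.hat.adic_pair_axioms Dp.hat.adic_pair_axioms tau_hom])
    (simp_all add: tau_ic tau0_con theta_c)

lemma tau_eqmod: "eqmod H (HJ m) y z \<Longrightarrow> eqmod H (HJ m) (tau y) (tau z)"
  by (rule eqmod_hom[OF Dp.hat.ring_axioms Dp.hat.ring_axioms tau_hom tau_HJ])

lemma ic_eqmod_iff:
  assumes "u \<in> carrier U" "v \<in> carrier U"
  shows "eqmod H (HJ m) (ic u) (ic v) \<longleftrightarrow> eqmod D (Dp.pw m) u v"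
proof -
  interpret i: ring_hom_ring D H ic by (intro ring_hom_ringI2 D.ring_axioms Dp.hat.ring_axioms ic_hom)
  have "ic (u \<ominus>\<^bsub>D\<^esub> v) = ic u \<ominus>\<^bsub>H\<^esub> ic v"
    unfolding D.minus_eq Dp.hat.minus_eq using i.hom_add i.hom_a_inv assms D.a_inv_closed by (metis D_simps(1))
  moreover have "u \<ominus>\<^bsub>D\<^esub> v \<in> carrier D" using assms by (intro D.minus_closed) simp_all
  ultimately show ?thesis using Dp.incl_pw_iff[of "u \<ominus>\<^bsub>D\<^esub> v" m] assms by (simp add: eqmod_def)
qed

lemma fl_1: "fl 1 = \<ominus>\<^bsub>D\<^esub> eps 1"
proof -
  have "dp_flip 1 + Polynomial.monom 1 1 = 0"
    by (simp add: dp_flip_def flip_coef_def add_monom one_pCons)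
  then have "fl 1 \<oplus>\<^bsub>U\<^esub> eps 1 = \<zero>\<^bsub>U\<^esub>"
    unfolding umap_eps[symmetric] umap_add[symmetric] by (simp only: umap_0)
  then show ?thesis using D.minus_equality[of "fl 1" "eps 1"] by simp
qed

end

context taylor
begin

text \<open>\<open>X_pow_Lid\<close> with n = p * m writes this power of \<xi> as a multiple of
  \<xi>^(p m) plus an element of (p, q-1)^m; the choice of n sends the first part into (p, q-1)^m as
  well.\<close>

lemma eps_pow_pw: "eps 1 [^]\<^bsub>D\<^esub> (p * m * m) \<in> Dp.pw m"
proof -
  interpret h: ring_hom_ring U D hh by (intro ring_hom_ringI2 U.P.ring_axioms D.ring_axioms hh_hom)
  interpret L: ideal "Dp.pw m" D by (rule Dp.pw_ideal)
  have "X [^]\<^bsub>U\<^esub> (p * m * m) \<in> Lid (p * m) m" by (rule X_pow_Lid)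
  then obtain w z where w: "w \<in> carrier U" "z \<in> Up.pw m" "X [^]\<^bsub>U\<^esub> (p * m * m) = tp (p * m) \<otimes>\<^bsub>U\<^esub> w \<oplus>\<^bsub>U\<^esub> z"
    unfolding Lid_iff by blast
  have zc: "z \<in> carrier U" by (rule Up.pw_carrier[OF w(2)])
  have "hh (tp (p * m) \<otimes>\<^bsub>U\<^esub> w) \<in> Dp.pw m"
    unfolding hh_mult[OF tp_closed w(1)] using w(1) by (intro L.I_r_closed hh_tp_pw) simp_all
  then have "hh (tp (p * m) \<otimes>\<^bsub>U\<^esub> w) \<oplus>\<^bsub>D\<^esub> hh z \<in> Dp.pw m"
    using hh_pw[OF w(2)] by (rule L.a_closed)
  then have "hh (X [^]\<^bsub>U\<^esub> (p * m * m)) \<in> Dp.pw m"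
    unfolding w(3) using w(1) zc by (simp add: hh_add)
  then show ?thesis using h.hom_nat_pow[OF X_closed, of "p * m * m"] by (simp only: hh_X)
qed

text \<open>To the given precision \<theta>(a) = a + v \<xi>. The flip sends a to \<theta>(a) and
  \<xi> to -\<xi>, which gives \<theta>(a) - \<tau>(v) \<xi>, again a plus a multiple of
  \<xi>.\<close>

lemma tau_theta_approx:
  assumes a: "a \<in> carrier A"
  shows "\<exists>w\<in>carrier U. eqmod H (HJ m) (tau (theta a)) (ic (con a \<oplus>\<^bsub>U\<^esub> w \<otimes>\<^bsub>D\<^esub> eps 1))"
proof -
  interpret HI: ideal "HJ m" H by (rule HJ_ideal)
  let ?n = "max (p * m) 1"
  have "T ?n a \<ominus>\<^bsub>U\<^esub> con a \<in> PIdl\<^bsub>U\<^esub> X" using T_con[OF a, of ?n] by (simp add: eqmod_def)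
  then obtain v where v: "v \<in> carrier U" "T ?n a \<ominus>\<^bsub>U\<^esub> con a = v \<otimes>\<^bsub>U\<^esub> X" unfolding cgenideal_def by blast
  have "T ?n a = (T ?n a \<ominus>\<^bsub>U\<^esub> con a) \<oplus>\<^bsub>U\<^esub> con a"
    using a by (simp add: U.P.minus_eq U.P.a_assoc U.P.l_neg)
  then have Tn: "T ?n a = v \<otimes>\<^bsub>U\<^esub> X \<oplus>\<^bsub>U\<^esub> con a" unfolding v(2) .
  have e: "hh (T ?n a) = hh v \<otimes>\<^bsub>D\<^esub> eps 1 \<oplus>\<^bsub>U\<^esub> con a"
    unfolding Tn using v(1) a by (simp add: hh_add hh_mult hh_con hh_X del: One_nat_def)
  have hv: "hh v \<in> carrier U" using v(1) by simp
  have ev: "hh v \<otimes>\<^bsub>D\<^esub> eps 1 \<in> carrier U" using hv by (intro D_closed) simp_all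
  have n: "p * m \<le> ?n" by simp
  have th: "eqmod H (HJ m) (theta a) (ic (hh v \<otimes>\<^bsub>D\<^esub> eps 1) \<oplus>\<^bsub>H\<^esub> ic (con a))"
    using theta(2)[OF a n] unfolding e ic_add[OF ev con_closed[OF a]] .
  \<comment> \<open>The factor \<tau>(v) lives in the completion; b approximates it in the
    uncompleted ring.\<close>
  obtain b where b: "b \<in> carrier U" "eqmod H (HJ m) (tau0 (hh v)) (ic b)"
    using Dp.hat_dense[OF tau0_closed[OF hv]] by auto
  have nb: "\<ominus>\<^bsub>D\<^esub> eps 1 \<in> carrier U" using D.a_inv_closed[of "eps 1"] by simp
  have "tau (ic (hh v \<otimes>\<^bsub>D\<^esub> eps 1) \<oplus>\<^bsub>H\<^esub> ic (con a)) = tau0 (hh v) \<otimes>\<^bsub>H\<^esub> ic (fl 1) \<oplus>\<^bsub>H\<^esub> theta a"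
    unfolding ic_add[OF ev con_closed[OF a], symmetric]
    using ev a hv by (simp add: tau_ic tau0_add tau0_mult tau0_eps tau0_con)
  then have 1: "eqmod H (HJ m) (tau (theta a)) (tau0 (hh v) \<otimes>\<^bsub>H\<^esub> ic (fl 1) \<oplus>\<^bsub>H\<^esub> theta a)"
    using tau_eqmod[OF th] by simp
  have "eqmod H (HJ m) (tau0 (hh v) \<otimes>\<^bsub>H\<^esub> ic (fl 1)) (ic b \<otimes>\<^bsub>H\<^esub> ic (fl 1))"
    by (rule HI.eqmod_mult[OF b(2) HI.eqmod_refl]) simp
  then have "eqmod H (HJ m) (tau0 (hh v) \<otimes>\<^bsub>H\<^esub> ic (fl 1) \<oplus>\<^bsub>H\<^esub> theta a)
      (ic b \<otimes>\<^bsub>H\<^esub> ic (fl 1) \<oplus>\<^bsub>H\<^esub> (ic (hh v \<otimes>\<^bsub>D\<^esub> eps 1) \<oplus>\<^bsub>H\<^esub> ic (con a)))"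
    by (rule HI.eqmod_add[OF _ th])
  with 1 have 2: "eqmod H (HJ m) (tau (theta a)) (ic b \<otimes>\<^bsub>H\<^esub> ic (fl 1) \<oplus>\<^bsub>H\<^esub> (ic (hh v \<otimes>\<^bsub>D\<^esub> eps 1) \<oplus>\<^bsub>H\<^esub> ic (con a)))"
    by (rule HI.eqmod_trans)
  have be: "b \<otimes>\<^bsub>D\<^esub> fl 1 \<in> carrier U" using b(1) by (intro D_closed) simp_all
  have w: "hh v \<ominus>\<^bsub>D\<^esub> b \<in> carrier U" using D.minus_closed[of "hh v" b] hv b(1) by simp
  have "b \<otimes>\<^bsub>D\<^esub> fl 1 \<oplus>\<^bsub>D\<^esub> (hh v \<otimes>\<^bsub>D\<^esub> eps 1 \<oplus>\<^bsub>D\<^esub> con a) = con a \<oplus>\<^bsub>D\<^esub> (hh v \<ominus>\<^bsub>D\<^esub> b) \<otimes>\<^bsub>D\<^esub> eps 1"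
  proof -
    have c: "b \<in> carrier D" "hh v \<in> carrier D" "con a \<in> carrier D" "eps 1 \<in> carrier D"
      using b(1) hv a by simp_all
    show ?thesis unfolding fl_1 D.minus_eq using c
      by (simp del: D_simps One_nat_def add: D.l_distr D.r_minus D.l_minus D.a_ac)
  qed
  then have "ic b \<otimes>\<^bsub>H\<^esub> ic (fl 1) \<oplus>\<^bsub>H\<^esub> (ic (hh v \<otimes>\<^bsub>D\<^esub> eps 1) \<oplus>\<^bsub>H\<^esub> ic (con a)) = ic (con a \<oplus>\<^bsub>U\<^esub> (hh v \<ominus>\<^bsub>D\<^esub> b) \<otimes>\<^bsub>D\<^esub> eps 1)"
    using b(1) a ev be U.P.add.m_closed[OF ev con_closed[OF a]]
    by (simp add: ic_mult[symmetric] ic_add[symmetric] del: One_nat_def)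
  with 2 w show ?thesis by auto
qed

text \<open>At each level both maps take values in a quotient where \<xi> is nilpotent. They agree
  modulo \<xi>, and on x because (x + \<xi>) - \<xi> = x, so uniqueness of lifts applies.\<close>

lemma tau_theta:
  assumes a: "a \<in> carrier A"
  shows "tau (theta a) = ic (con a)"
proof (rule Dp.hat.eq_if_eqmod)
  fix m
  interpret HI: ideal "HJ m" H by (rule HJ_ideal)
  interpret L: ideal "Dp.pw m" D by (rule Dp.pw_ideal)
  define N where "N = PIdl\<^bsub>D\<^esub> (eps 1) <+>\<^bsub>D\<^esub> Dp.pw m"
  have e1: "eps 1 \<in> carrier D" by simp
  have eI: "ideal (PIdl\<^bsub>D\<^esub> (eps 1)) D" by (rule D.cgenideal_ideal[OF e1])
  have N: "ideal N D" unfolding N_def by (intro D.add_ideals eI Dp.pw_ideal)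
  note sub = D.ideal_add_supsets[OF eI Dp.pw_ideal[of m], folded N_def]
  have nil: "ideal_pow D N (p * m * m) \<subseteq> Dp.pw m"
    unfolding N_def by (rule D.principal_nilpotent'[OF Dp.pw_ideal e1 eps_pow_pw])
  interpret N: ideal N D by (rule N)
  have tt: "tau (theta b) \<in> carrier H" if "b \<in> carrier A" for b using that by simp
  have "\<forall>b\<in>carrier A. \<exists>u\<in>carrier U. eqmod H (HJ m) (tau (theta b)) (ic u)"
  proof
    fix b assume "b \<in> carrier A"
    then show "\<exists>u\<in>carrier U. eqmod H (HJ m) (tau (theta b)) (ic u)"
      using Dp.hat_dense[OF tt, of b] by (metis D_simps(1))
  qed
  \<comment> \<open>Representatives are taken in the uncompleted ring, whose elements can be coded
    by lists.\<close>
  then obtain u where u: "\<And>b. b \<in> carrier A \<Longrightarrow> u b \<in> carrier U" "\<And>b. b \<in> carrier A \<Longrightarrow> eqmod H (HJ m) (tau (theta b)) (ic (u b))"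
    by metis
  have red: "eqmod D (Dp.pw m) (u b) v" if "b \<in> carrier A" "v \<in> carrier U" "eqmod H (HJ m) (tau (theta b)) (ic v)" for b v
    using HI.eqmod_trans[OF HI.eqmod_sym[OF u(2)[OF that(1)]] that(3)] ic_eqmod_iff[OF u(1)[OF that(1)] that(2)] by simp
  have tth: "(\<lambda>b. tau (theta b)) \<in> ring_hom A H"
    using ring_hom_trans[OF theta_hom tau_hom] by (simp add: comp_def)
  have hom: "hom_mod A D (Dp.pw m) u"
  proof (rule hom_modI)
    fix a b assume ab: "a \<in> carrier A" "b \<in> carrier A"
    show "u a \<in> carrier D" using u(1) ab by simp
    show "eqmod D (Dp.pw m) (u (a \<oplus> b)) (u a \<oplus>\<^bsub>D\<^esub> u b)"
    proof (rule red)
      show "eqmod H (HJ m) (tau (theta (a \<oplus> b))) (ic (u a \<oplus>\<^bsub>D\<^esub> u b))"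
        using HI.eqmod_add[OF u(2)[OF ab(1)] u(2)[OF ab(2)]] ring_hom_add[OF tth ab] u(1) ab by (simp add: ic_add)
    qed (use ab u(1) in simp_all)
    show "eqmod D (Dp.pw m) (u (a \<otimes> b)) (u a \<otimes>\<^bsub>D\<^esub> u b)"
    proof (rule red)
      show "eqmod H (HJ m) (tau (theta (a \<otimes> b))) (ic (u a \<otimes>\<^bsub>D\<^esub> u b))"
        using HI.eqmod_mult[OF u(2)[OF ab(1)] u(2)[OF ab(2)]] ring_hom_mult[OF tth ab] u(1) ab by (simp add: ic_mult)
    qed (use ab u(1) in simp_all)
  next
    have "\<one>\<^bsub>D\<^esub> = con \<one>" using ring_hom_one[OF con_hom_D] by simp
    then show "eqmod D (Dp.pw m) (u \<one>) \<one>\<^bsub>D\<^esub>"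
      using red[of \<one> "con \<one>"] ring_hom_one[OF tth] ic_con_one by simp
  qed
  have hom': "hom_mod A D (Dp.pw m) con"
    by (rule L.hom_mod_ring_hom[OF con_hom_D ring_axioms])
  have "eqmod D (Dp.pw m) (u a) (con a)"
  proof (rule E.lift_unique[where u' = u and u = con and a = a and m = m and dec = decU,
        OF D_cring _ Dp.pw_ideal N sub(2) nil hom' hom _ _ _ _ a])
    show "carrier D \<subseteq> range decU" using decU by simp
    show "ideal_pow D (Idl\<^bsub>D\<^esub> {con (\<eta> P), con (\<eta> Q)}) m \<subseteq> Dp.pw m"
      unfolding eta_P eta_Q by (simp add: Dp.pw_def)
    show "eqmod D (Dp.pw m) (u (\<eta> r)) (con (\<eta> r))" if r: "r \<in> carrier R" for r
    proof (rule red)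
      have "tau (theta (\<eta> r)) = ic (con (\<eta> r))"
        using r by (simp add: theta_eta tau_ic tau0_con)
      then show "eqmod H (HJ m) (tau (theta (\<eta> r))) (ic (con (\<eta> r)))"
        using r by simp
    qed (use r in simp_all)
    show "eqmod D (Dp.pw m) (u x) (con x)"
    proof (rule red)
      have "tau (theta x) = ic (con x \<oplus>\<^bsub>U\<^esub> eps 1) \<oplus>\<^bsub>H\<^esub> ic (fl 1)"
        unfolding theta_x by (simp add: tau_ic tau0_add tau0_con tau0_eps theta_x del: One_nat_def)
      also have "\<dots> = ic (con x \<oplus>\<^bsub>D\<^esub> eps 1 \<oplus>\<^bsub>D\<^esub> \<ominus>\<^bsub>D\<^esub> eps 1)"
        using ic_add[of "con x \<oplus>\<^bsub>U\<^esub> eps 1" "fl 1"] by (simp add: fl_1[symmetric] del: One_nat_def)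
      also have "con x \<oplus>\<^bsub>D\<^esub> eps 1 \<oplus>\<^bsub>D\<^esub> \<ominus>\<^bsub>D\<^esub> eps 1 = con x"
      proof -
        have "con x \<in> carrier D" by simp
        then show ?thesis using e1 by (simp del: D_simps One_nat_def add: D.a_assoc D.r_neg)
      qed
      finally show "eqmod H (HJ m) (tau (theta x)) (ic (con x))" by simp
    qed simp_all
    show "eqmod D N (u b) (con b)" if b: "b \<in> carrier A" for b
    proof -
      obtain w where w: "w \<in> carrier U" "eqmod H (HJ m) (tau (theta b)) (ic (con b \<oplus>\<^bsub>U\<^esub> w \<otimes>\<^bsub>D\<^esub> eps 1))"
        using tau_theta_approx[OF b] by blast
      have we: "w \<otimes>\<^bsub>D\<^esub> eps 1 \<in> carrier U" using w(1) by (intro D_closed) simp_all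
      have "eqmod D (Dp.pw m) (u b) (con b \<oplus>\<^bsub>U\<^esub> w \<otimes>\<^bsub>D\<^esub> eps 1)"
        by (rule red[OF b _ w(2)]) (use b we in simp)
      then have 1: "eqmod D N (u b) (con b \<oplus>\<^bsub>D\<^esub> w \<otimes>\<^bsub>D\<^esub> eps 1)"
        using eqmod_mono[OF _ sub(2)] by simp
      have "w \<otimes>\<^bsub>D\<^esub> eps 1 \<in> PIdl\<^bsub>D\<^esub> (eps 1)" unfolding cgenideal_def using w(1) by auto
      then have "w \<otimes>\<^bsub>D\<^esub> eps 1 \<in> N" using sub(1) by blast
      then have "eqmod D N (con b \<oplus>\<^bsub>D\<^esub> w \<otimes>\<^bsub>D\<^esub> eps 1) (con b \<oplus>\<^bsub>D\<^esub> \<zero>\<^bsub>D\<^esub>)"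
        using b by (intro N.eqmod_add N.eqmod_refl N.eqmod_zero_iff[THEN iffD2]) simp_all
      then have "eqmod D N (u b) (con b \<oplus>\<^bsub>D\<^esub> \<zero>\<^bsub>D\<^esub>)" by (rule N.eqmod_trans[OF 1])
      then show ?thesis using b by simp
    qed
  qed
  then have "eqmod H (HJ m) (ic (u a)) (ic (con a))" using ic_eqmod_iff[OF u(1)[OF a] con_closed[OF a]] by simp
  with u(2)[OF a] show "eqmod H (HJ m) (tau (theta a)) (ic (con a))" by (rule HI.eqmod_trans)
qed

text \<open>It suffices to test a \<xi>^[n]. Its flip is \<theta>(a) times the flipped power, and
  the second flip restores a by \<open>tau_theta\<close> and \<xi>^[n] by
  \<open>tau0_fl\<close>.\<close>

lemma tau_tau:
  assumes "y \<in> carrier H"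
  shows "tau (tau y) = y"
proof -
  have id: "(\<lambda>y. y) \<in> ring_hom H H" by (simp add: ring_hom_def)
  have tt: "(\<lambda>y. tau (tau y)) \<in> ring_hom H H"
    using ring_hom_trans[OF tau_hom tau_hom] by (simp add: comp_def)
  have ttu: "tau (tau (ic u)) = ic u" if "u \<in> carrier U" for u
    using that
  proof (induction u rule: U_induct)
    case (monom a n)
    have "tau (ic (fl n)) = ic (eps n)"
    proof (cases "n = 0")
      case True
      have "eps 0 = con \<one>" by (simp add: eps_def con_def)
      then show ?thesis unfolding True fl_0 by (simp add: ic_con_one ring_hom_one[OF tau_hom])
    next
      case False
      then show ?thesis by (simp add: tau_ic tau0_fl)
    qed
    moreover have "tau (tau (ic (mon a n))) = tau (theta a) \<otimes>\<^bsub>H\<^esub> tau (ic (fl n))"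
      using monom ring_hom_mult[OF tau_hom] by (simp add: tau_ic tau0_mon)
    ultimately have "tau (tau (ic (mon a n))) = ic (con a \<otimes>\<^bsub>D\<^esub> eps n)"
      using monom by (simp add: tau_theta ic_mult)
    then show ?case using monom by (simp add: con_D mon_eps)
  next
    case (add u v)
    then show ?case using ring_hom_add[OF tau_hom] by (simp add: ic_add)
  qed
  show ?thesis
    by (rule hom_eq_if_eq_on_incl[where g = "\<lambda>y. tau (tau y)" and g' = "\<lambda>y. y",
          OF Dp.adic_pair_axioms Dp.hat.complete_adic_pair_axioms tt id _ _ _ assms])
      (simp_all add: ttu)
qed

lemma flip_poly_eq:
  assumes "1 \<le> n"
  shows "flip_poly c A x n = fl n"
proof -
  have m: "up_ring.monom D = mon" by (simp add: dp_ring_def)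
  have "add_monoid D = add_monoid U" by simp
  then have fs: "finsum D = finsum U" unfolding finsum_def[abs_def] by simp
  have "c ((-1) ^ k * [:0, 1:] ^ (k * (k - 1) div 2) * [:1, -1:] ^ (n - k) * qbinom (n - 1) (k - 1)) \<otimes> x [^] (n - k)
      = evx ([:flip_coef n k:] * [:0, 1:] ^ (n - k))" for k
    unfolding evx_mult evx_const evx_power evx_x flip_coef_def ..
  then have "flip_poly c A x n = finsum U (\<lambda>k. umap (Polynomial.monom ([:flip_coef n k:] * [:0, 1:] ^ (n - k)) k)) {1..n}"
    unfolding flip_poly_def m fs umap_monom by simp
  also have "\<dots> = fl n"
  proof -
    have "dp_flip n = (\<Sum>k = 1..n. Polynomial.monom ([:flip_coef n k:] * [:0, 1:] ^ (n - k)) k)"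
      using assms unfolding dp_flip_def by (simp del: mult_pCons_left mult_pCons_right)
    then show ?thesis by (simp only: umap_sum finite_atLeastAtMost)
  qed
  finally show ?thesis .
qed

section \<open>Uniqueness of the flip map and conclusion\<close>

abbreviation is_flip where "is_flip \<equiv> is_flip_map p R c A \<eta> x"

lemma is_flip_iff:
  "is_flip \<tau> \<longleftrightarrow> \<tau> \<in> carrier H \<rightarrow> carrier H \<and>
     (\<forall>y\<in>carrier H. \<forall>z\<in>carrier H. \<tau> (y \<oplus>\<^bsub>H\<^esub> z) = \<tau> y \<oplus>\<^bsub>H\<^esub> \<tau> z) \<and>
     (\<forall>r\<in>carrier R. \<forall>y\<in>carrier H. \<tau> (ic (con (\<eta> r)) \<otimes>\<^bsub>H\<^esub> y) = ic (con (\<eta> r)) \<otimes>\<^bsub>H\<^esub> \<tau> y) \<and>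
     (\<forall>m. \<exists>k. \<forall>y\<in>HJ k. \<tau> y \<in> HJ m) \<and>
     (\<forall>f\<in>carrier A. \<tau> (ic (con f)) = theta f) \<and>
     (\<forall>f\<in>carrier A. \<forall>n\<ge>1. \<tau> (ic (mon f n)) = theta f \<otimes>\<^bsub>H\<^esub> ic (fl n))"
  unfolding is_flip_map_def Let_def dp_hat_eq dp_hat_pow to_dp_hat_eq dp_hat_monom_eq con_def[symmetric]
  using flip_poly_eq by (auto simp del: One_nat_def)

lemma tau_is_flip: "is_flip tau"
  unfolding is_flip_iff
proof (intro conjI ballI allI impI)
  fix r y assume r: "r \<in> carrier R" "y \<in> carrier H"
  show "tau (ic (con (\<eta> r)) \<otimes>\<^bsub>H\<^esub> y) = ic (con (\<eta> r)) \<otimes>\<^bsub>H\<^esub> tau y"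
    using ring_hom_mult[OF tau_hom, of "ic (con (\<eta> r))" y] r by (simp add: tau_ic tau0_con theta_eta)
next
  show "\<exists>k. \<forall>y\<in>HJ k. tau y \<in> HJ m" for m using tau_HJ by blast
qed (use ring_hom_add[OF tau_hom] in \<open>auto simp: tau_ic tau0_con tau0_mon\<close>)

text \<open>The conditions fix the map on every a \<xi>^[n]; additivity extends this to finite sums
  and continuity to the completion.\<close>

lemma is_flip_eq_tau:
  assumes "is_flip \<tau>" "y \<in> carrier H"
  shows "\<tau> y = tau y"
proof -
  note fl = assms(1)[unfolded is_flip_iff]
  have cl: "\<tau> y \<in> carrier H" if "y \<in> carrier H" for y using fl that by auto
  have add: "\<tau> (y \<oplus>\<^bsub>H\<^esub> z) = \<tau> y \<oplus>\<^bsub>H\<^esub> \<tau> z" if "y \<in> carrier H" "z \<in> carrier H" for y z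
    using fl that by blast
  have mon: "\<tau> (ic (mon a n)) = tau0 (mon a n)" if a: "a \<in> carrier A" for a n
  proof (cases "n = 0")
    case True
    have "\<tau> (ic (con a)) = theta a" using fl a by blast
    then show ?thesis unfolding True using tau0_con[OF a] by (simp add: con_def)
  next
    case False
    then have "1 \<le> n" by simp
    then have "\<tau> (ic (mon a n)) = theta a \<otimes>\<^bsub>H\<^esub> ic (fl n)" using fl a by blast
    then show ?thesis using a by (simp add: tau0_mon)
  qed
  have ic: "\<tau> (ic u) = tau0 u" if "u \<in> carrier U" for u
    using that
  proof (induction u rule: U_induct)
    case (monom a n)
    then show ?case by (rule mon)
  next
    case (add u v)
    then show ?case using \<open>\<And>z y. y \<in> carrier H \<Longrightarrow> z \<in> carrier H \<Longrightarrow> \<tau> (y \<oplus>\<^bsub>H\<^esub> z) = \<tau> y \<oplus>\<^bsub>H\<^esub> \<tau> z\<close>[of "ic u" "ic v"]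
      by (simp add: ic_add tau0_add)
  qed
  show ?thesis
  proof (rule Dp.hat.eq_if_eqmod)
    fix m
    interpret HI: ideal "HJ m" H by (rule HJ_ideal)
    obtain k where k: "\<And>z. z \<in> HJ k \<Longrightarrow> \<tau> z \<in> HJ m" using fl by blast
    \<comment> \<open>The precision \<open>max k m\<close> serves both maps: k for the given one,
      whose continuity is only known with a loss, and m for the constructed one.\<close>
    obtain u where u: "u \<in> carrier U" "eqmod H (HJ (max k m)) y (ic u)"
      using Dp.hat_dense[OF assms(2)] by auto
    define d where "d = y \<ominus>\<^bsub>H\<^esub> ic u"
    have d: "d \<in> HJ (max k m)" using u(2) by (simp add: eqmod_def d_def)
    then have dc: "d \<in> carrier H" by (rule Dp.hat.pw_carrier)
    have y: "y = d \<oplus>\<^bsub>H\<^esub> ic u"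
      unfolding d_def using assms(2) u(1) by (simp add: Dp.hat.minus_eq Dp.hat.a_assoc Dp.hat.l_neg)
    have dk: "d \<in> HJ k" using Dp.hat.pw_antimono[of k "max k m"] d by auto
    have "\<tau> d \<in> HJ m" by (rule k[OF dk])
    then have "eqmod H (HJ m) (\<tau> d \<oplus>\<^bsub>H\<^esub> tau0 u) (\<zero>\<^bsub>H\<^esub> \<oplus>\<^bsub>H\<^esub> tau0 u)"
      using u(1) by (intro HI.eqmod_add HI.eqmod_refl HI.eqmod_zero_iff[THEN iffD2]) simp_all
    then have 1: "eqmod H (HJ m) (\<tau> y) (tau0 u)"
      using add[OF dc ic_closed[OF u(1)]] u(1) by (simp add: y ic)
    have "eqmod H (HJ m) (tau y) (tau (ic u))"
      by (rule tau_eqmod[OF eqmod_mono[OF u(2)]]) (rule Dp.hat.pw_antimono, simp)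
    then have 2: "eqmod H (HJ m) (tau y) (tau0 u)" using u(1) by (simp add: tau_ic)
    show "eqmod H (HJ m) (\<tau> y) (tau y)" by (rule HI.eqmod_trans[OF 1 HI.eqmod_sym[OF 2]])
  qed
qed

text \<open>All conditions concern elements of the completion only, so the extensional restriction
  of a flip map is one too.\<close>

lemma is_flip_cong:
  assumes "is_flip \<tau>" "\<And>y. y \<in> carrier H \<Longrightarrow> \<tau>' y = \<tau> y"
  shows "is_flip \<tau>'"
proof -
  note fl = assms(1)[unfolded is_flip_iff]
  have HJc: "y \<in> HJ k \<Longrightarrow> y \<in> carrier H" for y k by (rule Dp.hat.pw_carrier)
  have "\<exists>k. \<forall>y\<in>HJ k. \<tau>' y \<in> HJ m" for m
  proof -
    obtain k where "\<forall>y\<in>HJ k. \<tau> y \<in> HJ m" using fl by blast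
    then show ?thesis using assms(2) HJc by metis
  qed
  then show ?thesis unfolding is_flip_iff using fl assms(2) by (simp add: Pi_def)
qed

theorem flip_map:
  "\<exists>!\<tau>. \<tau> \<in> extensional (carrier H) \<and> is_flip \<tau>"
  "is_flip \<tau> \<Longrightarrow> \<tau> \<in> ring_iso H H \<and> (\<forall>r\<in>carrier R. \<tau> (ic (con (\<eta> r))) = ic (con (\<eta> r))) \<and>
     (\<forall>y\<in>carrier H. \<tau> (\<tau> y) = y)"
proof -
  show "\<exists>!\<tau>. \<tau> \<in> extensional (carrier H) \<and> is_flip \<tau>"
  proof (rule ex1I[of _ "restrict tau (carrier H)"])
    show "restrict tau (carrier H) \<in> extensional (carrier H) \<and> is_flip (restrict tau (carrier H))"
      using is_flip_cong[OF tau_is_flip, of "restrict tau (carrier H)"] by simp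
  next
    fix \<tau> assume t: "\<tau> \<in> extensional (carrier H) \<and> is_flip \<tau>"
    show "\<tau> = restrict tau (carrier H)"
      by (rule extensionalityI[of _ "carrier H"]) (use t is_flip_eq_tau in auto)
  qed
  assume t: "is_flip \<tau>"
  have eq: "\<tau> y = tau y" if "y \<in> carrier H" for y by (rule is_flip_eq_tau[OF t that])
  have hom: "\<tau> \<in> ring_hom H H"
    by (rule ring_hom_memI)
      (simp_all add: eq ring_hom_mult[OF tau_hom] ring_hom_add[OF tau_hom] ring_hom_one[OF tau_hom])
  have tt: "\<tau> (\<tau> y) = y" if "y \<in> carrier H" for y using that by (simp add: eq tau_tau)
  \<comment> \<open>An involution is its own inverse.\<close>
  have "bij_betw \<tau> (carrier H) (carrier H)"
    by (rule bij_betwI[of _ _ _ \<tau>]) (use tt ring_hom_closed[OF hom] in auto)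
  then have "\<tau> \<in> ring_iso H H" using hom unfolding ring_iso_def by blast
  moreover have "\<tau> (ic (con (\<eta> r))) = ic (con (\<eta> r))" if "r \<in> carrier R" for r
    using that by (simp add: eq tau_ic tau0_con theta_eta)
  ultimately show "\<tau> \<in> ring_iso H H \<and> (\<forall>r\<in>carrier R. \<tau> (ic (con (\<eta> r))) = ic (con (\<eta> r))) \<and>
     (\<forall>y\<in>carrier H. \<tau> (\<tau> y) = y)" using tt by blast
qed

end

theorem proposition5p4:
  fixes p :: nat
    and R :: "('r, 'k) ring_scheme" and \<phi> :: "int poly fract \<Rightarrow> 'r"
    and A :: "('a, 'm) ring_scheme" and \<eta> :: "'r \<Rightarrow> 'a" and x :: 'a
  assumes "Factorial_Ring.prime p"
    and "cring R" and "\<phi> \<in> ring_hom (Zq_loc p) R"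
    and "cring A" and "\<eta> \<in> ring_hom R A"
    and "adic_complete A (pq_ideal p A (\<eta> \<circ> Zq_map \<phi>))"
    and "top_etale_coordinate p R (Zq_map \<phi>) A \<eta> x"
  shows "let c = \<eta> \<circ> Zq_map \<phi>; H = dp_hat p c A x in
     (\<exists>!\<tau>. \<tau> \<in> extensional (carrier H) \<and> is_flip_map p R c A \<eta> x \<tau>) \<and>
     (\<forall>\<tau>. is_flip_map p R c A \<eta> x \<tau> \<longrightarrow>
        \<tau> \<in> ring_iso H H \<and>
        (\<forall>r\<in>carrier R. \<tau> (dp_hat_monom p c A x (\<eta> r) 0) = dp_hat_monom p c A x (\<eta> r) 0) \<and>
        (\<forall>y\<in>carrier H. \<tau> (\<tau> y) = y))"
proof -
  interpret R: cring R by fact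
  interpret A: cring A by fact
  define c where "c = \<eta> \<circ> Zq_map \<phi>"
  \<comment> \<open>At q = 1 membership would make p divide 1. So 1 is an admissible denominator and
    all of \<int>[q] lies in the localization.\<close>
  have one: "(1 :: int poly) \<notin> pq_prime p"
  proof
    assume "1 \<in> pq_prime p"
    then obtain f g where "1 = [:int p:] * f + [:-1, 1:] * g" unfolding pq_prime_def by blast
    then have "poly 1 1 = poly ([:int p:] * f + [:-1, 1:] * g) 1" by simp
    then have "int p * poly f 1 = 1" by simp
    then have "int p dvd 1" by (intro dvdI[of _ _ "poly f 1"]) simp
    then show False using prime_gt_1_nat[OF assms(1)] by simp
  qed
  have loc: "Fract f 1 \<in> carrier (Zq_loc p)" for f using one by (auto simp: Zq_loc_def)
  have Z: "Zq_map \<phi> f \<in> carrier R" "Zq_map \<phi> (f + g) = Zq_map \<phi> f \<oplus>\<^bsub>R\<^esub> Zq_map \<phi> g"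
    "Zq_map \<phi> (f * g) = Zq_map \<phi> f \<otimes>\<^bsub>R\<^esub> Zq_map \<phi> g" "Zq_map \<phi> 1 = \<one>\<^bsub>R\<^esub>" for f g
  proof -
    show "Zq_map \<phi> f \<in> carrier R" unfolding Zq_map_def by (rule ring_hom_closed[OF assms(3) loc])
    have "Fract (f + g) 1 = Fract f 1 \<oplus>\<^bsub>Zq_loc p\<^esub> Fract g 1" "Fract (f * g) 1 = Fract f 1 \<otimes>\<^bsub>Zq_loc p\<^esub> Fract g 1"
      "Fract 1 1 = \<one>\<^bsub>Zq_loc p\<^esub>"
      by (simp_all add: Zq_loc_def One_fract_def)
    then show "Zq_map \<phi> (f + g) = Zq_map \<phi> f \<oplus>\<^bsub>R\<^esub> Zq_map \<phi> g"
      "Zq_map \<phi> (f * g) = Zq_map \<phi> f \<otimes>\<^bsub>R\<^esub> Zq_map \<phi> g" "Zq_map \<phi> 1 = \<one>\<^bsub>R\<^esub>"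
      unfolding Zq_map_def using ring_hom_add[OF assms(3) loc loc] ring_hom_mult[OF assms(3) loc loc]
        ring_hom_one[OF assms(3)] by simp_all
  qed
  have xc: "x \<in> carrier A" using assms(7) by (simp add: top_etale_coordinate_def)
  have cA: "coef_alg A c x"
  proof (intro coef_alg.intro coef_alg_axioms.intro A.cring_axioms xc)
    show "c f \<in> carrier A" "c (f + g) = c f \<oplus>\<^bsub>A\<^esub> c g" "c (f * g) = c f \<otimes>\<^bsub>A\<^esub> c g" "c 1 = \<one>\<^bsub>A\<^esub>" for f g
      using ring_hom_closed[OF assms(5) Z(1)] ring_hom_add[OF assms(5) Z(1) Z(1)] ring_hom_mult[OF assms(5) Z(1) Z(1)]
        ring_hom_one[OF assms(5)] by (simp_all add: c_def Z)
  qed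
  interpret coef_alg A c x by (rule cA)
  have "adic_pair A (c [:int p:]) (c [:-1, 1:])"
    by (intro adic_pair.intro adic_pair_axioms.intro A.cring_axioms c_closed)
  then have comp: "complete_adic_pair A (c [:int p:]) (c [:-1, 1:])"
    by (rule complete_adic_pairI) (use assms(6) in \<open>simp add: pq_ideal_def c_def\<close>)
  have et: "etale_algebra R A \<eta> x (Zq_map \<phi> [:int p:]) (Zq_map \<phi> [:-1, 1:])"
    by (intro etale_algebra.intro etale_algebra_axioms.intro assms(2,4,5) xc Z(1))
      (use assms(7) in \<open>simp add: top_etale_coordinate_def pq_ideal_def Let_def\<close>)
  have "taylor A c x p R \<eta> (Zq_map \<phi> [:int p:]) (Zq_map \<phi> [:-1, 1:])"
  proof (intro taylor.intro adic_alg.intro adic_alg_axioms.intro taylor_axioms.intro cA et comp)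
    show "0 < p" by (rule prime_gt_0_nat[OF assms(1)])
    show "\<exists>r\<in>carrier R. c f = \<eta> r" for f using Z(1) by (auto simp: c_def)
  qed (simp_all add: c_def)
  then interpret taylor A c x p R \<eta> "Zq_map \<phi> [:int p:]" "Zq_map \<phi> [:-1, 1:]" .
  show ?thesis
    unfolding Let_def c_def[symmetric] dp_hat_eq dp_hat_monom_eq con_def[symmetric]
    using flip_map by blast
qed

end
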